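(* Let $A_0=\mathrm{alg}\varinjlim(A_k,\phi_k)$ and $A_0'=\mathrm{alg}\varinjlim(A_k',\phi_k')$ belong to $\mathrm{Alglim}(\mathcal F^{reg}_{T_3})$ and let $$V(A_0)=\varinjlim(\mathbb Z_+^{10},\hat\phi_k),\qquad V(A_0')=\varinjlim(\mathbb Z_+^{10},\hat\phi_k')$$ be their dimension modules, with right action from $V_{\mathcal F^{reg}_{T_3}}=\mathbb Z_+^{10}$, determined by their defining direct systems. Then $A_0$ and $A_0'$ are stably star-extendibly isomorphic if and only if the dimension modules $V(A_0)$ and $V(A_0')$ are isomorphic, and are star-extendibly isomorphic if and only if $V(A_0)$ and $V(A_0')$ are isomorphic by a scale preserving isomorphism.
   Context: An operator algebra $A$ is given with its generated C*-algebra $C^*(A)$. A homomorphism $A\to B$ is star-extendible if it is the restriction of a *-homomorphism $C^*(A)\to C^*(B)$; a star-extendible isomorphism is the restriction of a *-isomorphism $C^*(A)\to C^*(B)$ carrying $A$ onto $B$. $T_3\subseteq M_3$ is the algebra of upper triangular matrices; a $T_3$-algebra is an algebra $T_3\otimes M_n$. A star-extendible homomorphism $T_3\otimes M_n\to T_3\otimes M_m$ is regular if it is a direct sum of star-extendible homomorphisms of multiplicity one (the multiplicity is that of the *-extension $M_3\otimes M_n\to M_3\otimes M_m$); $\mathcal F^{reg}_{T_3}$ is the family of all of these. $\mathrm{Alglim}(\mathcal F^{reg}_{T_3})$ is the class of algebraic direct limits of sequences of $T_3$-algebras with maps in $\mathcal F^{reg}_{T_3}$ (as subalgebras of $\varinjlim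 C^*(A_k)$). Stable star-extendible isomorphism means star-extendible isomorphism of $A_0\otimes\mathcal K$ and $A_0'\otimes\mathcal K$, where in this algebraic setting $A_0\otimes\mathcal K$ is understood as $\bigcup_nA_0\otimes M_n$ (corner inclusions). For a $T_3$-algebra $B$, $V(B)$ is the additive semigroup of inner unitary equivalence classes of regular maps $\psi:T_3\to B\otimes M_n\subseteq B\otimes\mathcal K$ ($n$ arbitrary, $\mathcal K$ the compact operators; equivalence by unitaries $u$ with $u,u^*$ in the unitisation of $B\otimes\mathcal K$), with $[\phi]+[\psi]=[\phi\oplus\psi]$; it is isomorphic to $\mathbb Z_+^{10}$, freely generated by the classes of multiplicity one maps, which correspond to the ten order preserving maps of $\{1,2,3\}$ to itself. $V_{\mathcal F^{reg}_{T_3}}=V(T_3)$ is a semiring under $[\phi][\theta]=[(\phi\otimes\mathrm{id})\circ\theta]$ and acts on the right of each $V(B)$ by the same formula. The scale of $V(B)$ is the set of classes of maps $\psi:T_3\to B=B\otimes p$, $p$ a rank one projection. $V(A_0)$ is the additive semigroup limit of the $V(A_k)$ under $\hat\phi_k([\psi])=[(\phi_k\otimes\mathrm{id})\circ\psi]$, with induced right action; its scale is the union of the images of the scales. Isomorphisms of dimension modules are additive semigroup isomorphisms commuting with the right actions; scale preserving means mapping scale onto scale. *)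

theory Defs
  imports "HOL-Analysis.Analysis" "HOL-Library.Nat_Bijection"
begin

section \<open>Star algebras and operator algebras inside them\<close>

record 'a star_algebra =
  sa_carrier :: "'a set"
  sa_add :: "'a \<Rightarrow> 'a \<Rightarrow> 'a"
  sa_mult :: "'a \<Rightarrow> 'a \<Rightarrow> 'a"
  sa_scale :: "complex \<Rightarrow> 'a \<Rightarrow> 'a"
  sa_star :: "'a \<Rightarrow> 'a"

definition star_hom :: "'a star_algebra \<Rightarrow> 'b star_algebra \<Rightarrow> ('a \<Rightarrow> 'b) \<Rightarrow> bool" where
  "star_hom S T f \<longleftrightarrow>
     (\<forall>x\<in>sa_carrier S. f x \<in> sa_carrier T) \<and>
     (\<forall>x\<in>sa_carrier S. \<forall>y\<in>sa_carrier S. f (sa_add S x y) = sa_add T (f x) (f y)) \<and>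
     (\<forall>x\<in>sa_carrier S. \<forall>y\<in>sa_carrier S. f (sa_mult S x y) = sa_mult T (f x) (f y)) \<and>
     (\<forall>c. \<forall>x\<in>sa_carrier S. f (sa_scale S c x) = sa_scale T c (f x)) \<and>
     (\<forall>x\<in>sa_carrier S. f (sa_star S x) = sa_star T (f x))"

definition star_iso :: "'a star_algebra \<Rightarrow> 'b star_algebra \<Rightarrow> ('a \<Rightarrow> 'b) \<Rightarrow> bool" where
  "star_iso S T f \<longleftrightarrow> star_hom S T f \<and> bij_betw f (sa_carrier S) (sa_carrier T)"

text \<open>An operator algebra is a pair \<open>(S, A)\<close>: a star algebra \<open>S\<close> (its generated C*-algebra)
  and a subset \<open>A\<close> of the carrier. A star-extendible homomorphism is represented by its
  *-extension, which is unique because \<open>A\<close> generates \<open>S\<close>.\<close>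

definition star_extendible ::
    "'a star_algebra \<times> 'a set \<Rightarrow> 'b star_algebra \<times> 'b set \<Rightarrow> ('a \<Rightarrow> 'b) \<Rightarrow> bool" where
  "star_extendible P Q f \<longleftrightarrow> star_hom (fst P) (fst Q) f \<and> f ` snd P \<subseteq> snd Q"

definition star_ext_isomorphic ::
    "'a star_algebra \<times> 'a set \<Rightarrow> 'b star_algebra \<times> 'b set \<Rightarrow> bool" where
  "star_ext_isomorphic P Q \<longleftrightarrow> (\<exists>f. star_iso (fst P) (fst Q) f \<and> f ` snd P = snd Q)"


section \<open>Complex matrices over arbitrary index types\<close>

type_synonym ('i, 'j) cmat = "'i \<Rightarrow> 'j \<Rightarrow> complex"

text \<open>The product is an infinite sum because unitaries in the unitisation of \<open>B \<otimes> K\<close> are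
  infinite matrices; for finitely supported matrices it is the usual matrix product.\<close>

definition mmult :: "('i, 'l) cmat \<Rightarrow> ('l, 'j) cmat \<Rightarrow> ('i, 'j) cmat" where
  "mmult x y = (\<lambda>i j. \<Sum>\<^sub>\<infinity>l. x i l * y l j)"

definition madj :: "('i, 'j) cmat \<Rightarrow> ('j, 'i) cmat" where
  "madj x = (\<lambda>j i. cnj (x i j))"

definition mid :: "'i set \<Rightarrow> ('i, 'i) cmat" where
  "mid I = (\<lambda>i j. if i = j \<and> i \<in> I then 1 else 0)"

definition mzero :: "('i, 'j) cmat" where
  "mzero = (\<lambda>i j. 0)"

definition fin_mat :: "'i set \<Rightarrow> ('i, 'i) cmat set" where
  "fin_mat I = {x. finite {(i, j). x i j \<noteq> 0} \<and> {(i, j). x i j \<noteq> 0} \<subseteq> I \<times> I}"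

text \<open>For finite \<open>I\<close> this is the full matrix algebra on \<open>I\<close>; for infinite \<open>I\<close> it is the union of
  the full matrix algebras on the finite subsets of \<open>I\<close>.\<close>

definition fin_mat_alg :: "'i set \<Rightarrow> ('i, 'i) cmat star_algebra" where
  "fin_mat_alg I =
     \<lparr>sa_carrier = fin_mat I,
      sa_add = (\<lambda>x y i j. x i j + y i j),
      sa_mult = mmult,
      sa_scale = (\<lambda>c x i j. c * x i j),
      sa_star = madj\<rparr>"

text \<open>The operator norm (with respect to the Euclidean norm on finitely supported vectors) of
  the difference of \<open>x\<close> and \<open>y\<close> is at most \<open>C\<close>.\<close>

definition opdist_le :: "('i, 'i) cmat \<Rightarrow> ('i, 'i) cmat \<Rightarrow> real \<Rightarrow> bool" where
  "opdist_le x y C \<longleftrightarrow>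
     (\<forall>F v w. finite F \<longrightarrow>
        norm (\<Sum>i\<in>F. \<Sum>j\<in>F. cnj (w i) * (x i j - y i j) * v j)
          \<le> C * L2_set (\<lambda>i. norm (w i)) F * L2_set (\<lambda>j. norm (v j)) F)"


section \<open>\<open>T\<^sub>3\<close>-algebras and regular maps\<close>

text \<open>For \<open>J\<close> of cardinality \<open>n\<close>, \<open>T3_idx J\<close> indexes the rows and columns of \<open>M\<^sub>3 \<otimes> M\<^sub>n\<close>.
  Further matrix factors are put into \<open>J\<close>: \<open>T\<^sub>3\<close> is \<open>T3 {()}\<close>,
  \<open>T\<^sub>3 \<otimes> M\<^sub>n\<close> is \<open>T3 {..<n}\<close>, \<open>T\<^sub>3 \<otimes> M\<^sub>n \<otimes> M\<^sub>p\<close> is \<open>T3 ({..<n} \<times> {..<p})\<close>, and the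
  corner inclusions in \<open>p\<close> become set inclusions.\<close>

definition T3_idx :: "'j set \<Rightarrow> (nat \<times> 'j) set" where
  "T3_idx J = {1..3} \<times> J"

definition T3 :: "'j set \<Rightarrow> (nat \<times> 'j, nat \<times> 'j) cmat set" where
  "T3 J = {x \<in> fin_mat (T3_idx J). \<forall>s a t b. t < s \<longrightarrow> x (s, a) (t, b) = 0}"

definition T3_alg ::
    "'j set \<Rightarrow> (nat \<times> 'j, nat \<times> 'j) cmat star_algebra \<times> (nat \<times> 'j, nat \<times> 'j) cmat set" where
  "T3_alg J = (fin_mat_alg (T3_idx J), T3 J)"

text \<open>A map between the full matrix algebras on the finite sets \<open>I\<close> and \<open>I'\<close> has multiplicity
  \<open>r\<close> if it is unitarily equivalent to \<open>r\<close> copies of the identity representation plus zero; the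
  \<open>V s\<close> are the isometries onto the \<open>r\<close> mutually orthogonal copies.\<close>

definition has_multiplicity ::
    "'i set \<Rightarrow> 'k set \<Rightarrow> (('i, 'i) cmat \<Rightarrow> ('k, 'k) cmat) \<Rightarrow> nat \<Rightarrow> bool" where
  "has_multiplicity I I' f r \<longleftrightarrow>
     (\<exists>V :: nat \<Rightarrow> ('k, 'i) cmat.
        (\<forall>s<r. \<forall>k i. V s k i \<noteq> 0 \<longrightarrow> k \<in> I' \<and> i \<in> I) \<and>
        (\<forall>s<r. \<forall>t<r. mmult (madj (V s)) (V t) = (if s = t then mid I else mzero)) \<and>
        (\<forall>x\<in>fin_mat I. f x = (\<lambda>k l. \<Sum>s<r. mmult (mmult (V s) x) (madj (V s)) k l)))"

text \<open>Direct sums are internal, i.e. sums of maps with mutually orthogonal ranges. The empty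
  sum, the zero map, is included.\<close>

definition regular ::
    "'j set \<Rightarrow> 'k set \<Rightarrow>
     ((nat \<times> 'j, nat \<times> 'j) cmat \<Rightarrow> (nat \<times> 'k, nat \<times> 'k) cmat) \<Rightarrow> bool" where
  "regular J K f \<longleftrightarrow>
     star_extendible (T3_alg J) (T3_alg K) f \<and>
     (\<exists>(r::nat) g.
        (\<forall>s<r. star_extendible (T3_alg J) (T3_alg K) (g s) \<and>
               has_multiplicity (T3_idx J) (T3_idx K) (g s) 1) \<and>
        (\<forall>s<r. \<forall>t<r. s \<noteq> t \<longrightarrow>
           (\<forall>x\<in>fin_mat (T3_idx J). \<forall>y\<in>fin_mat (T3_idx J). mmult (g s x) (g t y) = mzero)) \<and>
        (\<forall>x\<in>fin_mat (T3_idx J). f x = (\<lambda>k l. \<Sum>s<r. g s x k l)))"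

text \<open>\<open>amp f\<close> is \<open>f \<otimes> id\<close>, acting on a matrix of matrices entry by entry.\<close>

definition amp ::
    "((nat \<times> 'j, nat \<times> 'j) cmat \<Rightarrow> (nat \<times> 'k, nat \<times> 'k) cmat) \<Rightarrow>
     (nat \<times> 'j \<times> 'q, nat \<times> 'j \<times> 'q) cmat \<Rightarrow> (nat \<times> 'k \<times> 'q, nat \<times> 'k \<times> 'q) cmat" where
  "amp f x = (\<lambda>(s, a, p) (t, b, q). f (\<lambda>(s', a') (t', b'). x (s', a', p) (t', b', q)) (s, a) (t, b))"


section \<open>Direct limits\<close>

text \<open>\<open>conn h k d\<close> is the composed connecting map from level \<open>k\<close> to level \<open>k + d\<close>.\<close>

primrec conn :: "(nat \<Rightarrow> 'a \<Rightarrow> 'a) \<Rightarrow> nat \<Rightarrow> nat \<Rightarrow> 'a \<Rightarrow> 'a" where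
  "conn h k 0 x = x"
| "conn h k (Suc d) x = h (k + d) (conn h k d x)"

text \<open>The C*-algebra direct limit of the (closures of the) matrix algebras on the sets \<open>I k\<close>, with
  connecting maps \<open>h k\<close>: sequences that are asymptotically compatible with the connecting maps,
  modulo sequences tending to zero in norm.\<close>

definition lim_seqs ::
    "(nat \<Rightarrow> 'i set) \<Rightarrow> (nat \<Rightarrow> ('i, 'i) cmat \<Rightarrow> ('i, 'i) cmat) \<Rightarrow> (nat \<Rightarrow> ('i, 'i) cmat) set" where
  "lim_seqs I h =
     {x. (\<forall>k. x k \<in> fin_mat (I k)) \<and>
         (\<forall>e>0. \<exists>N. \<forall>k\<ge>N. \<forall>j\<ge>k. opdist_le (x j) (conn h k (j - k) (x k)) e)}"

definition lim_eq ::
    "(nat \<Rightarrow> 'i set) \<Rightarrow> (nat \<Rightarrow> ('i, 'i) cmat \<Rightarrow> ('i, 'i) cmat) \<Rightarrow>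
     ((nat \<Rightarrow> ('i, 'i) cmat) \<times> (nat \<Rightarrow> ('i, 'i) cmat)) set" where
  "lim_eq I h =
     {(x, y). x \<in> lim_seqs I h \<and> y \<in> lim_seqs I h \<and>
        (\<forall>e>0. \<exists>N. \<forall>k\<ge>N. opdist_le (x k) (y k) e)}"

definition cstar_lim ::
    "(nat \<Rightarrow> 'i set) \<Rightarrow> (nat \<Rightarrow> ('i, 'i) cmat \<Rightarrow> ('i, 'i) cmat) \<Rightarrow>
     (nat \<Rightarrow> ('i, 'i) cmat) set star_algebra" where
  "cstar_lim I h =
     \<lparr>sa_carrier = lim_seqs I h // lim_eq I h,
      sa_add = (\<lambda>X Y. \<Union>x\<in>X. \<Union>y\<in>Y. lim_eq I h `` {\<lambda>k i j. x k i j + y k i j}),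
      sa_mult = (\<lambda>X Y. \<Union>x\<in>X. \<Union>y\<in>Y. lim_eq I h `` {\<lambda>k. mmult (x k) (y k)}),
      sa_scale = (\<lambda>c X. \<Union>x\<in>X. lim_eq I h `` {\<lambda>k i j. c * x k i j}),
      sa_star = (\<lambda>X. \<Union>x\<in>X. lim_eq I h `` {\<lambda>k. madj (x k)})\<rparr>"

definition lim_map ::
    "(nat \<Rightarrow> 'i set) \<Rightarrow> (nat \<Rightarrow> ('i, 'i) cmat \<Rightarrow> ('i, 'i) cmat) \<Rightarrow>
     nat \<Rightarrow> ('i, 'i) cmat \<Rightarrow> (nat \<Rightarrow> ('i, 'i) cmat) set" where
  "lim_map I h k a = lim_eq I h `` {\<lambda>j. if j < k then mzero else conn h k (j - k) a}"

definition alg_lim ::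
    "(nat \<Rightarrow> 'i set) \<Rightarrow> (nat \<Rightarrow> ('i, 'i) cmat \<Rightarrow> ('i, 'i) cmat) \<Rightarrow>
     (nat \<Rightarrow> ('i, 'i) cmat set) \<Rightarrow> (nat \<Rightarrow> ('i, 'i) cmat) set set" where
  "alg_lim I h A = (\<Union>k. lim_map I h k ` A k)"

text \<open>\<open>A\<^sub>0\<close> for the system \<open>T\<^sub>3 \<otimes> M\<^bsub>n k\<^esub>\<close> with connecting maps \<open>f k\<close>, and its stabilisation
  \<open>\<Union>p. A\<^sub>0 \<otimes> M\<^sub>p\<close>, which generates \<open>C*(A\<^sub>0) \<otimes> K\<close>, the limit of the \<open>M\<^sub>3 \<otimes> M\<^bsub>n k\<^esub> \<otimes> K\<close>.\<close>

definition T3_lim ::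
    "(nat \<Rightarrow> nat) \<Rightarrow> (nat \<Rightarrow> (nat \<times> nat, nat \<times> nat) cmat \<Rightarrow> (nat \<times> nat, nat \<times> nat) cmat) \<Rightarrow>
     (nat \<Rightarrow> (nat \<times> nat, nat \<times> nat) cmat) set star_algebra \<times>
     (nat \<Rightarrow> (nat \<times> nat, nat \<times> nat) cmat) set set" where
  "T3_lim n f =
     (cstar_lim (\<lambda>k. T3_idx {..<n k}) f,
      alg_lim (\<lambda>k. T3_idx {..<n k}) f (\<lambda>k. T3 {..<n k}))"

definition T3_lim_stab ::
    "(nat \<Rightarrow> nat) \<Rightarrow> (nat \<Rightarrow> (nat \<times> nat, nat \<times> nat) cmat \<Rightarrow> (nat \<times> nat, nat \<times> nat) cmat) \<Rightarrow>
     (nat \<Rightarrow> (nat \<times> nat \<times> nat, nat \<times> nat \<times> nat) cmat) set star_algebra \<times>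
     (nat \<Rightarrow> (nat \<times> nat \<times> nat, nat \<times> nat \<times> nat) cmat) set set" where
  "T3_lim_stab n f =
     (cstar_lim (\<lambda>k. T3_idx ({..<n k} \<times> UNIV)) (\<lambda>k. amp (f k)),
      \<Union>p. alg_lim (\<lambda>k. T3_idx ({..<n k} \<times> UNIV)) (\<lambda>k. amp (f k)) (\<lambda>k. T3 ({..<n k} \<times> {..<p})))"


section \<open>The semigroups \<open>V(B)\<close>\<close>

text \<open>Throughout, \<open>B = T3 J\<close> with \<open>J\<close> finite, and \<open>K\<close> acts on the sequence space over \<open>nat\<close>.\<close>

type_synonym 'j vmap =
  "(nat \<times> unit, nat \<times> unit) cmat \<Rightarrow> (nat \<times> 'j \<times> nat, nat \<times> 'j \<times> nat) cmat"

definition V_maps :: "'j set \<Rightarrow> 'j vmap set" where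
  "V_maps J = {\<psi>. \<exists>n. regular {()} (J \<times> {..<n}) \<psi>}"

definition T3_compact :: "'j set \<Rightarrow> (nat \<times> 'j \<times> nat, nat \<times> 'j \<times> nat) cmat set" where
  "T3_compact J = {x. \<forall>e>0. \<exists>n. \<exists>a\<in>T3 (J \<times> {..<n}). opdist_le x a e}"

definition T3_compact_unitisation :: "'j set \<Rightarrow> (nat \<times> 'j \<times> nat, nat \<times> 'j \<times> nat) cmat set" where
  "T3_compact_unitisation J =
     {\<lambda>i j. c * mid (T3_idx (J \<times> UNIV)) i j + x i j | c x. x \<in> T3_compact J}"

definition inner_unitary :: "'j set \<Rightarrow> (nat \<times> 'j \<times> nat, nat \<times> 'j \<times> nat) cmat \<Rightarrow> bool" where
  "inner_unitary J u \<longleftrightarrow>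
     u \<in> T3_compact_unitisation J \<and> madj u \<in> T3_compact_unitisation J \<and>
     mmult u (madj u) = mid (T3_idx (J \<times> UNIV)) \<and> mmult (madj u) u = mid (T3_idx (J \<times> UNIV))"

definition V_eq :: "'j set \<Rightarrow> ('j vmap \<times> 'j vmap) set" where
  "V_eq J =
     {(\<psi>, \<psi>'). \<psi> \<in> V_maps J \<and> \<psi>' \<in> V_maps J \<and>
        (\<exists>u. inner_unitary J u \<and> (\<forall>x\<in>T3 {()}. \<psi>' x = mmult (mmult u (\<psi> x)) (madj u)))}"

definition V :: "'j set \<Rightarrow> 'j vmap set set" where
  "V J = V_maps J // V_eq J"

text \<open>The direct sum \<open>\<phi> \<oplus> \<psi>\<close>, with \<open>B \<otimes> (K \<oplus> K)\<close> placed in \<open>B \<otimes> K\<close> by the bijection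
  between \<open>nat + nat\<close> and \<open>nat\<close>.\<close>

definition V_dsum :: "'j vmap \<Rightarrow> 'j vmap \<Rightarrow> 'j vmap" where
  "V_dsum \<phi> \<psi> x = (\<lambda>(s, a, p) (t, b, q).
     (case (sum_decode p, sum_decode q) of
        (Inl p', Inl q') \<Rightarrow> \<phi> x (s, a, p') (t, b, q')
      | (Inr p', Inr q') \<Rightarrow> \<psi> x (s, a, p') (t, b, q')
      | _ \<Rightarrow> 0))"

definition V_add :: "'j set \<Rightarrow> 'j vmap set \<Rightarrow> 'j vmap set \<Rightarrow> 'j vmap set" where
  "V_add J X Y = (\<Union>\<phi>\<in>X. \<Union>\<psi>\<in>Y. V_eq J `` {V_dsum \<phi> \<psi>})"

text \<open>The map \<open>(\<psi> \<otimes> id) \<circ> \<theta>\<close> into \<open>B \<otimes> K \<otimes> K\<close>, with \<open>K \<otimes> K\<close> identified with \<open>K\<close> by the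
  bijection between \<open>nat \<times> nat\<close> and \<open>nat\<close>.\<close>

definition V_comp :: "'j vmap \<Rightarrow> unit vmap \<Rightarrow> 'j vmap" where
  "V_comp \<psi> \<theta> x = (\<lambda>(s, a, p) (t, b, q).
     amp \<psi> (\<theta> x) (s, (a, fst (prod_decode p)), snd (prod_decode p))
                 (t, (b, fst (prod_decode q)), snd (prod_decode q)))"

text \<open>For \<open>J = {()}\<close> this is the product of the semiring \<open>V(T\<^sub>3) = V {()}\<close>; for general \<open>J\<close> it is
  the right action of \<open>V {()}\<close> on \<open>V J\<close>.\<close>

definition V_act :: "'j set \<Rightarrow> 'j vmap set \<Rightarrow> unit vmap set \<Rightarrow> 'j vmap set" where
  "V_act J X \<Theta> = (\<Union>\<psi>\<in>X. \<Union>\<theta>\<in>\<Theta>. V_eq J `` {V_comp \<psi> \<theta>})"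

definition V_scale :: "'j set \<Rightarrow> 'j vmap set set" where
  "V_scale J = {V_eq J `` {\<psi>} | \<psi>. regular {()} (J \<times> {0}) \<psi>}"

text \<open>The map \<open>V J \<rightarrow> V J'\<close> induced by a regular map \<open>f\<close> from \<open>T3 J\<close> to \<open>T3 J'\<close>.\<close>

definition V_hat ::
    "'k set \<Rightarrow> ((nat \<times> 'j, nat \<times> 'j) cmat \<Rightarrow> (nat \<times> 'k, nat \<times> 'k) cmat) \<Rightarrow>
     'j vmap set \<Rightarrow> 'k vmap set" where
  "V_hat J' f X = (\<Union>\<psi>\<in>X. V_eq J' `` {amp f \<circ> \<psi>})"


section \<open>Dimension modules\<close>

record 'a dim_module =
  dm_carrier :: "'a set"
  dm_add :: "'a \<Rightarrow> 'a \<Rightarrow> 'a"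
  dm_act :: "'a \<Rightarrow> unit vmap set \<Rightarrow> 'a"
  dm_scale :: "'a set"

definition dim_module_iso :: "'a dim_module \<Rightarrow> 'b dim_module \<Rightarrow> ('a \<Rightarrow> 'b) \<Rightarrow> bool" where
  "dim_module_iso M N F \<longleftrightarrow>
     bij_betw F (dm_carrier M) (dm_carrier N) \<and>
     (\<forall>X\<in>dm_carrier M. \<forall>Y\<in>dm_carrier M. F (dm_add M X Y) = dm_add N (F X) (F Y)) \<and>
     (\<forall>X\<in>dm_carrier M. \<forall>\<Theta>\<in>V {()}. F (dm_act M X \<Theta>) = dm_act N (F X) \<Theta>)"

definition scale_preserving :: "'a dim_module \<Rightarrow> 'b dim_module \<Rightarrow> ('a \<Rightarrow> 'b) \<Rightarrow> bool" where
  "scale_preserving M N F \<longleftrightarrow> F ` dm_scale M = dm_scale N"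

text \<open>The limit of the sets \<open>C k\<close> under maps \<open>h k\<close> is the set of pairs (level, element) modulo
  eventual equality.\<close>

definition dl_eq ::
    "(nat \<Rightarrow> 'a set) \<Rightarrow> (nat \<Rightarrow> 'a \<Rightarrow> 'a) \<Rightarrow> ((nat \<times> 'a) \<times> (nat \<times> 'a)) set" where
  "dl_eq C h =
     {((k, X), (l, Y)). X \<in> C k \<and> Y \<in> C l \<and>
        (\<exists>m. k \<le> m \<and> l \<le> m \<and> conn h k (m - k) X = conn h l (m - l) Y)}"

definition V_lim ::
    "(nat \<Rightarrow> nat) \<Rightarrow> (nat \<Rightarrow> (nat \<times> nat, nat \<times> nat) cmat \<Rightarrow> (nat \<times> nat, nat \<times> nat) cmat) \<Rightarrow>
     (nat \<times> nat vmap set) set dim_module" where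
  "V_lim n f =
     (let J = (\<lambda>k. {..<n k});
          h = (\<lambda>k. V_hat (J (Suc k)) (f k));
          E = dl_eq (\<lambda>k. V (J k)) h
      in \<lparr>dm_carrier = Sigma UNIV (\<lambda>k. V (J k)) // E,
          dm_add = (\<lambda>P Q. \<Union>(k, X)\<in>P. \<Union>(l, Y)\<in>Q.
             E `` {(max k l, V_add (J (max k l)) (conn h k (max k l - k) X)
                                                 (conn h l (max k l - l) Y))}),
          dm_act = (\<lambda>P \<Theta>. \<Union>(k, X)\<in>P. E `` {(k, V_act (J k) X \<Theta>)}),
          dm_scale = {E `` {(k, X)} | k X. X \<in> V_scale (J k)}\<rparr>)"

end

theory Submission
  imports Defs
begin

text \<open>A regular map between \<open>T\<^sub>3\<close>-algebras is determined, up to unitary equivalence, by the multiset of the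
  order preserving maps of \<open>{1, 2, 3}\<close> that its multiplicity one summands induce, and composition of maps
  becomes the product of multisets. Thus \<open>V(B)\<close> is the semigroup of these multisets, and \<open>V(A\<^sub>0)\<close> is a limit of
  multiset semigroups.

  An isomorphism of dimension modules is determined by the images of the unit multisets at the levels \<open>k\<close>. These
  are classes of regular maps between finite levels, which exist once the sizes allow it (by the scale, or by
  amplification in the stable case). Correcting them by inner unitaries gives an exact intertwining of the two
  systems, hence an isomorphism of the limits.

  Conversely, a star-extendible isomorphism restricts to star-extendible maps between finite levels because the
  matrix unit relations are stable. These maps \<open>\<alpha>\<close> need not be regular, but \<open>\<alpha>' \<circ> \<beta> \<circ> \<alpha>\<close> is regular if
  \<open>\<beta> \<circ> \<alpha>\<close> and \<open>\<alpha>' \<circ> \<beta>\<close> are. Indeed \<open>\<alpha>\<close> compresses the block projections of its target to three triangular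
  resolutions of one projection, and it is regular exactly when these commute. Under composition their commutators
  are tensored with the identity component of the outer map. If this component of \<open>\<alpha>' \<circ> \<beta>\<close> vanishes, the
  commutators are destroyed; otherwise \<open>\<beta>\<close> has an identity component too, and the commutators of \<open>\<alpha>\<close>
  survive in the regular map \<open>\<beta> \<circ> \<alpha>\<close>, hence are zero.\<close>

section \<open>Order preserving maps and their multisets\<close>

text \<open>For \<open>i < j\<close> triangularity makes the first projections of the
  \<open>i\<close>-th and \<open>j\<close>-th resolution comparable, and likewise the last ones.
  Hence all commutators between two resolutions are 0 or, up to sign, one element
  \<open>\<kappa> i j\<close>, and with a regular outer map the nine signed tensor terms collapse to
  \<open>\<kappa> i j\<close> tensored with \<open>Z = E 1 1 * E 2 2 * E 3 3\<close>. This
  \<open>Z\<close> is the algebraic form of the identity component: it is defined for irregular maps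
  too and is multiplicative under composition, which links \<beta> with \<alpha>' \<circ> \<beta>.
  The hard point is that commutators of \<alpha> survive in \<beta> \<circ> \<alpha> although
  \<beta> may be irregular and \<open>Z\<close> then need not be a projection; a compressed
  commutation relation replaces the missing projection.

  Elsewhere: connecting maps may be zero, so equality in a limit yields equality only at a later
  level; unitaries of the unitisation are infinite matrices, so convergence must be extracted from
  unitarity; stabilised levels are infinite and are followed along finite blocks
  \<open>{..<n k} \<times> {..<Suc k}\<close>, whose growth also removes the size
  restriction.\<close>

typedef omap = "{f :: nat \<Rightarrow> nat. (\<forall>x\<in>{1..3}. f x \<in> {1..3}) \<and> mono_on {1..3} f \<and> (\<forall>x. x \<notin> {1..3} \<longrightarrow> f x = x)}"
  morphisms omap_apply Abs_omap
  by (rule exI[of _ id]) (auto simp: mono_on_def)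

setup_lifting type_definition_omap

instantiation omap :: monoid_mult
begin

lift_definition one_omap :: omap is id
  by (auto simp: mono_on_def)

lift_definition times_omap :: "omap \<Rightarrow> omap \<Rightarrow> omap" is comp
  by (auto simp: mono_on_def)

instance
  by standard (transfer; auto)+

end

lemma omap_apply_range: "x \<in> {1..3} \<Longrightarrow> omap_apply s x \<in> {1..3}"
  using omap_apply[of s] by auto

lemma omap_apply_mono: "x \<in> {1..3} \<Longrightarrow> y \<in> {1..3} \<Longrightarrow> x \<le> y \<Longrightarrow> omap_apply s x \<le> omap_apply s y"
  using omap_apply[of s] by (auto simp: mono_on_def)

text \<open>The type fixes the identity outside \<open>{1..3}\<close>, so three values determine an
  element while multiplication remains plain composition.\<close>

lemma omap_eqI:
  assumes "\<And>x. x \<in> {1..3} \<Longrightarrow> omap_apply s x = omap_apply t x"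
  shows "s = t"
proof -
  have "omap_apply s x = omap_apply t x" for x
    using assms[of x] omap_apply[of s] omap_apply[of t] by (cases "x \<in> {1..3}") auto
  then show ?thesis by (simp add: omap_apply_inject[symmetric] fun_eq_iff)
qed

lemma omap_exists:
  assumes "\<And>x. x \<in> {1..3} \<Longrightarrow> f x \<in> {1..3}"
    and "\<And>x y. x \<in> {1..3} \<Longrightarrow> y \<in> {1..3} \<Longrightarrow> x \<le> y \<Longrightarrow> f x \<le> f y"
  shows "\<exists>s. \<forall>x\<in>{1..3::nat}. omap_apply s x = f x"
proof -
  let ?g = "\<lambda>x. if x \<in> {1..3} then f x else x"
  have "?g \<in> {f. (\<forall>x\<in>{1..3}. f x \<in> {1..3}) \<and> mono_on {1..3} f \<and> (\<forall>x. x \<notin> {1..3} \<longrightarrow> f x = x)}"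
    using assms by (auto simp: mono_on_def)
  then have "omap_apply (Abs_omap ?g) = ?g" by (rule Abs_omap_inverse)
  then show ?thesis by (intro exI[of _ "Abs_omap ?g"]) auto
qed

lemma omap_apply_times: "omap_apply (s * t) x = omap_apply s (omap_apply t x)"
  by transfer simp

lemma omap_apply_one: "omap_apply 1 x = x"
  by transfer simp

text \<open>Multiplication in the semiring of formal sums of monoid elements with coefficients in
  the natural numbers; a multiset stands for such a sum.\<close>

definition mprod :: "'a::monoid_mult multiset \<Rightarrow> 'a multiset \<Rightarrow> 'a multiset" where
  "mprod A B = (\<Sum>x\<in>#A. image_mset ((*) x) B)"

lemma mprod_empty [simp]: "mprod {#} B = {#}" "mprod A {#} = {#}"
  by (simp_all add: mprod_def)

lemma mprod_add_left: "mprod (A + A') B = mprod A B + mprod A' B"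
  by (simp add: mprod_def)

lemma mprod_add_right: "mprod A (B + B') = mprod A B + mprod A B'"
  by (simp add: mprod_def sum_mset.distrib)

lemma mprod_add_mset: "mprod (add_mset x A) B = image_mset ((*) x) B + mprod A B"
  by (simp add: mprod_def)

lemma mprod_one_left [simp]: "mprod {#1#} B = B"
proof -
  have "image_mset ((*) 1) B = image_mset (\<lambda>x. x) B" by (rule image_mset_cong) simp
  then show ?thesis by (simp add: mprod_def)
qed

lemma mprod_one_right [simp]: "mprod A {#1#} = A"
  by (induction A) (auto simp: mprod_add_mset)

lemma image_mult_mprod: "image_mset ((*) x) (mprod A B) = mprod (image_mset ((*) x) A) B"
proof (induction A)
  case (add y A)
  have "image_mset ((*) x) (image_mset ((*) y) B) = image_mset ((*) (x * y)) B"
    unfolding multiset.map_comp by (rule image_mset_cong) (simp add: mult.assoc)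
  with add show ?case by (simp add: mprod_add_mset)
qed simp

lemma mprod_assoc: "mprod (mprod A B) C = mprod A (mprod B C)"
  by (induction A) (simp_all add: mprod_add_mset mprod_add_left image_mult_mprod)

text \<open>The summands of a composed map are indexed by pairs; this is the bridge from such a
  family to \<open>mprod\<close>.\<close>

lemma mprod_families:
  assumes "finite S" "finite T"
  shows "mprod (image_mset f (mset_set S)) (image_mset g (mset_set T)) =
    image_mset (\<lambda>(s, t). f s * g t) (mset_set (S \<times> T))"
  using assms(1)
proof (induction S)
  case (insert s S)
  have e: "insert s S \<times> T = Pair s ` T \<union> S \<times> T" by auto
  have "mset_set (insert s S \<times> T) = mset_set (Pair s ` T) + mset_set (S \<times> T)"
    unfolding e using insert assms(2) by (intro mset_set_Union) auto
  also have "mset_set (Pair s ` T) = image_mset (Pair s) (mset_set T)"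
    by (rule image_mset_mset_set[symmetric]) (auto simp: inj_on_def)
  finally show ?case using insert assms(2)
    by (simp add: mprod_add_mset multiset.map_comp comp_def)
qed simp

lemma mset_family: "\<exists>f. m = image_mset f (mset_set {..<size m})"
proof -
  obtain xs where "m = mset xs" by (metis ex_mset)
  moreover have "mset xs = image_mset ((!) xs) (mset_set {..<length xs})"
    by (metis map_nth mset_map mset_upt atLeast0LessThan)
  ultimately show ?thesis by auto
qed

text \<open>For each value the fibres in \<open>A\<close> and \<open>B\<close> have the same
  cardinality, the count of that value in the common multiset; bijections between the fibres are
  glued along \<open>f\<close>.\<close>

lemma image_mset_bij:
  assumes "finite A" "finite B" "image_mset f (mset_set A) = image_mset g (mset_set B)"
  shows "\<exists>h. bij_betw h A B \<and> (\<forall>a\<in>A. g (h a) = f a)"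
proof -
  have cnt: "card {a\<in>A. f a = c} = card {b\<in>B. g b = c}" for c
  proof -
    have "count (image_mset f (mset_set A)) c = card {a\<in>A. f a = c}"
      using assms(1) by (simp add: count_image_mset' sum.If_cases Int_def conj_commute eq_commute[of c])
    moreover have "count (image_mset g (mset_set B)) c = card {b\<in>B. g b = c}"
      using assms(2) by (simp add: count_image_mset' sum.If_cases Int_def conj_commute eq_commute[of c])
    ultimately show ?thesis using assms(3) by simp
  qed
  have "\<exists>h. bij_betw h {a\<in>A. f a = c} {b\<in>B. g b = c}" for c
    using cnt[of c] assms by (simp add: bij_betw_iff_card)
  then obtain h where h: "\<And>c. bij_betw (h c) {a\<in>A. f a = c} {b\<in>B. g b = c}" by metis
  let ?h = "\<lambda>a. h (f a) a"
  have mem: "?h a \<in> B \<and> g (?h a) = f a" if "a \<in> A" for a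
    using bij_betwE[OF h[of "f a"]] that by auto
  have inj: "inj_on ?h A"
  proof (rule inj_onI)
    fix a b assume ab: "a \<in> A" "b \<in> A" "?h a = ?h b"
    then have "f a = f b" using mem by metis
    then show "a = b" using ab bij_betw_imp_inj_on[OF h[of "f a"]] by (auto simp: inj_on_def)
  qed
  have "b \<in> ?h ` A" if "b \<in> B" for b
  proof -
    have "b \<in> h (g b) ` {a\<in>A. f a = g b}" using that bij_betw_imp_surj_on[OF h[of "g b"]] by auto
    then obtain a where "a \<in> A" "f a = g b" "b = h (g b) a" by blast
    then show ?thesis by (intro image_eqI[of _ _ a]) simp_all
  qed
  then have "bij_betw ?h A B" using inj mem by (auto simp: bij_betw_def)
  then show ?thesis using mem by (intro exI[of _ ?h]) auto
qed

text \<open>For a map on \<open>T3 {()}\<close> with multiset \<open>m\<close> this is the rank,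
  inside block \<open>t\<close> of the target, of the image of the identity: a copy labelled
  \<open>s\<close> contributes one dimension for each point that \<open>s\<close> sends to
  \<open>t\<close>. Comparing it with block sizes decides whether a map fits into its
  target.\<close>

definition wt :: "nat \<Rightarrow> omap multiset \<Rightarrow> nat" where
  "wt t m = (\<Sum>s\<in>#m. card {i\<in>{1..3}. omap_apply s i = t})"

lemma wt_add: "wt t (m + m') = wt t m + wt t m'"
  by (simp add: wt_def)

lemma wt_repeat_one: "t \<in> {1..3} \<Longrightarrow> wt t (repeat_mset n {#1#}) = n"
proof (induction n)
  case (Suc n)
  have "{i. (Suc 0 \<le> i \<and> i \<le> 3) \<and> i = t} = {t}" using Suc.prems by auto
  then show ?case using Suc by (simp add: wt_def omap_apply_one)
qed (simp add: wt_def)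

lemma wt_mprod_repeat: "wt t (mprod m (repeat_mset n {#1#})) = n * wt t m"
proof (induction n)
  case (Suc n)
  have "repeat_mset (Suc n) {#1#} = repeat_mset n {#1::omap#} + {#1#}" by simp
  then show ?case using Suc by (simp only: mprod_add_right wt_add) simp
qed (simp add: wt_def)

lemma wt_image_mult: "wt t (image_mset ((*) s) m) = (\<Sum>q\<in>{q\<in>{1..3}. omap_apply s q = t}. wt q m)"
proof (induction m)
  case (add r m)
  have "card {i\<in>{1..3}. omap_apply (s * r) i = t} =
    card (\<Union>q\<in>{q\<in>{1..3}. omap_apply s q = t}. {i\<in>{1..3}. omap_apply r i = q})"
    by (rule arg_cong[of _ _ card]) (use omap_apply_range[of _ r] in \<open>auto simp: omap_apply_times\<close>)
  also have "\<dots> = (\<Sum>q\<in>{q\<in>{1..3}. omap_apply s q = t}. card {i\<in>{1..3}. omap_apply r i = q})"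
    by (rule card_UN_disjoint) auto
  finally show ?case using add by (simp add: wt_def sum.distrib)
qed (simp add: wt_def)

text \<open>A summand \<open>s\<close> of \<open>m'\<close> contributes to block \<open>t\<close>
  the weights of \<open>m\<close> at the points that \<open>s\<close> sends to \<open>t\<close>, and
  each of these times \<open>p\<close> is at most \<open>p'\<close>. Read with level sizes for
  \<open>p\<close> and \<open>p'\<close>, this bounds the room that a composition needs.\<close>

lemma wt_mprod_le:
  assumes "\<And>q. q \<in> {1..3} \<Longrightarrow> p * wt q m \<le> p'"
  shows "p * wt t (mprod m' m) \<le> p' * wt t m'"
proof (induction m')
  case (add s m')
  have "p * wt t (image_mset ((*) s) m) \<le> p' * card {q\<in>{1..3}. omap_apply s q = t}"
    unfolding wt_image_mult sum_distrib_left
    using sum_bounded_above[of "{q\<in>{1..3}. omap_apply s q = t}" "\<lambda>q. p * wt q m" p'] assms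
    by (simp add: mult.commute)
  then show ?case using add by (simp add: mprod_add_mset wt_add wt_def algebra_simps)
qed (simp add: wt_def)

section \<open>Orthonormal families\<close>

text \<open>Vectors are coordinate functions, and the inner product is summed over a finite set
  \<open>K\<close>; a block of a matrix algebra is thus a choice of \<open>K\<close>, not a type of
  its own.\<close>

definition orthonormal_on :: "'k set \<Rightarrow> ('a \<Rightarrow> 'k \<Rightarrow> complex) \<Rightarrow> 'a set \<Rightarrow> bool" where
  "orthonormal_on K f A \<longleftrightarrow>
     (\<forall>a\<in>A. \<forall>b\<in>A. (\<Sum>k\<in>K. cnj (f a k) * f b k) = of_bool (a = b))"

lemma orthonormal_onD:
  "orthonormal_on K f A \<Longrightarrow> a \<in> A \<Longrightarrow> b \<in> A \<Longrightarrow> (\<Sum>k\<in>K. cnj (f a k) * f b k) = of_bool (a = b)"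
  by (simp add: orthonormal_on_def)

text \<open>The subtracted sum is the orthogonal projection of \<open>x\<close> on the span of the
  family. Its inner products with itself and with \<open>x\<close> all equal the sum of the squared
  coefficients, so Pythagoras remains.\<close>

lemma orthonormal_residual:
  assumes "finite K" "finite A" "orthonormal_on K f A"
  defines "c \<equiv> \<lambda>x a. \<Sum>k\<in>K. cnj (f a k) * x k"
  shows "(\<Sum>k\<in>K. (cmod (x k - (\<Sum>a\<in>A. c x a * f a k)))\<^sup>2) =
      (\<Sum>k\<in>K. (cmod (x k))\<^sup>2) - (\<Sum>a\<in>A. (cmod (c x a))\<^sup>2)"
    and "a \<in> A \<Longrightarrow> (\<Sum>k\<in>K. cnj (f a k) * (x k - (\<Sum>a\<in>A. c x a * f a k))) = 0"
proof -
  define y where "y k = (\<Sum>a\<in>A. c x a * f a k)" for k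
  have fy: "(\<Sum>k\<in>K. cnj (f b k) * y k) = c x b" if "b \<in> A" for b
  proof -
    have "(\<Sum>k\<in>K. cnj (f b k) * y k) = (\<Sum>a\<in>A. c x a * (\<Sum>k\<in>K. cnj (f b k) * f a k))"
      unfolding y_def sum_distrib_left by (subst sum.swap) (simp add: mult_ac)
    also have "\<dots> = (\<Sum>a\<in>A. if a = b then c x a else 0)"
      by (rule sum.cong) (auto simp: orthonormal_onD[OF assms(3) that])
    also have "\<dots> = c x b" using that assms(2) by simp
    finally show ?thesis .
  qed
  have yx: "(\<Sum>k\<in>K. cnj (y k) * z k) = (\<Sum>a\<in>A. cnj (c x a) * (\<Sum>k\<in>K. cnj (f a k) * z k))" for z
    unfolding y_def cnj_sum sum_distrib_left sum_distrib_right by (subst sum.swap) (simp add: mult_ac)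
  have yy: "(\<Sum>k\<in>K. cnj (y k) * y k) = (\<Sum>a\<in>A. cnj (c x a) * c x a)"
    unfolding yx using fy by simp
  have yx': "(\<Sum>k\<in>K. cnj (y k) * x k) = (\<Sum>a\<in>A. cnj (c x a) * c x a)"
    unfolding yx c_def ..
  have xy: "(\<Sum>k\<in>K. cnj (x k) * y k) = (\<Sum>a\<in>A. cnj (c x a) * c x a)"
    using arg_cong[OF yx', of cnj] by (simp add: mult.commute)
  have sq: "complex_of_real ((cmod z)\<^sup>2) = cnj z * z" for z
    by (simp only: mult.commute[of "cnj z"] complex_norm_square)
  have "complex_of_real (\<Sum>k\<in>K. (cmod (x k - y k))\<^sup>2) = (\<Sum>k\<in>K. cnj (x k - y k) * (x k - y k))"
    unfolding of_real_sum sq ..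
  also have "\<dots> = (\<Sum>k\<in>K. cnj (x k) * x k) - (\<Sum>k\<in>K. cnj (x k) * y k) - (\<Sum>k\<in>K. cnj (y k) * x k) + (\<Sum>k\<in>K. cnj (y k) * y k)"
    unfolding sum_subtractf[symmetric] sum.distrib[symmetric] by (rule sum.cong) (auto simp: algebra_simps)
  also have "\<dots> = (\<Sum>k\<in>K. cnj (x k) * x k) - (\<Sum>a\<in>A. cnj (c x a) * c x a)"
    unfolding yy yx' xy by simp
  also have "\<dots> = complex_of_real ((\<Sum>k\<in>K. (cmod (x k))\<^sup>2) - (\<Sum>a\<in>A. (cmod (c x a))\<^sup>2))"
    unfolding of_real_diff of_real_sum sq ..
  finally show "(\<Sum>k\<in>K. (cmod (x k - (\<Sum>a\<in>A. c x a * f a k)))\<^sup>2) =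
      (\<Sum>k\<in>K. (cmod (x k))\<^sup>2) - (\<Sum>a\<in>A. (cmod (c x a))\<^sup>2)"
    unfolding y_def of_real_eq_iff .
  show "(\<Sum>k\<in>K. cnj (f a k) * (x k - (\<Sum>a\<in>A. c x a * f a k))) = 0" if "a \<in> A"
    using fy[OF that] by (simp add: right_diff_distrib sum_subtractf y_def c_def)
qed

lemma orthonormal_bessel:
  assumes "finite K" "finite A" "orthonormal_on K f A"
  shows "(\<Sum>a\<in>A. (cmod (\<Sum>k\<in>K. cnj (f a k) * x k))\<^sup>2) \<le> (\<Sum>k\<in>K. (cmod (x k))\<^sup>2)"
  using orthonormal_residual(1)[OF assms, of x] sum_nonneg[of K "\<lambda>k. (cmod (x k - (\<Sum>a\<in>A. (\<Sum>k\<in>K. cnj (f a k) * x k) * f a k)))\<^sup>2"]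
  by simp

lemma sum_unit_vector: "finite K \<Longrightarrow> j \<in> K \<Longrightarrow> (\<Sum>k\<in>K. (f k :: complex) * of_bool (k = j)) = f j"
  by (simp add: of_bool_def if_distrib[of "\<lambda>x. _ * x"] cong: if_cong)

text \<open>Summed vector by vector, each vector contributes 1. Played off against the bound 1 for
  each coordinate, this identity serves as the dimension count.\<close>

lemma orthonormal_norm_sum:
  assumes "finite K" "finite A" "orthonormal_on K f A"
  shows "(\<Sum>k\<in>K. \<Sum>a\<in>A. (cmod (f a k))\<^sup>2) = card A"
proof -
  have "(\<Sum>k\<in>K. (cmod (f a k))\<^sup>2) = 1" if "a \<in> A" for a
  proof -
    have "complex_of_real (\<Sum>k\<in>K. (cmod (f a k))\<^sup>2) = (\<Sum>k\<in>K. cnj (f a k) * f a k)"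
      unfolding of_real_sum complex_norm_square by (simp add: mult.commute)
    also have "\<dots> = complex_of_real 1" using orthonormal_onD[OF assms(3) that that] by simp
    finally show ?thesis by (simp only: of_real_eq_iff)
  qed
  then show ?thesis by (subst sum.swap) simp
qed

lemma orthonormal_residual_unit:
  assumes "finite K" "finite A" "orthonormal_on K f A" "j \<in> K"
  shows "(\<Sum>k\<in>K. (cmod (of_bool (k = j) - (\<Sum>a\<in>A. cnj (f a j) * f a k)))\<^sup>2) =
    1 - (\<Sum>a\<in>A. (cmod (f a j))\<^sup>2)"
proof -
  have "(\<Sum>k\<in>K. cnj (f a k) * of_bool (k = j)) = cnj (f a j)" for a
    using assms(1,4) by (rule sum_unit_vector)
  moreover have "(\<Sum>k\<in>K. (cmod (of_bool (k = j)))\<^sup>2) = 1"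
    using assms(1,4) by (simp add: of_bool_def if_distrib[of "\<lambda>x. (cmod x)\<^sup>2"] cong: if_cong)
  ultimately show ?thesis
    using orthonormal_residual(1)[OF assms(1-3), of "\<lambda>k. of_bool (k = j)"] by (simp del: of_bool_eq_1_iff)
qed

lemma orthonormal_coord:
  assumes "finite K" "finite A" "orthonormal_on K f A" "j \<in> K"
  shows "(\<Sum>a\<in>A. (cmod (f a j))\<^sup>2) \<le> 1"
proof -
  have "0 \<le> (\<Sum>k\<in>K. (cmod (of_bool (k = j) - (\<Sum>a\<in>A. cnj (f a j) * f a k)))\<^sup>2)"
    by (intro sum_nonneg) simp
  then show ?thesis unfolding orthonormal_residual_unit[OF assms] by simp
qed

lemma orthonormal_card_le:
  assumes "finite K" "finite A" "orthonormal_on K f A"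
  shows "card A \<le> card K"
proof -
  have "(\<Sum>k\<in>K. \<Sum>a\<in>A. (cmod (f a k))\<^sup>2) \<le> (\<Sum>k\<in>K. 1::real)"
    by (rule sum_mono) (rule orthonormal_coord[OF assms])
  then show ?thesis using orthonormal_norm_sum[OF assms] by simp
qed

text \<open>The total mass is \<open>card K\<close> and each coordinate carries at most 1, so each
  carries exactly 1; then every coordinate vector has residual 0, i.e. it lies in the span.\<close>

lemma orthonormal_complete:
  assumes "finite K" "finite A" "orthonormal_on K f A" "card A = card K" "j \<in> K" "l \<in> K"
  shows "(\<Sum>a\<in>A. f a l * cnj (f a j)) = of_bool (l = j)"
proof -
  have one: "(\<Sum>a\<in>A. (cmod (f a j))\<^sup>2) = 1"
  proof (rule ccontr)
    assume "(\<Sum>a\<in>A. (cmod (f a j))\<^sup>2) \<noteq> 1"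
    then have "(\<Sum>a\<in>A. (cmod (f a j))\<^sup>2) < 1" using orthonormal_coord[OF assms(1-3,5)] by simp
    then have "(\<Sum>k\<in>K. \<Sum>a\<in>A. (cmod (f a k))\<^sup>2) < (\<Sum>k\<in>K. 1::real)"
      using orthonormal_coord[OF assms(1-3)] assms(1,5) by (intro sum_strict_mono_ex1) auto
    then show False using orthonormal_norm_sum[OF assms(1-3)] assms(4) by simp
  qed
  let ?x = "\<lambda>k. of_bool (k = j) :: complex"
  have "(\<Sum>k\<in>K. (cmod (?x k - (\<Sum>a\<in>A. cnj (f a j) * f a k)))\<^sup>2) = 0"
    using orthonormal_residual_unit[OF assms(1-3,5)] one by simp
  then have "?x l - (\<Sum>a\<in>A. cnj (f a j) * f a l) = 0"
    using assms by (subst (asm) sum_nonneg_eq_0_iff) auto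
  then show ?thesis by (simp add: mult.commute)
qed

text \<open>The total mass is less than \<open>card K\<close>, so some coordinate vector projects on
  the span with norm below 1; its residual, normalised, is the new vector.\<close>

lemma orthonormal_extend_one:
  assumes "finite K" "finite A" "orthonormal_on K f A" "card A < card K"
  shows "\<exists>g. (\<Sum>k\<in>K. cnj (g k) * g k) = 1 \<and> (\<forall>a\<in>A. (\<Sum>k\<in>K. cnj (f a k) * g k) = 0)"
proof -
  have "\<exists>j\<in>K. (\<Sum>a\<in>A. (cmod (f a j))\<^sup>2) < 1"
  proof (rule ccontr)
    assume "\<not> ?thesis"
    then have "(\<Sum>k\<in>K. 1::real) \<le> (\<Sum>k\<in>K. \<Sum>a\<in>A. (cmod (f a k))\<^sup>2)" by (intro sum_mono) force
    then show False using orthonormal_norm_sum[OF assms(1-3)] assms(4) by simp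
  qed
  then obtain j where j: "j \<in> K" "(\<Sum>a\<in>A. (cmod (f a j))\<^sup>2) < 1" by auto
  let ?x = "\<lambda>k. of_bool (k = j) :: complex"
  have c: "(\<Sum>k\<in>K. cnj (f a k) * ?x k) = cnj (f a j)" for a
    using assms(1) j(1) by (rule sum_unit_vector)
  define y where "y k = ?x k - (\<Sum>a\<in>A. cnj (f a j) * f a k)" for k
  define N where "N = (\<Sum>k\<in>K. (cmod (y k))\<^sup>2)"
  have "N = 1 - (\<Sum>a\<in>A. (cmod (f a j))\<^sup>2)"
    unfolding N_def y_def by (rule orthonormal_residual_unit[OF assms(1-3) j(1)])
  then have N: "N > 0" using j by simp
  have orth: "(\<Sum>k\<in>K. cnj (f a k) * y k) = 0" if "a \<in> A" for a
    unfolding y_def using orthonormal_residual(2)[OF assms(1-3) that, of ?x] unfolding c .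
  have yN: "(\<Sum>k\<in>K. cnj (y k) * y k) = complex_of_real N"
    unfolding N_def of_real_sum complex_norm_square by (simp add: mult.commute)
  let ?g = "\<lambda>k. y k / complex_of_real (sqrt N)"
  have "(\<Sum>k\<in>K. cnj (?g k) * ?g k) = (\<Sum>k\<in>K. cnj (y k) * y k) / complex_of_real N"
    unfolding sum_divide_distrib using N
    by (intro sum.cong refl) (simp add: field_simps of_real_mult[symmetric] del: of_real_mult)
  also have "\<dots> = 1" using N unfolding yN by simp
  finally have "(\<Sum>k\<in>K. cnj (?g k) * ?g k) = 1" .
  moreover have "(\<Sum>k\<in>K. cnj (f a k) * ?g k) = 0" if "a \<in> A" for a
    using orth[OF that] by (simp add: sum_divide_distrib[symmetric])
  ultimately show ?thesis by (intro exI[of _ ?g] conjI ballI)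
qed

lemma orthonormal_extend:
  assumes K: "finite K" and A: "finite A" and f: "orthonormal_on K f A"
  shows "\<exists>f'. (\<forall>a. f' (Inl a) = f a) \<and> orthonormal_on K f' (Inl ` A \<union> Inr ` {..<card K - card A})"
proof -
  have "\<exists>f'. (\<forall>a. f' (Inl a) = f a) \<and> orthonormal_on K f' (Inl ` A \<union> Inr ` {..<n})"
    if "n \<le> card K - card A" for n
    using that
  proof (induction n)
    case 0
    then show ?case using f by (intro exI[of _ "case_sum f (\<lambda>_. f undefined)"]) (auto simp: orthonormal_on_def)
  next
    case (Suc n)
    then obtain f' where f': "\<forall>a. f' (Inl a) = f a" "orthonormal_on K f' (Inl ` A \<union> Inr ` {..<n})" by auto
    have "card (Inl ` A \<union> Inr ` {..<n}) = card A + n"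
      using A by (subst card_Un_disjoint) (auto simp: card_image)
    then have "card (Inl ` A \<union> Inr ` {..<n}) < card K" using Suc.prems by linarith
    then obtain g where g: "(\<Sum>k\<in>K. cnj (g k) * g k) = 1"
      "\<And>a. a \<in> Inl ` A \<union> Inr ` {..<n} \<Longrightarrow> (\<Sum>k\<in>K. cnj (f' a k) * g k) = 0"
      using orthonormal_extend_one[OF K _ f'(2)] A by auto
    have g': "(\<Sum>k\<in>K. cnj (g k) * f' a k) = 0" if "a \<in> Inl ` A \<union> Inr ` {..<n}" for a
      using arg_cong[OF g(2)[OF that], of cnj] by (simp add: mult.commute)
    let ?f = "f'(Inr n := g)"
    have "orthonormal_on K ?f (Inl ` A \<union> Inr ` {..<Suc n})"
      unfolding orthonormal_on_def
    proof (intro ballI)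
      fix a b assume ab: "a \<in> Inl ` A \<union> Inr ` {..<Suc n}" "b \<in> Inl ` A \<union> Inr ` {..<Suc n}"
      consider "a = Inr n" "b = Inr n" | "a = Inr n" "b \<noteq> Inr n" | "a \<noteq> Inr n" "b = Inr n" | "a \<noteq> Inr n" "b \<noteq> Inr n" by auto
      then show "(\<Sum>k\<in>K. cnj (?f a k) * ?f b k) = of_bool (a = b)"
      proof cases
        case 1 then show ?thesis using g by simp
      next
        case 2
        then have "b \<in> Inl ` A \<union> Inr ` {..<n}" using ab by (auto simp: less_Suc_eq)
        then show ?thesis using 2 g' by simp
      next
        case 3
        then have "a \<in> Inl ` A \<union> Inr ` {..<n}" using ab by (auto simp: less_Suc_eq)
        then show ?thesis using 3 g by simp
      next
        case 4
        then have "a \<in> Inl ` A \<union> Inr ` {..<n}" "b \<in> Inl ` A \<union> Inr ` {..<n}" using ab by (auto simp: less_Suc_eq)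
        then show ?thesis using 4 orthonormal_onD[OF f'(2)] by simp
      qed
    qed
    moreover have "\<forall>a. ?f (Inl a) = f a" using f'(1) by simp
    ultimately show ?case by blast
  qed
  then show ?thesis by blast
qed

text \<open>Both families are completed to orthonormal bases with the same index set, the added
  vectors carrying the indices \<open>Inr\<close>.\<close>

lemma orthonormal_unitary:
  assumes K: "finite K" and A: "finite A" and v: "orthonormal_on K v A" and w: "orthonormal_on K w A"
  shows "\<exists>u. (\<forall>k l. u k l \<noteq> 0 \<longrightarrow> k \<in> K \<and> l \<in> K) \<and>
     (\<forall>k\<in>K. \<forall>l\<in>K. (\<Sum>j\<in>K. u k j * cnj (u l j)) = of_bool (k = l)) \<and>
     (\<forall>k\<in>K. \<forall>l\<in>K. (\<Sum>j\<in>K. cnj (u j k) * u j l) = of_bool (k = l)) \<and>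
     (\<forall>a\<in>A. \<forall>k\<in>K. (\<Sum>l\<in>K. u k l * v a l) = w a k)"
proof -
  let ?B = "Inl ` A \<union> Inr ` {..<card K - card A}"
  obtain v' where v': "\<forall>a. v' (Inl a) = v a" "orthonormal_on K v' ?B"
    using orthonormal_extend[OF K A v] by blast
  obtain w' where w': "\<forall>a. w' (Inl a) = w a" "orthonormal_on K w' ?B"
    using orthonormal_extend[OF K A w] by blast
  have fB: "finite ?B" using A by simp
  have "card ?B = card A + (card K - card A)"
    using A by (subst card_Un_disjoint) (auto simp: card_image)
  then have cB: "card ?B = card K" using orthonormal_card_le[OF K A v] by simp
  \<comment> \<open>The sum of the rank one operators that send the basis vector \<open>v' b\<close>
    to \<open>w' b\<close>.\<close>
  define u where "u k l = (if k \<in> K \<and> l \<in> K then \<Sum>b\<in>?B. w' b k * cnj (v' b l) else 0)" for k l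
  have uv: "(\<Sum>l\<in>K. u k l * v' b l) = w' b k" if "k \<in> K" "b \<in> ?B" for k b
  proof -
    have "(\<Sum>l\<in>K. u k l * v' b l) = (\<Sum>c\<in>?B. w' c k * (\<Sum>l\<in>K. cnj (v' c l) * v' b l))"
      unfolding u_def sum_distrib_left using that(1)
      by (subst sum.swap) (simp add: sum_distrib_left mult_ac)
    also have "\<dots> = (\<Sum>c\<in>?B. w' c k * of_bool (c = b))"
      by (rule sum.cong) (use orthonormal_onD[OF v'(2) _ that(2)] in auto)
    also have "\<dots> = w' b k" using that fB by (simp add: sum_unit_vector)
    finally show ?thesis .
  qed
  have uw: "(\<Sum>k\<in>K. cnj (u k l) * w' b k) = v' b l" if "l \<in> K" "b \<in> ?B" for l b
  proof -
    have "(\<Sum>k\<in>K. cnj (u k l) * w' b k) = (\<Sum>c\<in>?B. v' c l * (\<Sum>k\<in>K. cnj (w' c k) * w' b k))"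
      unfolding u_def sum_distrib_left using that(1)
      by (subst sum.swap) (simp add: sum_distrib_left mult_ac cnj_sum)
    also have "\<dots> = (\<Sum>c\<in>?B. v' c l * of_bool (c = b))"
      by (rule sum.cong) (use orthonormal_onD[OF w'(2) _ that(2)] in auto)
    also have "\<dots> = v' b l" using that fB by (simp add: sum_unit_vector)
    finally show ?thesis .
  qed
  have 1: "(\<Sum>j\<in>K. u k j * cnj (u l j)) = of_bool (k = l)" if kl: "k \<in> K" "l \<in> K" for k l
  proof -
    have "(\<Sum>j\<in>K. u k j * cnj (u l j)) = (\<Sum>j\<in>K. \<Sum>b\<in>?B. cnj (w' b l) * (u k j * v' b j))"
      by (rule sum.cong) (use kl in \<open>auto simp: u_def[of l] sum_distrib_left mult_ac\<close>)
    also have "\<dots> = (\<Sum>b\<in>?B. cnj (w' b l) * (\<Sum>j\<in>K. u k j * v' b j))"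
      unfolding sum_distrib_left by (subst sum.swap) simp
    also have "\<dots> = (\<Sum>b\<in>?B. w' b k * cnj (w' b l))"
      by (rule sum.cong) (use kl uv in auto)
    finally show ?thesis using orthonormal_complete[OF K fB w'(2) cB kl(2,1)] by simp
  qed
  have 2: "(\<Sum>j\<in>K. cnj (u j k) * u j l) = of_bool (k = l)" if kl: "k \<in> K" "l \<in> K" for k l
  proof -
    have "(\<Sum>j\<in>K. cnj (u j k) * u j l) = (\<Sum>j\<in>K. \<Sum>b\<in>?B. cnj (v' b l) * (cnj (u j k) * w' b j))"
      by (rule sum.cong) (use kl in \<open>auto simp: u_def[of _ l] sum_distrib_left mult_ac\<close>)
    also have "\<dots> = (\<Sum>b\<in>?B. cnj (v' b l) * (\<Sum>j\<in>K. cnj (u j k) * w' b j))"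
      unfolding sum_distrib_left by (subst sum.swap) simp
    also have "\<dots> = (\<Sum>b\<in>?B. v' b k * cnj (v' b l))"
      by (rule sum.cong) (use kl uw in auto)
    finally show ?thesis using orthonormal_complete[OF K fB v'(2) cB kl(2,1)] by simp
  qed
  have 3: "(\<Sum>l\<in>K. u k l * v a l) = w a k" if "a \<in> A" "k \<in> K" for a k
    using uv[of k "Inl a"] that v' w' by simp
  show ?thesis using 1 2 3 by (intro exI[of _ u]) (auto simp: u_def split: if_splits)
qed

section \<open>Regular maps as sums of block isometries\<close>

lemma mmult_eq_sum:
  assumes "finite F" "\<And>l. l \<notin> F \<Longrightarrow> x i l * y l j = 0"
  shows "mmult x y i j = (\<Sum>l\<in>F. x i l * y l j)"
proof -
  have "(\<Sum>\<^sub>\<infinity>l. x i l * y l j) = (\<Sum>\<^sub>\<infinity>l\<in>F. x i l * y l j)"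
    by (rule infsum_cong_neutral) (use assms(2) in auto)
  then show ?thesis unfolding mmult_def using assms(1) by simp
qed

lemma fin_matD: "x \<in> fin_mat I \<Longrightarrow> x i j \<noteq> 0 \<Longrightarrow> i \<in> I \<and> j \<in> I"
  by (auto simp: fin_mat_def)

lemma fin_mat_outside:
  "x \<in> fin_mat I \<Longrightarrow> i \<notin> I \<Longrightarrow> x i j = 0"
  "x \<in> fin_mat I \<Longrightarrow> j \<notin> I \<Longrightarrow> x i j = 0"
  by (auto simp: fin_mat_def)

lemma fin_mat_iff: "finite I \<Longrightarrow> x \<in> fin_mat I \<longleftrightarrow> (\<forall>i j. x i j \<noteq> 0 \<longrightarrow> i \<in> I \<and> j \<in> I)"
  unfolding fin_mat_def by (auto intro: finite_subset[of _ "I \<times> I"])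

lemma fin_mat_mono: "I \<subseteq> I' \<Longrightarrow> fin_mat I \<subseteq> fin_mat I'"
  by (auto simp: fin_mat_def)

lemma finite_T3_idx [simp]: "finite J \<Longrightarrow> finite (T3_idx J)"
  by (simp add: T3_idx_def)

lemma mem_T3_idx: "k \<in> T3_idx J \<longleftrightarrow> fst k \<in> {1..3} \<and> snd k \<in> J"
  by (cases k) (simp add: T3_idx_def)

definition munit :: "'i \<Rightarrow> 'j \<Rightarrow> ('i, 'j) cmat" where
  "munit i j = (\<lambda>k l. of_bool (k = i \<and> l = j))"

lemma munit_in_fin_mat: "i \<in> I \<Longrightarrow> j \<in> I \<Longrightarrow> munit i j \<in> fin_mat I"
  unfolding fin_mat_def munit_def by (auto intro: finite_subset[of _ "{(i, j)}"])

text \<open>The product of \<open>v\<close>, \<open>x\<close> and the adjoint of \<open>v\<close> as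
  a finite sum, which avoids the infinite sum hidden in \<open>mmult\<close>.\<close>

definition sandwich :: "'i set \<Rightarrow> ('k, 'i) cmat \<Rightarrow> ('i, 'i) cmat \<Rightarrow> ('k, 'k) cmat" where
  "sandwich I v x = (\<lambda>k l. \<Sum>i\<in>I. \<Sum>j\<in>I. v k i * x i j * cnj (v l j))"

lemma sandwich_munit:
  assumes "finite I" "i \<in> I" "j \<in> I"
  shows "sandwich I v (munit i j) k l = v k i * cnj (v l j)"
proof -
  have "sandwich I v (munit i j) k l = (\<Sum>p\<in>I. \<Sum>q\<in>I. (v k p * cnj (v l q) * of_bool (p = i)) * of_bool (q = j))"
    unfolding sandwich_def munit_def by (intro sum.cong) auto
  also have "\<dots> = v k i * cnj (v l j)" using assms by (simp only: sum_unit_vector)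
  finally show ?thesis .
qed

lemma sandwich_comp:
  "sandwich M U (sandwich I v x) = sandwich I (\<lambda>k i. \<Sum>m\<in>M. U k m * v m i) x"
proof (intro ext)
  fix k l
  have "sandwich M U (sandwich I v x) k l =
    (\<Sum>m\<in>M. \<Sum>n\<in>M. \<Sum>i\<in>I. \<Sum>j\<in>I. U k m * v m i * x i j * cnj (U l n * v n j))"
    unfolding sandwich_def by (simp add: sum_distrib_left sum_distrib_right mult_ac)
  also have "\<dots> = (\<Sum>m\<in>M. \<Sum>i\<in>I. \<Sum>n\<in>M. \<Sum>j\<in>I. U k m * v m i * x i j * cnj (U l n * v n j))"
    by (rule sum.cong[OF refl], rule sum.swap)
  also have "\<dots> = (\<Sum>i\<in>I. \<Sum>m\<in>M. \<Sum>n\<in>M. \<Sum>j\<in>I. U k m * v m i * x i j * cnj (U l n * v n j))"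
    by (rule sum.swap)
  also have "\<dots> = (\<Sum>i\<in>I. \<Sum>m\<in>M. \<Sum>j\<in>I. \<Sum>n\<in>M. U k m * v m i * x i j * cnj (U l n * v n j))"
    by (intro sum.cong[OF refl]) (rule sum.swap)
  also have "\<dots> = (\<Sum>i\<in>I. \<Sum>j\<in>I. \<Sum>m\<in>M. \<Sum>n\<in>M. U k m * v m i * x i j * cnj (U l n * v n j))"
    by (intro sum.cong[OF refl]) (rule sum.swap)
  also have "\<dots> = sandwich I (\<lambda>k i. \<Sum>m\<in>M. U k m * v m i) x k l"
    unfolding sandwich_def
    by (intro sum.cong[OF refl], simp only: cnj_sum sum_distrib_right, simp add: sum_distrib_left)
  finally show "sandwich M U (sandwich I v x) k l = sandwich I (\<lambda>k i. \<Sum>m\<in>M. U k m * v m i) x k l" .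
qed

text \<open>The constant \<open>c\<close> treats two situations at once: \<open>c = 1\<close> gives
  multiplicativity of one isometric copy, \<open>c = 0\<close> the orthogonality of two
  copies.\<close>

lemma sandwich_mult:
  assumes "finite I"
    and orth: "\<And>i j. i \<in> I \<Longrightarrow> j \<in> I \<Longrightarrow> (\<Sum>k\<in>K. cnj (v k i) * W k j) = c * of_bool (i = j)"
  shows "(\<Sum>m\<in>K. sandwich I v x k m * sandwich I W y m l) =
    c * (\<Sum>i\<in>I. \<Sum>j\<in>I. v k i * (\<Sum>p\<in>I. x i p * y p j) * cnj (W l j))"
proof -
  define X where "X p = (\<Sum>i\<in>I. v k i * x i p)" for p
  define Y where "Y q = (\<Sum>j\<in>I. y q j * cnj (W l j))" for q
  have X: "sandwich I v x k m = (\<Sum>p\<in>I. X p * cnj (v m p))" for m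
    unfolding sandwich_def X_def sum_distrib_right by (rule sum.swap)
  have Y: "sandwich I W y m l = (\<Sum>q\<in>I. W m q * Y q)" for m
    unfolding sandwich_def Y_def sum_distrib_left by (simp add: mult.assoc)
  have "(\<Sum>m\<in>K. sandwich I v x k m * sandwich I W y m l) =
    (\<Sum>m\<in>K. \<Sum>p\<in>I. \<Sum>q\<in>I. X p * Y q * (cnj (v m p) * W m q))"
    unfolding X Y sum_product by (simp add: mult_ac)
  also have "\<dots> = (\<Sum>p\<in>I. \<Sum>m\<in>K. \<Sum>q\<in>I. X p * Y q * (cnj (v m p) * W m q))"
    by (rule sum.swap)
  also have "\<dots> = (\<Sum>p\<in>I. \<Sum>q\<in>I. \<Sum>m\<in>K. X p * Y q * (cnj (v m p) * W m q))"
    by (intro sum.cong[OF refl]) (rule sum.swap)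
  also have "\<dots> = (\<Sum>p\<in>I. \<Sum>q\<in>I. (c * X p * Y q) * of_bool (q = p))"
    unfolding sum_distrib_left[symmetric] by (intro sum.cong[OF refl]) (auto simp: orth)
  also have "\<dots> = (\<Sum>p\<in>I. c * X p * Y p)"
    by (intro sum.cong[OF refl] sum_unit_vector assms)
  also have "\<dots> = (\<Sum>p\<in>I. \<Sum>i\<in>I. \<Sum>j\<in>I. c * (v k i * (x i p * y p j) * cnj (W l j)))"
    unfolding X_def Y_def by (subst mult.assoc, subst sum_product) (simp add: sum_distrib_left mult_ac)
  also have "\<dots> = (\<Sum>i\<in>I. \<Sum>p\<in>I. \<Sum>j\<in>I. c * (v k i * (x i p * y p j) * cnj (W l j)))"
    by (rule sum.swap)
  also have "\<dots> = (\<Sum>i\<in>I. \<Sum>j\<in>I. \<Sum>p\<in>I. c * (v k i * (x i p * y p j) * cnj (W l j)))"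
    by (rule sum.cong[OF refl], rule sum.swap)
  finally show ?thesis by (simp add: sum_distrib_left sum_distrib_right)
qed

lemma isometry_inner:
  assumes "finite M"
    and "\<And>m n. m \<in> M \<Longrightarrow> n \<in> M \<Longrightarrow> (\<Sum>k\<in>K. cnj (U k m) * W k n) = c * of_bool (m = n)"
  shows "(\<Sum>k\<in>K. cnj (\<Sum>m\<in>M. U k m * x m) * (\<Sum>m\<in>M. W k m * y m)) = c * (\<Sum>m\<in>M. cnj (x m) * y m)"
proof -
  have "(\<Sum>k\<in>K. cnj (\<Sum>m\<in>M. U k m * x m) * (\<Sum>m\<in>M. W k m * y m)) =
    (\<Sum>k\<in>K. \<Sum>m\<in>M. \<Sum>n\<in>M. cnj (x m) * y n * (cnj (U k m) * W k n))"
    unfolding cnj_sum sum_product by (simp add: mult_ac)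
  also have "\<dots> = (\<Sum>m\<in>M. \<Sum>k\<in>K. \<Sum>n\<in>M. cnj (x m) * y n * (cnj (U k m) * W k n))"
    by (rule sum.swap)
  also have "\<dots> = (\<Sum>m\<in>M. \<Sum>n\<in>M. \<Sum>k\<in>K. cnj (x m) * y n * (cnj (U k m) * W k n))"
    by (intro sum.cong[OF refl]) (rule sum.swap)
  also have "\<dots> = (\<Sum>m\<in>M. \<Sum>n\<in>M. (c * cnj (x m) * y n) * of_bool (n = m))"
    unfolding sum_distrib_left[symmetric] by (intro sum.cong[OF refl]) (auto simp: assms(2))
  also have "\<dots> = (\<Sum>m\<in>M. c * cnj (x m) * y m)"
    by (intro sum.cong[OF refl] sum_unit_vector assms)
  finally show ?thesis by (simp add: sum_distrib_left mult.assoc)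
qed

text \<open>A decomposition into multiplicity one summands: each \<open>v s\<close> is an isometry
  sending block \<open>p\<close> of the source into block \<open>omap_apply (\<sigma> s) p\<close>
  of the target, and orthonormality of all columns together makes the ranges orthogonal. The index
  type is left free because compositions produce pairs and direct sums produce disjoint unions of
  indices.\<close>

definition block_rep ::
    "'j set \<Rightarrow> 'k set \<Rightarrow> ((nat \<times> 'j, nat \<times> 'j) cmat \<Rightarrow> (nat \<times> 'k, nat \<times> 'k) cmat) \<Rightarrow>
     's set \<Rightarrow> ('s \<Rightarrow> (nat \<times> 'k, nat \<times> 'j) cmat) \<Rightarrow> ('s \<Rightarrow> omap) \<Rightarrow> bool" where
  "block_rep J K f S v \<sigma> \<longleftrightarrow> finite S \<and>
     (\<forall>s\<in>S. \<forall>k i. v s k i \<noteq> 0 \<longrightarrow> k \<in> T3_idx K \<and> i \<in> T3_idx J \<and> fst k = omap_apply (\<sigma> s) (fst i)) \<and>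
     orthonormal_on (T3_idx K) (\<lambda>(s, i) k. v s k i) (S \<times> T3_idx J) \<and>
     (\<forall>x\<in>fin_mat (T3_idx J). f x = (\<lambda>k l. \<Sum>s\<in>S. sandwich (T3_idx J) (v s) x k l))"

text \<open>The existential needs one fixed index type, hence an initial segment of the naturals;
  \<open>has_classI\<close> accepts every other index set by renumbering.\<close>

definition has_class ::
    "'j set \<Rightarrow> 'k set \<Rightarrow> ((nat \<times> 'j, nat \<times> 'j) cmat \<Rightarrow> (nat \<times> 'k, nat \<times> 'k) cmat) \<Rightarrow> omap multiset \<Rightarrow> bool" where
  "has_class J K f m \<longleftrightarrow>
     (\<exists>v \<sigma>. block_rep J K f {..<size m} v \<sigma> \<and> m = image_mset \<sigma> (mset_set {..<size m}))"

lemma block_repD: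
  assumes "block_rep J K f S v \<sigma>"
  shows "finite S"
    and "s \<in> S \<Longrightarrow> v s k i \<noteq> 0 \<Longrightarrow> k \<in> T3_idx K \<and> i \<in> T3_idx J \<and> fst k = omap_apply (\<sigma> s) (fst i)"
    and "s \<in> S \<Longrightarrow> t \<in> S \<Longrightarrow> i \<in> T3_idx J \<Longrightarrow> j \<in> T3_idx J \<Longrightarrow>
      (\<Sum>k\<in>T3_idx K. cnj (v s k i) * v t k j) = of_bool (s = t) * of_bool (i = j)"
    and "x \<in> fin_mat (T3_idx J) \<Longrightarrow> f x = (\<lambda>k l. \<Sum>s\<in>S. sandwich (T3_idx J) (v s) x k l)"
    and "orthonormal_on (T3_idx K) (\<lambda>(s, i) k. v s k i) (S \<times> T3_idx J)"
proof -
  have *: "finite S" "\<forall>s\<in>S. \<forall>k i. v s k i \<noteq> 0 \<longrightarrow> k \<in> T3_idx K \<and> i \<in> T3_idx J \<and> fst k = omap_apply (\<sigma> s) (fst i)"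
    and o: "orthonormal_on (T3_idx K) (\<lambda>(s, i) k. v s k i) (S \<times> T3_idx J)"
    and "\<forall>x\<in>fin_mat (T3_idx J). f x = (\<lambda>k l. \<Sum>s\<in>S. sandwich (T3_idx J) (v s) x k l)"
    using assms unfolding block_rep_def by blast+
  then show "finite S"
    and "s \<in> S \<Longrightarrow> v s k i \<noteq> 0 \<Longrightarrow> k \<in> T3_idx K \<and> i \<in> T3_idx J \<and> fst k = omap_apply (\<sigma> s) (fst i)"
    and "x \<in> fin_mat (T3_idx J) \<Longrightarrow> f x = (\<lambda>k l. \<Sum>s\<in>S. sandwich (T3_idx J) (v s) x k l)"
    and "orthonormal_on (T3_idx K) (\<lambda>(s, i) k. v s k i) (S \<times> T3_idx J)"
    by blast+
  show "s \<in> S \<Longrightarrow> t \<in> S \<Longrightarrow> i \<in> T3_idx J \<Longrightarrow> j \<in> T3_idx J \<Longrightarrow>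
      (\<Sum>k\<in>T3_idx K. cnj (v s k i) * v t k j) = of_bool (s = t) * of_bool (i = j)"
    using orthonormal_onD[OF o, of "(s, i)" "(t, j)"] by auto
qed

lemma block_repI:
  assumes "finite S"
    and "\<And>s k i. s \<in> S \<Longrightarrow> v s k i \<noteq> 0 \<Longrightarrow> k \<in> T3_idx K \<and> i \<in> T3_idx J \<and> fst k = omap_apply (\<sigma> s) (fst i)"
    and "\<And>s t i j. s \<in> S \<Longrightarrow> t \<in> S \<Longrightarrow> i \<in> T3_idx J \<Longrightarrow> j \<in> T3_idx J \<Longrightarrow>
      (\<Sum>k\<in>T3_idx K. cnj (v s k i) * v t k j) = of_bool (s = t) * of_bool (i = j)"
    and "\<And>x. x \<in> fin_mat (T3_idx J) \<Longrightarrow> f x = (\<lambda>k l. \<Sum>s\<in>S. sandwich (T3_idx J) (v s) x k l)"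
  shows "block_rep J K f S v \<sigma>"
  using assms unfolding block_rep_def orthonormal_on_def by auto

lemma block_rep_reindex:
  assumes f: "block_rep J K f S v \<sigma>" and h: "bij_betw h R S"
  shows "block_rep J K f R (\<lambda>r. v (h r)) (\<lambda>r. \<sigma> (h r))"
proof (rule block_repI)
  have hS: "h r \<in> S" if "r \<in> R" for r using h that by (auto dest: bij_betwE)
  show "finite R" using block_repD(1)[OF f] h by (simp add: bij_betw_finite)
  show "k \<in> T3_idx K \<and> i \<in> T3_idx J \<and> fst k = omap_apply (\<sigma> (h r)) (fst i)" if "r \<in> R" "v (h r) k i \<noteq> 0" for r k i
    using block_repD(2)[OF f hS[OF that(1)] that(2)] .
  show "(\<Sum>k\<in>T3_idx K. cnj (v (h s) k i) * v (h t) k j) = of_bool (s = t) * of_bool (i = j)"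
    if "s \<in> R" "t \<in> R" "i \<in> T3_idx J" "j \<in> T3_idx J" for s t i j
    using block_repD(3)[OF f hS[OF that(1)] hS[OF that(2)] that(3,4)] that(1,2) bij_betw_imp_inj_on[OF h]
    by (auto simp: inj_on_def)
  show "f x = (\<lambda>k l. \<Sum>s\<in>R. sandwich (T3_idx J) (v (h s)) x k l)" if "x \<in> fin_mat (T3_idx J)" for x
    unfolding block_repD(4)[OF f that] by (intro ext) (rule sum.reindex_bij_betw[OF h, symmetric])
qed

lemma has_classI:
  assumes f: "block_rep J K f S v \<sigma>" and m: "m = image_mset \<sigma> (mset_set S)"
  shows "has_class J K f m"
proof -
  have "size m = card S" using m by simp
  then obtain h where h: "bij_betw h {..<size m} S"
    using block_repD(1)[OF f] ex_bij_betw_nat_finite[of S] by (auto simp: atLeast0LessThan)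
  have "m = image_mset (\<lambda>r. \<sigma> (h r)) (mset_set {..<size m})"
  proof -
    have "mset_set S = image_mset h (mset_set {..<size m})"
      using image_mset_mset_set[OF bij_betw_imp_inj_on[OF h]] bij_betw_imp_surj_on[OF h] by simp
    then have "image_mset \<sigma> (mset_set S) = image_mset (\<lambda>r. \<sigma> (h r)) (mset_set {..<size m})"
      by (simp only: multiset.map_comp comp_def)
    with m show ?thesis by simp
  qed
  then show ?thesis unfolding has_class_def using block_rep_reindex[OF f h] by blast
qed

lemma has_classE:
  assumes "has_class J K f m"
  obtains v \<sigma> r where "block_rep J K f {..<r::nat} v \<sigma>" "m = image_mset \<sigma> (mset_set {..<r})"
  using assms unfolding has_class_def by blast

lemma has_class_cong:
  assumes "has_class J K f m" "\<And>x. x \<in> fin_mat (T3_idx J) \<Longrightarrow> g x = f x"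
  shows "has_class J K g m"
  using assms unfolding has_class_def block_rep_def by simp

lemma block_rep_munit:
  assumes "finite J" "block_rep J K f S v \<sigma>" "i \<in> T3_idx J" "j \<in> T3_idx J"
  shows "f (munit i j) k l = (\<Sum>s\<in>S. v s k i * cnj (v s l j))"
  using assms by (simp add: block_repD(4) munit_in_fin_mat sandwich_munit)

lemma mmult_fin_mat:
  assumes "finite I" "x \<in> fin_mat I \<or> y \<in> fin_mat I"
  shows "mmult x y i j = (\<Sum>l\<in>I. x i l * y l j)"
  by (rule mmult_eq_sum) (use assms in \<open>auto simp: fin_mat_outside\<close>)

lemma fin_mat_mmult:
  assumes "x \<in> fin_mat I" "y \<in> fin_mat I"
  shows "mmult x y \<in> fin_mat I"
proof -
  have *: "\<exists>l. x i l \<noteq> 0 \<and> y l j \<noteq> 0" if "mmult x y i j \<noteq> 0" for i j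
    using that unfolding mmult_def by (metis (no_types, lifting) infsum_0 mult_eq_0_iff)
  have "{(i, j). mmult x y i j \<noteq> 0} \<subseteq> fst ` {(i, j). x i j \<noteq> 0} \<times> snd ` {(i, j). y i j \<noteq> 0}"
    using * by (force simp: image_iff)
  moreover have "finite (fst ` {(i, j). x i j \<noteq> 0} \<times> snd ` {(i, j). y i j \<noteq> 0})"
    using assms by (auto simp: fin_mat_def)
  moreover have "{(i, j). mmult x y i j \<noteq> 0} \<subseteq> I \<times> I"
    using * assms by (fastforce dest: fin_matD)
  ultimately show ?thesis unfolding fin_mat_def by (auto intro: finite_subset)
qed

lemma fin_mat_add: "x \<in> fin_mat I \<Longrightarrow> y \<in> fin_mat I \<Longrightarrow> (\<lambda>i j. x i j + y i j) \<in> fin_mat I"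
proof -
  assume x: "x \<in> fin_mat I" and y: "y \<in> fin_mat I"
  have "{(i, j). x i j + y i j \<noteq> 0} \<subseteq> {(i, j). x i j \<noteq> 0} \<union> {(i, j). y i j \<noteq> 0}" by auto
  then show ?thesis using x y unfolding fin_mat_def by (auto intro: finite_subset)
qed

lemma fin_mat_scale: "x \<in> fin_mat I \<Longrightarrow> (\<lambda>i j. c * x i j) \<in> fin_mat I"
  unfolding fin_mat_def by (auto intro: finite_subset[of _ "{(i, j). x i j \<noteq> 0}"])

lemma fin_mat_madj:
  assumes "x \<in> fin_mat I"
  shows "madj x \<in> fin_mat I"
proof -
  have "{(i, j). madj x i j \<noteq> 0} = prod.swap ` {(i, j). x i j \<noteq> 0}"
    by (auto simp: madj_def image_iff)
  then show ?thesis using assms by (auto simp: fin_mat_def)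
qed

lemma block_rep_fin_mat:
  assumes J: "finite J" and K: "finite K" and f: "block_rep J K f S v \<sigma>" and x: "x \<in> fin_mat (T3_idx J)"
  shows "f x \<in> fin_mat (T3_idx K)"
proof -
  have "k \<in> T3_idx K \<and> l \<in> T3_idx K" if "f x k l \<noteq> 0" for k l
  proof -
    have "(\<Sum>s\<in>S. sandwich (T3_idx J) (v s) x k l) \<noteq> 0" using that unfolding block_repD(4)[OF f x] .
    then obtain s where s: "s \<in> S" "sandwich (T3_idx J) (v s) x k l \<noteq> 0" by (rule sum.not_neutral_contains_not_neutral)
    obtain i where "(\<Sum>j\<in>T3_idx J. v s k i * x i j * cnj (v s l j)) \<noteq> 0"
      using s(2) unfolding sandwich_def by (rule sum.not_neutral_contains_not_neutral)
    then obtain j where "v s k i * x i j * cnj (v s l j) \<noteq> 0" by (rule sum.not_neutral_contains_not_neutral)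
    then have "v s k i \<noteq> 0" "v s l j \<noteq> 0" by auto
    then show ?thesis using block_repD(2)[OF f s(1)] by blast
  qed
  then show ?thesis using K by (subst fin_mat_iff) auto
qed

text \<open>Multiplicativity is orthonormality of the columns, and triangularity of the images is
  monotonicity of the labels \<open>\<sigma> s\<close>.\<close>

lemma block_rep_star_extendible:
  assumes J: "finite J" and K: "finite K" and f: "block_rep J K f S v \<sigma>"
  shows "star_extendible (T3_alg J) (T3_alg K) f"
proof -
  note fx = block_repD(4)[OF f]
  have fin: "f x \<in> fin_mat (T3_idx K)" if "x \<in> fin_mat (T3_idx J)" for x
    using block_rep_fin_mat[OF J K f that] .
  have add: "f (\<lambda>i j. x i j + y i j) = (\<lambda>i j. f x i j + f y i j)"
    if "x \<in> fin_mat (T3_idx J)" "y \<in> fin_mat (T3_idx J)" for x y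
    unfolding fx[OF fin_mat_add[OF that]] fx[OF that(1)] fx[OF that(2)] sandwich_def
    by (intro ext) (simp add: algebra_simps sum.distrib)
  have scale: "f (\<lambda>i j. c * x i j) = (\<lambda>i j. c * f x i j)" if "x \<in> fin_mat (T3_idx J)" for c x
    unfolding fx[OF fin_mat_scale[OF that]] fx[OF that] sandwich_def
    by (intro ext) (simp add: mult_ac sum_distrib_left)
  have star: "f (madj x) = madj (f x)" if "x \<in> fin_mat (T3_idx J)" for x
    unfolding fx[OF fin_mat_madj[OF that]] fx[OF that] sandwich_def unfolding madj_def
    by (intro ext) (simp add: cnj_sum mult_ac, subst sum.swap, simp add: mult_ac)
  have mult: "f (mmult x y) = mmult (f x) (f y)"
    if x: "x \<in> fin_mat (T3_idx J)" and y: "y \<in> fin_mat (T3_idx J)" for x y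
  proof (intro ext)
    fix k l
    have xy: "mmult x y i j = (\<Sum>p\<in>T3_idx J. x i p * y p j)" for i j
      by (rule mmult_fin_mat) (use J x in auto)
    have "mmult (f x) (f y) k l = (\<Sum>m\<in>T3_idx K. f x k m * f y m l)"
      by (rule mmult_fin_mat) (use K fin[OF x] in auto)
    also have "\<dots> = (\<Sum>m\<in>T3_idx K. \<Sum>s\<in>S. \<Sum>t\<in>S. sandwich (T3_idx J) (v s) x k m * sandwich (T3_idx J) (v t) y m l)"
      unfolding fx[OF x] fx[OF y] sum_product ..
    also have "\<dots> = (\<Sum>s\<in>S. \<Sum>m\<in>T3_idx K. \<Sum>t\<in>S. sandwich (T3_idx J) (v s) x k m * sandwich (T3_idx J) (v t) y m l)"
      by (rule sum.swap)
    also have "\<dots> = (\<Sum>s\<in>S. \<Sum>t\<in>S. \<Sum>m\<in>T3_idx K. sandwich (T3_idx J) (v s) x k m * sandwich (T3_idx J) (v t) y m l)"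
      by (intro sum.cong[OF refl]) (rule sum.swap)
    also have "\<dots> = (\<Sum>s\<in>S. \<Sum>t\<in>S. (\<Sum>i\<in>T3_idx J. \<Sum>j\<in>T3_idx J. v s k i * mmult x y i j * cnj (v t l j)) * of_bool (t = s))"
    proof (intro sum.cong[OF refl])
      fix s t assume "s \<in> S" "t \<in> S"
      then have "(\<Sum>m\<in>T3_idx K. sandwich (T3_idx J) (v s) x k m * sandwich (T3_idx J) (v t) y m l) =
        of_bool (s = t) * (\<Sum>i\<in>T3_idx J. \<Sum>j\<in>T3_idx J. v s k i * mmult x y i j * cnj (v t l j))"
        unfolding xy by (intro sandwich_mult block_repD(3)[OF f] finite_T3_idx[OF J])
      then show "(\<Sum>m\<in>T3_idx K. sandwich (T3_idx J) (v s) x k m * sandwich (T3_idx J) (v t) y m l) =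
        (\<Sum>i\<in>T3_idx J. \<Sum>j\<in>T3_idx J. v s k i * mmult x y i j * cnj (v t l j)) * of_bool (t = s)"
        by (simp add: eq_commute[of s t])
    qed
    also have "\<dots> = (\<Sum>s\<in>S. (\<Sum>i\<in>T3_idx J. \<Sum>j\<in>T3_idx J. v s k i * mmult x y i j * cnj (v s l j)))"
      by (intro sum.cong[OF refl] sum_unit_vector block_repD(1)[OF f])
    also have "\<dots> = f (mmult x y) k l" unfolding fx[OF fin_mat_mmult[OF x y]] sandwich_def ..
    finally show "f (mmult x y) k l = mmult (f x) (f y) k l" ..
  qed
  have "f x \<in> T3 K" if "x \<in> T3 J" for x
  proof -
    have x: "x \<in> fin_mat (T3_idx J)" using that by (simp add: T3_def)
    have "f x (q, a) (q', b) = 0" if "q' < q" for q a q' b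
    proof -
      have "v s (q, a) i * x i j * cnj (v s (q', b) j) = 0"
        if s: "s \<in> S" and ij: "i \<in> T3_idx J" "j \<in> T3_idx J" for s i j
      proof (rule ccontr)
        assume "\<not> ?thesis"
        then have nz: "v s (q, a) i \<noteq> 0" "x i j \<noteq> 0" "v s (q', b) j \<noteq> 0" by auto
        have "fst i \<le> fst j"
        proof (rule ccontr)
          assume "\<not> fst i \<le> fst j"
          then have "x (fst i, snd i) (fst j, snd j) = 0" using \<open>x \<in> T3 J\<close> unfolding T3_def by (simp del: prod.collapse)
          then show False using nz(2) by simp
        qed
        then have "q \<le> q'"
          using block_repD(2)[OF f s nz(1)] block_repD(2)[OF f s nz(3)] omap_apply_mono[of "fst i" "fst j" "\<sigma> s"] ij
          by (auto simp: mem_T3_idx)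
        then show False using that \<open>q' < q\<close> by simp
      qed
      then show ?thesis unfolding fx[OF x] sandwich_def by (simp add: sum.neutral)
    qed
    then show ?thesis using fin[OF x] by (auto simp: T3_def)
  qed
  then show ?thesis using fin add scale star mult
    unfolding star_extendible_def star_hom_def T3_alg_def fin_mat_alg_def by auto
qed

lemma has_class_star_extendible:
  "finite J \<Longrightarrow> finite K \<Longrightarrow> has_class J K f m \<Longrightarrow> star_extendible (T3_alg J) (T3_alg K) f"
  by (metis has_class_def block_rep_star_extendible)

text \<open>The isometries of the composite are the products of an outer \<open>U t\<close> with an
  inner \<open>v s\<close>; their labels compose, which is exactly \<open>mprod\<close>.\<close>

lemma has_class_comp:
  assumes J: "finite J" and K: "finite K" and L: "finite L"
    and f: "has_class J K f m" and g: "has_class K L g m'"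
  shows "has_class J L (g \<circ> f) (mprod m' m)"
proof -
  obtain v \<sigma> r where f: "block_rep J K f {..<r::nat} v \<sigma>" and m: "m = image_mset \<sigma> (mset_set {..<r})"
    using f by (rule has_classE)
  obtain U \<tau> q where g: "block_rep K L g {..<q::nat} U \<tau>" and m': "m' = image_mset \<tau> (mset_set {..<q})"
    using g by (rule has_classE)
  let ?W = "\<lambda>(t, s) k i. \<Sum>p\<in>T3_idx K. U t k p * v s p i"
  let ?\<rho> = "\<lambda>(t, s). \<tau> t * \<sigma> s"
  have "block_rep J L (g \<circ> f) ({..<q} \<times> {..<r}) ?W ?\<rho>"
  proof (rule block_repI)
    show "finite ({..<q} \<times> {..<r})" by simp
    show "k \<in> T3_idx L \<and> i \<in> T3_idx J \<and> fst k = omap_apply (?\<rho> a) (fst i)"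
      if a: "a \<in> {..<q} \<times> {..<r}" and nz: "?W a k i \<noteq> 0" for a k i
    proof -
      obtain t s where ts: "a = (t, s)" "t < q" "s < r" using a by auto
      then have "(\<Sum>p\<in>T3_idx K. U t k p * v s p i) \<noteq> 0" using nz by simp
      then obtain p where "U t k p * v s p i \<noteq> 0" by (rule sum.not_neutral_contains_not_neutral)
      then show ?thesis using block_repD(2)[OF f, of s p i] block_repD(2)[OF g, of t k p] ts
        by (auto simp: omap_apply_times)
    qed
    show "(\<Sum>k\<in>T3_idx L. cnj (?W a k i) * ?W b k j) = of_bool (a = b) * of_bool (i = j)"
      if ab: "a \<in> {..<q} \<times> {..<r}" "b \<in> {..<q} \<times> {..<r}" and ij: "i \<in> T3_idx J" "j \<in> T3_idx J" for a b i j
    proof -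
      obtain t s t' s' where ts: "a = (t, s)" "t < q" "s < r" "b = (t', s')" "t' < q" "s' < r" using ab by auto
      have "(\<Sum>k\<in>T3_idx L. cnj (?W a k i) * ?W b k j) = of_bool (t = t') * (\<Sum>p\<in>T3_idx K. cnj (v s p i) * v s' p j)"
        using isometry_inner[OF finite_T3_idx[OF K], of "U t" "U t'" "T3_idx L" "of_bool (t = t')" "\<lambda>p. v s p i" "\<lambda>p. v s' p j"]
          block_repD(3)[OF g, of t t'] ts by simp
      then show ?thesis using block_repD(3)[OF f _ _ ij, of s s'] ts by auto
    qed
    fix x assume x: "x \<in> fin_mat (T3_idx J)"
    have lin: "sandwich (T3_idx K) (U t) (\<lambda>k l. \<Sum>s<r. sandwich (T3_idx J) (v s) x k l) k l =
       (\<Sum>s<r. sandwich (T3_idx K) (U t) (sandwich (T3_idx J) (v s) x) k l)" for t k l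
    proof -
      have "sandwich (T3_idx K) (U t) (\<lambda>k l. \<Sum>s<r. sandwich (T3_idx J) (v s) x k l) k l =
        (\<Sum>i\<in>T3_idx K. \<Sum>j\<in>T3_idx K. \<Sum>s<r. U t k i * sandwich (T3_idx J) (v s) x i j * cnj (U t l j))"
        unfolding sandwich_def[of "T3_idx K"] by (simp add: sum_distrib_left sum_distrib_right)
      also have "\<dots> = (\<Sum>i\<in>T3_idx K. \<Sum>s<r. \<Sum>j\<in>T3_idx K. U t k i * sandwich (T3_idx J) (v s) x i j * cnj (U t l j))"
        by (intro sum.cong[OF refl]) (rule sum.swap)
      also have "\<dots> = (\<Sum>s<r. \<Sum>i\<in>T3_idx K. \<Sum>j\<in>T3_idx K. U t k i * sandwich (T3_idx J) (v s) x i j * cnj (U t l j))"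
        by (rule sum.swap)
      finally show ?thesis unfolding sandwich_def[of "T3_idx K"] .
    qed
    show "(g \<circ> f) x = (\<lambda>k l. \<Sum>a\<in>{..<q} \<times> {..<r}. sandwich (T3_idx J) (?W a) x k l)"
    proof (intro ext)
      fix k l
      have "(g \<circ> f) x k l = (\<Sum>t<q. sandwich (T3_idx K) (U t) (f x) k l)"
        using block_repD(4)[OF g block_rep_fin_mat[OF J K f x]] by simp
      also have "\<dots> = (\<Sum>t<q. \<Sum>s<r. sandwich (T3_idx J) (?W (t, s)) x k l)"
        unfolding block_repD(4)[OF f x] lin sandwich_comp by simp
      finally show "(g \<circ> f) x k l = (\<Sum>a\<in>{..<q} \<times> {..<r}. sandwich (T3_idx J) (?W a) x k l)"
        by (simp add: sum.cartesian_product split_def)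
    qed
  qed
  moreover have "mprod m' m = image_mset ?\<rho> (mset_set ({..<q} \<times> {..<r}))"
    unfolding m m' by (rule mprod_families) auto
  ultimately show ?thesis by (rule has_classI)
qed

declare split_paired_All [simp del] split_paired_Ex [simp del]

lemma mmult_mmult_madj:
  assumes "finite I" "\<And>k i. i \<notin> I \<Longrightarrow> W k i = 0"
  shows "mmult (mmult W x) (madj W) = sandwich I W x"
proof (intro ext)
  fix k l
  have "mmult (mmult W x) (madj W) k l = (\<Sum>j\<in>I. mmult W x k j * madj W j l)"
    by (rule mmult_eq_sum) (use assms in \<open>auto simp: madj_def\<close>)
  also have "\<dots> = (\<Sum>j\<in>I. (\<Sum>i\<in>I. W k i * x i j) * cnj (W l j))"
    by (intro sum.cong[OF refl], subst mmult_eq_sum[of I]) (use assms in \<open>auto simp: madj_def\<close>)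
  also have "\<dots> = sandwich I W x k l"
    unfolding sandwich_def by (subst sum.swap) (simp add: sum_distrib_right)
  finally show "mmult (mmult W x) (madj W) k l = sandwich I W x k l" .
qed

lemma mmult_madj_left:
  assumes "finite K" "\<And>k i. k \<notin> K \<Longrightarrow> W k i = 0"
  shows "mmult (madj W) W' i j = (\<Sum>k\<in>K. cnj (W k i) * W' k j)"
  by (subst mmult_eq_sum[of K]) (use assms in \<open>auto simp: madj_def\<close>)

text \<open>The multiplicity gives one isometry \<open>W\<close>. Triangularity of the images of
  upper matrix units makes the block number of the support of a column a monotone function of the
  block number of the column; two columns of one block compare in both directions, so a whole block
  of columns lands in a single block. The three values are read off at the columns
  \<open>(p, a)\<close> for one point \<open>a\<close> of \<open>J\<close>.\<close>

lemma multiplicity_one_block: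
  assumes J: "finite J" "J \<noteq> {}" and K: "finite K"
    and g: "star_extendible (T3_alg J) (T3_alg K) g" "has_multiplicity (T3_idx J) (T3_idx K) g 1"
  shows "\<exists>W s. block_rep J K g {()} (\<lambda>_. W) (\<lambda>_. s)"
proof -
  obtain V0 :: "nat \<Rightarrow> _" where V0: "\<forall>s<1. \<forall>k i. V0 s k i \<noteq> 0 \<longrightarrow> k \<in> T3_idx K \<and> i \<in> T3_idx J"
    "\<forall>s<1. \<forall>t<1. mmult (madj (V0 s)) (V0 t) = (if s = t then mid (T3_idx J) else mzero)"
    "\<forall>x\<in>fin_mat (T3_idx J). g x = (\<lambda>k l. \<Sum>s<1. mmult (mmult (V0 s) x) (madj (V0 s)) k l)"
    using g(2) unfolding has_multiplicity_def by (elim exE conjE)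
  define W where "W = V0 0"
  have W: "k \<in> T3_idx K \<and> i \<in> T3_idx J" if "W k i \<noteq> 0" for k i using V0(1) that unfolding W_def by blast
  have W0: "W k i = 0" if "k \<notin> T3_idx K" for k i using W that by blast
  have gx: "g x = sandwich (T3_idx J) W x" if "x \<in> fin_mat (T3_idx J)" for x
  proof -
    have "mmult (mmult W x) (madj W) = sandwich (T3_idx J) W x"
    proof (rule mmult_mmult_madj[OF finite_T3_idx[OF J(1)]])
      show "W k i = 0" if "i \<notin> T3_idx J" for k i using W that by blast
    qed
    then show ?thesis using V0(3) that by (simp add: W_def)
  qed
  have iso: "(\<Sum>k\<in>T3_idx K. cnj (W k i) * W k j) = of_bool (i = j)" if "i \<in> T3_idx J" for i j
  proof -
    have "mmult (madj W) W i j = (\<Sum>k\<in>T3_idx K. cnj (W k i) * W k j)"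
      by (rule mmult_madj_left[OF finite_T3_idx[OF K]]) (rule W0)
    moreover have "mmult (madj W) W = mid (T3_idx J)" using V0(2) by (simp add: W_def)
    ultimately have "(\<Sum>k\<in>T3_idx K. cnj (W k i) * W k j) = mid (T3_idx J) i j" by simp
    then show ?thesis using that unfolding mid_def by simp
  qed
  \<comment> \<open>Entry \<open>(k, l)\<close> of the image of \<open>munit i j\<close> is
    \<open>W k i * cnj (W l j)\<close>, a product of nonzero numbers, whereas that image is upper
    triangular.\<close>
  have ord: "fst k \<le> fst l" if nz: "W k i \<noteq> 0" "W l j \<noteq> 0" and ij: "fst i \<le> fst j" for k l i j
  proof (rule ccontr)
    assume "\<not> fst k \<le> fst l"
    have i: "i \<in> T3_idx J" and j: "j \<in> T3_idx J" using W nz by blast+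
    have "munit i j \<in> T3 J" using ij i j unfolding T3_def by (auto simp: munit_in_fin_mat) (auto simp: munit_def)
    then have "g (munit i j) \<in> T3 K" using g(1) by (auto simp: star_extendible_def T3_alg_def)
    then have "g (munit i j) (fst k, snd k) (fst l, snd l) = 0"
      using \<open>\<not> fst k \<le> fst l\<close> unfolding T3_def by (simp del: prod.collapse)
    then show False using gx[OF munit_in_fin_mat[OF i j]] sandwich_munit[OF finite_T3_idx[OF J(1)] i j, of W k l] nz by simp
  qed
  obtain a where a: "a \<in> J" using J by blast
  have "\<exists>k. W k (p, a) \<noteq> 0" if "p \<in> {1..3}" for p
  proof (rule ccontr)
    assume "\<not> ?thesis"
    then show False using iso[of "(p, a)" "(p, a)"] that a by (simp add: mem_T3_idx)
  qed
  then obtain h where h: "\<And>p. p \<in> {1..3} \<Longrightarrow> W (h p) (p, a) \<noteq> 0" by metis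
  have "\<exists>s. \<forall>p\<in>{1..3}. omap_apply s p = fst (h p)"
  proof (rule omap_exists)
    show "fst (h p) \<in> {1..3}" if "p \<in> {1..3}" for p using W[OF h[OF that]] by (simp add: mem_T3_idx)
    show "fst (h p) \<le> fst (h q)" if "p \<in> {1..3}" "q \<in> {1..3}" "p \<le> q" for p q
      using ord[OF h[OF that(1)] h[OF that(2)]] that by simp
  qed
  then obtain s where s: "\<And>p. p \<in> {1..3} \<Longrightarrow> omap_apply s p = fst (h p)" by blast
  have "fst k = omap_apply s (fst i)" if "W k i \<noteq> 0" for k i
  proof -
    have p: "fst i \<in> {1..3}" using W[OF that] by (simp add: mem_T3_idx)
    show ?thesis unfolding s[OF p] using ord[OF that h[OF p]] ord[OF h[OF p] that] by simp
  qed
  then have "block_rep J K g {()} (\<lambda>_. W) (\<lambda>_. s)"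
    using W gx iso by (intro block_repI) auto
  then show ?thesis by blast
qed

text \<open>Orthogonality of the columns of different summands comes from diagonal units: each entry
  of the product of \<open>g s (munit i i)\<close> and \<open>g t (munit j j)\<close> is the inner
  product of two columns times a factor, and that factor is nonzero at suitable \<open>k\<close>,
  \<open>l\<close>.\<close>

lemma regular_has_class:
  assumes J: "finite J" "J \<noteq> {}" and K: "finite K" and f: "regular J K f"
  shows "\<exists>m. has_class J K f m"
proof -
  obtain r :: nat and g where r:
    "\<forall>s<r. star_extendible (T3_alg J) (T3_alg K) (g s) \<and> has_multiplicity (T3_idx J) (T3_idx K) (g s) 1"
    "\<forall>s<r. \<forall>t<r. s \<noteq> t \<longrightarrow> (\<forall>x\<in>fin_mat (T3_idx J). \<forall>y\<in>fin_mat (T3_idx J). mmult (g s x) (g t y) = mzero)"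
    "\<forall>x\<in>fin_mat (T3_idx J). f x = (\<lambda>k l. \<Sum>s<r. g s x k l)"
    using f unfolding regular_def by (elim exE conjE)
  have
    g: "\<And>s. s < r \<Longrightarrow> star_extendible (T3_alg J) (T3_alg K) (g s) \<and> has_multiplicity (T3_idx J) (T3_idx K) (g s) 1"
    and orth: "\<And>s t x y. s < r \<Longrightarrow> t < r \<Longrightarrow> s \<noteq> t \<Longrightarrow> x \<in> fin_mat (T3_idx J) \<Longrightarrow> y \<in> fin_mat (T3_idx J) \<Longrightarrow>
      mmult (g s x) (g t y) = mzero"
    and fg: "\<And>x. x \<in> fin_mat (T3_idx J) \<Longrightarrow> f x = (\<lambda>k l. \<Sum>s<r. g s x k l)"
    using r by blast+
  have "\<forall>s. \<exists>W \<sigma>. s < r \<longrightarrow> block_rep J K (g s) {()} (\<lambda>_. W) (\<lambda>_. \<sigma>)"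
    using multiplicity_one_block[OF J K] g by blast
  then obtain W \<sigma> where W: "\<And>s. s < r \<Longrightarrow> block_rep J K (g s) {()} (\<lambda>_. W s) (\<lambda>_. \<sigma> s)" by metis
  have gx: "g s x = sandwich (T3_idx J) (W s) x" if "s < r" "x \<in> fin_mat (T3_idx J)" for s x
    using block_repD(4)[OF W[OF that(1)] that(2)] by simp
  have iso: "(\<Sum>k\<in>T3_idx K. cnj (W s k i) * W s k j) = of_bool (i = j)"
    if "s < r" "i \<in> T3_idx J" "j \<in> T3_idx J" for s i j
    using block_repD(3)[OF W[OF that(1)] _ _ that(2,3)] by simp
  have nz: "\<exists>k. W s k i \<noteq> 0" if "s < r" "i \<in> T3_idx J" for s i
  proof (rule ccontr)
    assume "\<not> ?thesis"
    then show False using iso[OF that that(2)] by simp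
  qed
  have c0: "(\<Sum>k\<in>T3_idx K. cnj (W s k i) * W t k j) = 0"
    if st: "s < r" "t < r" "s \<noteq> t" and ij: "i \<in> T3_idx J" "j \<in> T3_idx J" for s t i j
  proof -
    obtain k l where kl: "W s k i \<noteq> 0" "W t l j \<noteq> 0" using nz st ij by meson
    have mu: "munit i i \<in> fin_mat (T3_idx J)" "munit j j \<in> fin_mat (T3_idx J)"
      using ij by (auto intro: munit_in_fin_mat)
    have "g s (munit i i) \<in> fin_mat (T3_idx K)"
      using block_rep_fin_mat[OF J(1) K W[OF st(1)] mu(1)] .
    then have "mmult (g s (munit i i)) (g t (munit j j)) k l =
      (\<Sum>m\<in>T3_idx K. g s (munit i i) k m * g t (munit j j) m l)"
      by (intro mmult_fin_mat) (use K in auto)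
    also have "\<dots> = (\<Sum>m\<in>T3_idx K. W s k i * cnj (W t l j) * (cnj (W s m i) * W t m j))"
      using ij by (simp add: gx[OF st(1) mu(1)] gx[OF st(2) mu(2)] sandwich_munit J mult_ac)
    also have "\<dots> = W s k i * cnj (W t l j) * (\<Sum>m\<in>T3_idx K. cnj (W s m i) * W t m j)"
      by (simp only: sum_distrib_left)
    finally show ?thesis using kl orth[OF st mu] by (simp add: mzero_def)
  qed
  have "block_rep J K f {..<r} W \<sigma>"
  proof (rule block_repI)
    show "k \<in> T3_idx K \<and> i \<in> T3_idx J \<and> fst k = omap_apply (\<sigma> s) (fst i)" if "s \<in> {..<r}" "W s k i \<noteq> 0" for s k i
      using block_repD(2)[OF W, of s "()"] that by auto
    show "(\<Sum>k\<in>T3_idx K. cnj (W s k i) * W t k j) = of_bool (s = t) * of_bool (i = j)"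
      if "s \<in> {..<r}" "t \<in> {..<r}" "i \<in> T3_idx J" "j \<in> T3_idx J" for s t i j
      using that iso c0 by (cases "s = t") auto
    show "f x = (\<lambda>k l. \<Sum>s\<in>{..<r}. sandwich (T3_idx J) (W s) x k l)" if "x \<in> fin_mat (T3_idx J)" for x
      using fg[OF that] gx[OF _ that] by simp
  qed simp
  then show ?thesis by (blast intro: has_classI)
qed

lemma has_class_regular:
  assumes J: "finite J" and K: "finite K" and f: "has_class J K f m"
  shows "regular J K f"
proof -
  obtain W \<sigma> r where W: "block_rep J K f {..<r::nat} W \<sigma>" using f by (rule has_classE)
  define g where "g s = sandwich (T3_idx J) (W s)" for s
  have b: "block_rep J K (g s) {s} W \<sigma>" if "s < r" for s
    using block_repD(2)[OF W] block_repD(3)[OF W] that unfolding g_def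
    by (intro block_repI) auto
  have m: "has_multiplicity (T3_idx J) (T3_idx K) (g s) 1" if "s < r" for s
  proof -
    have W0: "W s k i = 0" if "k \<notin> T3_idx K \<or> i \<notin> T3_idx J" for k i
      using block_repD(2)[OF W, of s k i] that \<open>s < r\<close> by blast
    have "mmult (madj (W s)) (W s) = mid (T3_idx J)"
    proof (intro ext)
      fix i j
      have "mmult (madj (W s)) (W s) i j = (\<Sum>k\<in>T3_idx K. cnj (W s k i) * W s k j)"
        by (rule mmult_madj_left) (use K W0 in auto)
      also have "\<dots> = mid (T3_idx J) i j"
      proof (cases "i \<in> T3_idx J \<and> j \<in> T3_idx J")
        case True
        then show ?thesis using block_repD(3)[OF W, of s s i j] \<open>s < r\<close> by (simp add: mid_def)
      next
        case False
        then have "cnj (W s k i) * W s k j = 0" for k using W0[of k i] W0[of k j] by fastforce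
        then have "(\<Sum>k\<in>T3_idx K. cnj (W s k i) * W s k j) = 0" by (intro sum.neutral ballI)
        then show ?thesis using False by (auto simp: mid_def)
      qed
      finally show "mmult (madj (W s)) (W s) i j = mid (T3_idx J) i j" .
    qed
    moreover have "g s x = mmult (mmult (W s) x) (madj (W s))" for x
      unfolding g_def by (rule mmult_mmult_madj[symmetric]) (use J W0 in auto)
    moreover have "k \<in> T3_idx K \<and> i \<in> T3_idx J" if "W s k i \<noteq> 0" for k i
      using W0 that by blast
    ultimately show ?thesis
      unfolding has_multiplicity_def by (intro exI[of _ "\<lambda>_. W s"]) simp
  qed
  have o: "mmult (g s x) (g t y) = mzero"
    if st: "s < r" "t < r" "s \<noteq> t" and xy: "x \<in> fin_mat (T3_idx J)" "y \<in> fin_mat (T3_idx J)" for s t x y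
  proof (intro ext)
    fix k l
    have "mmult (g s x) (g t y) k l = (\<Sum>m\<in>T3_idx K. g s x k m * g t y m l)"
      by (rule mmult_fin_mat) (use K block_rep_fin_mat[OF J K b[OF st(1)] xy(1)] in auto)
    also have "\<dots> = 0 * (\<Sum>i\<in>T3_idx J. \<Sum>j\<in>T3_idx J. W s k i * (\<Sum>p\<in>T3_idx J. x i p * y p j) * cnj (W t l j))"
      unfolding g_def by (rule sandwich_mult) (use J st block_repD(3)[OF W, of s t] in auto)
    finally show "mmult (g s x) (g t y) k l = mzero k l" by (simp add: mzero_def)
  qed
  show ?thesis
    unfolding regular_def
  proof (intro conjI exI[of _ r] exI[of _ g] allI ballI impI)
    show "star_extendible (T3_alg J) (T3_alg K) f" by (rule has_class_star_extendible[OF J K f])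
    show "star_extendible (T3_alg J) (T3_alg K) (g s)" if "s < r" for s
      by (rule block_rep_star_extendible[OF J K b[OF that]])
    show "f x = (\<lambda>k l. \<Sum>s<r. g s x k l)" if "x \<in> fin_mat (T3_idx J)" for x
      using block_repD(4)[OF W that] unfolding g_def .
  qed (use m o in auto)
qed

text \<open>A column whose label is \<open>t\<close> is supported in \<open>{t} \<times> K\<close>,
  so inner products may be computed there; each block becomes a separate space of dimension
  \<open>card K\<close>.\<close>

lemma block_rep_block:
  assumes K: "finite K" and f: "block_rep J K f S v \<sigma>"
  shows "orthonormal_on ({t} \<times> K) (\<lambda>(s, i) k. v s k i) {(s, i) \<in> S \<times> T3_idx J. omap_apply (\<sigma> s) (fst i) = t}"
  unfolding orthonormal_on_def
proof (intro ballI)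
  fix p q assume "p \<in> {(s, i) \<in> S \<times> T3_idx J. omap_apply (\<sigma> s) (fst i) = t}"
    "q \<in> {(s, i) \<in> S \<times> T3_idx J. omap_apply (\<sigma> s) (fst i) = t}"
  then obtain s i s' j where p: "p = (s, i)" "s \<in> S" "i \<in> T3_idx J" "omap_apply (\<sigma> s) (fst i) = t"
    and q: "q = (s', j)" "s' \<in> S" "j \<in> T3_idx J" by auto
  have t: "t \<in> {1..3}" using p omap_apply_range[of "fst i" "\<sigma> s"] by (simp add: mem_T3_idx)
  have "(\<Sum>k\<in>{t} \<times> K. cnj (v s k i) * v s' k j) = (\<Sum>k\<in>T3_idx K. cnj (v s k i) * v s' k j)"
    using K t block_repD(2)[OF f p(2)] p(4)
    by (intro sum.mono_neutral_left) (fastforce simp: T3_idx_def)+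
  also have "\<dots> = of_bool (p = q)" using block_repD(3)[OF f p(2) q(2) p(3) q(3)] p q by auto
  finally show "(\<Sum>k\<in>{t} \<times> K. cnj ((\<lambda>(s, i) k. v s k i) p k) * (\<lambda>(s, i) k. v s k i) q k) = of_bool (p = q)"
    using p q by simp
qed

lemma card_block:
  assumes "finite S" "finite J"
  shows "card {(s, i) \<in> S \<times> T3_idx J. omap_apply (\<sigma> s) (fst i) = t} = card J * wt t (image_mset \<sigma> (mset_set S))"
proof -
  have "{(s, i) \<in> S \<times> T3_idx J. omap_apply (\<sigma> s) (fst i) = t} =
    (SIGMA s:S. {p\<in>{1..3}. omap_apply (\<sigma> s) p = t} \<times> J)" by (auto simp: T3_idx_def)
  moreover have "card (SIGMA s:S. {p\<in>{1..3}. omap_apply (\<sigma> s) p = t} \<times> J) =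
    (\<Sum>s\<in>S. card ({p\<in>{1..3}. omap_apply (\<sigma> s) p = t} \<times> J))"
    using assms by (intro card_SigmaI) auto
  ultimately have "card {(s, i) \<in> S \<times> T3_idx J. omap_apply (\<sigma> s) (fst i) = t} =
    (\<Sum>s\<in>S. card {p\<in>{1..3}. omap_apply (\<sigma> s) p = t} * card J)"
    by (simp only: card_cartesian_product)
  also have "\<dots> = card J * wt t (image_mset \<sigma> (mset_set S))"
    unfolding wt_def by (simp add: sum_distrib_right[symmetric] sum_unfold_sum_mset multiset.map_comp comp_def)
  finally show ?thesis .
qed

text \<open>The columns labelled \<open>t\<close> are orthonormal in a space of dimension
  \<open>card K\<close>, and \<open>card_block\<close> counts them.\<close>

lemma has_class_size:
  assumes J: "finite J" and K: "finite K" and f: "has_class J K f m"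
  shows "card J * wt t m \<le> card K"
proof -
  obtain v \<sigma> r where v: "block_rep J K f {..<r::nat} v \<sigma>" and m: "m = image_mset \<sigma> (mset_set {..<r})"
    using f by (rule has_classE)
  have "finite {(s, i) \<in> {..<r} \<times> T3_idx J. omap_apply (\<sigma> s) (fst i) = t}"
    by (rule finite_subset[of _ "{..<r} \<times> T3_idx J"]) (use J in auto)
  then have "card {(s, i) \<in> {..<r} \<times> T3_idx J. omap_apply (\<sigma> s) (fst i) = t} \<le> card ({t} \<times> K)"
    using block_rep_block[OF K v, of t] K by (intro orthonormal_card_le) auto
  then show ?thesis using card_block[of "{..<r}" J \<sigma> t] J unfolding m by (simp add: card_cartesian_product)
qed

text \<open>The bound allows the columns labelled \<open>t\<close> to be sent injectively to the
  coordinates of block \<open>t\<close>; the isometries are then matrices with entries 0 and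
  1.\<close>

lemma has_class_exists:
  assumes J: "finite J" and K: "finite K" and size: "\<And>t. t \<in> {1..3} \<Longrightarrow> card J * wt t m \<le> card K"
  shows "\<exists>f. has_class J K f m"
proof -
  obtain \<sigma> where m: "m = image_mset \<sigma> (mset_set {..<size m})" using mset_family by blast
  define A where "A t = {(s, i) \<in> {..<size m} \<times> T3_idx J. omap_apply (\<sigma> s) (fst i) = t}" for t
  have fA: "finite (A t)" for t
    unfolding A_def by (rule finite_subset[of _ "{..<size m} \<times> T3_idx J"]) (use J in auto)
  have "card (A t) \<le> card K" if "t \<in> {1..3}" for t
    using size[OF that] card_block[of "{..<size m}" J \<sigma> t] J m unfolding A_def by simp
  then have "\<forall>t. \<exists>h. t \<in> {1..3} \<longrightarrow> inj_on h (A t) \<and> h ` A t \<subseteq> K"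
    using fA K by (metis card_le_inj)
  then obtain h where h: "\<And>t. t \<in> {1..3} \<Longrightarrow> inj_on (h t) (A t) \<and> h t ` A t \<subseteq> K" by metis
  \<comment> \<open>The coordinate that receives column \<open>i\<close> of copy \<open>s\<close>;
    \<open>h t\<close> is the injection chosen for block \<open>t\<close>.\<close>
  define pos where "pos s i = (let t = omap_apply (\<sigma> s) (fst i) in (t, h t (s, i)))" for s i
  define v where "v s k i = (of_bool (i \<in> T3_idx J \<and> k = pos s i) :: complex)" for s k i
  have t: "omap_apply (\<sigma> s) (fst i) \<in> {1..3}" if "i \<in> T3_idx J" for s i
    using that by (intro omap_apply_range) (simp add: mem_T3_idx)
  have pos: "pos s i \<in> T3_idx K \<and> fst (pos s i) = omap_apply (\<sigma> s) (fst i)"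
    if "s < size m" "i \<in> T3_idx J" for s i
  proof -
    have "(s, i) \<in> A (omap_apply (\<sigma> s) (fst i))" using that by (simp add: A_def)
    then have "h (omap_apply (\<sigma> s) (fst i)) (s, i) \<in> K" using h[OF t[OF that(2), of s]] by blast
    then show ?thesis using t[OF that(2), of s] by (simp add: pos_def Let_def mem_T3_idx)
  qed
  have posinj: "pos s i = pos s' j \<longleftrightarrow> s = s' \<and> i = j"
    if "s < size m" "i \<in> T3_idx J" "s' < size m" "j \<in> T3_idx J" for s i s' j
  proof
    assume eq: "pos s i = pos s' j"
    then have t': "omap_apply (\<sigma> s) (fst i) = omap_apply (\<sigma> s') (fst j)" by (simp add: pos_def Let_def)
    have "(s, i) \<in> A (omap_apply (\<sigma> s) (fst i))" "(s', j) \<in> A (omap_apply (\<sigma> s) (fst i))"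
      using that t' by (auto simp: A_def)
    moreover have "h (omap_apply (\<sigma> s) (fst i)) (s, i) = h (omap_apply (\<sigma> s) (fst i)) (s', j)"
      using eq t' by (simp add: pos_def Let_def)
    ultimately show "s = s' \<and> i = j" using h[OF t[OF that(2), of s]] by (metis inj_onD prod.inject)
  qed simp
  define f where "f x = (\<lambda>k l. \<Sum>s<size m. sandwich (T3_idx J) (v s) x k l)" for x
  have "block_rep J K f {..<size m} v \<sigma>"
  proof (rule block_repI)
    show "k \<in> T3_idx K \<and> i \<in> T3_idx J \<and> fst k = omap_apply (\<sigma> s) (fst i)" if "s \<in> {..<size m}" "v s k i \<noteq> 0" for s k i
      using that pos[of s i] by (auto simp: v_def)
    show "(\<Sum>k\<in>T3_idx K. cnj (v s k i) * v s' k j) = of_bool (s = s') * of_bool (i = j)"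
      if "s \<in> {..<size m}" "s' \<in> {..<size m}" "i \<in> T3_idx J" "j \<in> T3_idx J" for s s' i j
    proof -
      have "(\<Sum>k\<in>T3_idx K. cnj (v s k i) * v s' k j) = (\<Sum>k\<in>T3_idx K. of_bool (pos s i = pos s' j) * of_bool (k = pos s i))"
        using that by (intro sum.cong) (auto simp: v_def)
      also have "\<dots> = of_bool (pos s i = pos s' j)"
        using that pos K by (intro sum_unit_vector) auto
      finally show ?thesis using posinj that by auto
    qed
  qed (simp_all add: f_def)
  then show ?thesis using m by (blast intro: has_classI)
qed

text \<open>The unitaries of the algebra that lie in it together with their adjoint: being
  triangular in both directions means being block diagonal.\<close>

definition block_unitary :: "'k set \<Rightarrow> (nat \<times> 'k, nat \<times> 'k) cmat \<Rightarrow> bool" where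
  "block_unitary K u \<longleftrightarrow>
     (\<forall>k l. u k l \<noteq> 0 \<longrightarrow> k \<in> T3_idx K \<and> l \<in> T3_idx K \<and> fst k = fst l) \<and>
     (\<forall>k\<in>T3_idx K. \<forall>l\<in>T3_idx K. (\<Sum>j\<in>T3_idx K. u k j * cnj (u l j)) = of_bool (k = l)) \<and>
     (\<forall>k\<in>T3_idx K. \<forall>l\<in>T3_idx K. (\<Sum>j\<in>T3_idx K. cnj (u j k) * u j l) = of_bool (k = l))"

lemma has_class_conjugate:
  assumes "finite J" "finite K" "has_class J K f m" "block_unitary K u"
  shows "has_class J K (\<lambda>x. sandwich (T3_idx K) u (f x)) m"
proof -
  have "block_rep K K (sandwich (T3_idx K) u) {()} (\<lambda>_. u) (\<lambda>_. 1)"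
  proof (rule block_repI)
    show "k \<in> T3_idx K \<and> i \<in> T3_idx K \<and> fst k = omap_apply 1 (fst i)" if "u k i \<noteq> 0" for k i
      using assms(4) that unfolding block_unitary_def omap_apply_one by blast
  qed (use assms(4) in \<open>auto simp: block_unitary_def\<close>)
  then have "has_class K K (sandwich (T3_idx K) u) {#1#}" by (rule has_classI) simp
  from has_class_comp[OF assms(1,2,2,3) this] show ?thesis by (simp add: comp_def)
qed

text \<open>Equal multisets allow the copies to be matched with equal labels. Matched columns then
  lie in the same blocks, so the unitary can be found block by block.\<close>

lemma has_class_unitary:
  assumes J: "finite J" and K: "finite K" and f: "has_class J K f m" and g: "has_class J K g m"
  shows "\<exists>u. block_unitary K u \<and> (\<forall>x\<in>fin_mat (T3_idx J). g x = sandwich (T3_idx K) u (f x))"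
proof -
  obtain v \<sigma> r where v: "block_rep J K f {..<r::nat} v \<sigma>" and m: "m = image_mset \<sigma> (mset_set {..<r})"
    using f by (rule has_classE)
  obtain w0 \<tau>0 q where w0: "block_rep J K g {..<q::nat} w0 \<tau>0" and m0: "m = image_mset \<tau>0 (mset_set {..<q})"
    using g by (rule has_classE)
  obtain h where h: "bij_betw h {..<r} {..<q}" "\<forall>s\<in>{..<r}. \<tau>0 (h s) = \<sigma> s"
    using image_mset_bij[of "{..<r}" "{..<q}" \<sigma> \<tau>0] m m0 by auto
  define w where "w s = w0 (h s)" for s
  have w: "block_rep J K g {..<r} w \<sigma>"
    using block_rep_reindex[OF w0 h(1)] h(2) unfolding w_def block_rep_def by simp
  define A where "A t = {(s, i) \<in> {..<r} \<times> T3_idx J. omap_apply (\<sigma> s) (fst i) = t}" for t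
  have fA: "finite (A t)" for t
    unfolding A_def by (rule finite_subset[of _ "{..<r} \<times> T3_idx J"]) (use J in auto)
  \<comment> \<open>Within block \<open>t\<close> the columns of \<open>f\<close> and of
    \<open>g\<close> are orthonormal families with the same index set \<open>A t\<close>; the
    unitaries of the three blocks are put together below.\<close>
  have "\<exists>u. (\<forall>k l. u k l \<noteq> 0 \<longrightarrow> k \<in> {t} \<times> K \<and> l \<in> {t} \<times> K) \<and>
     (\<forall>k\<in>{t} \<times> K. \<forall>l\<in>{t} \<times> K. (\<Sum>j\<in>{t} \<times> K. u k j * cnj (u l j)) = of_bool (k = l)) \<and>
     (\<forall>k\<in>{t} \<times> K. \<forall>l\<in>{t} \<times> K. (\<Sum>j\<in>{t} \<times> K. cnj (u j k) * u j l) = of_bool (k = l)) \<and>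
     (\<forall>a\<in>A t. \<forall>k\<in>{t} \<times> K. (\<Sum>l\<in>{t} \<times> K. u k l * (\<lambda>(s, i) k. v s k i) a l) = (\<lambda>(s, i) k. w s k i) a k)" for t
    using K fA unfolding A_def
    by (intro orthonormal_unitary block_rep_block[OF K v] block_rep_block[OF K w]) auto
  from choice[OF allI, OF this] obtain U where U0: "\<forall>t. (\<forall>k l. U t k l \<noteq> 0 \<longrightarrow> k \<in> {t} \<times> K \<and> l \<in> {t} \<times> K) \<and>
     (\<forall>k\<in>{t} \<times> K. \<forall>l\<in>{t} \<times> K. (\<Sum>j\<in>{t} \<times> K. U t k j * cnj (U t l j)) = of_bool (k = l)) \<and>
     (\<forall>k\<in>{t} \<times> K. \<forall>l\<in>{t} \<times> K. (\<Sum>j\<in>{t} \<times> K. cnj (U t j k) * U t j l) = of_bool (k = l)) \<and>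
     (\<forall>a\<in>A t. \<forall>k\<in>{t} \<times> K. (\<Sum>l\<in>{t} \<times> K. U t k l * (\<lambda>(s, i) k. v s k i) a l) = (\<lambda>(s, i) k. w s k i) a k)" by (rule exE)
  have U:
    "\<And>t k l. U t k l \<noteq> 0 \<Longrightarrow> k \<in> {t} \<times> K \<and> l \<in> {t} \<times> K"
    "\<And>t k l. k \<in> {t} \<times> K \<Longrightarrow> l \<in> {t} \<times> K \<Longrightarrow> (\<Sum>j\<in>{t} \<times> K. U t k j * cnj (U t l j)) = of_bool (k = l)"
    "\<And>t k l. k \<in> {t} \<times> K \<Longrightarrow> l \<in> {t} \<times> K \<Longrightarrow> (\<Sum>j\<in>{t} \<times> K. cnj (U t j k) * U t j l) = of_bool (k = l)"
    "\<And>t s i k. (s, i) \<in> A t \<Longrightarrow> k \<in> {t} \<times> K \<Longrightarrow> (\<Sum>l\<in>{t} \<times> K. U t k l * v s l i) = w s k i"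
  proof -
    show "U t k l \<noteq> 0 \<Longrightarrow> k \<in> {t} \<times> K \<and> l \<in> {t} \<times> K" for t k l using spec[OF U0, of t] by blast
    show "(\<Sum>l\<in>{t} \<times> K. U t k l * v s l i) = w s k i" if "(s, i) \<in> A t" "k \<in> {t} \<times> K" for t s i k
      using conjunct2[OF conjunct2[OF conjunct2[OF spec[OF U0, of t]]], rule_format, OF that] by simp
  qed (use U0 in blast)+
  define u where "u k l = (if fst k = fst l \<and> fst k \<in> {1..3} then U (fst k) k l else 0)" for k l
  have nz: "k \<in> T3_idx K \<and> l \<in> T3_idx K \<and> fst k = fst l" if "u k l \<noteq> 0" for k l
    using that U(1)[of "fst k" k l] by (auto simp: u_def mem_T3_idx split: if_splits)
  have uU: "(\<Sum>j\<in>T3_idx K. F j) = (\<Sum>j\<in>{t} \<times> K. F j)" if "\<And>j. fst j \<noteq> t \<Longrightarrow> F j = 0" "t \<in> {1..3}" for t and F :: "nat \<times> _ \<Rightarrow> complex"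
  proof (intro sum.mono_neutral_right ballI)
    fix j assume "j \<in> T3_idx K - {t} \<times> K"
    then show "F j = 0" by (intro that(1)) (auto simp: T3_idx_def)
  qed (use K that(2) in \<open>auto simp: T3_idx_def\<close>)
  have u1: "(\<Sum>j\<in>T3_idx K. u k j * cnj (u l j)) = of_bool (k = l)" if kl: "k \<in> T3_idx K" "l \<in> T3_idx K" for k l
  proof (cases "fst k = fst l")
    case True
    have k: "fst k \<in> {1..3}" using kl by (simp add: mem_T3_idx)
    have "(\<Sum>j\<in>T3_idx K. u k j * cnj (u l j)) = (\<Sum>j\<in>{fst k} \<times> K. u k j * cnj (u l j))"
      by (rule uU) (use k in \<open>auto simp: u_def\<close>)
    also have "\<dots> = (\<Sum>j\<in>{fst k} \<times> K. U (fst k) k j * cnj (U (fst k) l j))"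
      by (rule sum.cong) (use k True in \<open>auto simp: u_def\<close>)
    also have "\<dots> = of_bool (k = l)" by (rule U(2)) (use True kl in \<open>auto simp: mem_T3_idx mem_Times_iff\<close>)
    finally show ?thesis .
  next
    case False
    then have "(\<Sum>j\<in>T3_idx K. u k j * cnj (u l j)) = 0" by (intro sum.neutral) (auto simp: u_def)
    then show ?thesis using False by auto
  qed
  have u2: "(\<Sum>j\<in>T3_idx K. cnj (u j k) * u j l) = of_bool (k = l)" if kl: "k \<in> T3_idx K" "l \<in> T3_idx K" for k l
  proof (cases "fst k = fst l")
    case True
    have k: "fst k \<in> {1..3}" using kl by (simp add: mem_T3_idx)
    have "(\<Sum>j\<in>T3_idx K. cnj (u j k) * u j l) = (\<Sum>j\<in>{fst k} \<times> K. cnj (u j k) * u j l)"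
      by (rule uU) (use k in \<open>auto simp: u_def\<close>)
    also have "\<dots> = (\<Sum>j\<in>{fst k} \<times> K. cnj (U (fst k) j k) * U (fst k) j l)"
      by (rule sum.cong) (use k True in \<open>auto simp: u_def\<close>)
    also have "\<dots> = of_bool (k = l)" by (rule U(3)) (use True kl in \<open>auto simp: mem_T3_idx mem_Times_iff\<close>)
    finally show ?thesis .
  next
    case False
    then have "(\<Sum>j\<in>T3_idx K. cnj (u j k) * u j l) = 0" by (intro sum.neutral) (auto simp: u_def)
    then show ?thesis using False by auto
  qed
  have uv: "(\<Sum>l\<in>T3_idx K. u k l * v s l i) = w s k i" if "s < r" "i \<in> T3_idx J" for s k i
  proof (cases "k \<in> T3_idx K \<and> fst k = omap_apply (\<sigma> s) (fst i)")
    case True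
    then have k: "fst k \<in> {1..3}" by (simp add: mem_T3_idx)
    have "(\<Sum>l\<in>T3_idx K. u k l * v s l i) = (\<Sum>l\<in>{fst k} \<times> K. u k l * v s l i)"
      by (rule uU) (use k in \<open>auto simp: u_def\<close>)
    also have "\<dots> = (\<Sum>l\<in>{fst k} \<times> K. U (fst k) k l * v s l i)"
      by (rule sum.cong) (use k True in \<open>auto simp: u_def\<close>)
    also have "\<dots> = w s k i" by (rule U(4)) (use True that in \<open>auto simp: A_def mem_T3_idx mem_Times_iff\<close>)
    finally show ?thesis .
  next
    case False
    have "u k l * v s l i = 0" for l
    proof (rule ccontr)
      assume "u k l * v s l i \<noteq> 0"
      then have "u k l \<noteq> 0" "v s l i \<noteq> 0" by auto
      then show False using nz[of k l] block_repD(2)[OF v, of s l i] that(1) False by auto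
    qed
    then have "(\<Sum>l\<in>T3_idx K. u k l * v s l i) = 0" by (intro sum.neutral ballI)
    moreover have "w s k i = 0" using block_repD(2)[OF w, of s k i] that False by blast
    ultimately show ?thesis by simp
  qed
  have "g x = sandwich (T3_idx K) u (f x)" if x: "x \<in> fin_mat (T3_idx J)" for x
  proof (intro ext)
    fix k l
    have "sandwich (T3_idx K) u (f x) k l = (\<Sum>s<r. sandwich (T3_idx K) u (sandwich (T3_idx J) (v s) x) k l)"
      unfolding block_repD(4)[OF v x] sandwich_def[of "T3_idx K"]
      by (simp add: sum_distrib_left sum_distrib_right) (subst sum.swap, intro sum.cong[OF refl], subst sum.swap, simp)
    also have "\<dots> = (\<Sum>s<r. sandwich (T3_idx J) (w s) x k l)"
    proof (rule sum.cong[OF refl])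
      fix s assume s: "s \<in> {..<r}"
      show "sandwich (T3_idx K) u (sandwich (T3_idx J) (v s) x) k l = sandwich (T3_idx J) (w s) x k l"
        unfolding sandwich_comp unfolding sandwich_def using uv s by (intro sum.cong) auto
    qed
    also have "\<dots> = g x k l" using block_repD(4)[OF w x] by simp
    finally show "g x k l = sandwich (T3_idx K) u (f x) k l" ..
  qed
  moreover have "block_unitary K u" unfolding block_unitary_def using nz u1 u2 by blast
  ultimately show ?thesis by blast
qed

text \<open>Size alone provides some \<open>h\<close> of class \<open>b\<close>. Then
  \<open>h \<circ> f\<close> and \<open>g\<close> have the same class, and conjugating
  \<open>h\<close> by the resulting block unitary makes the triangle commute exactly, not only up to
  equivalence.\<close>

lemma has_class_lift:
  assumes J: "finite J" and K: "finite K" and L: "finite L"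
    and f: "has_class J K f m" and g: "has_class J L g (mprod b m)"
    and size: "\<And>t. t \<in> {1..3} \<Longrightarrow> card K * wt t b \<le> card L"
  shows "\<exists>h. has_class K L h b \<and> (\<forall>x\<in>fin_mat (T3_idx J). h (f x) = g x)"
proof -
  obtain h where h: "has_class K L h b" using has_class_exists[OF K L size] by blast
  obtain u where "block_unitary L u" "\<forall>x\<in>fin_mat (T3_idx J). g x = sandwich (T3_idx L) u ((h \<circ> f) x)"
    using has_class_unitary[OF J L has_class_comp[OF J K L f h] g] by blast
  then show ?thesis using has_class_conjugate[OF K L h, of u] by auto
qed

text \<open>Let \<open>C s t\<close> be the inner product of copy \<open>s\<close> of the first
  family with copy \<open>t\<close> of the second; it is the same for all three indices
  \<open>i\<close>. The squared moduli have row and column sums 1, and a nonzero entry forces equal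
  labels, so summing them over the copies with a given label counts these copies in both families.
  The statement is about vectors rather than \<open>block_rep\<close> since it is also applied to
  vectors moved by an inner unitary.\<close>

lemma class_unique:
  fixes v :: "'s \<Rightarrow> nat \<Rightarrow> 'k \<Rightarrow> complex" and w :: "'t \<Rightarrow> nat \<Rightarrow> 'k \<Rightarrow> complex"
  assumes fin: "finite S" "finite T" "finite K"
    and v: "orthonormal_on K (\<lambda>(s, i). v s i) (S \<times> {1..3})" and w: "orthonormal_on K (\<lambda>(t, i). w t i) (T \<times> {1..3})"
    and \<sigma>: "\<And>s i k. s \<in> S \<Longrightarrow> i \<in> {1..3} \<Longrightarrow> v s i k \<noteq> 0 \<Longrightarrow> lab k = omap_apply (\<sigma> s) i"
    and \<tau>: "\<And>t i k. t \<in> T \<Longrightarrow> i \<in> {1..3} \<Longrightarrow> w t i k \<noteq> 0 \<Longrightarrow> lab k = omap_apply (\<tau> t) i"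
    and eq: "\<And>i j k l. i \<in> {1..3} \<Longrightarrow> j \<in> {1..3} \<Longrightarrow> k \<in> K \<Longrightarrow> l \<in> K \<Longrightarrow>
      (\<Sum>s\<in>S. v s i k * cnj (v s j l)) = (\<Sum>t\<in>T. w t i k * cnj (w t j l))"
  shows "image_mset \<sigma> (mset_set S) = image_mset \<tau> (mset_set T)"
proof -
  \<comment> \<open>The operator attached to the index pair \<open>(i, j)\<close> is written in both
    families and applied to the vector \<open>w' t j\<close>.\<close>
  have expand: "w' t i k = (\<Sum>s\<in>S'. v' s i k * (\<Sum>l\<in>K. cnj (v' s j l) * w' t j l))"
    if "finite S'" "finite T'" "orthonormal_on K (\<lambda>(t, i). w' t i) (T' \<times> {1..3})"
      "\<And>i j k l. i \<in> {1..3} \<Longrightarrow> j \<in> {1..3} \<Longrightarrow> k \<in> K \<Longrightarrow> l \<in> K \<Longrightarrow>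
      (\<Sum>s\<in>S'. v' s i k * cnj (v' s j l)) = (\<Sum>t\<in>T'. w' t i k * cnj (w' t j l))"
      "t \<in> T'" "i \<in> {1..3}" "j \<in> {1..3}" "k \<in> K"
    for S' :: "'x set" and T' :: "'y set" and v' w' t i j k
  proof -
    have "(\<Sum>s\<in>S'. v' s i k * (\<Sum>l\<in>K. cnj (v' s j l) * w' t j l)) =
      (\<Sum>l\<in>K. (\<Sum>s\<in>S'. v' s i k * cnj (v' s j l)) * w' t j l)"
      unfolding sum_distrib_left sum_distrib_right by (subst sum.swap) (simp add: mult_ac)
    also have "\<dots> = (\<Sum>l\<in>K. (\<Sum>t'\<in>T'. w' t' i k * cnj (w' t' j l)) * w' t j l)"
      using that by (intro sum.cong) auto
    also have "\<dots> = (\<Sum>t'\<in>T'. w' t' i k * (\<Sum>l\<in>K. cnj (w' t' j l) * w' t j l))"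
      unfolding sum_distrib_left sum_distrib_right by (subst sum.swap) (simp add: mult_ac)
    also have "\<dots> = (\<Sum>t'\<in>T'. w' t' i k * of_bool (t' = t))"
      using orthonormal_onD[OF that(3), of "(_, j)" "(t, j)"] that by (intro sum.cong) auto
    also have "\<dots> = w' t i k" using that by (simp only: sum_unit_vector)
    finally show ?thesis ..
  qed
  have norm_exp: "(\<Sum>s\<in>S'. (cmod (\<Sum>l\<in>K. cnj (v' s j l) * w' t j l))\<^sup>2) = 1"
    if "finite S'" "finite T'" "orthonormal_on K (\<lambda>(s, i). v' s i) (S' \<times> {1..3})" "orthonormal_on K (\<lambda>(t, i). w' t i) (T' \<times> {1..3})"
      "\<And>i j k l. i \<in> {1..3} \<Longrightarrow> j \<in> {1..3} \<Longrightarrow> k \<in> K \<Longrightarrow> l \<in> K \<Longrightarrow>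
      (\<Sum>s\<in>S'. v' s i k * cnj (v' s j l)) = (\<Sum>t\<in>T'. w' t i k * cnj (w' t j l))"
      "t \<in> T'" "j \<in> {1..3}"
    for S' :: "'x set" and T' :: "'y set" and v' w' t j
  proof -
    let ?c = "\<lambda>s. \<Sum>l\<in>K. cnj (v' s j l) * w' t j l"
    have "complex_of_real (\<Sum>s\<in>S'. (cmod (?c s))\<^sup>2) = (\<Sum>s\<in>S'. ?c s * cnj (?c s))"
      unfolding of_real_sum complex_norm_square ..
    also have "\<dots> = (\<Sum>k\<in>K. cnj (\<Sum>s\<in>S'. v' s j k * ?c s) * w' t j k)"
    proof -
      have "(\<Sum>k\<in>K. cnj (\<Sum>s\<in>S'. v' s j k * ?c s) * w' t j k) = (\<Sum>k\<in>K. \<Sum>s\<in>S'. cnj (?c s) * (cnj (v' s j k) * w' t j k))"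
        unfolding cnj_sum[of _ S'] sum_distrib_right[of _ S'] by (intro sum.cong[OF refl]) (simp only: complex_cnj_mult mult_ac)
      also have "\<dots> = (\<Sum>s\<in>S'. cnj (?c s) * ?c s)"
        unfolding sum_distrib_left by (rule sum.swap)
      finally show ?thesis by (simp only: mult.commute)
    qed
    also have "\<dots> = (\<Sum>k\<in>K. cnj (w' t j k) * w' t j k)"
      using expand[OF that(1,2,4,5,6,7,7)] by simp
    also have "\<dots> = complex_of_real 1" using orthonormal_onD[OF that(4), of "(t, j)" "(t, j)"] that(6,7) by simp
    finally show ?thesis unfolding of_real_eq_iff .
  qed
  define C where "C s t = (\<Sum>l\<in>K. cnj (v s 1 l) * w t 1 l)" for s t
  \<comment> \<open>By \<open>expand\<close> every \<open>w t i\<close> has the coefficients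
    \<open>C s t\<close> in the vectors \<open>v s i\<close>, whatever \<open>i\<close> is.\<close>
  have C: "C s t = (\<Sum>l\<in>K. cnj (v s i l) * w t i l)" if st: "s \<in> S" "t \<in> T" and i: "i \<in> {1..3}" for s t i
  proof -
    have "(\<Sum>l\<in>K. cnj (v s i l) * w t i l) = (\<Sum>l\<in>K. cnj (v s i l) * (\<Sum>s'\<in>S. v s' i l * C s' t))"
      unfolding C_def using st i fin eq by (intro sum.cong[OF refl] arg_cong2[of _ _ _ _ "(*)"] expand[OF fin(1,2) w]) auto
    also have "\<dots> = (\<Sum>s'\<in>S. C s' t * (\<Sum>l\<in>K. cnj (v s i l) * v s' i l))"
      unfolding sum_distrib_left by (subst sum.swap) (simp add: mult_ac)
    also have "\<dots> = (\<Sum>s'\<in>S. C s' t * of_bool (s' = s))"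
      using orthonormal_onD[OF v, of "(s, i)" "(_, i)"] st i by (intro sum.cong) auto
    also have "\<dots> = C s t" using fin st by (simp only: sum_unit_vector)
    finally show ?thesis ..
  qed
  have lab: "\<sigma> s = \<tau> t" if "s \<in> S" "t \<in> T" "C s t \<noteq> 0" for s t
  proof (rule omap_eqI)
    fix i :: nat assume i: "i \<in> {1..3}"
    have "(\<Sum>l\<in>K. cnj (v s i l) * w t i l) \<noteq> 0" using C[OF that(1,2) i] that(3) by simp
    then obtain l where "cnj (v s i l) * w t i l \<noteq> 0" by (rule sum.not_neutral_contains_not_neutral)
    then have "v s i l \<noteq> 0" "w t i l \<noteq> 0" by auto
    then show "omap_apply (\<sigma> s) i = omap_apply (\<tau> t) i" using \<sigma>[OF that(1) i, of l] \<tau>[OF that(2) i, of l] by simp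
  qed
  have colsum: "(\<Sum>s\<in>S. (cmod (C s t))\<^sup>2) = 1" if "t \<in> T" for t
    unfolding C_def by (rule norm_exp[OF fin(1,2) v w eq that]) auto
  have rowsum: "(\<Sum>t\<in>T. (cmod (C s t))\<^sup>2) = 1" if "s \<in> S" for s
  proof -
    have "cmod (C s t) = cmod (\<Sum>l\<in>K. cnj (w t 1 l) * v s 1 l)" for t
      unfolding C_def by (subst complex_mod_cnj[symmetric]) (simp add: mult.commute)
    then show ?thesis using norm_exp[OF fin(2,1) w v eq[symmetric] that, of 1] by simp
  qed
  show ?thesis
  proof (rule multiset_eqI)
    fix c
    \<comment> \<open>The restriction \<open>\<sigma> s = c\<close> may be traded for
      \<open>\<tau> t = c\<close> wherever \<open>C s t\<close> is nonzero; row sums then give one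
      cardinality and column sums the other.\<close>
    have "(\<Sum>s\<in>{s\<in>S. \<sigma> s = c}. \<Sum>t\<in>T. (cmod (C s t))\<^sup>2) = (\<Sum>s\<in>S. \<Sum>t\<in>T. of_bool (\<sigma> s = c) * (cmod (C s t))\<^sup>2)"
      using fin by (intro sum.mono_neutral_cong_left) (auto simp: sum_distrib_left[symmetric])
    also have "\<dots> = (\<Sum>s\<in>S. \<Sum>t\<in>T. of_bool (\<tau> t = c) * (cmod (C s t))\<^sup>2)"
      using lab by (intro sum.cong[OF refl]) (metis (no_types, lifting) mult_eq_0_iff norm_zero power_zero_numeral)
    also have "\<dots> = (\<Sum>t\<in>T. \<Sum>s\<in>S. of_bool (\<tau> t = c) * (cmod (C s t))\<^sup>2)" by (rule sum.swap)
    also have "\<dots> = (\<Sum>t\<in>{t\<in>T. \<tau> t = c}. \<Sum>s\<in>S. (cmod (C s t))\<^sup>2)"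
      using fin by (intro sum.mono_neutral_cong_right) (auto simp: sum_distrib_left[symmetric])
    finally have "card {s\<in>S. \<sigma> s = c} = card {t\<in>T. \<tau> t = c}" using rowsum colsum by simp
    then show "count (image_mset \<sigma> (mset_set S)) c = count (image_mset \<tau> (mset_set T)) c"
      using fin by (simp add: count_image_mset' sum.If_cases Int_def conj_commute eq_commute[of c])
  qed
qed

section \<open>The semigroups of classes\<close>

text \<open>One point \<open>a\<close> of \<open>J\<close> is enough: the three columns
  \<open>(i, a)\<close> of each copy satisfy the hypotheses of \<open>class_unique\<close>, the
  labels being the blocks of the target.\<close>

lemma has_class_unique:
  assumes J: "finite J" "J \<noteq> {}" and K: "finite K" and f: "has_class J K f m" and g: "has_class J K g m'"
    and eq: "\<And>x. x \<in> fin_mat (T3_idx J) \<Longrightarrow> f x = g x"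
  shows "m = m'"
proof -
  obtain v \<sigma> r where v: "block_rep J K f {..<r::nat} v \<sigma>" and m: "m = image_mset \<sigma> (mset_set {..<r})"
    using f by (rule has_classE)
  obtain w \<tau> q where w: "block_rep J K g {..<q::nat} w \<tau>" and m': "m' = image_mset \<tau> (mset_set {..<q})"
    using g by (rule has_classE)
  obtain a where a: "a \<in> J" using J by blast
  have i: "(i, a) \<in> T3_idx J" if "i \<in> {1..3}" for i using that a by (simp add: mem_T3_idx)
  show ?thesis unfolding m m'
  proof (rule class_unique[of _ _ "T3_idx K" "\<lambda>s i k. v s k (i, a)" "\<lambda>s i k. w s k (i, a)" fst])
    show "orthonormal_on (T3_idx K) (\<lambda>(s, i) k. v s k (i, a)) ({..<r} \<times> {1..3})"
      unfolding orthonormal_on_def using block_repD(3)[OF v _ _ i i] by auto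
    show "orthonormal_on (T3_idx K) (\<lambda>(s, i) k. w s k (i, a)) ({..<q} \<times> {1..3})"
      unfolding orthonormal_on_def using block_repD(3)[OF w _ _ i i] by auto
    show "fst k = omap_apply (\<sigma> s) i" if "s \<in> {..<r}" "v s k (i, a) \<noteq> 0" for s i k
      using block_repD(2)[OF v that] by simp
    show "fst k = omap_apply (\<tau> s) i" if "s \<in> {..<q}" "w s k (i, a) \<noteq> 0" for s i k
      using block_repD(2)[OF w that] by simp
    show "(\<Sum>s<r. v s k (i, a) * cnj (v s l (j, a))) = (\<Sum>t<q. w t k (i, a) * cnj (w t l (j, a)))"
      if "i \<in> {1..3}" "j \<in> {1..3}" for i j k l
      using block_rep_munit[OF J(1) v i i, OF that] block_rep_munit[OF J(1) w i i, OF that]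
        eq[OF munit_in_fin_mat[OF i i, OF that]] by simp
  qed (use K in auto)
qed

section \<open>The multiset under corner inclusions, relocations, direct sums and
  amplification\<close>

lemma has_class_mono:
  assumes "has_class J K f m" "K \<subseteq> K'" "finite K'"
  shows "has_class J K' f m"
proof -
  obtain v \<sigma> r where v: "block_rep J K f {..<r::nat} v \<sigma>" and m: "m = image_mset \<sigma> (mset_set {..<r})"
    using assms(1) by (rule has_classE)
  have sub: "T3_idx K \<subseteq> T3_idx K'" using assms(2) by (auto simp: T3_idx_def)
  have "block_rep J K' f {..<r} v \<sigma>"
  proof (rule block_repI)
    show "k \<in> T3_idx K' \<and> i \<in> T3_idx J \<and> fst k = omap_apply (\<sigma> s) (fst i)" if "s \<in> {..<r}" "v s k i \<noteq> 0" for s k i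
      using block_repD(2)[OF v that] sub by blast
    show "(\<Sum>k\<in>T3_idx K'. cnj (v s k i) * v t k j) = of_bool (s = t) * of_bool (i = j)"
      if "s \<in> {..<r}" "t \<in> {..<r}" "i \<in> T3_idx J" "j \<in> T3_idx J" for s t i j
    proof -
      have "(\<Sum>k\<in>T3_idx K'. cnj (v s k i) * v t k j) = (\<Sum>k\<in>T3_idx K. cnj (v s k i) * v t k j)"
        using assms(3) sub
      proof (intro sum.mono_neutral_right ballI)
        fix k assume "k \<in> T3_idx K' - T3_idx K"
        then show "cnj (v s k i) * v t k j = 0" using block_repD(2)[OF v that(2), of k j] by auto
      qed auto
      then show ?thesis using block_repD(3)[OF v that] by simp
    qed
  qed (use block_repD(4)[OF v] in auto)
  then show ?thesis using m by (rule has_classI)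
qed

lemma has_class_fin_mat:
  "finite J \<Longrightarrow> finite K \<Longrightarrow> has_class J K f m \<Longrightarrow> x \<in> fin_mat (T3_idx J) \<Longrightarrow> f x \<in> fin_mat (T3_idx K)"
  by (metis has_class_def block_rep_fin_mat)

text \<open>Transport of a matrix along an injection of the inner index; it realises the embeddings
  by which a direct sum or a tensor product of copies of the compact operators is placed in one
  copy.\<close>

definition relocate ::
    "('k \<Rightarrow> 'l) \<Rightarrow> 'k set \<Rightarrow> (nat \<times> 'k, nat \<times> 'k) cmat \<Rightarrow> (nat \<times> 'l, nat \<times> 'l) cmat" where
  "relocate \<rho> K x = (\<lambda>k l. if snd k \<in> \<rho> ` K \<and> snd l \<in> \<rho> ` K
     then x (fst k, inv_into K \<rho> (snd k)) (fst l, inv_into K \<rho> (snd l)) else 0)"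

lemma has_class_relocate:
  assumes f: "has_class J K f m" and \<rho>: "inj_on \<rho> K"
  shows "has_class J (\<rho> ` K) (\<lambda>x. relocate \<rho> K (f x)) m"
proof -
  obtain v \<sigma> r where v: "block_rep J K f {..<r::nat} v \<sigma>" and m: "m = image_mset \<sigma> (mset_set {..<r})"
    using f by (rule has_classE)
  define w where "w s k i = (if snd k \<in> \<rho> ` K then v s (fst k, inv_into K \<rho> (snd k)) i else 0)" for s k i
  have bij: "bij_betw (\<lambda>k. (fst k, \<rho> (snd k))) (T3_idx K) (T3_idx (\<rho> ` K))"
    using \<rho> by (fastforce simp: bij_betw_def inj_on_def T3_idx_def image_iff)
  have wv: "w s (fst k, \<rho> (snd k)) i = v s k i" if "k \<in> T3_idx K" for s k i
    using that \<rho> by (simp add: w_def mem_T3_idx)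
  have "block_rep J (\<rho> ` K) (\<lambda>x. relocate \<rho> K (f x)) {..<r} w \<sigma>"
  proof (rule block_repI)
    show "k \<in> T3_idx (\<rho> ` K) \<and> i \<in> T3_idx J \<and> fst k = omap_apply (\<sigma> s) (fst i)" if "s \<in> {..<r}" "w s k i \<noteq> 0" for s k i
    proof -
      have k: "snd k \<in> \<rho> ` K" and nz: "v s (fst k, inv_into K \<rho> (snd k)) i \<noteq> 0"
        using that(2) by (auto simp: w_def split: if_splits)
      then show ?thesis using block_repD(2)[OF v that(1) nz] by (simp add: mem_T3_idx)
    qed
    show "(\<Sum>k\<in>T3_idx (\<rho> ` K). cnj (w s k i) * w t k j) = of_bool (s = t) * of_bool (i = j)"
      if "s \<in> {..<r}" "t \<in> {..<r}" "i \<in> T3_idx J" "j \<in> T3_idx J" for s t i j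
    proof -
      have "(\<Sum>k\<in>T3_idx (\<rho> ` K). cnj (w s k i) * w t k j) = (\<Sum>k\<in>T3_idx K. cnj (v s k i) * v t k j)"
        unfolding sum.reindex_bij_betw[OF bij, symmetric] by (intro sum.cong) (auto simp: wv)
      then show ?thesis using block_repD(3)[OF v that] by simp
    qed
    show "relocate \<rho> K (f x) = (\<lambda>k l. \<Sum>s\<in>{..<r}. sandwich (T3_idx J) (w s) x k l)" if "x \<in> fin_mat (T3_idx J)" for x
      unfolding block_repD(4)[OF v that] relocate_def sandwich_def w_def by (intro ext) auto
  qed simp
  then show ?thesis using m by (rule has_classI)
qed

lemma has_class_add:
  assumes f: "has_class J K f m" and g: "has_class J L g m'" and disj: "K \<inter> L = {}" and fin: "finite K" "finite L"
  shows "has_class J (K \<union> L) (\<lambda>x k l. f x k l + g x k l) (m + m')"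
proof -
  have f: "has_class J (K \<union> L) f m" "has_class J K f m" and g: "has_class J (K \<union> L) g m'" "has_class J L g m'"
    using f g fin by (auto intro: has_class_mono)
  obtain v \<sigma> r where v: "block_rep J K f {..<r::nat} v \<sigma>" and m: "m = image_mset \<sigma> (mset_set {..<r})"
    using f(2) by (rule has_classE)
  obtain w \<tau> q where w: "block_rep J L g {..<q::nat} w \<tau>" and m': "m' = image_mset \<tau> (mset_set {..<q})"
    using g(2) by (rule has_classE)
  let ?S = "Inl ` {..<r} \<union> Inr ` {..<q}"
  have KL: "T3_idx (K \<union> L) = T3_idx K \<union> T3_idx L" "T3_idx K \<inter> T3_idx L = {}"
    using disj by (auto simp: T3_idx_def)
  have v0: "v s k i = 0" if "s < r" "k \<notin> T3_idx K" for s k i using block_repD(2)[OF v] that by blast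
  have w0: "w s k i = 0" if "s < q" "k \<notin> T3_idx L" for s k i using block_repD(2)[OF w] that by blast
  have split: "(\<Sum>k\<in>T3_idx (K \<union> L). F k) = (\<Sum>k\<in>T3_idx K. F k) + (\<Sum>k\<in>T3_idx L. F k)" for F :: "_ \<Rightarrow> complex"
    unfolding KL(1) using fin KL(2) by (intro sum.union_disjoint) auto
  have notL: "k \<notin> T3_idx L" if "k \<in> T3_idx K" for k using KL(2) that by blast
  have notK: "k \<notin> T3_idx K" if "k \<in> T3_idx L" for k using KL(2) that by blast
  have "block_rep J (K \<union> L) (\<lambda>x k l. f x k l + g x k l) ?S (case_sum v w) (case_sum \<sigma> \<tau>)"
  proof (rule block_repI)
    show "k \<in> T3_idx (K \<union> L) \<and> i \<in> T3_idx J \<and> fst k = omap_apply (case_sum \<sigma> \<tau> s) (fst i)"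
      if "s \<in> ?S" "case_sum v w s k i \<noteq> 0" for s k i
      using that block_repD(2)[OF v, of "projl s" k i] block_repD(2)[OF w, of "projr s" k i] KL by auto
    show "(\<Sum>k\<in>T3_idx (K \<union> L). cnj (case_sum v w s k i) * case_sum v w t k j) = of_bool (s = t) * of_bool (i = j)"
      if "s \<in> ?S" "t \<in> ?S" "i \<in> T3_idx J" "j \<in> T3_idx J" for s t i j
      using that block_repD(3)[OF v _ _ that(3,4)] block_repD(3)[OF w _ _ that(3,4)] unfolding split
      by (auto simp: v0 w0 notL notK)
    show "(\<lambda>k l. f x k l + g x k l) = (\<lambda>k l. \<Sum>s\<in>?S. sandwich (T3_idx J) (case_sum v w s) x k l)"
      if "x \<in> fin_mat (T3_idx J)" for x
      unfolding block_repD(4)[OF v that] block_repD(4)[OF w that]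
      by (subst sum.union_disjoint) (auto simp: sum.reindex)
  qed simp
  moreover have "m + m' = image_mset (case_sum \<sigma> \<tau>) (mset_set ?S)"
    unfolding m m'
    by (subst mset_set_Union) (auto simp: image_mset_mset_set[symmetric] multiset.map_comp comp_def)
  ultimately show ?thesis by (rule has_classI)
qed

text \<open>The isometries of the amplification are \<open>v s\<close> tensored with the identity on
  \<open>Q\<close>, with the same labels.\<close>

lemma has_class_amp:
  assumes J: "finite J" and K: "finite K" and Q: "finite Q" and f: "has_class J K f m"
  shows "has_class (J \<times> Q) (K \<times> Q) (amp f) m"
proof -
  obtain v \<sigma> r where v: "block_rep J K f {..<r::nat} v \<sigma>" and m: "m = image_mset \<sigma> (mset_set {..<r})"
    using f by (rule has_classE)
  define w where "w s k i = (if snd (snd k) = snd (snd i) \<and> snd (snd i) \<in> Q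
    then v s (fst k, fst (snd k)) (fst i, fst (snd i)) else 0)" for s and k :: "nat \<times> 'b \<times> 'c" and i :: "nat \<times> 'a \<times> 'c"
  have bJ: "bij_betw (\<lambda>(i, q). (fst i, snd i, q)) (T3_idx J \<times> Q) (T3_idx (J \<times> Q))"
    by (rule bij_betw_byWitness[where f' = "\<lambda>i. ((fst i, fst (snd i)), snd (snd i))"]) (auto simp: T3_idx_def)
  have bK: "bij_betw (\<lambda>(i, q). (fst i, snd i, q)) (T3_idx K \<times> Q) (T3_idx (K \<times> Q))"
    by (rule bij_betw_byWitness[where f' = "\<lambda>i. ((fst i, fst (snd i)), snd (snd i))"]) (auto simp: T3_idx_def)
  have sJ: "(\<Sum>i\<in>T3_idx (J \<times> Q). F i) = (\<Sum>q\<in>Q. \<Sum>i\<in>T3_idx J. F (fst i, snd i, q))" for F :: "_ \<Rightarrow> complex"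
    unfolding sum.reindex_bij_betw[OF bJ, symmetric] by (subst sum.swap) (simp add: sum.cartesian_product split_def)
  have sK: "(\<Sum>i\<in>T3_idx (K \<times> Q). F i) = (\<Sum>q\<in>Q. \<Sum>i\<in>T3_idx K. F (fst i, snd i, q))" for F :: "_ \<Rightarrow> complex"
    unfolding sum.reindex_bij_betw[OF bK, symmetric] by (subst sum.swap) (simp add: sum.cartesian_product split_def)
  have "block_rep (J \<times> Q) (K \<times> Q) (amp f) {..<r} w \<sigma>"
  proof (rule block_repI)
    show "k \<in> T3_idx (K \<times> Q) \<and> i \<in> T3_idx (J \<times> Q) \<and> fst k = omap_apply (\<sigma> s) (fst i)"
      if "s \<in> {..<r}" "w s k i \<noteq> 0" for s k i
      using that block_repD(2)[OF v that(1), of "(fst k, fst (snd k))" "(fst i, fst (snd i))"]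
      by (auto simp: w_def mem_T3_idx mem_Times_iff split: if_splits)
    show "(\<Sum>k\<in>T3_idx (K \<times> Q). cnj (w s k i) * w t k j) = of_bool (s = t) * of_bool (i = j)"
      if st: "s \<in> {..<r}" "t \<in> {..<r}" and ij: "i \<in> T3_idx (J \<times> Q)" "j \<in> T3_idx (J \<times> Q)" for s t i j
    proof -
      obtain a b p where i: "i = (a, b, p)" by (metis surj_pair)
      obtain a' b' p' where j: "j = (a', b', p')" by (metis surj_pair)
      have mem: "(a, b) \<in> T3_idx J" "(a', b') \<in> T3_idx J" "p \<in> Q" "p' \<in> Q" using ij i j by (auto simp: T3_idx_def)
      have "(\<Sum>k\<in>T3_idx (K \<times> Q). cnj (w s k i) * w t k j) =
        (\<Sum>q\<in>Q. (of_bool (p = p') * (\<Sum>k\<in>T3_idx K. cnj (v s k (a, b)) * v t k (a', b'))) * of_bool (q = p))"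
        unfolding sK by (intro sum.cong[OF refl]) (auto simp: w_def i j mem)
      also have "\<dots> = of_bool (p = p') * (\<Sum>k\<in>T3_idx K. cnj (v s k (a, b)) * v t k (a', b'))"
        using Q mem by (intro sum_unit_vector)
      finally show ?thesis using block_repD(3)[OF v st mem(1,2)] i j by auto
    qed
    fix x :: "(nat \<times> 'a \<times> 'c, nat \<times> 'a \<times> 'c) cmat" assume x: "x \<in> fin_mat (T3_idx (J \<times> Q))"
    show "amp f x = (\<lambda>k l. \<Sum>s\<in>{..<r}. sandwich (T3_idx (J \<times> Q)) (w s) x k l)"
    proof (intro ext)
      fix k l :: "nat \<times> 'b \<times> 'c"
      obtain a b p where k: "k = (a, b, p)" by (metis surj_pair)
      obtain a' b' p' where l: "l = (a', b', p')" by (metis surj_pair)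
      \<comment> \<open>The matrix over \<open>J\<close> obtained from \<open>x\<close> by fixing
        the outer indices \<open>p\<close>, \<open>p'\<close>; \<open>amp f\<close> applies
        \<open>f\<close> to exactly this slice.\<close>
      define y where "y = (\<lambda>(s, a) (t, b). x (s, a, p) (t, b, p'))"
      have y: "y \<in> fin_mat (T3_idx J)"
        using J x by (subst fin_mat_iff) (auto simp: y_def T3_idx_def dest: fin_matD)
      have "sandwich (T3_idx (J \<times> Q)) (w s) x k l = sandwich (T3_idx J) (v s) y (a, b) (a', b')" for s
      proof (cases "p \<in> Q \<and> p' \<in> Q")
        case True
        have "sandwich (T3_idx (J \<times> Q)) (w s) x k l =
          (\<Sum>q\<in>Q. \<Sum>i\<in>T3_idx J. \<Sum>q'\<in>Q. \<Sum>j\<in>T3_idx J. w s k (fst i, snd i, q) * x (fst i, snd i, q) (fst j, snd j, q') * cnj (w s l (fst j, snd j, q')))"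
          unfolding sandwich_def sJ ..
        also have "\<dots> = (\<Sum>q\<in>Q. (\<Sum>i\<in>T3_idx J. \<Sum>q'\<in>Q. (\<Sum>j\<in>T3_idx J. v s (a, b) i * x (fst i, snd i, p) (fst j, snd j, p') * cnj (v s (a', b') j)) * of_bool (q' = p')) * of_bool (q = p))"
          unfolding sum_distrib_right by (intro sum.cong[OF refl]) (auto simp: w_def k l)
        also have "\<dots> = (\<Sum>i\<in>T3_idx J. \<Sum>j\<in>T3_idx J. v s (a, b) i * x (fst i, snd i, p) (fst j, snd j, p') * cnj (v s (a', b') j))"
          using Q True by (simp only: sum_unit_vector)
        finally show ?thesis by (simp add: sandwich_def y_def split_def)
      next
        case False
        have "y i j = 0" for i j
          using False fin_mat_outside(1)[OF x, of "(fst i, snd i, p)" "(fst j, snd j, p')"]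
            fin_mat_outside(2)[OF x, of "(fst j, snd j, p')" "(fst i, snd i, p)"]
          by (auto simp: y_def split_def mem_T3_idx)
        moreover have "w s k i = 0 \<or> w s l j = 0" for i j using False by (auto simp: w_def k l)
        ultimately have "w s k i * x i j * cnj (w s l j) = 0" "y i' j' = 0" for i j i' j'
          by (metis complex_cnj_zero mult_eq_0_iff, blast)
        then show ?thesis unfolding sandwich_def by (simp only: mult_zero_right mult_zero_left sum.neutral_const)
      qed
      moreover have "amp f x k l = f y (a, b) (a', b')" by (simp add: amp_def k l y_def)
      ultimately show "amp f x k l = (\<Sum>s\<in>{..<r}. sandwich (T3_idx (J \<times> Q)) (w s) x k l)"
        using block_repD(4)[OF v y] by simp
    qed
  qed simp
  then show ?thesis using m by (rule has_classI)
qed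

section \<open>Inner unitary equivalence classes of regular maps are given by multisets\<close>

definition vclass :: "'j set \<Rightarrow> omap multiset \<Rightarrow> 'j vmap set" where
  "vclass J m = {\<psi>. \<exists>n. has_class {()} (J \<times> {..<n}) \<psi> m}"

lemma vclass_common:
  assumes "finite J" "\<psi> \<in> vclass J m" "\<psi>' \<in> vclass J m'"
  shows "\<exists>n. has_class {()} (J \<times> {..<n}) \<psi> m \<and> has_class {()} (J \<times> {..<n}) \<psi>' m'"
proof -
  obtain n n' where n: "has_class {()} (J \<times> {..<n}) \<psi> m" "has_class {()} (J \<times> {..<n'}) \<psi>' m'"
    using assms by (auto simp: vclass_def)
  have "has_class {()} (J \<times> {..<max n n'}) \<psi> m" by (rule has_class_mono[OF n(1)]) (use assms(1) in auto)
  moreover have "has_class {()} (J \<times> {..<max n n'}) \<psi>' m'" by (rule has_class_mono[OF n(2)]) (use assms(1) in auto)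
  ultimately show ?thesis by blast
qed

lemma vclass_unique: "finite J \<Longrightarrow> \<psi> \<in> vclass J m \<Longrightarrow> \<psi> \<in> vclass J m' \<Longrightarrow> m = m'"
proof -
  assume J: "finite J" and \<psi>: "\<psi> \<in> vclass J m" "\<psi> \<in> vclass J m'"
  obtain n where n: "has_class {()} (J \<times> {..<n}) \<psi> m" "has_class {()} (J \<times> {..<n}) \<psi> m'"
    using vclass_common[OF J \<psi>] by blast
  show "m = m'" by (rule has_class_unique[OF _ _ _ n]) (use J in auto)
qed

lemma V_maps_eq:
  assumes "finite J"
  shows "V_maps J = (\<Union>m. vclass J m)"
proof -
  have "regular {()} (J \<times> {..<n}) \<psi> \<longleftrightarrow> (\<exists>m. has_class {()} (J \<times> {..<n}) \<psi> m)" for n and \<psi> :: "'a vmap"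
    using regular_has_class[of "{()}" "J \<times> {..<n}" \<psi>] has_class_regular[of "{()}" "J \<times> {..<n}" \<psi>] assms by auto
  then show ?thesis unfolding V_maps_def vclass_def by auto
qed

lemma vclass_nonempty:
  assumes "finite J" "J \<noteq> {}"
  shows "vclass J m \<noteq> {}"
proof -
  define N where "N = wt 1 m + wt 2 m + wt 3 m"
  have "card {()} * wt t m \<le> card (J \<times> {..<N})" if "t \<in> {1..3}" for t
  proof -
    have "t = 1 \<or> t = 2 \<or> t = 3" using that by auto
    then have "wt t m \<le> N" by (auto simp: N_def)
    also have "N \<le> card J * N" using assms by (simp add: card_gt_0_iff Suc_leI)
    finally show ?thesis by (simp add: card_cartesian_product)
  qed
  then obtain \<psi> where "has_class {()} (J \<times> {..<N}) \<psi> m"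
    using has_class_exists[of "{()}" "J \<times> {..<N}" m] assms by auto
  then show ?thesis unfolding vclass_def by blast
qed

text \<open>Only the middle factor needs finite support, so \<open>U\<close> may be an infinite
  matrix such as an inner unitary.\<close>

lemma mmult_mmult_madj_fin:
  assumes "finite I" "y \<in> fin_mat I"
  shows "mmult (mmult U y) (madj U) = sandwich I U y"
proof (intro ext)
  fix k l
  have Uy: "mmult U y k j = (\<Sum>i\<in>I. U k i * y i j)" for j
    by (rule mmult_eq_sum) (use assms in \<open>auto simp: fin_mat_outside\<close>)
  have "mmult (mmult U y) (madj U) k l = (\<Sum>j\<in>I. mmult U y k j * madj U j l)"
    by (rule mmult_eq_sum) (use assms in \<open>auto simp: Uy fin_mat_outside\<close>)
  also have "\<dots> = (\<Sum>j\<in>I. \<Sum>i\<in>I. U k i * y i j * cnj (U l j))"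
    by (simp add: Uy madj_def sum_distrib_right)
  also have "\<dots> = sandwich I U y k l" unfolding sandwich_def by (rule sum.swap)
  finally show "mmult (mmult U y) (madj U) k l = sandwich I U y k l" .
qed

lemma opdist_le_refl: "opdist_le x x C" if "C \<ge> 0"
  using that by (simp add: opdist_le_def L2_set_nonneg)

lemma opdist_le_entry:
  assumes "opdist_le x y C"
  shows "cmod (x i j - y i j) \<le> C"
proof -
  have "norm (\<Sum>p\<in>{i, j}. \<Sum>q\<in>{i, j}. cnj (of_bool (p = i)) * (x p q - y p q) * of_bool (q = j)) \<le>
     C * L2_set (\<lambda>p. norm (of_bool (p = i) :: complex)) {i, j} * L2_set (\<lambda>q. norm (of_bool (q = j) :: complex)) {i, j}"
    using assms[unfolded opdist_le_def, rule_format, of "{i, j}" "\<lambda>p. of_bool (p = i)" "\<lambda>q. of_bool (q = j)"] by simp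
  moreover have "(\<Sum>p\<in>{i, j}. \<Sum>q\<in>{i, j}. cnj (of_bool (p = i)) * (x p q - y p q) * of_bool (q = j)) = x i j - y i j"
    by (cases "i = j") auto
  moreover have "L2_set (\<lambda>p. norm (of_bool (p = i) :: complex)) {i, j} = 1" "L2_set (\<lambda>q. norm (of_bool (q = j) :: complex)) {i, j} = 1"
    by (cases "i = j"; simp add: L2_set_def)+
  ultimately show ?thesis by simp
qed

text \<open>Norm approximation bounds every single entry, so zeros common to all the finite
  triangular matrices persist in the closure.\<close>

lemma T3_compact_entry:
  assumes "x \<in> T3_compact J"
  shows "t < s \<Longrightarrow> x (s, a) (t, b) = 0"
    and "k \<notin> T3_idx (J \<times> UNIV) \<or> l \<notin> T3_idx (J \<times> UNIV) \<Longrightarrow> x k l = 0"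
proof -
  have small: "x k l = 0" if "\<And>n y. y \<in> T3 (J \<times> {..<n}) \<Longrightarrow> y k l = 0" for k l
  proof (rule ccontr)
    assume nz: "x k l \<noteq> 0"
    then have "cmod (x k l) / 2 > 0" by simp
    then obtain n y where y: "y \<in> T3 (J \<times> {..<n})" "opdist_le x y (cmod (x k l) / 2)"
      using assms unfolding T3_compact_def by blast
    then have "cmod (x k l - y k l) \<le> cmod (x k l) / 2" by (intro opdist_le_entry)
    then show False using that[OF y(1)] nz by simp
  qed
  show "t < s \<Longrightarrow> x (s, a) (t, b) = 0" by (rule small) (auto simp: T3_def)
  show "x k l = 0" if "k \<notin> T3_idx (J \<times> UNIV) \<or> l \<notin> T3_idx (J \<times> UNIV)"
  proof (rule small)
    fix n and y :: "(nat \<times> 'a \<times> nat, nat \<times> 'a \<times> nat) cmat" assume "y \<in> T3 (J \<times> {..<n})"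
    then have "y \<in> fin_mat (T3_idx (J \<times> UNIV))"
      using fin_mat_mono[of "T3_idx (J \<times> {..<n})" "T3_idx (J \<times> UNIV)"] by (auto simp: T3_def T3_idx_def)
    then show "y k l = 0" using that by (auto simp: fin_mat_outside)
  qed
qed

text \<open>Both \<open>u\<close> and \<open>madj u\<close> are a scalar plus a triangular matrix,
  which excludes entries on either side of the block diagonal.\<close>

lemma inner_unitary_block:
  assumes "inner_unitary J u" "u k l \<noteq> 0"
  shows "fst k = fst l" "k \<in> T3_idx (J \<times> UNIV)" "l \<in> T3_idx (J \<times> UNIV)"
proof -
  obtain c x where x: "x \<in> T3_compact J" "u = (\<lambda>i j. c * mid (T3_idx (J \<times> UNIV)) i j + x i j)"
    using assms(1) unfolding inner_unitary_def T3_compact_unitisation_def by blast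
  obtain d y where y: "y \<in> T3_compact J" "madj u = (\<lambda>i j. d * mid (T3_idx (J \<times> UNIV)) i j + y i j)"
    using assms(1) unfolding inner_unitary_def T3_compact_unitisation_def by blast
  have u': "u k l = cnj (madj u l k)" by (simp add: madj_def)
  show "k \<in> T3_idx (J \<times> UNIV)" "l \<in> T3_idx (J \<times> UNIV)"
    using assms(2) T3_compact_entry(2)[OF x(1), of k l] unfolding x(2) by (auto simp: mid_def split: if_splits)
  show "fst k = fst l"
  proof (rule ccontr)
    assume ne: "fst k \<noteq> fst l"
    then have "k \<noteq> l" by auto
    then have "u k l = x k l" "u k l = cnj (y l k)"
      using fun_cong[OF fun_cong[OF x(2)], of k l] u' fun_cong[OF fun_cong[OF y(2)], of l k] by (simp_all add: mid_def)
    then show False using assms(2) ne T3_compact_entry(1)[OF x(1), of "fst l" "fst k" "snd k" "snd l"]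
      T3_compact_entry(1)[OF y(1), of "fst k" "fst l" "snd l" "snd k"] by (auto simp: neq_iff)
  qed
qed

lemma block_unitary_madj: "block_unitary K u \<Longrightarrow> block_unitary K (madj u)"
  unfolding block_unitary_def madj_def by (simp add: mult.commute)

text \<open>The corner unitary is continued by the identity. The difference from the identity is
  finitely supported and block diagonal, so it belongs to a finite triangular algebra and the
  extension to the unitisation.\<close>

lemma inner_unitary_extend:
  assumes J: "finite J" and u: "block_unitary (J \<times> {..<n}) u"
  defines "U \<equiv> \<lambda>k l. mid (T3_idx (J \<times> UNIV)) k l + (u k l - mid (T3_idx (J \<times> {..<n})) k l)"
  shows "inner_unitary J U" and "y \<in> fin_mat (T3_idx (J \<times> {..<n})) \<Longrightarrow>
    sandwich (T3_idx (J \<times> {..<n})) U y = sandwich (T3_idx (J \<times> {..<n})) u y"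
proof -
  let ?K = "T3_idx (J \<times> {..<n})" and ?I = "T3_idx (J \<times> (UNIV :: nat set))"
  define ext where "ext w k l = mid ?I k l + (w k l - mid ?K k l)" for w :: "(nat \<times> 'a \<times> nat, nat \<times> 'a \<times> nat) cmat" and k l
  have sub: "?K \<subseteq> ?I" by (auto simp: T3_idx_def)
  have fK: "finite ?K" using J by simp
  have K: "ext w k l = w k l" if "l \<in> ?K \<or> k \<in> ?K" for w k l
    using that sub by (auto simp: ext_def mid_def)
  have outK: "ext w k l = mid ?I k l" if "block_unitary (J \<times> {..<n}) w" "k \<notin> ?K \<or> l \<notin> ?K" for w k l
    using that by (auto simp: ext_def mid_def block_unitary_def)
  have prod: "mmult (ext w) (madj (ext w)) = mid ?I" if w: "block_unitary (J \<times> {..<n}) w" for w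
  proof (intro ext)
    fix k l
    have w0: "w k l = 0" if "k \<notin> ?K \<or> l \<notin> ?K" for k l using w that by (auto simp: block_unitary_def)
    show "mmult (ext w) (madj (ext w)) k l = mid ?I k l"
    proof (cases "k \<in> ?K")
      case True
      have "mmult (ext w) (madj (ext w)) k l = (\<Sum>j\<in>?K. ext w k j * madj (ext w) j l)"
        by (rule mmult_eq_sum[OF fK]) (use True w0 in \<open>auto simp: K\<close>)
      also have "\<dots> = (\<Sum>j\<in>?K. w k j * cnj (w l j))" by (intro sum.cong) (auto simp: K madj_def)
      also have "\<dots> = mid ?I k l"
      proof (cases "l \<in> ?K")
        case True
        then show ?thesis using w \<open>k \<in> ?K\<close> sub unfolding block_unitary_def by (auto simp: mid_def)
      next
        case False
        then have "(\<Sum>j\<in>?K. w k j * cnj (w l j)) = 0" using w0 by (intro sum.neutral) auto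
        then show ?thesis using False True by (auto simp: mid_def)
      qed
      finally show ?thesis .
    next
      case False
      have "mmult (ext w) (madj (ext w)) k l = (\<Sum>j\<in>{k}. ext w k j * madj (ext w) j l)"
        by (rule mmult_eq_sum) (use False outK[OF w] in \<open>auto simp: mid_def\<close>)
      also have "\<dots> = mid ?I k l" using False outK[OF w, of k k] outK[OF w, of l k] by (auto simp: madj_def mid_def)
      finally show ?thesis .
    qed
  qed
  have unit: "ext w \<in> T3_compact_unitisation J" if w: "block_unitary (J \<times> {..<n}) w" for w
  proof -
    let ?x = "\<lambda>k l. w k l - mid ?K k l"
    have nz: "k \<in> ?K \<and> l \<in> ?K \<and> fst k = fst l" if "?x k l \<noteq> 0" for k l
    proof (cases "w k l = 0")
      case True then show ?thesis using that by (auto simp: mid_def split: if_splits)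
    next
      case False then show ?thesis using w unfolding block_unitary_def by blast
    qed
    have "?x \<in> fin_mat ?K" unfolding fin_mat_iff[OF fK] using nz by blast
    moreover have "?x (s, a) (t, b) = 0" if "t < s" for s a t b
      using nz[of "(s, a)" "(t, b)"] that by auto
    ultimately have "?x \<in> T3 (J \<times> {..<n})" unfolding T3_def by blast
    then have "?x \<in> T3_compact J" unfolding T3_compact_def using opdist_le_refl[of _ ?x]
      by (auto intro!: exI[of _ n] bexI[of _ ?x])
    then show ?thesis unfolding T3_compact_unitisation_def ext_def
      by (intro CollectI exI[of _ 1] exI[of _ ?x]) auto
  qed
  have Ue: "U = ext u" by (simp add: U_def ext_def fun_eq_iff)
  have mU: "madj (ext w) = ext (madj w)" for w by (auto simp: ext_def madj_def mid_def fun_eq_iff)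
  have "madj (ext (madj u)) = ext u" unfolding mU by (simp add: madj_def)
  then have "mmult (madj U) U = mid ?I" using prod[OF block_unitary_madj[OF u]] unfolding Ue mU by simp
  then show "inner_unitary J U"
    unfolding inner_unitary_def using unit[OF u] unit[OF block_unitary_madj[OF u]] prod[OF u] mU Ue by simp
  show "sandwich ?K U y = sandwich ?K u y" unfolding sandwich_def Ue
    by (intro ext sum.cong refl) (auto simp: K)
qed

lemma has_sum_finite_sum:
  fixes f :: "'i \<Rightarrow> 'a \<Rightarrow> 'b :: topological_comm_monoid_add"
  assumes "finite F" "\<And>i. i \<in> F \<Longrightarrow> (f i has_sum s i) A"
  shows "((\<lambda>x. \<Sum>i\<in>F. f i x) has_sum (\<Sum>i\<in>F. s i)) A"
  using assms by (induction F) (auto intro: has_sum_add)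

text \<open>An infinite sum that does not converge has the default value 0, so the unitarity
  equations alone give values but not convergence. On the diagonal the value 1 rules the default
  out; off the diagonal the terms are dominated by the sum of two diagonal families.\<close>

lemma inner_unitary_has_sum:
  assumes u: "inner_unitary J u" and l: "l \<in> T3_idx (J \<times> UNIV)" and l': "l' \<in> T3_idx (J \<times> UNIV)"
  shows "((\<lambda>k. cnj (u k l) * u k l') has_sum of_bool (l = l')) UNIV"
proof -
  have val: "(\<Sum>\<^sub>\<infinity>k. cnj (u k l) * u k l') = of_bool (l = l')" if "l \<in> T3_idx (J \<times> UNIV)" for l l'
  proof -
    have "mmult (madj u) u l l' = mid (T3_idx (J \<times> UNIV)) l l'" using u unfolding inner_unitary_def by simp
    then show ?thesis using that by (auto simp: mmult_def madj_def mid_def)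
  qed
  have sq: "(\<lambda>k. (cmod (u k l))\<^sup>2) summable_on UNIV" if "l \<in> T3_idx (J \<times> UNIV)" for l
  proof -
    have "(\<lambda>k. cnj (u k l) * u k l) summable_on UNIV"
      using val[OF that, of l] infsum_not_exists[of "\<lambda>k. cnj (u k l) * u k l" UNIV] by fastforce
    then have "(\<lambda>k. Re (cnj (u k l) * u k l)) summable_on UNIV" by (rule summable_on_Re)
    moreover have "Re (cnj (u k l) * u k l) = (cmod (u k l))\<^sup>2" for k
      unfolding cmod_power2 by (simp add: power2_eq_square)
    ultimately show ?thesis by simp
  qed
  have "(\<lambda>k. norm ((cmod (u k l))\<^sup>2 + (cmod (u k l'))\<^sup>2)) summable_on UNIV"
    using summable_on_add[OF sq[OF l] sq[OF l']] by simp
  then have "(\<lambda>k. norm (cnj (u k l) * u k l')) summable_on UNIV"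
  proof (rule Infinite_Sum.abs_summable_on_comparison_test)
    fix k
    have "2 * (cmod (u k l) * cmod (u k l')) \<le> (cmod (u k l))\<^sup>2 + (cmod (u k l'))\<^sup>2"
      using sum_squares_bound[of "cmod (u k l)" "cmod (u k l')"] by simp
    then have "cmod (u k l) * cmod (u k l') \<le> (cmod (u k l))\<^sup>2 + (cmod (u k l'))\<^sup>2"
      using mult_nonneg_nonneg[OF norm_ge_zero norm_ge_zero, of "u k l" "u k l'"] by linarith
    then show "norm (cnj (u k l) * u k l') \<le> norm ((cmod (u k l))\<^sup>2 + (cmod (u k l'))\<^sup>2)"
      by (simp add: norm_mult)
  qed
  then have "(\<lambda>k. cnj (u k l) * u k l') summable_on UNIV" by (rule abs_summable_summable)
  from has_sum_infsum[OF this] show ?thesis unfolding val[OF l] .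
qed

text \<open>The vectors obtained from those of \<open>\<psi>\<close> by \<open>u\<close> decompose
  \<open>\<psi>'\<close> as well. The equivalence speaks of \<open>T3 {()}\<close> only, but the
  lower matrix units are adjoints of upper ones; once the infinite sums are reduced to a finite
  corner, \<open>class_unique\<close> compares the two decompositions.\<close>

lemma V_eq_same_class:
  assumes J: "finite J" and eq: "(\<psi>, \<psi>') \<in> V_eq J" and \<psi>: "\<psi> \<in> vclass J m" and \<psi>': "\<psi>' \<in> vclass J m'"
  shows "m = m'"
proof -
  obtain u where u: "inner_unitary J u" and conj: "\<And>x. x \<in> T3 {()} \<Longrightarrow> \<psi>' x = mmult (mmult u (\<psi> x)) (madj u)"
    using eq unfolding V_eq_def by blast
  obtain n where n: "has_class {()} (J \<times> {..<n}) \<psi> m" "has_class {()} (J \<times> {..<n}) \<psi>' m'"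
    using vclass_common[OF J \<psi> \<psi>'] by blast
  let ?K = "T3_idx (J \<times> {..<n})"
  have fK: "finite ?K" and f1: "finite {()}" using J by auto
  have subK: "?K \<subseteq> T3_idx (J \<times> UNIV)" by (auto simp: T3_idx_def)
  obtain v \<sigma> r where v: "block_rep {()} (J \<times> {..<n}) \<psi> {..<r::nat} v \<sigma>" and m: "m = image_mset \<sigma> (mset_set {..<r})"
    using n(1) by (rule has_classE)
  obtain w \<tau> q where w: "block_rep {()} (J \<times> {..<n}) \<psi>' {..<q::nat} w \<tau>" and m': "m' = image_mset \<tau> (mset_set {..<q})"
    using n(2) by (rule has_classE)
  define v' where "v' s i k = (\<Sum>l\<in>?K. u k l * v s l (i, ()))" for s i k
  have i: "(i, ()) \<in> T3_idx {()}" if "i \<in> {1..3}" for i using that by (simp add: T3_idx_def)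
  have eq0: "\<psi>' (munit (i, ()) (j, ())) k l = (\<Sum>s<r. v' s i k * cnj (v' s j l))"
    if ij: "i \<in> {1..3}" "j \<in> {1..3}" "i \<le> j" for i j k l
  proof -
    have mu: "munit (i, ()) (j, ()) \<in> fin_mat (T3_idx {()})" using i ij by (intro munit_in_fin_mat)
    moreover have "munit (i, ()) (j, ()) \<in> T3 {()}" unfolding T3_def using mu ij(3) by (auto simp: munit_def)
    ultimately have "\<psi>' (munit (i, ()) (j, ())) = sandwich ?K u (\<psi> (munit (i, ()) (j, ())))"
      using conj mmult_mmult_madj_fin[OF fK block_rep_fin_mat[OF f1 _ v mu]] J by simp
    then have "\<psi>' (munit (i, ()) (j, ())) k l = sandwich ?K u (\<psi> (munit (i, ()) (j, ()))) k l" by simp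
    also have "\<dots> = (\<Sum>p\<in>?K. \<Sum>p'\<in>?K. \<Sum>s<r. u k p * v s p (i, ()) * cnj (u l p' * v s p' (j, ())))"
      unfolding sandwich_def block_rep_munit[OF f1 v i i, OF ij(1,2)]
      by (simp add: sum_distrib_left sum_distrib_right mult_ac)
    also have "\<dots> = (\<Sum>p\<in>?K. \<Sum>s<r. \<Sum>p'\<in>?K. u k p * v s p (i, ()) * cnj (u l p' * v s p' (j, ())))"
      by (rule sum.cong[OF refl], rule sum.swap)
    also have "\<dots> = (\<Sum>s<r. \<Sum>p\<in>?K. \<Sum>p'\<in>?K. u k p * v s p (i, ()) * cnj (u l p' * v s p' (j, ())))"
      by (rule sum.swap)
    also have "\<dots> = (\<Sum>s<r. v' s i k * cnj (v' s j l))"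
      unfolding v'_def cnj_sum sum_product ..
    finally show ?thesis .
  qed
  have eq: "(\<Sum>s<r. v' s i k * cnj (v' s j l)) = (\<Sum>t<q. w t k (i, ()) * cnj (w t l (j, ())))"
    if ij: "i \<in> {1..3}" "j \<in> {1..3}" for i j k l
  proof (cases "i \<le> j")
    case True
    show ?thesis using eq0[OF ij True, of k l] block_rep_munit[OF f1 w i i, OF ij, of k l] by simp
  next
    case False
    then have "(\<Sum>s<r. v' s j l * cnj (v' s i k)) = (\<Sum>t<q. w t l (j, ()) * cnj (w t k (i, ())))"
      using eq0[OF ij(2,1), of l k] block_rep_munit[OF f1 w i i, OF ij(2,1), of l k] by simp
    from arg_cong[OF this, of cnj] show ?thesis by (simp add: mult.commute)
  qed
  \<comment> \<open>Outside the corner the diagonal entry of the image of a diagonal unit is 0, and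
    in terms of \<open>v'\<close> it is a sum of squared moduli.\<close>
  have supp: "v' s i k = 0" if "s < r" "i \<in> {1..3}" "k \<notin> ?K" for s i k
  proof -
    have w0: "w t k (i, ()) = 0" if "t < q" for t using block_repD(2)[OF w, of t k "(i, ())"] that \<open>k \<notin> ?K\<close> by auto
    have "complex_of_real (\<Sum>s<r. (cmod (v' s i k))\<^sup>2) = (\<Sum>s<r. v' s i k * cnj (v' s i k))"
      unfolding of_real_sum complex_norm_square ..
    also have "\<dots> = 0" unfolding eq[OF that(2) that(2)] by (simp add: w0)
    finally have "(\<Sum>s<r. (cmod (v' s i k))\<^sup>2) = 0" by (simp only: of_real_eq_0_iff)
    then show ?thesis using that(1) by (subst (asm) sum_nonneg_eq_0_iff) auto
  qed
  \<comment> \<open>Unitarity of \<open>u\<close> evaluates the sum over all rows; by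
    \<open>supp\<close> it is the sum over \<open>?K\<close>.\<close>
  have on: "(\<Sum>k\<in>?K. cnj (v' s i k) * v' t j k) = of_bool (s = t) * of_bool (i = j)"
    if st: "s < r" "t < r" and ij: "i \<in> {1..3}" "j \<in> {1..3}" for s t i j
  proof -
    let ?c = "\<lambda>l l'. cnj (v s l (i, ())) * v t l' (j, ())"
    have "((\<lambda>k. \<Sum>l\<in>?K. \<Sum>l'\<in>?K. ?c l l' * (cnj (u k l) * u k l')) has_sum
        (\<Sum>l\<in>?K. \<Sum>l'\<in>?K. ?c l l' * of_bool (l = l'))) UNIV"
      using subK by (intro has_sum_finite_sum fK has_sum_cmult_right inner_unitary_has_sum[OF u]) auto
    moreover have "(\<Sum>l\<in>?K. \<Sum>l'\<in>?K. ?c l l' * (cnj (u k l) * u k l')) = cnj (v' s i k) * v' t j k" for k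
      unfolding v'_def cnj_sum sum_product by (simp add: mult_ac)
    moreover have "(\<Sum>l\<in>?K. \<Sum>l'\<in>?K. ?c l l' * of_bool (l = l')) = of_bool (s = t) * of_bool (i = j)"
    proof -
      have "(\<Sum>l\<in>?K. \<Sum>l'\<in>?K. ?c l l' * of_bool (l = l')) = (\<Sum>l\<in>?K. ?c l l)"
        by (intro sum.cong[OF refl]) (subst eq_commute, rule sum_unit_vector[OF fK])
      then show ?thesis using block_repD(3)[OF v, of s t "(i, ())" "(j, ())"] st i ij by simp
    qed
    ultimately have "((\<lambda>k. cnj (v' s i k) * v' t j k) has_sum (of_bool (s = t) * of_bool (i = j))) UNIV" by simp
    moreover have "((\<lambda>k. cnj (v' s i k) * v' t j k) has_sum (\<Sum>k\<in>?K. cnj (v' s i k) * v' t j k)) UNIV"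
    proof (subst has_sum_cong_neutral[of ?K UNIV "\<lambda>k. cnj (v' s i k) * v' t j k" "\<lambda>k. cnj (v' s i k) * v' t j k"])
      show "((\<lambda>k. cnj (v' s i k) * v' t j k) has_sum (\<Sum>k\<in>?K. cnj (v' s i k) * v' t j k)) ?K"
        using fK by (rule has_sum_finite)
    qed (use supp[OF st(1) ij(1)] in auto)
    ultimately show ?thesis by (rule has_sum_unique[symmetric])
  qed
  show ?thesis unfolding m m'
  proof (rule class_unique[of _ _ ?K v' "\<lambda>s i k. w s k (i, ())" fst])
    show "orthonormal_on ?K (\<lambda>(s, i). v' s i) ({..<r} \<times> {1..3})"
      unfolding orthonormal_on_def using on by auto
    show "orthonormal_on ?K (\<lambda>(s, i) k. w s k (i, ())) ({..<q} \<times> {1..3})"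
      unfolding orthonormal_on_def using block_repD(3)[OF w _ _ i i] by auto
    show "fst k = omap_apply (\<sigma> s) i" if s: "s \<in> {..<r}" and nz: "v' s i k \<noteq> 0" for s i k
    proof -
      obtain l where "u k l * v s l (i, ()) \<noteq> 0"
        using nz unfolding v'_def by (rule sum.not_neutral_contains_not_neutral)
      then show ?thesis using inner_unitary_block(1)[OF u, of k l] block_repD(2)[OF v s, of l "(i, ())"] by auto
    qed
    show "fst k = omap_apply (\<tau> s) i" if "s \<in> {..<q}" "w s k (i, ()) \<noteq> 0" for s i k
      using block_repD(2)[OF w that] by simp
  qed (use fK eq in auto)
qed

text \<open>For maps of the same class the block unitary is found in a common finite corner and
  continued by the identity to an inner unitary.\<close>

lemma V_eq_iff:
  assumes J: "finite J"
  shows "(\<psi>, \<psi>') \<in> V_eq J \<longleftrightarrow> (\<exists>m. \<psi> \<in> vclass J m \<and> \<psi>' \<in> vclass J m)"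
proof
  assume eq: "(\<psi>, \<psi>') \<in> V_eq J"
  then have "\<psi> \<in> V_maps J" "\<psi>' \<in> V_maps J" by (auto simp: V_eq_def)
  then obtain m m' where "\<psi> \<in> vclass J m" "\<psi>' \<in> vclass J m'" unfolding V_maps_eq[OF J] by blast
  then show "\<exists>m. \<psi> \<in> vclass J m \<and> \<psi>' \<in> vclass J m" using V_eq_same_class[OF J eq] by blast
next
  assume "\<exists>m. \<psi> \<in> vclass J m \<and> \<psi>' \<in> vclass J m"
  then obtain m where m: "\<psi> \<in> vclass J m" "\<psi>' \<in> vclass J m" by blast
  obtain n where n: "has_class {()} (J \<times> {..<n}) \<psi> m" "has_class {()} (J \<times> {..<n}) \<psi>' m"
    using vclass_common[OF J m] by blast
  have fin: "finite {()}" "finite (J \<times> {..<n})" using J by auto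
  obtain u where u: "block_unitary (J \<times> {..<n}) u"
    "\<And>x. x \<in> fin_mat (T3_idx {()}) \<Longrightarrow> \<psi>' x = sandwich (T3_idx (J \<times> {..<n})) u (\<psi> x)"
    using has_class_unitary[OF fin n] by blast
  define U where "U k l = mid (T3_idx (J \<times> UNIV)) k l + (u k l - mid (T3_idx (J \<times> {..<n})) k l)" for k l
  have U: "inner_unitary J U" "\<And>y. y \<in> fin_mat (T3_idx (J \<times> {..<n})) \<Longrightarrow>
    sandwich (T3_idx (J \<times> {..<n})) U y = sandwich (T3_idx (J \<times> {..<n})) u y"
    unfolding U_def using inner_unitary_extend[OF J u(1)] by auto
  have "\<psi>' x = mmult (mmult U (\<psi> x)) (madj U)" if "x \<in> T3 {()}" for x
  proof -
    have x: "x \<in> fin_mat (T3_idx {()})" using that by (simp add: T3_def)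
    have y: "\<psi> x \<in> fin_mat (T3_idx (J \<times> {..<n}))" by (rule has_class_fin_mat[OF fin n(1) x])
    show ?thesis unfolding mmult_mmult_madj_fin[OF finite_T3_idx[OF fin(2)] y] U(2)[OF y] u(2)[OF x] ..
  qed
  then show "(\<psi>, \<psi>') \<in> V_eq J" using U(1) m unfolding V_eq_def V_maps_eq[OF J] by blast
qed

lemma V_eq_class: "finite J \<Longrightarrow> \<psi> \<in> vclass J m \<Longrightarrow> V_eq J `` {\<psi>} = vclass J m"
  by (auto simp: V_eq_iff dest: vclass_unique)

text \<open>Together with \<open>vclass_inject\<close> this identifies \<open>V J\<close> with the
  free commutative semigroup on \<open>omap\<close>; it does not depend on the size of
  \<open>J\<close>.\<close>

lemma V_eq_range:
  assumes "finite J" "J \<noteq> {}"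
  shows "V J = range (vclass J)"
proof -
  have "V J = (\<lambda>\<psi>. V_eq J `` {\<psi>}) ` (\<Union>m. vclass J m)"
    unfolding V_def quotient_def V_maps_eq[OF assms(1)] by blast
  also have "\<dots> = range (vclass J)"
    using V_eq_class[OF assms(1)] vclass_nonempty[OF assms] by (auto simp: image_iff) (metis ex_in_conv)
  finally show ?thesis .
qed

lemma vclass_inject:
  assumes "finite J" "J \<noteq> {}"
  shows "vclass J m = vclass J m' \<longleftrightarrow> m = m'"
  using vclass_nonempty[OF assms] vclass_unique[OF assms(1)] by blast

section \<open>Addition, action, induced maps and scale in terms of multisets\<close>

lemma relocate_apply:
  assumes "inj \<rho>" "y \<in> fin_mat (T3_idx K)"
  shows "relocate \<rho> K y (s, \<rho> a) (t, \<rho> b) = y (s, a) (t, b)"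
  using assms inj_image_mem_iff[OF assms(1), of _ K] fin_mat_outside[OF assms(2)]
  by (auto simp: relocate_def inv_into_f_f inj_on_subset[OF assms(1)] mem_T3_idx)

lemma relocate_outside: "snd k \<notin> range \<rho> \<or> snd l \<notin> range \<rho> \<Longrightarrow> relocate \<rho> K y k l = 0"
  by (auto simp: relocate_def)

lemma bounded_second:
  assumes "finite X" "X \<subseteq> J \<times> UNIV"
  shows "\<exists>N::nat. X \<subseteq> J \<times> {..<N}"
proof -
  have "finite (snd ` X)" using assms by simp
  then obtain N where "\<And>p. p \<in> snd ` X \<Longrightarrow> p < N" by (auto simp: finite_nat_set_iff_bounded)
  then show ?thesis using assms(2) by (intro exI[of _ N]) force
qed

lemma vclassI:
  assumes "finite J" "has_class {()} X \<psi> m" "finite X" "X \<subseteq> J \<times> UNIV"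
  shows "\<psi> \<in> vclass J m"
proof -
  obtain N where "X \<subseteq> J \<times> {..<N}" using bounded_second[OF assms(3,4)] by blast
  then have "has_class {()} (J \<times> {..<N}) \<psi> m" using has_class_mono[OF assms(2)] assms(1) by simp
  then show ?thesis by (auto simp: vclass_def)
qed

text \<open>The two ranges of \<open>sum_encode\<close> receive the two summands, so
  \<open>\<rho>\<close> and \<open>\<rho>'\<close> have disjoint images and the direct sum is an
  internal sum.\<close>

lemma V_dsum_vclass:
  assumes J: "finite J" and \<phi>: "\<phi> \<in> vclass J m" and \<psi>: "\<psi> \<in> vclass J m'"
  shows "V_dsum \<phi> \<psi> \<in> vclass J (m + m')"
proof -
  obtain n where n: "has_class {()} (J \<times> {..<n}) \<phi> m" "has_class {()} (J \<times> {..<n}) \<psi> m'"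
    using vclass_common[OF J \<phi> \<psi>] by blast
  let ?K = "J \<times> {..<n}"
  define \<rho> :: "'a \<times> nat \<Rightarrow> 'a \<times> nat" where "\<rho> = (\<lambda>(b, p). (b, sum_encode (Inl p)))"
  define \<rho>' :: "'a \<times> nat \<Rightarrow> 'a \<times> nat" where "\<rho>' = (\<lambda>(b, p). (b, sum_encode (Inr p)))"
  have inj: "inj \<rho>" "inj \<rho>'" by (auto simp: inj_on_def \<rho>_def \<rho>'_def sum_encode_eq)
  have cl: "has_class {()} (\<rho> ` ?K \<union> \<rho>' ` ?K) (\<lambda>x k l. relocate \<rho> ?K (\<phi> x) k l + relocate \<rho>' ?K (\<psi> x) k l) (m + m')"
  proof (rule has_class_add)
    show "has_class {()} (\<rho> ` ?K) (\<lambda>x. relocate \<rho> ?K (\<phi> x)) m"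
      by (rule has_class_relocate[OF n(1) inj_on_subset[OF inj(1)]]) simp
    show "has_class {()} (\<rho>' ` ?K) (\<lambda>x. relocate \<rho>' ?K (\<psi> x)) m'"
      by (rule has_class_relocate[OF n(2) inj_on_subset[OF inj(2)]]) simp
  qed (use J in \<open>auto simp: \<rho>_def \<rho>'_def sum_encode_eq\<close>)
  have "V_dsum \<phi> \<psi> x = (\<lambda>k l. relocate \<rho> ?K (\<phi> x) k l + relocate \<rho>' ?K (\<psi> x) k l)" if x: "x \<in> fin_mat (T3_idx {()})" for x
  proof (intro ext)
    fix k l :: "nat \<times> 'a \<times> nat"
    have fin: "\<phi> x \<in> fin_mat (T3_idx ?K)" "\<psi> x \<in> fin_mat (T3_idx ?K)"
      using J by (auto intro: has_class_fin_mat[OF _ _ n(1) x] has_class_fin_mat[OF _ _ n(2) x])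
    obtain s a p where k: "k = (s, a, sum_encode p)" by (metis surj_pair sum_decode_inverse)
    obtain t b q where l: "l = (t, b, sum_encode q)" by (metis surj_pair sum_decode_inverse)
    have r: "relocate \<rho> ?K (\<phi> x) (s, a, sum_encode (Inl p')) (t, b, sum_encode (Inl q')) = \<phi> x (s, a, p') (t, b, q')" for p' q'
      using relocate_apply[OF inj(1) fin(1), of s "(a, p')" t "(b, q')"] by (simp add: \<rho>_def)
    have r': "relocate \<rho>' ?K (\<psi> x) (s, a, sum_encode (Inr p')) (t, b, sum_encode (Inr q')) = \<psi> x (s, a, p') (t, b, q')" for p' q'
      using relocate_apply[OF inj(2) fin(2), of s "(a, p')" t "(b, q')"] by (simp add: \<rho>'_def)
    have z: "relocate \<rho> ?K (\<phi> x) k l = 0" if "(\<exists>p'. p = Inr p') \<or> (\<exists>q'. q = Inr q')"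
      by (rule relocate_outside) (use that k l in \<open>auto simp: \<rho>_def sum_encode_eq\<close>)
    have z': "relocate \<rho>' ?K (\<psi> x) k l = 0" if "(\<exists>p'. p = Inl p') \<or> (\<exists>q'. q = Inl q')"
      by (rule relocate_outside) (use that k l in \<open>auto simp: \<rho>'_def sum_encode_eq\<close>)
    show "V_dsum \<phi> \<psi> x k l = relocate \<rho> ?K (\<phi> x) k l + relocate \<rho>' ?K (\<psi> x) k l"
      using z z' by (cases p; cases q) (simp_all add: V_dsum_def k l r r')
  qed
  then have "has_class {()} (\<rho> ` ?K \<union> \<rho>' ` ?K) (V_dsum \<phi> \<psi>) (m + m')" by (rule has_class_cong[OF cl])
  then show ?thesis by (rule vclassI[OF J]) (use J in \<open>auto simp: \<rho>_def \<rho>'_def\<close>)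
qed

text \<open>The composite passes through \<open>(J \<times> {..<n}) \<times> {..<q}\<close>, where
  \<open>amp \<psi>\<close> still has class \<open>m\<close>; afterwards \<open>\<rho>\<close>
  merges the two matrix factors by \<open>prod_encode\<close>.\<close>

lemma V_comp_vclass:
  assumes J: "finite J" and \<psi>: "\<psi> \<in> vclass J m" and \<theta>: "\<theta> \<in> vclass {()} a"
  shows "V_comp \<psi> \<theta> \<in> vclass J (mprod m a)"
proof -
  obtain n where n: "has_class {()} (J \<times> {..<n}) \<psi> m" using \<psi> by (auto simp: vclass_def)
  obtain q where q: "has_class {()} ({()} \<times> {..<q}) \<theta> a" using \<theta> by (auto simp: vclass_def)
  let ?K = "(J \<times> {..<n}) \<times> {..<q}"
  define \<rho> :: "('a \<times> nat) \<times> nat \<Rightarrow> 'a \<times> nat" where "\<rho> = (\<lambda>((b, p), q). (b, prod_encode (p, q)))"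
  have inj: "inj \<rho>" by (auto simp: inj_on_def \<rho>_def)
  have amp: "has_class ({()} \<times> {..<q}) ?K (amp \<psi>) m" using J by (intro has_class_amp[OF _ _ _ n]) auto
  have comp: "has_class {()} ?K (amp \<psi> \<circ> \<theta>) (mprod m a)"
    using J by (intro has_class_comp[OF _ _ _ q amp]) auto
  have cl: "has_class {()} (\<rho> ` ?K) (\<lambda>x. relocate \<rho> ?K ((amp \<psi> \<circ> \<theta>) x)) (mprod m a)"
    by (rule has_class_relocate[OF comp inj_on_subset[OF inj]]) simp
  have "V_comp \<psi> \<theta> x = relocate \<rho> ?K ((amp \<psi> \<circ> \<theta>) x)" if x: "x \<in> fin_mat (T3_idx {()})" for x
  proof (intro ext)
    fix k l :: "nat \<times> 'a \<times> nat"
    have fin: "(amp \<psi> \<circ> \<theta>) x \<in> fin_mat (T3_idx ?K)"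
      by (rule has_class_fin_mat[OF _ _ comp x]) (use J in auto)
    obtain s b p p' where k: "k = (s, b, prod_encode (p, p'))" by (metis surj_pair prod_decode_inverse)
    obtain t d r r' where l: "l = (t, d, prod_encode (r, r'))" by (metis surj_pair prod_decode_inverse)
    show "V_comp \<psi> \<theta> x k l = relocate \<rho> ?K ((amp \<psi> \<circ> \<theta>) x) k l"
      using relocate_apply[OF inj fin, of s "((b, p), p')" t "((d, r), r')"]
      by (simp add: V_comp_def k l \<rho>_def)
  qed
  then have "has_class {()} (\<rho> ` ?K) (V_comp \<psi> \<theta>) (mprod m a)" by (rule has_class_cong[OF cl])
  then show ?thesis by (rule vclassI[OF J]) (use J in \<open>auto simp: \<rho>_def\<close>)
qed

lemma V_hat_comp_vclass:
  assumes J: "finite J" and J': "finite J'" and f: "has_class J J' f c" and \<psi>: "\<psi> \<in> vclass J m"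
  shows "amp f \<circ> \<psi> \<in> vclass J' (mprod c m)"
proof -
  obtain n where n: "has_class {()} (J \<times> {..<n}) \<psi> m" using \<psi> by (auto simp: vclass_def)
  have "has_class (J \<times> {..<n}) (J' \<times> {..<n}) (amp f) c" by (rule has_class_amp[OF J J' _ f]) simp
  then have "has_class {()} (J' \<times> {..<n}) (amp f \<circ> \<psi>) (mprod c m)"
    using J J' by (intro has_class_comp[OF _ _ _ n]) auto
  then show ?thesis unfolding vclass_def by blast
qed

text \<open>The operations on classes are unions over representatives; this evaluates such a union
  once the outcome is known to be independent of the choice.\<close>

lemma UN_const_eq: "X \<noteq> {} \<Longrightarrow> (\<And>x. x \<in> X \<Longrightarrow> F x = C) \<Longrightarrow> (\<Union>x\<in>X. F x) = C"
  by auto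

context
  fixes J :: "'j set"
  assumes J: "finite J" "J \<noteq> {}"
begin

lemma V_add_vclass: "V_add J (vclass J m) (vclass J m') = vclass J (m + m')"
  unfolding V_add_def
  by (intro UN_const_eq vclass_nonempty V_eq_class V_dsum_vclass J)

lemma V_act_vclass: "V_act J (vclass J m) (vclass {()} a) = vclass J (mprod m a)"
  unfolding V_act_def
  by (intro UN_const_eq vclass_nonempty V_eq_class V_comp_vclass J) auto

lemma V_hat_vclass:
  assumes "finite J'" "has_class J J' f c"
  shows "V_hat J' f (vclass J m) = vclass J' (mprod c m)"
  unfolding V_hat_def
  by (intro UN_const_eq vclass_nonempty V_eq_class V_hat_comp_vclass[OF J(1)] J assms)

text \<open>In the scale only one copy of \<open>J\<close> is available, so by
  \<open>has_class_size\<close> and \<open>has_class_exists\<close> the sole restriction is that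
  each block has room for its weight.\<close>

lemma V_scale_eq: "V_scale J = {vclass J m | m. \<forall>t\<in>{1..3}. wt t m \<le> card J}"
proof (intro equalityI subsetI)
  have J0: "finite (J \<times> {0::nat})" "J \<times> {0} \<subseteq> J \<times> UNIV" "card (J \<times> {0::nat}) = card J" using J by auto
  {
    fix X assume "X \<in> V_scale J"
    then obtain \<psi> where \<psi>: "X = V_eq J `` {\<psi>}" "regular {()} (J \<times> {0}) \<psi>" by (auto simp: V_scale_def)
    then obtain m where m: "has_class {()} (J \<times> {0}) \<psi> m" using regular_has_class[of "{()}" "J \<times> {0}" \<psi>] J0 by auto
    have "wt t m \<le> card J" for t using has_class_size[OF _ J0(1) m, of t] J0(3) by simp
    moreover have "X = vclass J m" unfolding \<psi> by (intro V_eq_class vclassI[OF _ m] J J0)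
    ultimately show "X \<in> {vclass J m | m. \<forall>t\<in>{1..3}. wt t m \<le> card J}" by blast
  next
    fix X assume "X \<in> {vclass J m | m. \<forall>t\<in>{1..3}. wt t m \<le> card J}"
    then obtain m where m: "X = vclass J m" "\<And>t. t \<in> {1..3} \<Longrightarrow> wt t m \<le> card J" by blast
    have "\<exists>\<psi>. has_class {()} (J \<times> {0::nat}) \<psi> m"
      by (rule has_class_exists) (use m(2) J0 in auto)
    then obtain \<psi> where \<psi>: "has_class {()} (J \<times> {0::nat}) \<psi> m" by blast
    have "X = V_eq J `` {\<psi>}" unfolding m by (intro V_eq_class[symmetric] vclassI[OF _ \<psi>] J J0)
    then show "X \<in> V_scale J" using has_class_regular[OF _ J0(1) \<psi>] by (auto simp: V_scale_def)
  }
qed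

end

section \<open>Limits of multiset semigroups\<close>

lemma conn_add: "conn h k (d + d') x = conn h (k + d) d' (conn h k d x)"
  by (induction d') (simp_all add: add.assoc)

text \<open>The product \<open>c (p - 1) ... c k\<close>, the multiset of the connecting map from
  level \<open>k\<close> to level \<open>p\<close>.\<close>

definition compose_from :: "(nat \<Rightarrow> omap multiset) \<Rightarrow> nat \<Rightarrow> nat \<Rightarrow> omap multiset" where
  "compose_from c k p = conn (\<lambda>j. mprod (c j)) k (p - k) {#1#}"

lemma compose_from_refl [simp]: "compose_from c k k = {#1#}"
  by (simp add: compose_from_def)

lemma compose_from_Suc: "k \<le> p \<Longrightarrow> compose_from c k (Suc p) = mprod (c p) (compose_from c k p)"
  by (simp add: compose_from_def Suc_diff_le)

lemma compose_from_trans: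
  assumes "k \<le> p" "p \<le> q"
  shows "mprod (compose_from c p q) (compose_from c k p) = compose_from c k q"
  using assms(2)
proof (induction q rule: dec_induct)
  case (step q)
  then show ?case using assms(1) by (simp add: compose_from_Suc mprod_assoc)
qed simp

lemma compose_from_size:
  assumes "\<And>j t. N j * wt t (c j) \<le> N (Suc j)" "k \<le> p" "t \<in> {1..3}"
  shows "N k * wt t (compose_from c k p) \<le> N p"
  using assms(2,3)
proof (induction p arbitrary: t rule: dec_induct)
  case base
  then show ?case using wt_repeat_one[of t 1] by simp
next
  case (step p)
  have "N k * wt t (mprod (c p) (compose_from c k p)) \<le> N p * wt t (c p)"
    by (rule wt_mprod_le) (use step in auto)
  also have "\<dots> \<le> N (Suc p)" by (rule assms(1))
  finally show ?case using step by (simp add: compose_from_Suc)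
qed

definition lim_rel :: "(nat \<Rightarrow> omap multiset) \<Rightarrow> nat \<Rightarrow> omap multiset \<Rightarrow> nat \<Rightarrow> omap multiset \<Rightarrow> bool" where
  "lim_rel c k m l m' \<longleftrightarrow> (\<exists>p. k \<le> p \<and> l \<le> p \<and> mprod (compose_from c k p) m = mprod (compose_from c l p) m')"

lemma lim_rel_later:
  assumes "mprod (compose_from c k p) m = mprod (compose_from c l p) m'" "k \<le> p" "l \<le> p" "p \<le> q"
  shows "mprod (compose_from c k q) m = mprod (compose_from c l q) m'"
  using arg_cong[OF assms(1), of "mprod (compose_from c p q)"] assms(2-)
  by (simp add: mprod_assoc[symmetric] compose_from_trans)

lemma lim_rel_refl: "lim_rel c k m k m"
  unfolding lim_rel_def by blast

lemma lim_rel_sym: "lim_rel c k m l m' \<Longrightarrow> lim_rel c l m' k m"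
  unfolding lim_rel_def by metis

lemma lim_rel_trans:
  assumes "lim_rel c k m l m'" "lim_rel c l m' r m''"
  shows "lim_rel c k m r m''"
proof -
  obtain p where p: "k \<le> p" "l \<le> p" "mprod (compose_from c k p) m = mprod (compose_from c l p) m'"
    using assms(1) unfolding lim_rel_def by blast
  obtain q where q: "l \<le> q" "r \<le> q" "mprod (compose_from c l q) m' = mprod (compose_from c r q) m''"
    using assms(2) unfolding lim_rel_def by blast
  have "mprod (compose_from c k (max p q)) m = mprod (compose_from c r (max p q)) m''"
    using lim_rel_later[OF p(3,1,2), of "max p q"] lim_rel_later[OF q(3,1,2), of "max p q"] by simp
  then show ?thesis unfolding lim_rel_def using p q by (intro exI[of _ "max p q"]) auto
qed

lemma lim_rel_push: "k \<le> p \<Longrightarrow> lim_rel c k m p (mprod (compose_from c k p) m)"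
  unfolding lim_rel_def by (intro exI[of _ p]) simp

lemma lim_rel_act: "lim_rel c k m l m' \<Longrightarrow> lim_rel c k (mprod m a) l (mprod m' a)"
  unfolding lim_rel_def by (metis mprod_assoc)

lemma lim_rel_add:
  assumes "lim_rel c k m l m'" "lim_rel c k a l a'"
  shows "lim_rel c k (m + a) l (m' + a')"
proof -
  obtain p where p: "k \<le> p" "l \<le> p" "mprod (compose_from c k p) m = mprod (compose_from c l p) m'"
    using assms(1) unfolding lim_rel_def by blast
  obtain q where q: "k \<le> q" "l \<le> q" "mprod (compose_from c k q) a = mprod (compose_from c l q) a'"
    using assms(2) unfolding lim_rel_def by blast
  have "mprod (compose_from c k (max p q)) m = mprod (compose_from c l (max p q)) m'"
    "mprod (compose_from c k (max p q)) a = mprod (compose_from c l (max p q)) a'"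
    using lim_rel_later[OF p(3,1,2), of "max p q"] lim_rel_later[OF q(3,1,2), of "max p q"] by auto
  then show ?thesis unfolding lim_rel_def using p by (intro exI[of _ "max p q"]) (auto simp: mprod_add_right)
qed

text \<open>All that is used later about \<open>V_lim\<close>: \<open>G k m\<close> is the element
  represented by \<open>m\<close> at level \<open>k\<close>, and \<open>N k\<close> is the size of
  that level. With an abstract carrier type the quotients disappear from view.\<close>

locale multiset_limit =
  fixes M :: "'x dim_module" and c :: "nat \<Rightarrow> omap multiset" and N :: "nat \<Rightarrow> nat"
    and G :: "nat \<Rightarrow> omap multiset \<Rightarrow> 'x"
  assumes carrier: "dm_carrier M = {G k m | k m. True}"
    and G_eq: "G k m = G l m' \<longleftrightarrow> lim_rel c k m l m'"
    and G_add: "dm_add M (G k m) (G k m') = G k (m + m')"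
    and G_act: "dm_act M (G k m) (vclass {()} a) = G k (mprod m a)"
    and G_scale: "dm_scale M = {G k m | k m. \<forall>t\<in>{1..3}. wt t m \<le> N k}"
    and size: "N k * wt t (c k) \<le> N (Suc k)"
    and pos: "N k \<ge> 1"
begin

lemma G_push: "k \<le> p \<Longrightarrow> G p (mprod (compose_from c k p) m) = G k m"
  unfolding G_eq by (rule lim_rel_sym[OF lim_rel_push])

lemma size_from: "k \<le> p \<Longrightarrow> t \<in> {1..3} \<Longrightarrow> N k * wt t (compose_from c k p) \<le> N p"
  by (rule compose_from_size[where N = N]) (rule size)

end

text \<open>Under \<open>vclass\<close> the connecting maps become left multiplication by
  \<open>c k\<close>, so eventual equality in \<open>dl_eq\<close> is \<open>lim_rel\<close>; sums
  are evaluated after moving both representatives to a common level.\<close>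

lemma V_lim_multiset_limit:
  fixes n :: "nat \<Rightarrow> nat"
  assumes n: "\<And>k. n k \<ge> 1" and c: "\<And>k. has_class {..<n k} {..<n (Suc k)} (\<phi> k) (c k)"
  shows "\<exists>G. multiset_limit (V_lim n \<phi>) c n G"
proof -
  define J where "J k = {..<n k}" for k
  have J: "finite (J k)" "J k \<noteq> {}" for k using n[of k] by (auto simp: J_def lessThan_empty_iff)
  define h where "h k = V_hat (J (Suc k)) (\<phi> k)" for k
  define E where "E = dl_eq (\<lambda>k. V (J k)) h"
  define G where "G k m = E `` {(k, vclass (J k) m)}" for k m
  have hat: "h k (vclass (J k) m) = vclass (J (Suc k)) (mprod (c k) m)" for k m
    unfolding h_def using c J by (intro V_hat_vclass) (auto simp: J_def)
  have conn: "conn h k (p - k) (vclass (J k) m) = vclass (J p) (mprod (compose_from c k p) m)" if "k \<le> p" for k p m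
    using that
  proof (induction p rule: dec_induct)
    case (step p)
    then show ?case by (simp add: Suc_diff_le hat compose_from_Suc mprod_assoc)
  qed simp
  have Vm: "vclass (J k) m \<in> V (J k)" for k m using V_eq_range[OF J] by blast
  have E_iff: "((k, vclass (J k) m), (l, vclass (J l) m')) \<in> E \<longleftrightarrow> lim_rel c k m l m'" for k m l m'
    unfolding E_def dl_eq_def lim_rel_def using Vm
    by (auto simp: conn vclass_inject[OF J]) 
  have E_mem: "\<exists>l m'. y = (l, vclass (J l) m')" if "(x, y) \<in> E" for x y
    using that V_eq_range[OF J] unfolding E_def dl_eq_def by auto
  have G_mem: "y \<in> G k m \<longleftrightarrow> (\<exists>l m'. y = (l, vclass (J l) m') \<and> lim_rel c k m l m')" for y k m
    unfolding G_def Image_singleton_iff using E_mem[of "(k, vclass (J k) m)" y] E_iff by metis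
  have G_eq: "G k m = G l m' \<longleftrightarrow> lim_rel c k m l m'" for k m l m'
  proof
    assume "G k m = G l m'"
    moreover have "(l, vclass (J l) m') \<in> G l m'" unfolding G_mem using lim_rel_refl by blast
    ultimately have "(l, vclass (J l) m') \<in> G k m" by simp
    then show "lim_rel c k m l m'" unfolding G_def using E_iff by auto
  next
    assume "lim_rel c k m l m'"
    then have "lim_rel c k m p a \<longleftrightarrow> lim_rel c l m' p a" for p a by (metis lim_rel_sym lim_rel_trans)
    then show "G k m = G l m'" by (intro set_eqI) (simp only: G_mem)
  qed
  have VL: "dm_carrier (V_lim n \<phi>) = Sigma UNIV (\<lambda>k. V (J k)) // E"
    "dm_add (V_lim n \<phi>) P Q = (\<Union>(k, X)\<in>P. \<Union>(l, Y)\<in>Q.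
       E `` {(max k l, V_add (J (max k l)) (conn h k (max k l - k) X) (conn h l (max k l - l) Y))})"
    "dm_act (V_lim n \<phi>) P \<Theta> = (\<Union>(k, X)\<in>P. E `` {(k, V_act (J k) X \<Theta>)})"
    "dm_scale (V_lim n \<phi>) = {E `` {(k, X)} | k X. X \<in> V_scale (J k)}" for P Q \<Theta>
    unfolding V_lim_def Let_def J_def h_def E_def by simp_all
  have self: "(k, vclass (J k) m) \<in> G k m" for k m unfolding G_mem using lim_rel_refl by blast
  have "multiset_limit (V_lim n \<phi>) c n G"
  proof
    show "dm_carrier (V_lim n \<phi>) = {G k m | k m. True}"
      unfolding VL quotient_def using V_eq_range[OF J] by (auto simp: G_def)
    show "dm_add (V_lim n \<phi>) (G k m) (G k m') = G k (m + m')" for k m m'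
    proof -
      have eq: "E `` {(max l l', V_add (J (max l l')) (conn h l (max l l' - l) X) (conn h l' (max l l' - l') Y))} = G k (m + m')"
        if lX: "(l, X) \<in> G k m" and lY: "(l', Y) \<in> G k m'" for l X l' Y
      proof -
        obtain a where a: "X = vclass (J l) a" "lim_rel c k m l a" using lX unfolding G_mem by blast
        obtain b where b: "Y = vclass (J l') b" "lim_rel c k m' l' b" using lY unfolding G_mem by blast
        let ?p = "max l l'"
        have "lim_rel c k m ?p (mprod (compose_from c l ?p) a)" "lim_rel c k m' ?p (mprod (compose_from c l' ?p) b)"
          using lim_rel_trans[OF a(2) lim_rel_push] lim_rel_trans[OF b(2) lim_rel_push] by auto
        then have "lim_rel c k (m + m') ?p (mprod (compose_from c l ?p) a + mprod (compose_from c l' ?p) b)"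
          by (rule lim_rel_add)
        then show ?thesis unfolding a b
          by (simp add: conn V_add_vclass[OF J] G_def[symmetric] G_eq lim_rel_sym)
      qed
      have "(\<Union>(l, X)\<in>G k m. \<Union>(l', Y)\<in>G k m'. E `` {(max l l', V_add (J (max l l')) (conn h l (max l l' - l) X) (conn h l' (max l l' - l') Y))}) = G k (m + m')"
      proof (intro UN_const_eq)
        show "G k m \<noteq> {}" using self by blast
        fix x assume x: "x \<in> G k m"
        obtain l X where lX: "x = (l, X)" by force
        have "(\<Union>(l', Y)\<in>G k m'. E `` {(max l l', V_add (J (max l l')) (conn h l (max l l' - l) X) (conn h l' (max l l' - l') Y))}) = G k (m + m')"
        proof (intro UN_const_eq)
          show "G k m' \<noteq> {}" using self by blast
          fix y assume y: "y \<in> G k m'"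
          obtain l' Y where "y = (l', Y)" by force
          then show "(case y of (l', Y) \<Rightarrow> E `` {(max l l', V_add (J (max l l')) (conn h l (max l l' - l) X) (conn h l' (max l l' - l') Y))}) = G k (m + m')"
            using eq[of l X l' Y] x y lX by simp
        qed
        then show "(case x of (l, X) \<Rightarrow> \<Union>(l', Y)\<in>G k m'. E `` {(max l l', V_add (J (max l l')) (conn h l (max l l' - l) X) (conn h l' (max l l' - l') Y))}) = G k (m + m')"
          using lX by simp
      qed
      then show ?thesis unfolding VL .
    qed
    show "dm_act (V_lim n \<phi>) (G k m) (vclass {()} a) = G k (mprod m a)" for k m a
    proof -
      have "E `` {(l, V_act (J l) X (vclass {()} a))} = G k (mprod m a)" if lX: "(l, X) \<in> G k m" for l X
      proof -
        obtain m' where m': "X = vclass (J l) m'" "lim_rel c k m l m'" using lX unfolding G_mem by blast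
        then show ?thesis using lim_rel_act[OF m'(2), of a] 
          by (simp add: V_act_vclass[OF J] G_def[symmetric] G_eq lim_rel_sym)
      qed
      then have "(\<Union>(l, X)\<in>G k m. E `` {(l, V_act (J l) X (vclass {()} a))}) = G k (mprod m a)"
        using self by (intro UN_const_eq) (fast, auto)
      then show ?thesis unfolding VL .
    qed
    show "dm_scale (V_lim n \<phi>) = {G k m | k m. \<forall>t\<in>{1..3}. wt t m \<le> n k}"
      unfolding VL V_scale_eq[OF J] G_def by (auto simp: J_def)
    show "n k * wt t (c k) \<le> n (Suc k)" for k t using has_class_size[OF _ _ c[of k], of t] by simp
  qed (use G_eq n in auto)
  then show ?thesis by blast
qed

text \<open>\<open>S k l a\<close> is meant to say that some regular map of class \<open>a\<close>
  from level \<open>k\<close> to level \<open>l\<close> induces a given isomorphism of limits, and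
  \<open>S'\<close> plays this part for the inverse. A relation is used because such maps are not
  unique. Only composition with earlier connecting maps is demanded, and round trips have to agree
  with the identity in the limit.\<close>

locale limit_correspondence = M: multiset_limit M c N G + M': multiset_limit M' c' N' G'
  for M :: "'x dim_module" and c N G and M' :: "'y dim_module" and c' N' G' +
  fixes S S' :: "nat \<Rightarrow> nat \<Rightarrow> omap multiset \<Rightarrow> bool"
  assumes S_ex: "\<exists>l a. S k l a" and S'_ex: "\<exists>l a. S' k l a"
    and S_down: "S p l a \<Longrightarrow> k \<le> p \<Longrightarrow> S k l (mprod a (compose_from c k p))"
    and S'_down: "S' p l a \<Longrightarrow> k \<le> p \<Longrightarrow> S' k l (mprod a (compose_from c' k p))"
    and S_S': "S k l a \<Longrightarrow> S' l p b \<Longrightarrow> lim_rel c p (mprod b a) k {#1#}"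
    and S'_S: "S' k l a \<Longrightarrow> S l p b \<Longrightarrow> lim_rel c' p (mprod b a) k {#1#}"
begin

lemma flip: "limit_correspondence M' c' N' G' M c N G S' S"
  by unfold_locales (use S_ex S'_ex S_down S'_down S_S' S'_S in auto)

text \<open>There is no axiom comparing two elements of \<open>S\<close> directly, so the comparison
  makes a detour through \<open>S'\<close>. With \<open>S' l p b\<close>, the product
  \<open>b a\<close> becomes a connecting map at a late level; restricting \<open>d\<close> to level
  \<open>p\<close> and composing it with \<open>b\<close> gives the identity of level
  \<open>l\<close>, and acting by \<open>a\<close> yields the claim.\<close>

lemma eventually_determined:
  assumes "S k l a"
  shows "\<exists>r0\<ge>k. \<forall>r\<ge>r0. \<forall>q d. S r q d \<longrightarrow> lim_rel c' l a q (mprod d (compose_from c k r))"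
proof -
  obtain p b where b: "S' l p b" using S'_ex by blast
  obtain r0 where r0: "p \<le> r0" "k \<le> r0" "mprod (compose_from c p r0) (mprod b a) = compose_from c k r0"
    using S_S'[OF assms b] unfolding lim_rel_def by auto
  have "lim_rel c' l a q (mprod d (compose_from c k r))" if "r \<ge> r0" "S r q d" for r q d
  proof -
    have r: "mprod (compose_from c p r) (mprod b a) = compose_from c k r"
      using lim_rel_later[of c p r0 "mprod b a" k "{#1#}" r] r0 that(1) by simp
    have "lim_rel c' q (mprod (mprod d (compose_from c p r)) b) l {#1#}"
      using S'_S[OF b S_down[OF that(2)]] r0(1) that(1) by simp
    from lim_rel_act[OF this, of a] have "lim_rel c' q (mprod d (compose_from c k r)) l a"
      by (simp add: mprod_assoc r)
    then show ?thesis by (rule lim_rel_sym)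
  qed
  then show ?thesis using r0 by blast
qed

text \<open>Both choices are compared with a third element of \<open>S\<close> that starts at a
  level late enough for \<open>m\<close> and \<open>m'\<close> to have become equal.\<close>

lemma well_defined:
  assumes "S k l a" "S k' l' a'" "G k m = G k' m'"
  shows "G' l (mprod a m) = G' l' (mprod a' m')"
proof -
  obtain p where p: "k \<le> p" "k' \<le> p" "mprod (compose_from c k p) m = mprod (compose_from c k' p) m'"
    using assms(3) unfolding M.G_eq lim_rel_def by blast
  obtain r0 where r0: "\<And>r q d. r \<ge> r0 \<Longrightarrow> S r q d \<Longrightarrow> lim_rel c' l a q (mprod d (compose_from c k r))"
    using eventually_determined[OF assms(1)] by blast
  obtain r1 where r1: "\<And>r q d. r \<ge> r1 \<Longrightarrow> S r q d \<Longrightarrow> lim_rel c' l' a' q (mprod d (compose_from c k' r))"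
    using eventually_determined[OF assms(2)] by blast
  define r where "r = max p (max r0 r1)"
  obtain q d where d: "S r q d" using S_ex by blast
  have "mprod (compose_from c k r) m = mprod (compose_from c k' r) m'"
    using lim_rel_later[OF p(3,1,2), of r] by (simp add: r_def)
  moreover have "lim_rel c' l (mprod a m) q (mprod d (mprod (compose_from c k r) m))"
    using lim_rel_act[OF r0[OF _ d], of m] by (simp add: r_def mprod_assoc)
  moreover have "lim_rel c' l' (mprod a' m') q (mprod d (mprod (compose_from c k' r) m'))"
    using lim_rel_act[OF r1[OF _ d], of m'] by (simp add: r_def mprod_assoc)
  ultimately show ?thesis unfolding M'.G_eq using lim_rel_trans lim_rel_sym by metis
qed

definition induced :: "'x \<Rightarrow> 'y" where
  "induced x = (SOME y. \<exists>k m l a. x = G k m \<and> S k l a \<and> y = G' l (mprod a m))"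

lemma induced_eq:
  assumes "S k l a"
  shows "induced (G k m) = G' l (mprod a m)"
  unfolding induced_def
proof (rule some_equality)
  show "\<exists>k' m' l' a'. G k m = G k' m' \<and> S k' l' a' \<and> G' l (mprod a m) = G' l' (mprod a' m')"
    using assms by blast
qed (use well_defined[OF assms] in metis)

lemma induced_carrier: "induced (G k m) \<in> dm_carrier M'"
  using S_ex[of k] induced_eq M'.carrier by fastforce

lemma induced_inverse:
  assumes "x \<in> dm_carrier M"
  shows "limit_correspondence.induced G' G S' (induced x) = x"
proof -
  obtain k m where x: "x = G k m" using assms M.carrier by blast
  obtain l a where a: "S k l a" using S_ex by blast
  obtain p b where b: "S' l p b" using S'_ex by blast
  have "limit_correspondence.induced G' G S' (induced x) = G p (mprod b (mprod a m))"
    unfolding x induced_eq[OF a] by (rule limit_correspondence.induced_eq[OF flip b])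
  also have "\<dots> = G k m" unfolding M.G_eq using lim_rel_act[OF S_S'[OF a b], of m] by (simp add: mprod_assoc)
  finally show ?thesis by (simp add: x)
qed

lemma induced_iso: "dim_module_iso M M' induced"
  unfolding dim_module_iso_def
proof (intro conjI ballI)
  interpret flip: limit_correspondence M' c' N' G' M c N G S' S by (rule flip)
  show "bij_betw induced (dm_carrier M) (dm_carrier M')"
  proof (rule bij_betw_byWitness[where f' = flip.induced])
    show "\<forall>x\<in>dm_carrier M. flip.induced (induced x) = x" using induced_inverse by blast
    show "\<forall>x\<in>dm_carrier M'. induced (flip.induced x) = x" using flip.induced_inverse by blast
    show "induced ` dm_carrier M \<subseteq> dm_carrier M'" using M.carrier induced_carrier by auto
    show "flip.induced ` dm_carrier M' \<subseteq> dm_carrier M" using M'.carrier flip.induced_carrier by auto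
  qed
  show "induced (dm_add M X Y) = dm_add M' (induced X) (induced Y)" if XY: "X \<in> dm_carrier M" "Y \<in> dm_carrier M" for X Y
  proof -
    obtain k m where X: "X = G k m" using XY(1) M.carrier by blast
    obtain k' m' where Y: "Y = G k' m'" using XY(2) M.carrier by blast
    define p where "p = max k k'"
    have X': "X = G p (mprod (compose_from c k p) m)" unfolding X by (rule M.G_push[symmetric]) (simp add: p_def)
    have Y': "Y = G p (mprod (compose_from c k' p) m')" unfolding Y by (rule M.G_push[symmetric]) (simp add: p_def)
    obtain l a where "S p l a" using S_ex by blast
    then show ?thesis unfolding X' Y' by (simp add: M.G_add induced_eq M'.G_add mprod_add_right)
  qed
  show "induced (dm_act M X \<Theta>) = dm_act M' (induced X) \<Theta>" if X\<Theta>: "X \<in> dm_carrier M" "\<Theta> \<in> V {()}" for X \<Theta>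
  proof -
    obtain k m where X: "X = G k m" using X\<Theta>(1) M.carrier by blast
    obtain b where b: "\<Theta> = vclass {()} b" using X\<Theta>(2) V_eq_range[of "{()}"] by auto
    obtain l a where "S k l a" using S_ex by blast
    then show ?thesis unfolding X b by (simp add: M.G_act induced_eq M'.G_act mprod_assoc)
  qed
qed

text \<open>An element of the scale at level \<open>k\<close> has weights at most
  \<open>N k\<close>, and \<open>a\<close> has room for \<open>N k\<close> copies at level
  \<open>l\<close>; \<open>wt_mprod_le\<close> combines the two.\<close>

lemma induced_scale:
  assumes "\<And>k l a t. S k l a \<Longrightarrow> N k * wt t a \<le> N' l"
  shows "induced ` dm_scale M \<subseteq> dm_scale M'"
proof
  fix y assume "y \<in> induced ` dm_scale M"
  then obtain k m where y: "y = induced (G k m)" and m: "\<forall>t\<in>{1..3}. wt t m \<le> N k"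
    using M.G_scale by auto
  obtain l a where a: "S k l a" using S_ex by blast
  have "wt t (mprod a m) \<le> N' l" for t
  proof -
    have "1 * wt t (mprod a m) \<le> N k * wt t a" by (rule wt_mprod_le) (use m in auto)
    also have "\<dots> \<le> N' l" by (rule assms[OF a])
    finally show ?thesis by simp
  qed
  then show "y \<in> dm_scale M'" unfolding y induced_eq[OF a] M'.G_scale by blast
qed

lemma induced_scale_preserving:
  assumes "\<And>k l a t. S k l a \<Longrightarrow> N k * wt t a \<le> N' l" and "\<And>k l a t. S' k l a \<Longrightarrow> N' k * wt t a \<le> N l"
  shows "scale_preserving M M' induced"
proof -
  interpret flip: limit_correspondence M' c' N' G' M c N G S' S by (rule flip)
  have "y \<in> induced ` dm_scale M" if "y \<in> dm_scale M'" for y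
  proof (rule image_eqI)
    show "flip.induced y \<in> dm_scale M" using flip.induced_scale[OF assms(2)] that by blast
    have "y \<in> dm_carrier M'" using that M'.G_scale M'.carrier by blast
    then show "y = induced (flip.induced y)" using flip.induced_inverse by simp
  qed
  then show ?thesis unfolding scale_preserving_def using induced_scale[OF assms(1)] by blast
qed

end

section \<open>Images of the unit multisets under a module isomorphism\<close>

locale two_limits = M: multiset_limit M c N G + M': multiset_limit M' c' N' G'
  for M :: "'x dim_module" and c N G and M' :: "'y dim_module" and c' N' G' +
  fixes F assumes iso: "dim_module_iso M M' F"
begin

text \<open>\<open>G k m\<close> is the unit \<open>G k {#1#}\<close> acted on by the class of
  \<open>m\<close>, and \<open>F\<close> commutes with the action.\<close>

lemma image_G:
  assumes "F (G k {#1#}) = G' l a"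
  shows "F (G k m) = G' l (mprod a m)"
proof -
  have "vclass {()} m \<in> V {()}" using V_eq_range[of "{()}"] by auto
  moreover have "G k {#1#} \<in> dm_carrier M" using M.carrier by blast
  ultimately have "F (dm_act M (G k {#1#}) (vclass {()} m)) = dm_act M' (F (G k {#1#})) (vclass {()} m)"
    using iso unfolding dim_module_iso_def by blast
  then show ?thesis by (simp add: assms M.G_act M'.G_act)
qed

lemma image_ex: "\<exists>l a. F (G k m) = G' l a"
proof -
  have "F (G k m) \<in> dm_carrier M'"
    using iso M.carrier unfolding dim_module_iso_def bij_betw_def by blast
  then show ?thesis using M'.carrier by blast
qed

lemma image_later:
  assumes "F (G k m) = G' l a" "l \<le> p"
  shows "F (G k m) = G' p (mprod (compose_from c' l p) a)"
  using assms M'.G_push by simp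

text \<open>The scale at level \<open>k\<close> contains \<open>N k\<close> copies of the unit, so
  their image is represented in the scale of some level. Moved to a later level, \<open>N k\<close>
  copies of the image of the unit still fit, which is the size condition for a map from level
  \<open>k\<close>.\<close>

lemma image_scaled:
  assumes "scale_preserving M M' F"
  shows "\<exists>l a. F (G k {#1#}) = G' l a \<and> (\<forall>t\<in>{1..3}. N k * wt t a \<le> N' l)"
proof -
  \<comment> \<open>The class of the diagonal embedding with \<open>N k\<close> copies; each of its
    weights is exactly \<open>N k\<close>.\<close>
  let ?u = "repeat_mset (N k) {#1::omap#}"
  obtain l a where a: "F (G k {#1#}) = G' l a" using image_ex by blast
  have "G k ?u \<in> dm_scale M" unfolding M.G_scale using wt_repeat_one[of _ "N k"] by fastforce
  then have "F (G k ?u) \<in> dm_scale M'" using assms by (auto simp: scale_preserving_def)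
  then obtain p b where b: "F (G k ?u) = G' p b" "\<forall>t\<in>{1..3}. wt t b \<le> N' p" unfolding M'.G_scale by blast
  then have "lim_rel c' l (mprod a ?u) p b" using image_G[OF a, of ?u] unfolding M'.G_eq[symmetric] by simp
  then obtain r where r: "l \<le> r" "p \<le> r" "mprod (compose_from c' l r) (mprod a ?u) = mprod (compose_from c' p r) b"
    unfolding lim_rel_def by blast
  have "N k * wt t (mprod (compose_from c' l r) a) \<le> N' r" if t: "t \<in> {1..3}" for t
  proof -
    have "N k * wt t (mprod (compose_from c' l r) a) = wt t (mprod (compose_from c' p r) b)"
      unfolding r(3)[symmetric] mprod_assoc[symmetric] wt_mprod_repeat ..
    also have "1 * \<dots> \<le> N' p * wt t (compose_from c' p r)" by (rule wt_mprod_le) (use b(2) in auto)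
    also have "\<dots> \<le> N' r" by (rule M'.size_from[OF r(2) t])
    finally show ?thesis by simp
  qed
  then show ?thesis using image_later[OF a r(1)] by blast
qed

text \<open>No scale is required: at level \<open>p\<close> the weights of the image are at most
  \<open>W * N' p\<close>, while the matrix factor \<open>Suc p\<close> of the stabilised levels
  grows without bound.\<close>

lemma image_stable:
  "\<exists>l a. F (G k {#1#}) = G' l a \<and> (\<forall>t\<in>{1..3}. N k * Suc k * wt t a \<le> N' l * Suc l)"
proof -
  obtain l a where a: "F (G k {#1#}) = G' l a" using image_ex by blast
  define W where "W = wt 1 a + wt 2 a + wt 3 a"
  have W: "1 * wt t a \<le> W" if "t \<in> {1..3}" for t
  proof -
    have "t = 1 \<or> t = 2 \<or> t = 3" using that by auto
    then show ?thesis by (auto simp: W_def)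
  qed
  \<comment> \<open>Late enough for the factor \<open>Suc p\<close> to dominate
    \<open>N k * Suc k * W\<close>.\<close>
  define p where "p = max l (N k * Suc k * W)"
  have p: "l \<le> p" "N k * Suc k * W \<le> p" by (auto simp: p_def)
  have "N k * Suc k * wt t (mprod (compose_from c' l p) a) \<le> N' p * Suc p" if t: "t \<in> {1..3}" for t
  proof -
    have "1 * wt t (mprod (compose_from c' l p) a) \<le> W * wt t (compose_from c' l p)"
      by (rule wt_mprod_le) (rule W)
    also have "\<dots> \<le> W * (N' l * wt t (compose_from c' l p))" using M'.pos[of l] by simp
    also have "\<dots> \<le> W * N' p" using M'.size_from[OF p(1) t] by simp
    finally have "N k * Suc k * wt t (mprod (compose_from c' l p) a) \<le> N k * Suc k * W * N' p"
      by (simp add: mult.assoc)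
    also have "\<dots> \<le> Suc p * N' p" using p(2) by (intro mult_right_mono) auto
    finally show ?thesis by (simp add: mult.commute)
  qed
  then show ?thesis using image_later[OF a p(1)] by blast
qed

end

lemma dim_module_iso_inverse:
  assumes iso: "dim_module_iso M M' F"
    and add: "\<And>X Y. X \<in> dm_carrier M \<Longrightarrow> Y \<in> dm_carrier M \<Longrightarrow> dm_add M X Y \<in> dm_carrier M"
    and act: "\<And>X \<Theta>. X \<in> dm_carrier M \<Longrightarrow> \<Theta> \<in> V {()} \<Longrightarrow> dm_act M X \<Theta> \<in> dm_carrier M"
  shows "dim_module_iso M' M (inv_into (dm_carrier M) F)"
proof -
  let ?H = "inv_into (dm_carrier M) F"
  have bij: "bij_betw F (dm_carrier M) (dm_carrier M')" using iso by (simp add: dim_module_iso_def)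
  have H: "?H Y \<in> dm_carrier M \<and> F (?H Y) = Y" if "Y \<in> dm_carrier M'" for Y
    using bij that by (auto simp: bij_betw_def inv_into_into f_inv_into_f)
  have HF: "?H (F X) = X" if "X \<in> dm_carrier M" for X using bij that by (auto simp: bij_betw_def)
  have "?H (dm_add M' X Y) = dm_add M (?H X) (?H Y)" if "X \<in> dm_carrier M'" "Y \<in> dm_carrier M'" for X Y
    using HF[OF add[of "?H X" "?H Y"]] iso H[OF that(1)] H[OF that(2)] by (auto simp: dim_module_iso_def)
  moreover have "?H (dm_act M' X \<Theta>) = dm_act M (?H X) \<Theta>" if "X \<in> dm_carrier M'" "\<Theta> \<in> V {()}" for X \<Theta>
    using HF[OF act[of "?H X" \<Theta>]] iso H[OF that(1)] that(2) by (auto simp: dim_module_iso_def)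
  ultimately show ?thesis using bij_betw_inv_into[OF bij] by (auto simp: dim_module_iso_def)
qed

lemma (in two_limits) flip: "two_limits M' c' N' G' M c N G (inv_into (dm_carrier M) F)"
proof -
  have "dim_module_iso M' M (inv_into (dm_carrier M) F)"
  proof (rule dim_module_iso_inverse[OF iso])
    show "dm_add M X Y \<in> dm_carrier M" if XY: "X \<in> dm_carrier M" "Y \<in> dm_carrier M" for X Y
    proof -
      obtain k m where X: "X = G k m" using XY(1) M.carrier by blast
      obtain k' m' where Y: "Y = G k' m'" using XY(2) M.carrier by blast
      have "X = G (max k k') (mprod (compose_from c k (max k k')) m)" "Y = G (max k k') (mprod (compose_from c k' (max k k')) m')"
        unfolding X Y by (rule M.G_push[symmetric], simp)+
      then show ?thesis using M.G_add M.carrier by auto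
    qed
    show "dm_act M X \<Theta> \<in> dm_carrier M" if "X \<in> dm_carrier M" "\<Theta> \<in> V {()}" for X \<Theta>
      using that M.carrier M.G_act V_eq_range[of "{()}"] by auto blast
  qed
  then show ?thesis by unfold_locales
qed

lemma (in two_limits) scale_preserving_flip:
  assumes "scale_preserving M M' F"
  shows "scale_preserving M' M (inv_into (dm_carrier M) F)"
proof -
  have "dm_scale M \<subseteq> dm_carrier M" unfolding M.G_scale M.carrier by blast
  moreover have "bij_betw F (dm_carrier M) (dm_carrier M')" using iso by (simp add: dim_module_iso_def)
  ultimately show ?thesis using assms unfolding scale_preserving_def bij_betw_def
    by (metis inv_into_image_cancel)
qed

section \<open>The operator norm\<close>

lemma opdist_le_mono: "opdist_le x y C \<Longrightarrow> C \<le> D \<Longrightarrow> opdist_le x y D"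
  unfolding opdist_le_def
  by (meson L2_set_nonneg mult_right_mono order_trans)

lemma opdist_le_sym:
  assumes "opdist_le x y C" shows "opdist_le y x C"
proof -
  have "(\<Sum>i\<in>F. \<Sum>j\<in>F. cnj (w i) * (y i j - x i j) * v j) = - (\<Sum>i\<in>F. \<Sum>j\<in>F. cnj (w i) * (x i j - y i j) * v j)" for F w v
    unfolding sum_negf[symmetric] by (intro sum.cong[OF refl]) (simp add: algebra_simps)
  then show ?thesis using assms unfolding opdist_le_def by simp
qed

text \<open>The common source of the triangle inequality and of the estimate for sums.\<close>

lemma opdist_le_combine:
  assumes "opdist_le x y C" "opdist_le x' y' D" "\<And>i j. z i j - z' i j = (x i j - y i j) + (x' i j - y' i j)"
  shows "opdist_le z z' (C + D)"
  unfolding opdist_le_def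
proof (intro allI impI)
  fix F :: "'a set" and v w :: "'a \<Rightarrow> complex" assume F: "finite F"
  let ?n = "L2_set (\<lambda>i. norm (w i)) F * L2_set (\<lambda>j. norm (v j)) F"
  have "(\<Sum>i\<in>F. \<Sum>j\<in>F. cnj (w i) * (z i j - z' i j) * v j) =
    (\<Sum>i\<in>F. \<Sum>j\<in>F. cnj (w i) * (x i j - y i j) * v j) + (\<Sum>i\<in>F. \<Sum>j\<in>F. cnj (w i) * (x' i j - y' i j) * v j)"
    unfolding assms(3) sum.distrib[symmetric] by (intro sum.cong[OF refl]) (simp add: algebra_simps)
  also have "norm \<dots> \<le> C * ?n + D * ?n"
    using assms(1,2) F unfolding opdist_le_def mult.assoc by (intro norm_triangle_mono) auto
  finally show "norm (\<Sum>i\<in>F. \<Sum>j\<in>F. cnj (w i) * (z i j - z' i j) * v j) \<le> (C + D) * L2_set (\<lambda>i. norm (w i)) F * L2_set (\<lambda>j. norm (v j)) F"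
    by (simp add: algebra_simps)
qed

lemma opdist_le_trans: "opdist_le x y C \<Longrightarrow> opdist_le y z D \<Longrightarrow> opdist_le x z (C + D)"
  by (rule opdist_le_combine) auto

lemma opdist_le_add:
  "opdist_le x x' C \<Longrightarrow> opdist_le y y' D \<Longrightarrow> opdist_le (\<lambda>i j. x i j + y i j) (\<lambda>i j. x' i j + y' i j) (C + D)"
  by (rule opdist_le_combine) auto

lemma opdist_le_scale:
  assumes "opdist_le x y C" shows "opdist_le (\<lambda>i j. c * x i j) (\<lambda>i j. c * y i j) (cmod c * C)"
  unfolding opdist_le_def
proof (intro allI impI)
  fix F :: "'a set" and v w :: "'a \<Rightarrow> complex" assume F: "finite F"
  have "(\<Sum>i\<in>F. \<Sum>j\<in>F. cnj (w i) * (c * x i j - c * y i j) * v j) = c * (\<Sum>i\<in>F. \<Sum>j\<in>F. cnj (w i) * (x i j - y i j) * v j)"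
    unfolding sum_distrib_left by (intro sum.cong[OF refl]) (simp add: algebra_simps)
  also have "norm \<dots> \<le> cmod c * (C * L2_set (\<lambda>i. norm (w i)) F * L2_set (\<lambda>j. norm (v j)) F)"
    unfolding norm_mult using assms F unfolding opdist_le_def by (intro mult_left_mono) auto
  finally show "norm (\<Sum>i\<in>F. \<Sum>j\<in>F. cnj (w i) * (c * x i j - c * y i j) * v j) \<le> cmod c * C * L2_set (\<lambda>i. norm (w i)) F * L2_set (\<lambda>j. norm (v j)) F"
    by (simp add: mult.assoc)
qed

lemma opdist_le_madj:
  assumes "opdist_le x y C" shows "opdist_le (madj x) (madj y) C"
  unfolding opdist_le_def
proof (intro allI impI)
  fix F :: "'a set" and v w :: "'a \<Rightarrow> complex" assume F: "finite F"
  have "(\<Sum>i\<in>F. \<Sum>j\<in>F. cnj (w i) * (madj x i j - madj y i j) * v j) = cnj (\<Sum>i\<in>F. \<Sum>j\<in>F. cnj (v i) * (x i j - y i j) * w j)"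
    by (subst sum.swap) (simp add: madj_def cnj_sum algebra_simps)
  also have "norm \<dots> \<le> C * L2_set (\<lambda>j. norm (v j)) F * L2_set (\<lambda>i. norm (w i)) F"
    unfolding complex_mod_cnj using assms F unfolding opdist_le_def by auto
  finally show "norm (\<Sum>i\<in>F. \<Sum>j\<in>F. cnj (w i) * (madj x i j - madj y i j) * v j) \<le> C * L2_set (\<lambda>i. norm (w i)) F * L2_set (\<lambda>j. norm (v j)) F"
    by (simp add: mult_ac)
qed

definition form_bound :: "'i set \<Rightarrow> ('i, 'i) cmat \<Rightarrow> real \<Rightarrow> bool" where
  "form_bound I z C \<longleftrightarrow> (\<forall>v w. norm (\<Sum>i\<in>I. \<Sum>j\<in>I. cnj (w i) * z i j * v j) \<le>
     C * L2_set (\<lambda>i. norm (w i)) I * L2_set (\<lambda>j. norm (v j)) I)"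

lemma form_boundD: "form_bound I z C \<Longrightarrow> norm (\<Sum>i\<in>I. \<Sum>j\<in>I. cnj (w i) * z i j * v j) \<le>
     C * L2_set (\<lambda>i. norm (w i)) I * L2_set (\<lambda>j. norm (v j)) I"
  unfolding form_bound_def by blast

text \<open>A test on \<open>F\<close> becomes a test on \<open>F \<union> I\<close> by setting the
  vectors to 0 outside \<open>F\<close>, and then a test on \<open>I\<close> because the difference
  vanishes elsewhere. It remains to treat one finite index set.\<close>

lemma opdist_le_iff_form_bound:
  assumes I: "finite I" and x: "x \<in> fin_mat I" and y: "y \<in> fin_mat I" and C: "C \<ge> 0"
  shows "opdist_le x y C \<longleftrightarrow> form_bound I (\<lambda>i j. x i j - y i j) C"
proof
  assume "opdist_le x y C"
  then show "form_bound I (\<lambda>i j. x i j - y i j) C" using I unfolding opdist_le_def form_bound_def by blast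
next
  assume fb: "form_bound I (\<lambda>i j. x i j - y i j) C"
  have z0: "x i j - y i j = 0" if "i \<notin> I \<or> j \<notin> I" for i j
    using that fin_mat_outside[OF x] fin_mat_outside[OF y] by auto
  show "opdist_le x y C" unfolding opdist_le_def
  proof (intro allI impI)
    fix F :: "'a set" and v w :: "'a \<Rightarrow> complex" assume F: "finite F"
    define v' where "v' j = (if j \<in> F then v j else 0)" for j
    define w' where "w' j = (if j \<in> F then w j else 0)" for j
    have "(\<Sum>i\<in>F. \<Sum>j\<in>F. cnj (w i) * (x i j - y i j) * v j) = (\<Sum>i\<in>F \<union> I. \<Sum>j\<in>F \<union> I. cnj (w' i) * (x i j - y i j) * v' j)"
    proof (rule sum.mono_neutral_cong_left)
      show "(\<Sum>j\<in>F. cnj (w i) * (x i j - y i j) * v j) = (\<Sum>j\<in>F \<union> I. cnj (w' i) * (x i j - y i j) * v' j)" if "i \<in> F" for i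
        by (rule sum.mono_neutral_cong_left) (use F I that in \<open>auto simp: v'_def w'_def\<close>)
    qed (use F I in \<open>auto simp: w'_def\<close>)
    also have "\<dots> = (\<Sum>i\<in>I. \<Sum>j\<in>I. cnj (w' i) * (x i j - y i j) * v' j)"
    proof (rule sum.mono_neutral_cong_right)
      show "(\<Sum>j\<in>F \<union> I. cnj (w' i) * (x i j - y i j) * v' j) = (\<Sum>j\<in>I. cnj (w' i) * (x i j - y i j) * v' j)" for i
        by (rule sum.mono_neutral_right) (use F I z0 in auto)
      show "\<forall>i\<in>F \<union> I - I. (\<Sum>j\<in>F \<union> I. cnj (w' i) * (x i j - y i j) * v' j) = 0"
        using z0 by (auto intro!: sum.neutral)
    qed (use F I in auto)
    finally have eq: "(\<Sum>i\<in>F. \<Sum>j\<in>F. cnj (w i) * (x i j - y i j) * v j) = (\<Sum>i\<in>I. \<Sum>j\<in>I. cnj (w' i) * (x i j - y i j) * v' j)" .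
    have L2: "L2_set (\<lambda>i. norm (if i \<in> F then u i else 0 :: complex)) I \<le> L2_set (\<lambda>i. norm (u i)) F" for u
    proof -
      have "(\<Sum>i\<in>I. (norm (if i \<in> F then u i else 0))\<^sup>2) = (\<Sum>i\<in>I \<inter> F. (norm (u i))\<^sup>2)"
        by (rule sum.mono_neutral_cong_right) (use I in auto)
      also have "\<dots> \<le> (\<Sum>i\<in>F. (norm (u i))\<^sup>2)" by (rule sum_mono2) (use F in auto)
      finally show ?thesis unfolding L2_set_def by simp
    qed
    have "norm (\<Sum>i\<in>I. \<Sum>j\<in>I. cnj (w' i) * (x i j - y i j) * v' j) \<le> C * L2_set (\<lambda>i. norm (w' i)) I * L2_set (\<lambda>j. norm (v' j)) I"
      by (rule form_boundD[OF fb])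
    also have "\<dots> \<le> C * L2_set (\<lambda>i. norm (w i)) F * L2_set (\<lambda>j. norm (v j)) F"
      unfolding w'_def v'_def using C by (intro mult_mono L2 mult_nonneg_nonneg L2_set_nonneg) auto
    finally show "norm (\<Sum>i\<in>F. \<Sum>j\<in>F. cnj (w i) * (x i j - y i j) * v j) \<le> C * L2_set (\<lambda>i. norm (w i)) F * L2_set (\<lambda>j. norm (v j)) F"
      unfolding eq .
  qed
qed

lemma mzero_fin_mat: "mzero \<in> fin_mat I"
  by (simp add: fin_mat_def mzero_def)

lemma fin_mat_finite_support:
  assumes "x \<in> fin_mat I"
  shows "\<exists>F. finite F \<and> F \<subseteq> I \<and> x \<in> fin_mat F"
proof -
  let ?F = "fst ` {(i, j). x i j \<noteq> 0} \<union> snd ` {(i, j). x i j \<noteq> 0}"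
  have "finite ?F" "?F \<subseteq> I" using assms by (auto simp: fin_mat_def)
  moreover have "x \<in> fin_mat ?F" using assms by (force simp: fin_mat_def)
  ultimately show ?thesis by blast
qed

lemma opdist_le_exists:
  assumes "x \<in> fin_mat I"
  shows "\<exists>B\<ge>0. opdist_le x mzero B"
proof -
  obtain F where F: "finite F" "x \<in> fin_mat F" using fin_mat_finite_support[OF assms] by blast
  define B where "B = (\<Sum>i\<in>F. \<Sum>j\<in>F. norm (x i j))"
  have B: "B \<ge> 0" by (simp add: B_def sum_nonneg)
  have "form_bound F (\<lambda>i j. x i j - mzero i j) B"
    unfolding form_bound_def
  proof (intro allI)
    fix v w :: "'a \<Rightarrow> complex"
    let ?w = "L2_set (\<lambda>i. norm (w i)) F" and ?v = "L2_set (\<lambda>i. norm (v i)) F"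
    have "norm (\<Sum>i\<in>F. \<Sum>j\<in>F. cnj (w i) * (x i j - mzero i j) * v j) \<le> (\<Sum>i\<in>F. \<Sum>j\<in>F. norm (x i j) * (?w * ?v))"
    proof (intro order_trans[OF norm_sum] sum_mono)
      fix i j assume ij: "i \<in> F" "j \<in> F"
      have "norm (w i) \<le> ?w" "norm (v j) \<le> ?v" using F ij by (auto intro: member_le_L2_set)
      then have "norm (x i j) * (norm (w i) * norm (v j)) \<le> norm (x i j) * (?w * ?v)"
        by (intro mult_left_mono mult_mono) auto
      then show "norm (cnj (w i) * (x i j - mzero i j) * v j) \<le> norm (x i j) * (?w * ?v)"
        by (simp add: mzero_def norm_mult mult_ac)
    qed
    also have "\<dots> = B * ?w * ?v" unfolding B_def by (simp add: sum_distrib_right mult.assoc)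
    finally show "norm (\<Sum>i\<in>F. \<Sum>j\<in>F. cnj (w i) * (x i j - mzero i j) * v j) \<le> B * ?w * ?v" .
  qed
  then have "opdist_le x mzero B" using opdist_le_iff_form_bound[OF F mzero_fin_mat B] by simp
  then show ?thesis using B by blast
qed

lemma L2_set_sq: "(L2_set f A)\<^sup>2 = (\<Sum>i\<in>A. (f i)\<^sup>2)"
  by (simp add: L2_set_def sum_nonneg)

text \<open>The form is tested against the image vector itself, and one factor of its norm is
  cancelled.\<close>

lemma form_bound_apply:
  assumes "form_bound I y B"
  shows "L2_set (\<lambda>i. norm (\<Sum>j\<in>I. y i j * v j)) I \<le> B * L2_set (\<lambda>j. norm (v j)) I"
proof -
  let ?u = "\<lambda>i. \<Sum>j\<in>I. y i j * v j"
  let ?n = "L2_set (\<lambda>i. norm (?u i)) I"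
  have "complex_of_real (?n\<^sup>2) = (\<Sum>i\<in>I. cnj (?u i) * ?u i)"
    unfolding L2_set_sq of_real_sum complex_norm_square by (simp add: mult.commute)
  also have "\<dots> = (\<Sum>i\<in>I. \<Sum>j\<in>I. cnj (?u i) * y i j * v j)"
    unfolding sum_distrib_left[of "cnj _"] mult.assoc ..
  finally have "norm (complex_of_real (?n\<^sup>2)) = norm (\<Sum>i\<in>I. \<Sum>j\<in>I. cnj (?u i) * y i j * v j)"
    by (rule arg_cong)
  then have "?n\<^sup>2 = norm (\<Sum>i\<in>I. \<Sum>j\<in>I. cnj (?u i) * y i j * v j)"
    by (simp only: norm_of_real abs_power2)
  also have "\<dots> \<le> B * ?n * L2_set (\<lambda>j. norm (v j)) I"
    by (rule form_boundD[OF assms])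
  finally have le: "?n * ?n \<le> (B * L2_set (\<lambda>j. norm (v j)) I) * ?n" by (simp add: power2_eq_square mult_ac)
  show ?thesis
  proof (cases "?n = 0")
    case False
    then have "?n > 0" using L2_set_nonneg[of "\<lambda>i. norm (?u i)" I] by linarith
    then show ?thesis using le by simp
  next
    \<comment> \<open>The sign of \<open>B\<close> is not given; that \<open>B\<close> times the
      norm of \<open>v\<close> is nonnegative follows by testing the form with
      \<open>w = v\<close>.\<close>
    case True
    have "0 \<le> norm (\<Sum>i\<in>I. \<Sum>j\<in>I. cnj (v i) * y i j * v j)" by simp
    also have "\<dots> \<le> B * L2_set (\<lambda>j. norm (v j)) I * L2_set (\<lambda>j. norm (v j)) I"
      by (rule form_boundD[OF assms])
    finally have "0 \<le> B * L2_set (\<lambda>j. norm (v j)) I * L2_set (\<lambda>j. norm (v j)) I" .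
    then show ?thesis unfolding True using L2_set_nonneg[of "\<lambda>j. norm (v j)" I]
      by (cases "L2_set (\<lambda>j. norm (v j)) I = 0") (auto simp: zero_le_mult_iff)
  qed
qed

lemma opdist_le_mmult_right:
  assumes "x \<in> fin_mat I" "x' \<in> fin_mat I" "y \<in> fin_mat I"
    and xx': "opdist_le x x' C" and y: "opdist_le y mzero B" and C: "C \<ge> 0" and B: "B \<ge> 0"
  shows "opdist_le (mmult x y) (mmult x' y) (C * B)"
proof -
  obtain F1 F2 F3 where F: "finite F1" "x \<in> fin_mat F1" "finite F2" "x' \<in> fin_mat F2" "finite F3" "y \<in> fin_mat F3"
    using assms(1-3) fin_mat_finite_support by meson
  define F where "F = F1 \<union> F2 \<union> F3"
  have fF: "finite F" and x: "x \<in> fin_mat F" and x': "x' \<in> fin_mat F" and y': "y \<in> fin_mat F"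
    using F fin_mat_mono[of F1 F] fin_mat_mono[of F2 F] fin_mat_mono[of F3 F] unfolding F_def by auto
  have fz: "form_bound F (\<lambda>i j. x i j - x' i j) C" using xx' opdist_le_iff_form_bound[OF fF x x' C] by simp
  have fy: "form_bound F y B" using y opdist_le_iff_form_bound[OF fF y' mzero_fin_mat B] by (simp add: mzero_def)
  have "form_bound F (\<lambda>i j. mmult x y i j - mmult x' y i j) (C * B)"
    unfolding form_bound_def
  proof (intro allI)
    fix v w :: "'a \<Rightarrow> complex"
    let ?u = "\<lambda>i. \<Sum>j\<in>F. y i j * v j"
    have "(\<Sum>i\<in>F. \<Sum>j\<in>F. cnj (w i) * (mmult x y i j - mmult x' y i j) * v j) =
      (\<Sum>i\<in>F. \<Sum>j\<in>F. \<Sum>l\<in>F. cnj (w i) * (x i l - x' i l) * (y l j * v j))"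
      using x x' y' fF by (intro sum.cong[OF refl])
        (simp add: mmult_fin_mat sum_subtractf[symmetric] sum_distrib_left sum_distrib_right algebra_simps)
    also have "\<dots> = (\<Sum>i\<in>F. \<Sum>l\<in>F. \<Sum>j\<in>F. cnj (w i) * (x i l - x' i l) * (y l j * v j))"
      by (rule sum.cong[OF refl], rule sum.swap)
    also have "\<dots> = (\<Sum>i\<in>F. \<Sum>l\<in>F. cnj (w i) * (x i l - x' i l) * ?u l)"
      by (simp only: sum_distrib_left)
    also have "norm \<dots> \<le> C * L2_set (\<lambda>i. norm (w i)) F * L2_set (\<lambda>j. norm (?u j)) F"
      by (rule form_boundD[OF fz])
    also have "\<dots> \<le> C * L2_set (\<lambda>i. norm (w i)) F * (B * L2_set (\<lambda>j. norm (v j)) F)"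
      using C by (intro mult_left_mono form_bound_apply fy mult_nonneg_nonneg L2_set_nonneg)
    finally show "norm (\<Sum>i\<in>F. \<Sum>j\<in>F. cnj (w i) * (mmult x y i j - mmult x' y i j) * v j) \<le>
      C * B * L2_set (\<lambda>i. norm (w i)) F * L2_set (\<lambda>j. norm (v j)) F" by (simp add: mult_ac)
  qed
  then show ?thesis
    using opdist_le_iff_form_bound[OF fF fin_mat_mmult[OF x y'] fin_mat_mmult[OF x' y'], of "C * B"] C B by simp
qed

lemma madj_madj [simp]: "madj (madj x) = x"
  by (simp add: madj_def)

lemma madj_mmult:
  assumes "x \<in> fin_mat I" "y \<in> fin_mat I"
  shows "madj (mmult x y) = mmult (madj y) (madj x)"
proof -
  obtain F where F: "finite F" "x \<in> fin_mat F" using fin_mat_finite_support[OF assms(1)] by blast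
  show ?thesis
    using F fin_mat_madj[OF F(2)] by (intro ext) (simp add: madj_def[of "mmult _ _"] mmult_fin_mat cnj_sum madj_def mult.commute)
qed

text \<open>Adjoints exchange the factors and preserve \<open>opdist_le\<close>.\<close>

lemma opdist_le_mmult_left:
  assumes "x \<in> fin_mat I" "x' \<in> fin_mat I" "y \<in> fin_mat I"
    and "opdist_le x x' C" "opdist_le y mzero B" "C \<ge> 0" "B \<ge> 0"
  shows "opdist_le (mmult y x) (mmult y x') (C * B)"
proof -
  have "opdist_le (madj y) mzero B" using opdist_le_madj[OF assms(5)] by (simp add: madj_def mzero_def)
  then have "opdist_le (mmult (madj x) (madj y)) (mmult (madj x') (madj y)) (C * B)"
    using assms by (intro opdist_le_mmult_right fin_mat_madj opdist_le_madj)
  from opdist_le_madj[OF this] show ?thesis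
    using assms by (simp add: madj_mmult[of _ I] fin_mat_madj)
qed

text \<open>The form of \<open>f x\<close> at two vectors splits over the copies into forms of
  \<open>x\<close> at the compressed vectors \<open>co w s\<close> and \<open>co u s\<close>. Both
  norm estimates for regular maps rest on this.\<close>

lemma has_class_form:
  assumes f: "block_rep J K f S v \<sigma>" and x: "x \<in> fin_mat (T3_idx J)" and y: "y \<in> fin_mat (T3_idx J)"
  defines "co \<equiv> \<lambda>u s i. \<Sum>k\<in>T3_idx K. cnj (v s k i) * u k"
  shows "(\<Sum>k\<in>T3_idx K. \<Sum>l\<in>T3_idx K. cnj (w k) * (f x k l - f y k l) * u l) =
    (\<Sum>s\<in>S. \<Sum>i\<in>T3_idx J. \<Sum>j\<in>T3_idx J. cnj (co w s i) * (x i j - y i j) * co u s j)"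
proof -
  have fxy: "f x k l - f y k l = (\<Sum>s\<in>S. \<Sum>i\<in>T3_idx J. \<Sum>j\<in>T3_idx J. v s k i * (x i j - y i j) * cnj (v s l j))" for k l
    unfolding block_repD(4)[OF f x] block_repD(4)[OF f y] sandwich_def sum_subtractf[symmetric]
    by (simp add: algebra_simps)
  have "(\<Sum>k\<in>T3_idx K. \<Sum>l\<in>T3_idx K. cnj (w k) * (f x k l - f y k l) * u l) =
    (\<Sum>k\<in>T3_idx K. \<Sum>l\<in>T3_idx K. \<Sum>s\<in>S. \<Sum>i\<in>T3_idx J. \<Sum>j\<in>T3_idx J. cnj (w k) * v s k i * (x i j - y i j) * (cnj (v s l j) * u l))"
    unfolding fxy by (simp add: sum_distrib_left sum_distrib_right mult_ac)
  also have "\<dots> = (\<Sum>k\<in>T3_idx K. \<Sum>s\<in>S. \<Sum>l\<in>T3_idx K. \<Sum>i\<in>T3_idx J. \<Sum>j\<in>T3_idx J. cnj (w k) * v s k i * (x i j - y i j) * (cnj (v s l j) * u l))"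
    by (rule sum.cong[OF refl], rule sum.swap)
  also have "\<dots> = (\<Sum>s\<in>S. \<Sum>k\<in>T3_idx K. \<Sum>l\<in>T3_idx K. \<Sum>i\<in>T3_idx J. \<Sum>j\<in>T3_idx J. cnj (w k) * v s k i * (x i j - y i j) * (cnj (v s l j) * u l))"
    by (rule sum.swap)
  also have "\<dots> = (\<Sum>s\<in>S. \<Sum>k\<in>T3_idx K. \<Sum>i\<in>T3_idx J. \<Sum>l\<in>T3_idx K. \<Sum>j\<in>T3_idx J. cnj (w k) * v s k i * (x i j - y i j) * (cnj (v s l j) * u l))"
    by (rule sum.cong[OF refl], rule sum.cong[OF refl], rule sum.swap)
  also have "\<dots> = (\<Sum>s\<in>S. \<Sum>i\<in>T3_idx J. \<Sum>k\<in>T3_idx K. \<Sum>l\<in>T3_idx K. \<Sum>j\<in>T3_idx J. cnj (w k) * v s k i * (x i j - y i j) * (cnj (v s l j) * u l))"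
    by (rule sum.cong[OF refl], rule sum.swap)
  also have "\<dots> = (\<Sum>s\<in>S. \<Sum>i\<in>T3_idx J. \<Sum>k\<in>T3_idx K. \<Sum>j\<in>T3_idx J. \<Sum>l\<in>T3_idx K. cnj (w k) * v s k i * (x i j - y i j) * (cnj (v s l j) * u l))"
    by (rule sum.cong[OF refl], rule sum.cong[OF refl], rule sum.cong[OF refl], rule sum.swap)
  also have "\<dots> = (\<Sum>s\<in>S. \<Sum>i\<in>T3_idx J. \<Sum>j\<in>T3_idx J. \<Sum>k\<in>T3_idx K. \<Sum>l\<in>T3_idx K. cnj (w k) * v s k i * (x i j - y i j) * (cnj (v s l j) * u l))"
    by (rule sum.cong[OF refl], rule sum.cong[OF refl], rule sum.swap)
  also have "\<dots> = (\<Sum>s\<in>S. \<Sum>i\<in>T3_idx J. \<Sum>j\<in>T3_idx J. cnj (co w s i) * (x i j - y i j) * co u s j)"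
    unfolding co_def cnj_sum by (intro sum.cong[OF refl]) (simp add: sum_distrib_left sum_distrib_right mult_ac)
  finally show ?thesis .
qed

text \<open>By Bessel the compressed vectors together are no longer than the original ones; the
  copies are then summed with the Cauchy-Schwarz inequality.\<close>

lemma has_class_contractive:
  assumes J: "finite J" and K: "finite K" and f: "has_class J K f m"
    and x: "x \<in> fin_mat (T3_idx J)" and y: "y \<in> fin_mat (T3_idx J)" and C: "C \<ge> 0" and xy: "opdist_le x y C"
  shows "opdist_le (f x) (f y) C"
proof -
  obtain v \<sigma> r where v: "block_rep J K f {..<r::nat} v \<sigma>" using f by (rule has_classE)
  let ?I = "T3_idx J" and ?K = "T3_idx K"
  have fin: "finite ?I" "finite ?K" using J K by auto
  have z: "form_bound ?I (\<lambda>i j. x i j - y i j) C" using xy opdist_le_iff_form_bound[OF fin(1) x y C] by simp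
  have "form_bound ?K (\<lambda>k l. f x k l - f y k l) C"
    unfolding form_bound_def
  proof (intro allI)
    fix u w :: "nat \<times> 'b \<Rightarrow> complex"
    define co where "co u s i = (\<Sum>k\<in>?K. cnj (v s k i) * u k)" for u s i
    define n where "n u s = L2_set (\<lambda>i. norm (co u s i)) ?I" for u s
    have bessel: "L2_set (n u) {..<r} \<le> L2_set (\<lambda>k. norm (u k)) ?K" for u
    proof -
      have "(\<Sum>s<r. (n u s)\<^sup>2) = (\<Sum>(s, i)\<in>{..<r} \<times> ?I. (norm (co u s i))\<^sup>2)"
        unfolding n_def L2_set_sq by (simp add: sum.cartesian_product)
      also have "\<dots> \<le> (\<Sum>k\<in>?K. (norm (u k))\<^sup>2)"
        using orthonormal_bessel[OF fin(2) _ block_repD(5)[OF v], of u] fin(1) by (simp add: co_def split_def)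
      finally show ?thesis unfolding L2_set_def by simp
    qed
    have "(\<Sum>k\<in>?K. \<Sum>l\<in>?K. cnj (w k) * (f x k l - f y k l) * u l) =
      (\<Sum>s<r. \<Sum>i\<in>?I. \<Sum>j\<in>?I. cnj (co w s i) * (x i j - y i j) * co u s j)"
      unfolding co_def by (rule has_class_form[OF v x y])
    also have "norm \<dots> \<le> (\<Sum>s<r. C * n w s * n u s)"
      unfolding n_def by (intro order_trans[OF norm_sum sum_mono] form_boundD[OF z])
    also have "\<dots> = C * (\<Sum>s<r. \<bar>n w s\<bar> * \<bar>n u s\<bar>)" by (simp add: sum_distrib_left mult.assoc n_def L2_set_nonneg)
    also have "\<dots> \<le> C * (L2_set (n w) {..<r} * L2_set (n u) {..<r})"
      using C by (intro mult_left_mono L2_set_mult_ineq)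
    also have "\<dots> \<le> C * (L2_set (\<lambda>k. norm (w k)) ?K * L2_set (\<lambda>k. norm (u k)) ?K)"
      using C by (intro mult_left_mono mult_mono bessel L2_set_nonneg)
    finally show "norm (\<Sum>k\<in>?K. \<Sum>l\<in>?K. cnj (w k) * (f x k l - f y k l) * u l) \<le>
      C * L2_set (\<lambda>k. norm (w k)) ?K * L2_set (\<lambda>k. norm (u k)) ?K" by (simp add: mult.assoc)
  qed
  then show ?thesis
    using opdist_le_iff_form_bound[OF fin(2) has_class_fin_mat[OF J K f x] has_class_fin_mat[OF J K f y] C] by simp
qed

text \<open>Vectors of the source are moved isometrically into the range of copy 0, which exists
  because \<open>m\<close> is nonempty; all other copies see them as 0.\<close>

lemma has_class_isometric:
  assumes J: "finite J" and K: "finite K" and f: "has_class J K f m" and m: "m \<noteq> {#}"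
    and x: "x \<in> fin_mat (T3_idx J)" and y: "y \<in> fin_mat (T3_idx J)" and C: "C \<ge> 0" and xy: "opdist_le (f x) (f y) C"
  shows "opdist_le x y C"
proof -
  obtain v \<sigma> r where v: "block_rep J K f {..<r::nat} v \<sigma>" "m = image_mset \<sigma> (mset_set {..<r})" using f by (rule has_classE)
  then have r: "0 \<in> {..<r}" using m by (cases r) auto
  let ?I = "T3_idx J" and ?K = "T3_idx K"
  have fin: "finite ?I" "finite ?K" using J K by auto
  have z: "form_bound ?K (\<lambda>k l. f x k l - f y k l) C"
    using xy opdist_le_iff_form_bound[OF fin(2) has_class_fin_mat[OF J K f x] has_class_fin_mat[OF J K f y] C] by simp
  have "form_bound ?I (\<lambda>i j. x i j - y i j) C"
    unfolding form_bound_def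
  proof (intro allI)
    fix u w :: "nat \<times> 'a \<Rightarrow> complex"
    define up where "up u k = (\<Sum>i\<in>?I. v 0 k i * u i)" for u k
    have co: "(\<Sum>k\<in>?K. cnj (v s k i) * up u k) = of_bool (s = 0) * u i" if "s < r" "i \<in> ?I" for s i u
    proof -
      have "(\<Sum>k\<in>?K. cnj (v s k i) * up u k) = (\<Sum>j\<in>?I. u j * (\<Sum>k\<in>?K. cnj (v s k i) * v 0 k j))"
        unfolding up_def sum_distrib_left by (subst sum.swap) (simp add: mult_ac)
      also have "\<dots> = (\<Sum>j\<in>?I. (of_bool (s = 0) * u j) * of_bool (j = i))"
        using block_repD(3)[OF v(1) _ r that(2)] that(1) by (intro sum.cong[OF refl]) auto
      also have "\<dots> = of_bool (s = 0) * u i" by (rule sum_unit_vector[OF fin(1) that(2)])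
      finally show ?thesis .
    qed
    have nrm: "L2_set (\<lambda>k. norm (up u k)) ?K = L2_set (\<lambda>i. norm (u i)) ?I" for u
    proof -
      have "complex_of_real (\<Sum>k\<in>?K. (norm (up u k))\<^sup>2) = (\<Sum>k\<in>?K. cnj (up u k) * up u k)"
        unfolding of_real_sum complex_norm_square by (simp add: mult.commute)
      also have "\<dots> = 1 * (\<Sum>i\<in>?I. cnj (u i) * u i)"
        unfolding up_def using block_repD(3)[OF v(1) r r] by (intro isometry_inner fin(1)) auto
      also have "\<dots> = complex_of_real (\<Sum>i\<in>?I. (norm (u i))\<^sup>2)"
        unfolding of_real_sum complex_norm_square by (simp add: mult.commute)
      finally show ?thesis unfolding L2_set_def of_real_eq_iff by simp
    qed
    have "(\<Sum>k\<in>?K. \<Sum>l\<in>?K. cnj (up w k) * (f x k l - f y k l) * up u l) =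
      (\<Sum>s<r. \<Sum>i\<in>?I. \<Sum>j\<in>?I. cnj (of_bool (s = 0) * w i) * (x i j - y i j) * (of_bool (s = 0) * u j))"
      unfolding has_class_form[OF v(1) x y] by (intro sum.cong[OF refl]) (simp add: co)
    also have "\<dots> = (\<Sum>s<r. (\<Sum>i\<in>?I. \<Sum>j\<in>?I. cnj (w i) * (x i j - y i j) * u j) * of_bool (s = 0))"
      by (intro sum.cong[OF refl]) auto
    also have "\<dots> = (\<Sum>i\<in>?I. \<Sum>j\<in>?I. cnj (w i) * (x i j - y i j) * u j)" using r by (intro sum_unit_vector) auto
    finally show "norm (\<Sum>i\<in>?I. \<Sum>j\<in>?I. cnj (w i) * (x i j - y i j) * u j) \<le>
      C * L2_set (\<lambda>k. norm (w k)) ?I * L2_set (\<lambda>k. norm (u k)) ?I"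
      using form_boundD[OF z, of "up w" "up u"] unfolding nrm by simp
  qed
  then show ?thesis using opdist_le_iff_form_bound[OF fin(1) x y C] by simp
qed

section \<open>Limit C*-algebras\<close>

definition push :: "(nat \<Rightarrow> 'a \<Rightarrow> 'a) \<Rightarrow> nat \<Rightarrow> nat \<Rightarrow> 'a \<Rightarrow> 'a" where
  "push h k p = conn h k (p - k)"

lemma push_refl [simp]: "push h k k x = x"
  by (simp add: push_def)

lemma push_Suc: "k \<le> p \<Longrightarrow> push h k (Suc p) x = h p (push h k p x)"
  by (simp add: push_def Suc_diff_le)

lemma push_push: "k \<le> p \<Longrightarrow> p \<le> q \<Longrightarrow> push h p q (push h k p x) = push h k q x"
  using conn_add[of h k "p - k" "q - p" x] by (simp add: push_def)

text \<open>The index sets may be infinite. Contractivity is therefore an assumption, to be checked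
  on finite corners, and it is what makes asymptotic compatibility stable under the connecting
  maps.\<close>

locale matrix_system =
  fixes I :: "nat \<Rightarrow> 'i set" and h :: "nat \<Rightarrow> ('i, 'i) cmat \<Rightarrow> ('i, 'i) cmat"
  assumes hom: "star_hom (fin_mat_alg (I k)) (fin_mat_alg (I (Suc k))) (h k)"
    and contractive: "x \<in> fin_mat (I k) \<Longrightarrow> y \<in> fin_mat (I k) \<Longrightarrow> C \<ge> 0 \<Longrightarrow> opdist_le x y C \<Longrightarrow> opdist_le (h k x) (h k y) C"
begin

lemma push_hom: "k \<le> p \<Longrightarrow> star_hom (fin_mat_alg (I k)) (fin_mat_alg (I p)) (push h k p)"
proof (induction p rule: dec_induct)
  case base
  show ?case by (simp add: star_hom_def)
next
  case (step p)
  then show ?case using hom[of p] unfolding star_hom_def fin_mat_alg_def by (simp add: push_Suc)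
qed

lemma push_fin_mat: "k \<le> p \<Longrightarrow> x \<in> fin_mat (I k) \<Longrightarrow> push h k p x \<in> fin_mat (I p)"
  using push_hom unfolding star_hom_def fin_mat_alg_def by auto

lemma push_add: "k \<le> p \<Longrightarrow> x \<in> fin_mat (I k) \<Longrightarrow> y \<in> fin_mat (I k) \<Longrightarrow>
    push h k p (\<lambda>i j. x i j + y i j) = (\<lambda>i j. push h k p x i j + push h k p y i j)"
  using push_hom unfolding star_hom_def fin_mat_alg_def by auto

lemma push_mult: "k \<le> p \<Longrightarrow> x \<in> fin_mat (I k) \<Longrightarrow> y \<in> fin_mat (I k) \<Longrightarrow>
    push h k p (mmult x y) = mmult (push h k p x) (push h k p y)"
  using push_hom unfolding star_hom_def fin_mat_alg_def by auto

lemma push_scale: "k \<le> p \<Longrightarrow> x \<in> fin_mat (I k) \<Longrightarrow>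
    push h k p (\<lambda>i j. c * x i j) = (\<lambda>i j. c * push h k p x i j)"
  using push_hom unfolding star_hom_def fin_mat_alg_def by auto

lemma push_star: "k \<le> p \<Longrightarrow> x \<in> fin_mat (I k) \<Longrightarrow> push h k p (madj x) = madj (push h k p x)"
  using push_hom unfolding star_hom_def fin_mat_alg_def by auto

lemma push_zero: "k \<le> p \<Longrightarrow> push h k p mzero = mzero"
  using push_scale[of k p mzero 0, OF _ mzero_fin_mat] by (simp add: mzero_def)

lemma push_contractive:
  "k \<le> p \<Longrightarrow> x \<in> fin_mat (I k) \<Longrightarrow> y \<in> fin_mat (I k) \<Longrightarrow> C \<ge> 0 \<Longrightarrow> opdist_le x y C \<Longrightarrow> opdist_le (push h k p x) (push h k p y) C"
proof (induction p rule: dec_induct)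
  case (step p)
  then show ?case using push_fin_mat by (simp add: push_Suc contractive)
qed simp

abbreviation "seqs \<equiv> lim_seqs I h"

lemma seqs_iff: "x \<in> seqs \<longleftrightarrow> (\<forall>k. x k \<in> fin_mat (I k)) \<and>
    (\<forall>e>0. \<exists>N. \<forall>k\<ge>N. \<forall>j\<ge>k. opdist_le (x j) (push h k j (x k)) e)"
  by (simp add: lim_seqs_def push_def)

definition asym_eq :: "(nat \<Rightarrow> ('i, 'i) cmat) \<Rightarrow> (nat \<Rightarrow> ('i, 'i) cmat) \<Rightarrow> bool" where
  "asym_eq x y \<longleftrightarrow> (\<forall>e>0. \<exists>N. \<forall>k\<ge>N. opdist_le (x k) (y k) e)"

lemma lim_eq_iff: "(x, y) \<in> lim_eq I h \<longleftrightarrow> x \<in> seqs \<and> y \<in> seqs \<and> asym_eq x y"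
  by (simp add: lim_eq_def asym_eq_def)

lemma asym_eq_refl: "asym_eq x x"
  unfolding asym_eq_def using opdist_le_refl by (meson less_imp_le)

lemma asym_eq_sym: "asym_eq x y \<Longrightarrow> asym_eq y x"
  unfolding asym_eq_def using opdist_le_sym by meson

lemma asym_eqE:
  assumes "asym_eq x y" "e > 0"
  obtains N where "\<And>k. k \<ge> N \<Longrightarrow> opdist_le (x k) (y k) e"
  using assms unfolding asym_eq_def by blast

lemma asym_eq_trans:
  assumes "asym_eq x y" "asym_eq y z" shows "asym_eq x z"
  unfolding asym_eq_def
proof (intro allI impI)
  fix e :: real assume "e > 0"
  then have e2: "e / 2 > 0" by simp
  obtain N1 where N1: "\<And>k. k \<ge> N1 \<Longrightarrow> opdist_le (x k) (y k) (e / 2)" using asym_eqE[OF assms(1) e2] by blast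
  obtain N2 where N2: "\<And>k. k \<ge> N2 \<Longrightarrow> opdist_le (y k) (z k) (e / 2)" using asym_eqE[OF assms(2) e2] by blast
  have "opdist_le (x k) (z k) e" if "k \<ge> max N1 N2" for k
    using opdist_le_trans[OF N1[of k] N2[of k]] that by simp
  then show "\<exists>N. \<forall>k\<ge>N. opdist_le (x k) (z k) e" by blast
qed

lemma seqs_close:
  assumes x: "x \<in> seqs" and y: "\<And>k. y k \<in> fin_mat (I k)" and xy: "asym_eq x y"
  shows "y \<in> seqs"
  unfolding seqs_iff
proof (intro conjI allI impI)
  fix e :: real assume "e > 0"
  then have e3: "e / 3 > 0" by simp
  obtain N1 where N1: "\<And>k j. k \<ge> N1 \<Longrightarrow> j \<ge> k \<Longrightarrow> opdist_le (x j) (push h k j (x k)) (e / 3)"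
    using x e3 unfolding seqs_iff by blast
  obtain N2 where N2: "\<And>k. k \<ge> N2 \<Longrightarrow> opdist_le (x k) (y k) (e / 3)" using asym_eqE[OF xy e3] by blast
  have "opdist_le (y j) (push h k j (y k)) e" if k: "k \<ge> max N1 N2" and j: "j \<ge> k" for k j
  proof -
    have "opdist_le (y j) (x j) (e / 3)" by (rule opdist_le_sym, rule N2) (use k j in auto)
    from opdist_le_trans[OF this N1[of k j]] have "opdist_le (y j) (push h k j (x k)) (e / 3 + e / 3)"
      using k j by simp
    moreover have "opdist_le (push h k j (x k)) (push h k j (y k)) (e / 3)"
      using x y N2[of k] k j e3 by (intro push_contractive) (auto simp: seqs_iff)
    ultimately have "opdist_le (y j) (push h k j (y k)) (e / 3 + e / 3 + e / 3)" by (rule opdist_le_trans)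
    then show ?thesis by simp
  qed
  then show "\<exists>N. \<forall>k\<ge>N. \<forall>j\<ge>k. opdist_le (y j) (push h k j (y k)) e" by blast
qed (use y in auto)

lemma seqs_bounded:
  assumes x: "x \<in> seqs"
  shows "\<exists>B\<ge>0. \<exists>N. \<forall>k\<ge>N. opdist_le (x k) mzero B"
proof -
  obtain N where "\<forall>k\<ge>N. \<forall>j\<ge>k. opdist_le (x j) (push h k j (x k)) 1"
    using x zero_less_one unfolding seqs_iff by blast
  then have N: "\<And>j. j \<ge> N \<Longrightarrow> opdist_le (x j) (push h N j (x N)) 1" by simp
  have xN: "x N \<in> fin_mat (I N)" using x by (simp add: seqs_iff)
  obtain B where B: "B \<ge> 0" "opdist_le (x N) mzero B" using opdist_le_exists[OF xN] by blast
  have "opdist_le (x j) mzero (1 + B)" if "j \<ge> N" for j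
  proof -
    have "opdist_le (push h N j (x N)) (push h N j mzero) B"
      using that xN B by (intro push_contractive mzero_fin_mat)
    then show ?thesis using opdist_le_trans[OF N[OF that]] push_zero[OF that] by simp
  qed
  then show ?thesis using B(1) by (intro exI[of _ "1 + B"]) auto
qed

lemma asym_eq_add:
  assumes "asym_eq x x'" "asym_eq y y'"
  shows "asym_eq (\<lambda>k i j. x k i j + y k i j) (\<lambda>k i j. x' k i j + y' k i j)"
  unfolding asym_eq_def
proof (intro allI impI)
  fix e :: real assume "e > 0"
  then have e2: "e / 2 > 0" by simp
  obtain N1 where N1: "\<And>k. k \<ge> N1 \<Longrightarrow> opdist_le (x k) (x' k) (e / 2)" using asym_eqE[OF assms(1) e2] by blast
  obtain N2 where N2: "\<And>k. k \<ge> N2 \<Longrightarrow> opdist_le (y k) (y' k) (e / 2)" using asym_eqE[OF assms(2) e2] by blast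
  have "opdist_le (\<lambda>i j. x k i j + y k i j) (\<lambda>i j. x' k i j + y' k i j) e" if "k \<ge> max N1 N2" for k
    using opdist_le_add[OF N1[of k] N2[of k]] that by simp
  then show "\<exists>N. \<forall>k\<ge>N. opdist_le (\<lambda>i j. x k i j + y k i j) (\<lambda>i j. x' k i j + y' k i j) e" by blast
qed

lemma scale_le: "0 < (e::real) \<Longrightarrow> cmod c * (e / (cmod c + 1)) \<le> e"
proof -
  assume e: "0 < e"
  have "cmod c * e \<le> e * (cmod c + 1)" using e by (simp add: algebra_simps)
  then show ?thesis by (simp add: pos_divide_le_eq add_nonneg_pos)
qed

lemma asym_eq_scale:
  assumes "asym_eq x x'" shows "asym_eq (\<lambda>k i j. c * x k i j) (\<lambda>k i j. c * x' k i j)"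
  unfolding asym_eq_def
proof (intro allI impI)
  fix e :: real assume "e > 0"
  then have e2: "e / (cmod c + 1) > 0" by (simp add: add_nonneg_pos)
  obtain N where N: "\<And>k. k \<ge> N \<Longrightarrow> opdist_le (x k) (x' k) (e / (cmod c + 1))" using asym_eqE[OF assms e2] by blast
  have le: "cmod c * (e / (cmod c + 1)) \<le> e"
    by (rule scale_le[OF \<open>e > 0\<close>])
  have "opdist_le (\<lambda>i j. c * x k i j) (\<lambda>i j. c * x' k i j) e" if "k \<ge> N" for k
    using opdist_le_mono[OF opdist_le_scale[OF N[OF that]] le] .
  then show "\<exists>N. \<forall>k\<ge>N. opdist_le (\<lambda>i j. c * x k i j) (\<lambda>i j. c * x' k i j) e" by blast
qed

lemma asym_eq_star: "asym_eq x x' \<Longrightarrow> asym_eq (\<lambda>k. madj (x k)) (\<lambda>k. madj (x' k))"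
  unfolding asym_eq_def using opdist_le_madj by meson

lemma mult_close:
  assumes fin: "x \<in> fin_mat I0" "x' \<in> fin_mat I0" "y \<in> fin_mat I0" "y' \<in> fin_mat I0"
    and "opdist_le x x' d" "opdist_le y y' d" "opdist_le y mzero B" "opdist_le x' mzero B" "0 \<le> d" "0 \<le> B"
  shows "opdist_le (mmult x y) (mmult x' y') (2 * B * d)"
proof -
  have "opdist_le (mmult x y) (mmult x' y) (d * B)" using assms by (intro opdist_le_mmult_right)
  moreover have "opdist_le (mmult x' y) (mmult x' y') (d * B)" using assms by (intro opdist_le_mmult_left)
  ultimately have "opdist_le (mmult x y) (mmult x' y') (d * B + d * B)" by (rule opdist_le_trans)
  then show ?thesis by (simp add: algebra_simps)
qed

lemma asym_eq_mult:
  assumes s: "x \<in> seqs" "x' \<in> seqs" "y \<in> seqs" "y' \<in> seqs" and "asym_eq x x'" "asym_eq y y'"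
  shows "asym_eq (\<lambda>k. mmult (x k) (y k)) (\<lambda>k. mmult (x' k) (y' k))"
  unfolding asym_eq_def
proof (intro allI impI)
  fix e :: real assume e: "e > 0"
  obtain B1 M1 where B1: "B1 \<ge> 0" "\<And>k. k \<ge> M1 \<Longrightarrow> opdist_le (y k) mzero B1" using seqs_bounded[OF s(3)] by blast
  obtain B2 M2 where B2: "B2 \<ge> 0" "\<And>k. k \<ge> M2 \<Longrightarrow> opdist_le (x' k) mzero B2" using seqs_bounded[OF s(2)] by blast
  define B where "B = max B1 B2 + 1"
  define d where "d = e / (2 * B)"
  have B: "B > 0" using B1(1) by (simp add: B_def add_nonneg_pos)
  then have d: "d > 0" and Bd: "2 * B * d = e" using e by (auto simp: d_def)
  obtain N1 where N1: "\<And>k. k \<ge> N1 \<Longrightarrow> opdist_le (x k) (x' k) d" using asym_eqE[OF assms(5) d] by blast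
  obtain N2 where N2: "\<And>k. k \<ge> N2 \<Longrightarrow> opdist_le (y k) (y' k) d" using asym_eqE[OF assms(6) d] by blast
  have "opdist_le (mmult (x k) (y k)) (mmult (x' k) (y' k)) e" if k: "k \<ge> max (max M1 M2) (max N1 N2)" for k
  proof -
    have "opdist_le (y k) mzero B" "opdist_le (x' k) mzero B"
      using opdist_le_mono[OF B1(2)[of k]] opdist_le_mono[OF B2(2)[of k]] k by (auto simp: B_def)
    then have "opdist_le (mmult (x k) (y k)) (mmult (x' k) (y' k)) (2 * B * d)"
      using s N1[of k] N2[of k] k B d by (intro mult_close[of _ "I k"]) (auto simp: seqs_iff)
    then show ?thesis unfolding Bd .
  qed
  then show "\<exists>N. \<forall>k\<ge>N. opdist_le (mmult (x k) (y k)) (mmult (x' k) (y' k)) e" by blast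
qed

lemma seqs_add:
  assumes x: "x \<in> seqs" and y: "y \<in> seqs"
  shows "(\<lambda>k i j. x k i j + y k i j) \<in> seqs"
  unfolding seqs_iff
proof (intro conjI allI impI)
  have fin: "x k \<in> fin_mat (I k)" "y k \<in> fin_mat (I k)" for k using x y by (auto simp: seqs_iff)
  show "(\<lambda>i j. x k i j + y k i j) \<in> fin_mat (I k)" for k using fin by (rule fin_mat_add)
  fix e :: real assume "e > 0"
  then have e2: "e / 2 > 0" by simp
  obtain N1 where N1: "\<And>k j. k \<ge> N1 \<Longrightarrow> j \<ge> k \<Longrightarrow> opdist_le (x j) (push h k j (x k)) (e / 2)"
    using x e2 unfolding seqs_iff by blast
  obtain N2 where N2: "\<And>k j. k \<ge> N2 \<Longrightarrow> j \<ge> k \<Longrightarrow> opdist_le (y j) (push h k j (y k)) (e / 2)"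
    using y e2 unfolding seqs_iff by blast
  have "opdist_le (\<lambda>i l. x j i l + y j i l) (push h k j (\<lambda>i l. x k i l + y k i l)) e"
    if "k \<ge> max N1 N2" "j \<ge> k" for k j
    using opdist_le_add[OF N1[of k j] N2[of k j]] that fin by (simp add: push_add)
  then show "\<exists>N. \<forall>k\<ge>N. \<forall>j\<ge>k. opdist_le (\<lambda>i l. x j i l + y j i l) (push h k j (\<lambda>i l. x k i l + y k i l)) e" by blast
qed

lemma seqs_scale:
  assumes x: "x \<in> seqs"
  shows "(\<lambda>k i j. c * x k i j) \<in> seqs"
  unfolding seqs_iff
proof (intro conjI allI impI)
  have fin: "x k \<in> fin_mat (I k)" for k using x by (auto simp: seqs_iff)
  show "(\<lambda>i j. c * x k i j) \<in> fin_mat (I k)" for k using fin by (rule fin_mat_scale)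
  fix e :: real assume "e > 0"
  then have e2: "e / (cmod c + 1) > 0" by (simp add: add_nonneg_pos)
  obtain N where N: "\<And>k j. k \<ge> N \<Longrightarrow> j \<ge> k \<Longrightarrow> opdist_le (x j) (push h k j (x k)) (e / (cmod c + 1))"
    using x e2 unfolding seqs_iff by blast
  have le: "cmod c * (e / (cmod c + 1)) \<le> e"
    by (rule scale_le[OF \<open>e > 0\<close>])
  have "opdist_le (\<lambda>i l. c * x j i l) (push h k j (\<lambda>i l. c * x k i l)) e" if "k \<ge> N" "j \<ge> k" for k j
    using opdist_le_mono[OF opdist_le_scale[OF N[OF that]] le] that fin by (simp add: push_scale)
  then show "\<exists>N. \<forall>k\<ge>N. \<forall>j\<ge>k. opdist_le (\<lambda>i l. c * x j i l) (push h k j (\<lambda>i l. c * x k i l)) e" by blast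
qed

lemma seqs_star:
  assumes x: "x \<in> seqs"
  shows "(\<lambda>k. madj (x k)) \<in> seqs"
proof -
  have fin: "x k \<in> fin_mat (I k)" for k using x by (auto simp: seqs_iff)
  have "\<exists>N. \<forall>k\<ge>N. \<forall>j\<ge>k. opdist_le (madj (x j)) (push h k j (madj (x k))) e" if e: "e > 0" for e
  proof -
    obtain N where "\<And>k j. k \<ge> N \<Longrightarrow> j \<ge> k \<Longrightarrow> opdist_le (x j) (push h k j (x k)) e"
      using x e unfolding seqs_iff by blast
    from opdist_le_madj[OF this] show ?thesis using push_star[OF _ fin] by auto
  qed
  then show ?thesis using fin_mat_madj[OF fin] unfolding seqs_iff by blast
qed

lemma seqs_mult:
  assumes x: "x \<in> seqs" and y: "y \<in> seqs"
  shows "(\<lambda>k. mmult (x k) (y k)) \<in> seqs"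
  unfolding seqs_iff
proof (intro conjI allI impI)
  have fin: "x k \<in> fin_mat (I k)" "y k \<in> fin_mat (I k)" for k using x y by (auto simp: seqs_iff)
  show "mmult (x k) (y k) \<in> fin_mat (I k)" for k using fin by (rule fin_mat_mmult)
  fix e :: real assume e: "e > 0"
  obtain B1 M1 where B1: "B1 \<ge> 0" "\<And>k. k \<ge> M1 \<Longrightarrow> opdist_le (y k) mzero B1" using seqs_bounded[OF y] by blast
  obtain B2 M2 where B2: "B2 \<ge> 0" "\<And>k. k \<ge> M2 \<Longrightarrow> opdist_le (x k) mzero B2" using seqs_bounded[OF x] by blast
  define B where "B = max B1 B2 + 1"
  define d where "d = e / (2 * B)"
  have B: "B > 0" using B1(1) by (simp add: B_def add_nonneg_pos)
  then have d: "d > 0" and Bd: "2 * B * d = e" using e by (auto simp: d_def)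
  obtain N1 where N1: "\<And>k j. k \<ge> N1 \<Longrightarrow> j \<ge> k \<Longrightarrow> opdist_le (x j) (push h k j (x k)) d"
    using x d unfolding seqs_iff by blast
  obtain N2 where N2: "\<And>k j. k \<ge> N2 \<Longrightarrow> j \<ge> k \<Longrightarrow> opdist_le (y j) (push h k j (y k)) d"
    using y d unfolding seqs_iff by blast
  have "opdist_le (mmult (x j) (y j)) (push h k j (mmult (x k) (y k))) e"
    if k: "k \<ge> max (max M1 M2) (max N1 N2)" and j: "j \<ge> k" for k j
  proof -
    have "opdist_le (y j) mzero B" "opdist_le (x k) mzero B"
      using opdist_le_mono[OF B1(2)[of j]] opdist_le_mono[OF B2(2)[of k]] k j by (auto simp: B_def)
    moreover from this(2) have "opdist_le (push h k j (x k)) mzero B"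
      using push_contractive[OF j fin(1) mzero_fin_mat, of B] B push_zero[OF j] by simp
    ultimately have "opdist_le (mmult (x j) (y j)) (mmult (push h k j (x k)) (push h k j (y k))) (2 * B * d)"
      using fin N1[of k j] N2[of k j] k j B d by (intro mult_close[of _ "I j"]) (auto simp: push_fin_mat)
    then show ?thesis unfolding Bd using fin j by (simp add: push_mult)
  qed
  then show "\<exists>N. \<forall>k\<ge>N. \<forall>j\<ge>k. opdist_le (mmult (x j) (y j)) (push h k j (mmult (x k) (y k))) e" by blast
qed

definition cls :: "(nat \<Rightarrow> ('i, 'i) cmat) \<Rightarrow> (nat \<Rightarrow> ('i, 'i) cmat) set" where
  "cls x = lim_eq I h `` {x}"

abbreviation "A \<equiv> cstar_lim I h"

lemma mem_cls: "y \<in> cls x \<longleftrightarrow> x \<in> seqs \<and> y \<in> seqs \<and> asym_eq x y"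
  by (simp add: cls_def lim_eq_iff)

lemma cls_eq_iff:
  assumes "x \<in> seqs" "y \<in> seqs"
  shows "cls x = cls y \<longleftrightarrow> asym_eq x y"
proof
  assume "cls x = cls y"
  moreover have "y \<in> cls y" using assms asym_eq_refl by (simp add: mem_cls)
  ultimately show "asym_eq x y" using mem_cls by blast
next
  assume xy: "asym_eq x y"
  then have "asym_eq x z \<longleftrightarrow> asym_eq y z" for z using asym_eq_trans asym_eq_sym by blast
  then show "cls x = cls y" using assms by (intro set_eqI) (simp add: mem_cls)
qed

lemma carrier_eq: "sa_carrier A = cls ` seqs"
  by (auto simp: cstar_lim_def quotient_def cls_def)

lemma UN_cls:
  assumes "x \<in> seqs" "\<And>x'. x' \<in> seqs \<Longrightarrow> asym_eq x x' \<Longrightarrow> F x' = Z"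
  shows "(\<Union>x\<in>cls x. F x) = Z"
  using assms asym_eq_refl[of x] by (intro UN_const_eq) (auto simp: mem_cls)

lemma add_cls:
  assumes "x \<in> seqs" "y \<in> seqs"
  shows "sa_add A (cls x) (cls y) = cls (\<lambda>k i j. x k i j + y k i j)"
  unfolding cstar_lim_def star_algebra.simps cls_def[symmetric]
  using assms by (intro UN_cls) (auto simp: cls_eq_iff seqs_add intro: asym_eq_add asym_eq_sym)

lemma mult_cls:
  assumes "x \<in> seqs" "y \<in> seqs"
  shows "sa_mult A (cls x) (cls y) = cls (\<lambda>k. mmult (x k) (y k))"
  unfolding cstar_lim_def star_algebra.simps cls_def[symmetric]
  using assms by (intro UN_cls) (auto simp: cls_eq_iff seqs_mult intro: asym_eq_mult asym_eq_sym)

lemma scale_cls: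
  assumes "x \<in> seqs"
  shows "sa_scale A c (cls x) = cls (\<lambda>k i j. c * x k i j)"
  unfolding cstar_lim_def star_algebra.simps cls_def[symmetric]
  using assms by (intro UN_cls) (auto simp: cls_eq_iff seqs_scale intro: asym_eq_scale asym_eq_sym)

lemma star_cls:
  assumes "x \<in> seqs"
  shows "sa_star A (cls x) = cls (\<lambda>k. madj (x k))"
  unfolding cstar_lim_def star_algebra.simps cls_def[symmetric]
  using assms by (intro UN_cls) (auto simp: cls_eq_iff seqs_star intro: asym_eq_star asym_eq_sym)

end

text \<open>Both limits have this form. In the plain case \<open>I k\<close> is
  \<open>T3_idx (J k)\<close>; in the stabilised case \<open>I k\<close> is infinite, the
  \<open>J k\<close> are growing finite blocks, and \<open>absorb\<close> says that each finitely
  supported matrix is eventually carried into them.\<close>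

locale T3_system = matrix_system I h
  for I :: "nat \<Rightarrow> (nat \<times> 'j) set" and h +
  fixes J :: "nat \<Rightarrow> 'j set" and c :: "nat \<Rightarrow> omap multiset"
  assumes finite_J: "finite (J k)" and J_nonempty: "J k \<noteq> {}" and J_sub: "T3_idx (J k) \<subseteq> I k"
    and step_class: "has_class (J k) (J (Suc k)) (h k) (c k)"
    and absorb: "x \<in> fin_mat (I k) \<Longrightarrow> \<exists>p\<ge>k. push h k p x \<in> fin_mat (T3_idx (J p))"
begin

abbreviation "D k \<equiv> fin_mat (T3_idx (J k))"

lemma D_sub: "x \<in> D k \<Longrightarrow> x \<in> fin_mat (I k)"
  using fin_mat_mono[OF J_sub] by blast

lemma push_class: "k \<le> p \<Longrightarrow> has_class (J k) (J p) (push h k p) (compose_from c k p)"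
proof (induction p rule: dec_induct)
  case base
  have "has_class (J k) (J k) (\<lambda>x. x) {#1#}"
  proof (rule has_classI)
    let ?v = "\<lambda>_::unit. mid (T3_idx (J k))"
    show "block_rep (J k) (J k) (\<lambda>x. x) {()} ?v (\<lambda>_. 1)"
    proof (rule block_repI)
      show "(\<Sum>p\<in>T3_idx (J k). cnj (?v s p i) * ?v t p j) = of_bool (s = t) * of_bool (i = j)"
        if "i \<in> T3_idx (J k)" "j \<in> T3_idx (J k)" for s t :: unit and i j
      proof -
        have "(\<Sum>p\<in>T3_idx (J k). cnj (?v s p i) * ?v t p j) = (\<Sum>p\<in>T3_idx (J k). of_bool (i = j) * of_bool (p = i))"
          by (intro sum.cong) (auto simp: mid_def)
        also have "\<dots> = of_bool (i = j)" using that finite_J by (intro sum_unit_vector) auto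
        finally show ?thesis by simp
      qed
      show "x = (\<lambda>p l. \<Sum>s\<in>{()}. sandwich (T3_idx (J k)) (?v s) x p l)" if x: "x \<in> D k" for x
      proof (intro ext)
        fix p l
        have "sandwich (T3_idx (J k)) (mid (T3_idx (J k))) x p l =
          (\<Sum>i\<in>T3_idx (J k). \<Sum>j\<in>T3_idx (J k). (x p l * of_bool (j = l)) * of_bool (i = p))"
          unfolding sandwich_def by (intro sum.cong) (auto simp: mid_def)
        also have "\<dots> = x p l"
        proof (cases "p \<in> T3_idx (J k) \<and> l \<in> T3_idx (J k)")
          case True
          then show ?thesis unfolding sum_distrib_right[symmetric] using finite_J by (simp only: sum_unit_vector finite_T3_idx)
        next
          case False
          then have "x p l = 0" using fin_mat_outside[OF x] by blast
          then show ?thesis by simp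
        qed
        finally show "x p l = (\<Sum>s\<in>{()}. sandwich (T3_idx (J k)) (?v s) x p l)" by simp
      qed
    qed (auto simp: mid_def omap_apply_one split: if_splits)
  qed simp
  then show ?case by (simp add: push_def conn.simps(1)[abs_def])
next
  case (step p)
  have "has_class (J k) (J (Suc p)) (h p \<circ> push h k p) (mprod (c p) (compose_from c k p))"
    using step finite_J step_class by (intro has_class_comp[of _ "J p"]) auto
  moreover have "push h k (Suc p) = h p \<circ> push h k p" using step by (intro ext) (simp add: push_Suc)
  ultimately show ?case using step by (simp add: compose_from_Suc comp_def)
qed

lemma push_D: "k \<le> p \<Longrightarrow> x \<in> D k \<Longrightarrow> push h k p x \<in> D p"
  using has_class_fin_mat[OF finite_J finite_J push_class] by blast

lemma push_T3:
  assumes "k \<le> p" "x \<in> T3 (J k)"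
  shows "push h k p x \<in> T3 (J p)"
  using has_class_star_extendible[OF finite_J finite_J push_class[OF assms(1)]] assms(2)
  by (auto simp: star_extendible_def T3_alg_def)

lemma T3_D: "x \<in> T3 (J k) \<Longrightarrow> x \<in> D k"
  by (simp add: T3_def)

text \<open>A compatible sequence may stay outside the finite blocks at every level. At level
  \<open>j\<close> it is replaced by the image of the latest \<open>x m\<close> that has been
  absorbed by level \<open>j\<close>; by \<open>absorb\<close> this \<open>m\<close> tends to
  infinity with \<open>j\<close>.\<close>

lemma good_representative:
  assumes x: "x \<in> seqs"
  shows "\<exists>y\<in>seqs. (\<forall>k. y k \<in> D k) \<and> asym_eq x y"
proof -
  have fin: "x k \<in> fin_mat (I k)" for k using x by (simp add: seqs_iff)
  define ok where "ok m j \<longleftrightarrow> m \<le> j \<and> push h m j (x m) \<in> D j" for m j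
  define best where "best j = (GREATEST m. ok m j)" for j
  have best: "ok (best j) j \<and> m \<le> best j" if "ok m j" for m j
    unfolding best_def using that GreatestI_nat[of "\<lambda>m. ok m j" m j] Greatest_le_nat[of "\<lambda>m. ok m j" m j]
    by (auto simp: ok_def)
  \<comment> \<open>At early levels nothing may have been absorbed yet; \<open>mzero\<close> fills
    the gap and does not affect the limit.\<close>
  define y where "y j = (if \<exists>m. ok m j then push h (best j) j (x (best j)) else mzero)" for j
  have yD: "y j \<in> D j" for j using best mzero_fin_mat by (auto simp: y_def ok_def)
  have xy: "asym_eq x y"
    unfolding asym_eq_def
  proof (intro allI impI)
    fix e :: real assume "e > 0"
    then obtain N where N: "\<And>k j. k \<ge> N \<Longrightarrow> j \<ge> k \<Longrightarrow> opdist_le (x j) (push h k j (x k)) e"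
      using x unfolding seqs_iff by blast
    obtain p where p: "p \<ge> N" "push h N p (x N) \<in> D p" using absorb[OF fin] by blast
    have "opdist_le (x j) (y j) e" if "j \<ge> p" for j
    proof -
      have "ok N j" using push_D[OF that p(2)] push_push[OF p(1) that, of h "x N"] p(1) that by (simp add: ok_def)
      then show ?thesis using best[of N j] N[of "best j" j] by (auto simp: y_def ok_def)
    qed
    then show "\<exists>N. \<forall>k\<ge>N. opdist_le (x k) (y k) e" by blast
  qed
  have "y \<in> seqs" by (rule seqs_close[OF x _ xy]) (use yD D_sub in blast)
  then show ?thesis using yD xy by blast
qed

lemma constant_seq:
  assumes a: "a \<in> fin_mat (I k)"
  shows "(\<lambda>j. if j < k then mzero else push h k j a) \<in> seqs"
  unfolding seqs_iff
proof (intro conjI allI impI)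
  show "(if j < k then mzero else push h k j a) \<in> fin_mat (I j)" for j
    using a mzero_fin_mat push_fin_mat by auto
  fix e :: real assume e: "e > 0"
  have "opdist_le (if j' < k then mzero else push h k j' a) (push h j j' (if j < k then mzero else push h k j a)) e"
    if "j \<ge> k" "j' \<ge> j" for j j'
    using that opdist_le_refl[of e] e by (simp add: push_push)
  then show "\<exists>N. \<forall>j\<ge>N. \<forall>j'\<ge>j. opdist_le (if j' < k then mzero else push h k j' a)
      (push h j j' (if j < k then mzero else push h k j a)) e" by blast
qed

lemma lim_map_cls: "lim_map I h k a = cls (\<lambda>j. if j < k then mzero else push h k j a)"
  unfolding lim_map_def cls_def push_def ..

end

lemma strict_mono_ge: "strict_mono f \<Longrightarrow> i \<le> f (i :: nat)"
  by (rule strict_mono_imp_increasing)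

text \<open>The step reached at level \<open>j\<close> when maps are available at the levels
  \<open>l 0 < l 1 < ...\<close> only.\<close>

definition last_below :: "(nat \<Rightarrow> nat) \<Rightarrow> nat \<Rightarrow> nat" where
  "last_below l j = (GREATEST i. l i \<le> j)"

lemma last_below:
  assumes l: "strict_mono l" and i: "l i \<le> j"
  shows "l (last_below l j) \<le> j" "i \<le> last_below l j"
proof -
  have b: "i \<le> j" if "l i \<le> j" for i using strict_mono_ge[OF l, of i] that by simp
  show "l (last_below l j) \<le> j" unfolding last_below_def using GreatestI_nat[of "\<lambda>i. l i \<le> j" i j] i b by blast
  show "i \<le> last_below l j" unfolding last_below_def using Greatest_le_nat[of "\<lambda>i. l i \<le> j" i j] i b by blast
qed

lemma last_below_self:
  assumes "strict_mono l"
  shows "last_below l (l i) = i"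
  using last_below[OF assms, of i "l i"] assms by (simp add: strict_mono_less_eq)

section \<open>Maps of limits induced by compatible maps of levels\<close>

locale system_morphism = S: T3_system I h J c + S': T3_system I' h' J' c'
  for I h and J :: "nat \<Rightarrow> 'j set" and c and I' h' and J' :: "nat \<Rightarrow> 'k set" and c' +
  fixes lev lev' :: "nat \<Rightarrow> nat" and \<alpha> :: "nat \<Rightarrow> (nat \<times> 'j, nat \<times> 'j) cmat \<Rightarrow> (nat \<times> 'k, nat \<times> 'k) cmat"
  assumes lev: "strict_mono lev" and lev': "strict_mono lev'"
    and \<alpha>_class: "\<exists>a. has_class (J (lev i)) (J' (lev' i)) (\<alpha> i) a"
    and \<alpha>_compat: "x \<in> S.D (lev i) \<Longrightarrow> \<alpha> (Suc i) (push h (lev i) (lev (Suc i)) x) = push h' (lev' i) (lev' (Suc i)) (\<alpha> i x)"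
begin

lemma lev_mono: "i \<le> i' \<Longrightarrow> lev i \<le> lev i'" and lev'_mono: "i \<le> i' \<Longrightarrow> lev' i \<le> lev' i'"
  using lev lev' by (auto simp: strict_mono_less_eq)

lemma \<alpha>_extendible: "star_extendible (T3_alg (J (lev i))) (T3_alg (J' (lev' i))) (\<alpha> i)"
  using \<alpha>_class has_class_star_extendible S.finite_J S'.finite_J by blast

lemma \<alpha>_D: "x \<in> S.D (lev i) \<Longrightarrow> \<alpha> i x \<in> S'.D (lev' i)"
  using \<alpha>_extendible[of i] unfolding star_extendible_def star_hom_def T3_alg_def fin_mat_alg_def by auto

lemma \<alpha>_contractive:
  assumes "x \<in> S.D (lev i)" "y \<in> S.D (lev i)" "C \<ge> 0" "opdist_le x y C"
  shows "opdist_le (\<alpha> i x) (\<alpha> i y) C"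
  using \<alpha>_class[of i] has_class_contractive[OF S.finite_J S'.finite_J _ assms] by blast

lemma \<alpha>_compat_le:
  assumes "i \<le> i'" "x \<in> S.D (lev i)"
  shows "\<alpha> i' (push h (lev i) (lev i') x) = push h' (lev' i) (lev' i') (\<alpha> i x)"
  using assms(1)
proof (induction i' rule: dec_induct)
  case (step i')
  have le: "lev i \<le> lev i'" "lev i' \<le> lev (Suc i')" "lev' i \<le> lev' i'" "lev' i' \<le> lev' (Suc i')"
    using step by (auto intro: lev_mono lev'_mono)
  have "\<alpha> (Suc i') (push h (lev i) (lev (Suc i')) x) = \<alpha> (Suc i') (push h (lev i') (lev (Suc i')) (push h (lev i) (lev i') x))"
    using le by (simp add: push_push)
  also have "\<dots> = push h' (lev' i') (lev' (Suc i')) (push h' (lev' i) (lev' i') (\<alpha> i x))"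
    using \<alpha>_compat[OF S.push_D[OF le(1) assms(2)]] step by simp
  finally show ?case using le by (simp add: push_push)
qed simp

text \<open>At level \<open>j\<close> the latest \<open>\<alpha> i\<close> that lands at or before
  \<open>j\<close> is followed by a connecting map; before \<open>lev' 0\<close> there is none,
  hence the value \<open>mzero\<close>.\<close>

definition lift :: "(nat \<Rightarrow> (nat \<times> 'j, nat \<times> 'j) cmat) \<Rightarrow> nat \<Rightarrow> (nat \<times> 'k, nat \<times> 'k) cmat" where
  "lift x j = (if j < lev' 0 then mzero else
     push h' (lev' (last_below lev' j)) j (\<alpha> (last_below lev' j) (x (lev (last_below lev' j)))))"

lemma last:
  assumes "lev' i \<le> j"
  shows "lev' (last_below lev' j) \<le> j" "i \<le> last_below lev' j" "\<not> j < lev' 0"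
  using last_below[OF lev' assms] lev'_mono[of 0 i] assms by auto

lemma lift_D: "(\<And>k. x k \<in> S.D k) \<Longrightarrow> lift x j \<in> S'.D j"
  using mzero_fin_mat S'.push_D[OF last(1)[of 0 j] \<alpha>_D] by (auto simp: lift_def)

lemma lift_seqs:
  assumes x: "x \<in> S.seqs" and D: "\<And>k. x k \<in> S.D k"
  shows "lift x \<in> S'.seqs"
  unfolding S'.seqs_iff
proof (intro conjI allI impI)
  show "lift x j \<in> fin_mat (I' j)" for j by (rule S'.D_sub[OF lift_D[OF D]])
  fix e :: real assume e: "e > 0"
  then obtain N where N: "\<And>k j. k \<ge> N \<Longrightarrow> j \<ge> k \<Longrightarrow> opdist_le (x j) (push h k j (x k)) e"
    using x unfolding S.seqs_iff by blast
  have "opdist_le (lift x j) (push h' k j (lift x k)) e" if k: "k \<ge> lev' N" and j: "j \<ge> k" for k j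
  proof -
    define i where "i = last_below lev' k"
    define i' where "i' = last_below lev' j"
    have i: "lev' i \<le> k" "N \<le> i" "\<not> k < lev' 0" using last[OF k] by (auto simp: i_def)
    have i': "lev' i' \<le> j" "i \<le> i'" "\<not> j < lev' 0" using last[of i j] i j by (auto simp: i'_def)
    note le = lev_mono[OF i'(2)] lev'_mono[OF i'(2)]
    have "push h' k j (lift x k) = push h' (lev' i') j (push h' (lev' i) (lev' i') (\<alpha> i (x (lev i))))"
      using i i' j le by (simp add: lift_def i_def[symmetric] push_push)
    also have "\<dots> = push h' (lev' i') j (\<alpha> i' (push h (lev i) (lev i') (x (lev i))))"
      using \<alpha>_compat_le[OF i'(2) D] by simp
    finally have eq: "push h' k j (lift x k) = push h' (lev' i') j (\<alpha> i' (push h (lev i) (lev i') (x (lev i))))" .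
    have "opdist_le (x (lev i')) (push h (lev i) (lev i') (x (lev i))) e"
      using N[of "lev i" "lev i'"] le strict_mono_ge[OF lev, of i] i by simp
    then have "opdist_le (\<alpha> i' (x (lev i'))) (\<alpha> i' (push h (lev i) (lev i') (x (lev i)))) e"
      using D e le S.push_D by (intro \<alpha>_contractive) auto
    then have "opdist_le (push h' (lev' i') j (\<alpha> i' (x (lev i')))) (push h' (lev' i') j (\<alpha> i' (push h (lev i) (lev i') (x (lev i))))) e"
      using D e le i' S.push_D by (intro S'.push_contractive S'.D_sub \<alpha>_D) auto
    then show ?thesis unfolding eq using i' by (simp add: lift_def i'_def[symmetric])
  qed
  then show "\<exists>N. \<forall>k\<ge>N. \<forall>j\<ge>k. opdist_le (lift x j) (push h' k j (lift x k)) e" by blast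
qed

lemma lift_asym_eq:
  assumes D: "\<And>k. x k \<in> S.D k" "\<And>k. y k \<in> S.D k" and xy: "S.asym_eq x y"
  shows "S'.asym_eq (lift x) (lift y)"
  unfolding S'.asym_eq_def
proof (intro allI impI)
  fix e :: real assume e: "e > 0"
  obtain N where N: "\<And>k. k \<ge> N \<Longrightarrow> opdist_le (x k) (y k) e" using S.asym_eqE[OF xy e] by blast
  have "opdist_le (lift x j) (lift y j) e" if j: "j \<ge> lev' N" for j
  proof -
    define i where "i = last_below lev' j"
    have i: "lev' i \<le> j" "N \<le> i" "\<not> j < lev' 0" using last[OF j] by (auto simp: i_def)
    have "opdist_le (x (lev i)) (y (lev i)) e" using N strict_mono_ge[OF lev, of i] i by simp
    then have "opdist_le (push h' (lev' i) j (\<alpha> i (x (lev i)))) (push h' (lev' i) j (\<alpha> i (y (lev i)))) e"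
      using D e i by (intro S'.push_contractive S'.D_sub \<alpha>_D \<alpha>_contractive) auto
    then show ?thesis using i by (simp add: lift_def i_def[symmetric])
  qed
  then show "\<exists>N. \<forall>k\<ge>N. opdist_le (lift x k) (lift y k) e" by blast
qed

text \<open>The maps \<open>\<alpha> i\<close> are controlled on the finite blocks only, so a
  representative inside the blocks is chosen; \<open>lift_asym_eq\<close> makes the result
  independent of the choice.\<close>

definition limit_map :: "(nat \<Rightarrow> (nat \<times> 'j, nat \<times> 'j) cmat) set \<Rightarrow> (nat \<Rightarrow> (nat \<times> 'k, nat \<times> 'k) cmat) set" where
  "limit_map X = S'.cls (lift (SOME x. x \<in> S.seqs \<and> (\<forall>k. x k \<in> S.D k) \<and> S.cls x = X))"

lemma limit_map_cls:
  assumes "x \<in> S.seqs" "\<And>k. x k \<in> S.D k"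
  shows "limit_map (S.cls x) = S'.cls (lift x)"
proof -
  let ?P = "\<lambda>y. y \<in> S.seqs \<and> (\<forall>k. y k \<in> S.D k) \<and> S.cls y = S.cls x"
  have y: "?P (SOME y. ?P y)" by (rule someI[of ?P x]) (use assms in auto)
  then have "S.asym_eq (SOME y. ?P y) x" using assms S.cls_eq_iff by blast
  then show ?thesis unfolding limit_map_def using y assms
    by (subst S'.cls_eq_iff) (auto intro: lift_seqs lift_asym_eq)
qed

lemma carrier_good:
  assumes "X \<in> sa_carrier S.A"
  obtains x where "x \<in> S.seqs" "\<And>k. x k \<in> S.D k" "X = S.cls x"
proof -
  obtain y where y: "y \<in> S.seqs" "X = S.cls y" using assms S.carrier_eq by blast
  obtain x where "x \<in> S.seqs" "\<forall>k. x k \<in> S.D k" "S.asym_eq y x" using S.good_representative[OF y(1)] by blast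
  then show ?thesis using that[of x] y S.cls_eq_iff by blast
qed

lemma lift_hom:
  assumes D: "\<And>k. x k \<in> S.D k" "\<And>k. y k \<in> S.D k"
  shows "lift (\<lambda>k i j. x k i j + y k i j) = (\<lambda>k i j. lift x k i j + lift y k i j)"
    and "lift (\<lambda>k. mmult (x k) (y k)) = (\<lambda>k. mmult (lift x k) (lift y k))"
    and "lift (\<lambda>k i j. a * x k i j) = (\<lambda>k i j. a * lift x k i j)"
    and "lift (\<lambda>k. madj (x k)) = (\<lambda>k. madj (lift x k))"
proof -
  have hom: "star_hom (fin_mat_alg (T3_idx (J (lev i)))) (fin_mat_alg (T3_idx (J' (lev' i)))) (\<alpha> i)" for i
    using \<alpha>_extendible[of i] by (simp add: star_extendible_def T3_alg_def)
  have \<alpha>: "\<alpha> i (\<lambda>p q. x k p q + y k p q) = (\<lambda>p q. \<alpha> i (x k) p q + \<alpha> i (y k) p q)"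
    "\<alpha> i (mmult (x k) (y k)) = mmult (\<alpha> i (x k)) (\<alpha> i (y k))"
    "\<alpha> i (\<lambda>p q. a * x k p q) = (\<lambda>p q. a * \<alpha> i (x k) p q)"
    "\<alpha> i (madj (x k)) = madj (\<alpha> i (x k))"
    "\<alpha> i (x k) \<in> fin_mat (I' (lev' i))" "\<alpha> i (y k) \<in> fin_mat (I' (lev' i))" if "k = lev i" for i k
    using hom[of i] D[of k] that S'.D_sub[OF \<alpha>_D] unfolding star_hom_def fin_mat_alg_def by auto
  have le: "lev' (last_below lev' j) \<le> j" if "\<not> j < lev' 0" for j using last(1)[of 0 j] that by simp
  have "lift (\<lambda>k i j. x k i j + y k i j) j = (\<lambda>p q. lift x j p q + lift y j p q)" for j
    unfolding lift_def using le[of j] by (auto simp: \<alpha> S'.push_add mzero_def)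
  then show "lift (\<lambda>k i j. x k i j + y k i j) = (\<lambda>k i j. lift x k i j + lift y k i j)" by (rule ext)
  have "lift (\<lambda>k. mmult (x k) (y k)) j = mmult (lift x j) (lift y j)" for j
    unfolding lift_def using le[of j] by (auto simp: \<alpha> S'.push_mult) (simp add: mmult_def mzero_def)
  then show "lift (\<lambda>k. mmult (x k) (y k)) = (\<lambda>k. mmult (lift x k) (lift y k))" by (rule ext)
  have "lift (\<lambda>k i j. a * x k i j) j = (\<lambda>p q. a * lift x j p q)" for j
    unfolding lift_def using le[of j] by (auto simp: \<alpha> S'.push_scale mzero_def)
  then show "lift (\<lambda>k i j. a * x k i j) = (\<lambda>k i j. a * lift x k i j)" by (rule ext)
  have "lift (\<lambda>k. madj (x k)) j = madj (lift x j)" for j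
    unfolding lift_def using le[of j] by (auto simp: \<alpha> S'.push_star) (simp add: madj_def mzero_def)
  then show "lift (\<lambda>k. madj (x k)) = (\<lambda>k. madj (lift x k))" by (rule ext)
qed

lemma limit_map_hom: "star_hom S.A S'.A limit_map"
  unfolding star_hom_def
proof (intro conjI ballI allI)
  fix X assume X: "X \<in> sa_carrier S.A"
  obtain x where x: "x \<in> S.seqs" "\<And>k. x k \<in> S.D k" "X = S.cls x" using carrier_good[OF X] by blast
  have Lx: "lift x \<in> S'.seqs" by (rule lift_seqs[OF x(1,2)])
  show "limit_map X \<in> sa_carrier S'.A" unfolding x(3) limit_map_cls[OF x(1,2)] S'.carrier_eq using Lx by blast
  show "limit_map (sa_scale S.A a X) = sa_scale S'.A a (limit_map X)" for a
  proof -
    have "(\<lambda>i j. a * x k i j) \<in> S.D k" for k by (rule fin_mat_scale[OF x(2)])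
    then show ?thesis unfolding x(3) S.scale_cls[OF x(1)] limit_map_cls[OF x(1,2)] S'.scale_cls[OF Lx]
      using limit_map_cls[OF S.seqs_scale[OF x(1)]] lift_hom(3)[of x x a] x(2) by simp
  qed
  show "limit_map (sa_star S.A X) = sa_star S'.A (limit_map X)"
  proof -
    have "madj (x k) \<in> S.D k" for k by (rule fin_mat_madj[OF x(2)])
    then show ?thesis unfolding x(3) S.star_cls[OF x(1)] limit_map_cls[OF x(1,2)] S'.star_cls[OF Lx]
      using limit_map_cls[OF S.seqs_star[OF x(1)]] lift_hom(4)[of x x] x(2) by simp
  qed
  fix Y assume Y: "Y \<in> sa_carrier S.A"
  obtain y where y: "y \<in> S.seqs" "\<And>k. y k \<in> S.D k" "Y = S.cls y" using carrier_good[OF Y] by blast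
  have Ly: "lift y \<in> S'.seqs" by (rule lift_seqs[OF y(1,2)])
  show "limit_map (sa_add S.A X Y) = sa_add S'.A (limit_map X) (limit_map Y)"
  proof -
    have "(\<lambda>i j. x k i j + y k i j) \<in> S.D k" for k by (rule fin_mat_add[OF x(2) y(2)])
    then show ?thesis unfolding x(3) y(3) S.add_cls[OF x(1) y(1)] limit_map_cls[OF x(1,2)] limit_map_cls[OF y(1,2)] S'.add_cls[OF Lx Ly]
      using limit_map_cls[OF S.seqs_add[OF x(1) y(1)]] lift_hom(1)[of x y] x(2) y(2) by simp
  qed
  show "limit_map (sa_mult S.A X Y) = sa_mult S'.A (limit_map X) (limit_map Y)"
  proof -
    have "mmult (x k) (y k) \<in> S.D k" for k by (rule fin_mat_mmult[OF x(2) y(2)])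
    then show ?thesis unfolding x(3) y(3) S.mult_cls[OF x(1) y(1)] limit_map_cls[OF x(1,2)] limit_map_cls[OF y(1,2)] S'.mult_cls[OF Lx Ly]
      using limit_map_cls[OF S.seqs_mult[OF x(1) y(1)]] lift_hom(2)[of x y] x(2) y(2) by simp
  qed
qed

text \<open>A constant sequence is lifted to one that from level \<open>lev' k\<close> on is the
  constant sequence of \<open>b\<close>, and \<open>b\<close> is triangular because
  \<open>\<alpha> k\<close> is star-extendible.\<close>

lemma limit_map_alg: "limit_map ` alg_lim I h (\<lambda>k. T3 (J k)) \<subseteq> alg_lim I' h' (\<lambda>k. T3 (J' k))"
proof
  fix Y assume "Y \<in> limit_map ` alg_lim I h (\<lambda>k. T3 (J k))"
  then obtain k a where a: "a \<in> T3 (J k)" and Y: "Y = limit_map (lim_map I h k a)" by (auto simp: alg_lim_def)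
  let ?x = "\<lambda>j. if j < k then mzero else push h k j a"
  have aD: "a \<in> S.D k" using a by (rule S.T3_D)
  have x: "?x \<in> S.seqs" by (rule S.constant_seq[OF S.D_sub[OF aD]])
  have xD: "?x j \<in> S.D j" for j using aD mzero_fin_mat S.push_D by auto
  \<comment> \<open>Since \<open>k \<le> lev k\<close>, the element can be moved to the level where
    \<open>\<alpha> k\<close> starts.\<close>
  define b where "b = \<alpha> k (push h k (lev k) a)"
  have k: "k \<le> lev k" by (rule strict_mono_ge[OF lev])
  have "push h k (lev k) a \<in> T3 (J (lev k))" by (rule S.push_T3[OF k a])
  then have b: "b \<in> T3 (J' (lev' k))"
    using \<alpha>_extendible[of k] unfolding b_def star_extendible_def T3_alg_def by auto
  let ?y = "\<lambda>j. if j < lev' k then mzero else push h' (lev' k) j b"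
  have y: "?y \<in> S'.seqs" by (rule S'.constant_seq[OF S'.D_sub[OF S'.T3_D[OF b]]])
  have "lift ?x j = ?y j" if j: "lev' k \<le> j" for j
  proof -
    define i where "i = last_below lev' j"
    have i: "lev' i \<le> j" "k \<le> i" "\<not> j < lev' 0" using last[OF j] by (auto simp: i_def)
    note le = lev_mono[OF i(2)] lev'_mono[OF i(2)]
    have "lift ?x j = push h' (lev' i) j (\<alpha> i (push h (lev k) (lev i) (push h k (lev k) a)))"
      using i le k by (simp add: lift_def i_def[symmetric] push_push)
    also have "\<dots> = push h' (lev' i) j (push h' (lev' k) (lev' i) b)"
      unfolding b_def using \<alpha>_compat_le[OF i(2) S.push_D[OF k aD]] by simp
    finally show ?thesis using j i le by (simp add: push_push)
  qed
  then have "S'.asym_eq (lift ?x) ?y"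
    unfolding S'.asym_eq_def using opdist_le_refl[OF less_imp_le] by (intro allI impI exI[of _ "lev' k"]) simp
  then have "Y = lim_map I' h' (lev' k) b"
    unfolding Y S.lim_map_cls S'.lim_map_cls limit_map_cls[OF x xD]
    using S'.cls_eq_iff[OF lift_seqs[OF x xD] y] by blast
  then show "Y \<in> alg_lim I' h' (\<lambda>k. T3 (J' k))" using b unfolding alg_lim_def by blast
qed

end

text \<open>A zigzag: \<open>\<alpha> i\<close> leads from \<open>lev i\<close> to
  \<open>lev' i\<close>, and \<open>\<beta> i\<close> leads back to \<open>lev (Suc i)\<close>,
  which explains the shifted levels of the backward morphism. The triangles commute exactly.\<close>

locale intertwining = M: system_morphism I h J c I' h' J' c' lev lev' \<alpha> +
    M': system_morphism I' h' J' c' I h J c lev' "lev \<circ> Suc" \<beta>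
  for I h and J :: "nat \<Rightarrow> 'j set" and c and I' h' and J' :: "nat \<Rightarrow> 'k set" and c' and lev lev' \<alpha> \<beta> +
  assumes \<beta>\<alpha>: "x \<in> M.S.D (lev i) \<Longrightarrow> \<beta> i (\<alpha> i x) = push h (lev i) (lev (Suc i)) x"
    and \<alpha>\<beta>: "y \<in> M.S'.D (lev' i) \<Longrightarrow> \<alpha> (Suc i) (\<beta> i y) = push h' (lev' i) (lev' (Suc i)) y"
begin

text \<open>At level \<open>j\<close> the round trip is the image of \<open>x (lev i)\<close> under
  the connecting map, for the last \<open>i\<close> with \<open>lev (Suc i) \<le> j\<close>; a
  compatible sequence is asymptotically equal to this.\<close>

lemma lift_lift:
  assumes x: "x \<in> M.S.seqs" "\<And>k. x k \<in> M.S.D k"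
  shows "M.S.asym_eq (M'.lift (M.lift x)) x"
  unfolding M.S.asym_eq_def
proof (intro allI impI)
  fix e :: real assume "e > 0"
  then obtain N where N: "\<And>k j. k \<ge> N \<Longrightarrow> j \<ge> k \<Longrightarrow> opdist_le (x j) (push h k j (x k)) e"
    using x unfolding M.S.seqs_iff by blast
  have "opdist_le (M'.lift (M.lift x) j) (x j) e" if j: "j \<ge> lev (Suc N)" for j
  proof -
    define i where "i = last_below (lev \<circ> Suc) j"
    have i: "lev (Suc i) \<le> j" "N \<le> i" "\<not> j < lev (Suc 0)" using M'.last[of N j] j by (auto simp: i_def)
    have "M.lift x (lev' i) = \<alpha> i (x (lev i))"
      using M.lev'_mono[of 0 i] by (simp add: M.lift_def last_below_self[OF M.lev'])
    then have "M'.lift (M.lift x) j = push h (lev (Suc i)) j (push h (lev i) (lev (Suc i)) (x (lev i)))"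
      using i by (simp add: M'.lift_def i_def[symmetric] \<beta>\<alpha>[OF x(2)])
    also have "\<dots> = push h (lev i) j (x (lev i))" using i M.lev_mono[of i "Suc i"] by (simp add: push_push)
    finally have eq: "M'.lift (M.lift x) j = push h (lev i) j (x (lev i))" .
    show ?thesis unfolding eq
      using N[of "lev i" j] strict_mono_ge[OF M.lev, of i] i M.lev_mono[of i "Suc i"] by (intro opdist_le_sym[of "x j" "push h (lev i) j (x (lev i))"]) auto
  qed
  then show "\<exists>N. \<forall>k\<ge>N. opdist_le (M'.lift (M.lift x) k) (x k) e" by blast
qed

lemma lift_lift':
  assumes y: "y \<in> M.S'.seqs" "\<And>k. y k \<in> M.S'.D k"
  shows "M.S'.asym_eq (M.lift (M'.lift y)) y"
  unfolding M.S'.asym_eq_def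
proof (intro allI impI)
  fix e :: real assume "e > 0"
  then obtain N where N: "\<And>k j. k \<ge> N \<Longrightarrow> j \<ge> k \<Longrightarrow> opdist_le (y j) (push h' k j (y k)) e"
    using y unfolding M.S'.seqs_iff by blast
  have "opdist_le (M.lift (M'.lift y) j) (y j) e" if j: "j \<ge> lev' (Suc N)" for j
  proof -
    \<comment> \<open>The bound \<open>j \<ge> lev' (Suc N)\<close> makes the last step a successor,
      so that there is a \<open>\<beta> i\<close> before \<open>\<alpha> (Suc i)\<close>.\<close>
    obtain i where i': "last_below lev' j = Suc i" and N': "N \<le> i"
      using M.last(2)[OF j] by (cases "last_below lev' j") auto
    have i: "lev' (Suc i) \<le> j" "\<not> j < lev' 0" using M.last[OF j] i' by auto
    have "M'.lift y (lev (Suc i)) = \<beta> i (y (lev' i))"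
      using M.lev_mono[of "Suc 0" "Suc i"] last_below_self[OF M'.lev', of i] by (simp add: M'.lift_def)
    then have "M.lift (M'.lift y) j = push h' (lev' (Suc i)) j (push h' (lev' i) (lev' (Suc i)) (y (lev' i)))"
      using i by (simp add: M.lift_def i' \<alpha>\<beta>[OF y(2)])
    also have "\<dots> = push h' (lev' i) j (y (lev' i))" using i M.lev'_mono[of i "Suc i"] by (simp add: push_push)
    finally have eq: "M.lift (M'.lift y) j = push h' (lev' i) j (y (lev' i))" .
    show ?thesis unfolding eq
      using N[of "lev' i" j] strict_mono_ge[OF M.lev', of i] i N' M.lev'_mono[of i "Suc i"] by (intro opdist_le_sym[of "y j" "push h' (lev' i) j (y (lev' i))"]) auto
  qed
  then show "\<exists>N. \<forall>k\<ge>N. opdist_le (M.lift (M'.lift y) k) (y k) e" by blast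
qed

lemma limits_isomorphic:
  "star_ext_isomorphic (cstar_lim I h, alg_lim I h (\<lambda>k. T3 (J k))) (cstar_lim I' h', alg_lim I' h' (\<lambda>k. T3 (J' k)))"
proof -
  have inv: "M'.limit_map (M.limit_map X) = X" if X: "X \<in> sa_carrier M.S.A" for X
  proof -
    obtain x where x: "x \<in> M.S.seqs" "\<And>k. x k \<in> M.S.D k" "X = M.S.cls x" using M.carrier_good[OF X] by blast
    note Lx = M.lift_seqs[OF x(1,2)] M.lift_D[OF x(2)]
    show ?thesis unfolding x(3) M.limit_map_cls[OF x(1,2)] M'.limit_map_cls[OF Lx]
      using M.S.cls_eq_iff[OF M'.lift_seqs[OF Lx] x(1)] lift_lift[OF x(1,2)] by blast
  qed
  have inv': "M.limit_map (M'.limit_map X) = X" if X: "X \<in> sa_carrier M.S'.A" for X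
  proof -
    obtain x where x: "x \<in> M.S'.seqs" "\<And>k. x k \<in> M.S'.D k" "X = M.S'.cls x" using M'.carrier_good[OF X] by blast
    note Lx = M'.lift_seqs[OF x(1,2)] M'.lift_D[OF x(2)]
    show ?thesis unfolding x(3) M'.limit_map_cls[OF x(1,2)] M.limit_map_cls[OF Lx]
      using M.S'.cls_eq_iff[OF M.lift_seqs[OF Lx] x(1)] lift_lift'[OF x(1,2)] by blast
  qed
  have car: "M.limit_map X \<in> sa_carrier M.S'.A" if "X \<in> sa_carrier M.S.A" for X
    using M.limit_map_hom that unfolding star_hom_def by blast
  have car': "M'.limit_map X \<in> sa_carrier M.S.A" if "X \<in> sa_carrier M.S'.A" for X
    using M'.limit_map_hom that unfolding star_hom_def by blast
  have "bij_betw M.limit_map (sa_carrier M.S.A) (sa_carrier M.S'.A)"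
    by (rule bij_betw_byWitness[where f' = M'.limit_map]) (use inv inv' car car' in auto)
  then have iso: "star_iso M.S.A M.S'.A M.limit_map" unfolding star_iso_def using M.limit_map_hom by blast
  have "alg_lim I' h' (\<lambda>k. T3 (J' k)) \<subseteq> sa_carrier M.S'.A"
    unfolding alg_lim_def M.S'.carrier_eq M.S'.lim_map_cls
    using M.S'.constant_seq[OF M.S'.D_sub[OF M.S'.T3_D]] by auto
  then have "X \<in> M.limit_map ` alg_lim I h (\<lambda>k. T3 (J k))" if "X \<in> alg_lim I' h' (\<lambda>k. T3 (J' k))" for X
    using inv'[of X, symmetric] M'.limit_map_alg that by (intro image_eqI[of X _ "M'.limit_map X"]) auto
  then have "M.limit_map ` alg_lim I h (\<lambda>k. T3 (J k)) = alg_lim I' h' (\<lambda>k. T3 (J' k))"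
    using M.limit_map_alg by blast
  then show ?thesis unfolding star_ext_isomorphic_def using iso by auto
qed

end

section \<open>Exact intertwinings from isomorphisms of dimension modules\<close>

locale T3_system_pair = S: T3_system I h J c + S': T3_system I' h' J' c'
  for I h and J :: "nat \<Rightarrow> 'j set" and c and I' h' and J' :: "nat \<Rightarrow> 'k set" and c'
begin

text \<open>\<open>F'\<close> undoes \<open>F\<close> on the unit, so the product of
  \<open>b1\<close> and \<open>a\<close> agrees with the unit of level \<open>k\<close> in the
  limit, hence as multisets at a late level. There \<open>has_class_lift\<close> turns equality of
  classes into a commuting triangle.\<close>

lemma next_map:
  fixes G :: "nat \<Rightarrow> omap multiset \<Rightarrow> 'x" and G' :: "nat \<Rightarrow> omap multiset \<Rightarrow> 'y"
  assumes G_eq: "\<And>k m l m'. G k m = G l m' \<longleftrightarrow> lim_rel c k m l m'"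
    and F'_G: "\<And>l k b m. F' (G' l {#1#}) = G k b \<Longrightarrow> F' (G' l m) = G k (mprod b m)"
    and inv: "F' (F (G k {#1#})) = G k {#1#}"
    and size: "\<exists>k b. F' (G' l {#1#}) = G k b \<and> (\<forall>t\<in>{1..3}. card (J' l) * wt t b \<le> card (J k))"
    and \<alpha>: "has_class (J k) (J' l) \<alpha> a" "F (G k {#1#}) = G' l a"
  shows "\<exists>k' \<beta> b. k < k' \<and> has_class (J' l) (J k') \<beta> b \<and> F' (G' l {#1#}) = G k' b \<and>
    (\<forall>x\<in>S.D k. \<beta> (\<alpha> x) = push h k k' x)"
proof -
  obtain k1 b1 where b1: "F' (G' l {#1#}) = G k1 b1" "\<And>t. t \<in> {1..3} \<Longrightarrow> card (J' l) * wt t b1 \<le> card (J k1)"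
    using size by blast
  have "G k1 (mprod b1 a) = G k {#1#}" using F'_G[OF b1(1), of a] inv \<alpha>(2) by simp
  then obtain p where p: "k1 \<le> p" "k \<le> p" "mprod (compose_from c k1 p) (mprod b1 a) = mprod (compose_from c k p) {#1#}"
    unfolding G_eq lim_rel_def by blast
  \<comment> \<open>One level beyond \<open>p\<close>, so that \<open>k < k'\<close> is strict and
    the levels of the zigzag increase.\<close>
  define k' where "k' = Suc p"
  define b where "b = mprod (compose_from c k1 k') b1"
  have k': "k1 \<le> k'" "k < k'" "k \<le> k'" using p by (auto simp: k'_def)
  have ba: "mprod b a = compose_from c k k'"
    using lim_rel_later[OF p(3,1,2), of k'] by (simp add: b_def k'_def mprod_assoc)
  have "G k1 b1 = G k' b" unfolding G_eq b_def by (rule lim_rel_push[OF k'(1)])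
  moreover have "card (J' l) * wt t b \<le> card (J k')" if "t \<in> {1..3}" for t
  proof -
    have "card (J' l) * wt t b \<le> card (J k1) * wt t (compose_from c k1 k')"
      unfolding b_def by (rule wt_mprod_le) (rule b1(2))
    also have "\<dots> \<le> card (J k')" by (rule has_class_size[OF S.finite_J S.finite_J S.push_class[OF k'(1)]])
    finally show ?thesis .
  qed
  then obtain \<beta> where "has_class (J' l) (J k') \<beta> b" "\<forall>x\<in>S.D k. \<beta> (\<alpha> x) = push h k k' x"
    using has_class_lift[OF S.finite_J S'.finite_J S.finite_J \<alpha>(1), of k' "push h k k'" b] S.push_class[OF k'(3)] ba by metis
  ultimately show ?thesis using k'(2) b1(1) by auto
qed

end

text \<open>\<open>P\<close> keeps a level map whose class is the image of the unit, and
  \<open>Q\<close> describes one turn of the zigzag; \<open>next_map\<close> in both directions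
  provides the turn, and dependent choice the sequence. The compatibility of the
  \<open>\<alpha> i\<close> and \<open>\<beta> i\<close> with the connecting maps follows from the
  two families of triangles.\<close>

lemma (in T3_system_pair) isomorphic_limits:
  fixes G :: "nat \<Rightarrow> omap multiset \<Rightarrow> 'x" and G' :: "nat \<Rightarrow> omap multiset \<Rightarrow> 'y"
  assumes G_eq: "\<And>k m l m'. G k m = G l m' \<longleftrightarrow> lim_rel c k m l m'"
    and G'_eq: "\<And>k m l m'. G' k m = G' l m' \<longleftrightarrow> lim_rel c' k m l m'"
    and F_G: "\<And>k l a m. F (G k {#1#}) = G' l a \<Longrightarrow> F (G k m) = G' l (mprod a m)"
    and F'_G: "\<And>l k b m. F' (G' l {#1#}) = G k b \<Longrightarrow> F' (G' l m) = G k (mprod b m)"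
    and inv: "\<And>k. F' (F (G k {#1#})) = G k {#1#}" and inv': "\<And>l. F (F' (G' l {#1#})) = G' l {#1#}"
    and size: "\<And>k. \<exists>l a. F (G k {#1#}) = G' l a \<and> (\<forall>t\<in>{1..3}. card (J k) * wt t a \<le> card (J' l))"
    and size': "\<And>l. \<exists>k b. F' (G' l {#1#}) = G k b \<and> (\<forall>t\<in>{1..3}. card (J' l) * wt t b \<le> card (J k))"
  shows "star_ext_isomorphic (cstar_lim I h, alg_lim I h (\<lambda>k. T3 (J k))) (cstar_lim I' h', alg_lim I' h' (\<lambda>k. T3 (J' k)))"
proof -
  interpret flip: T3_system_pair I' h' J' c' I h J c by unfold_locales
  define P where "P s \<longleftrightarrow> (case s of (k, l, \<alpha>) \<Rightarrow> \<exists>a. has_class (J k) (J' l) \<alpha> a \<and> F (G k {#1#}) = G' l a)"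
    for s :: "nat \<times> nat \<times> ((nat \<times> 'j, nat \<times> 'j) cmat \<Rightarrow> (nat \<times> 'k, nat \<times> 'k) cmat)"
  define Q where "Q s s' \<longleftrightarrow> (case s of (k, l, \<alpha>) \<Rightarrow> case s' of (k', l', \<alpha>') \<Rightarrow>
    k < k' \<and> l < l' \<and> (\<exists>\<beta> b. has_class (J' l) (J k') \<beta> b \<and> (\<forall>x\<in>S.D k. \<beta> (\<alpha> x) = push h k k' x) \<and>
      (\<forall>y\<in>S'.D l. \<alpha>' (\<beta> y) = push h' l l' y)))"
    for s s' :: "nat \<times> nat \<times> ((nat \<times> 'j, nat \<times> 'j) cmat \<Rightarrow> (nat \<times> 'k, nat \<times> 'k) cmat)"
  have "\<exists>s. P s"
  proof -
    obtain l a where a: "F (G 0 {#1#}) = G' l a" "\<And>t. t \<in> {1..3} \<Longrightarrow> card (J 0) * wt t a \<le> card (J' l)"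
      using size by blast
    obtain \<alpha> where "has_class (J 0) (J' l) \<alpha> a" using has_class_exists[OF S.finite_J S'.finite_J a(2)] by blast
    then have "P (0, l, \<alpha>)" using a(1) by (auto simp: P_def)
    then show ?thesis by blast
  qed
  moreover have "\<exists>s'. P s' \<and> Q s s'" if s: "P s" for s
  proof -
    obtain k l \<alpha> where kl: "s = (k, l, \<alpha>)" by (metis surj_pair)
    then obtain a where a: "has_class (J k) (J' l) \<alpha> a" "F (G k {#1#}) = G' l a" using s by (auto simp: P_def)
    obtain k' \<beta> b where b: "k < k'" "has_class (J' l) (J k') \<beta> b" "F' (G' l {#1#}) = G k' b"
      "\<forall>x\<in>S.D k. \<beta> (\<alpha> x) = push h k k' x"
      using next_map[where G = G and G' = G' and F = F and F' = F' and l = l, OF G_eq F'_G inv size' a] by blast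
    obtain l' \<alpha>' a' where a': "l < l'" "has_class (J k') (J' l') \<alpha>' a'" "F (G k' {#1#}) = G' l' a'"
      "\<forall>y\<in>S'.D l. \<alpha>' (\<beta> y) = push h' l l' y"
      using flip.next_map[where G = G' and G' = G and F = F' and F' = F and l = k', OF G'_eq F_G inv' size b(2,3)] by blast
    have "P (k', l', \<alpha>')" "Q s (k', l', \<alpha>')" using a' b by (auto simp: P_def Q_def kl)
    then show ?thesis by blast
  qed
  ultimately obtain f where f: "\<And>i. P (f i)" "\<And>i. Q (f i) (f (Suc i))"
    using dependent_nat_choice[of "\<lambda>_ s. P s" "\<lambda>_ s s'. Q s s'"] by blast
  define lev where "lev i = fst (f i)" for i
  define lev' where "lev' i = fst (snd (f i))" for i
  define \<alpha> where "\<alpha> i = snd (snd (f i))" for i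
  have fi: "f i = (lev i, lev' i, \<alpha> i)" for i by (simp add: lev_def lev'_def \<alpha>_def)
  have cl: "\<exists>a. has_class (J (lev i)) (J' (lev' i)) (\<alpha> i) a" for i using f(1)[of i] by (auto simp: P_def fi)
  have mono: "strict_mono lev" "strict_mono lev'" using f(2) by (auto simp: strict_mono_Suc_iff Q_def fi)
  have "\<forall>i. \<exists>\<beta>. (\<exists>b. has_class (J' (lev' i)) (J (lev (Suc i))) \<beta> b) \<and>
      (\<forall>x\<in>S.D (lev i). \<beta> (\<alpha> i x) = push h (lev i) (lev (Suc i)) x) \<and>
      (\<forall>y\<in>S'.D (lev' i). \<alpha> (Suc i) (\<beta> y) = push h' (lev' i) (lev' (Suc i)) y)"
    using f(2) by (auto simp: Q_def fi)
  then obtain \<beta> where \<beta>: "\<And>i. \<exists>b. has_class (J' (lev' i)) (J (lev (Suc i))) (\<beta> i) b"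
    "\<And>i x. x \<in> S.D (lev i) \<Longrightarrow> \<beta> i (\<alpha> i x) = push h (lev i) (lev (Suc i)) x"
    "\<And>i y. y \<in> S'.D (lev' i) \<Longrightarrow> \<alpha> (Suc i) (\<beta> i y) = push h' (lev' i) (lev' (Suc i)) y"
    by metis
  have \<alpha>D: "\<alpha> i x \<in> S'.D (lev' i)" if "x \<in> S.D (lev i)" for i x
    using cl[of i] has_class_fin_mat[OF S.finite_J S'.finite_J _ that] by blast
  have \<beta>D: "\<beta> i y \<in> S.D (lev (Suc i))" if "y \<in> S'.D (lev' i)" for i y
    using \<beta>(1)[of i] has_class_fin_mat[OF S'.finite_J S.finite_J _ that] by blast
  interpret intertwining I h J c I' h' J' c' lev lev' \<alpha> \<beta>
  proof unfold_locales
    show "\<alpha> (Suc i) (push h (lev i) (lev (Suc i)) x) = push h' (lev' i) (lev' (Suc i)) (\<alpha> i x)"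
      if "x \<in> S.D (lev i)" for x i
      using \<beta>(2)[OF that] \<beta>(3)[OF \<alpha>D[OF that]] by simp
    show "\<beta> (Suc i) (push h' (lev' i) (lev' (Suc i)) y) = push h ((lev \<circ> Suc) i) ((lev \<circ> Suc) (Suc i)) (\<beta> i y)"
      if "y \<in> S'.D (lev' i)" for y i
      using \<beta>(3)[OF that] \<beta>(2)[OF \<beta>D[OF that]] by simp
    show "strict_mono (lev \<circ> Suc)" using mono(1) by (auto simp: strict_mono_def)
  qed (use mono cl \<beta> in auto)
  show ?thesis by (rule limits_isomorphic)
qed

text \<open>The sizes of the systems are kept apart from the \<open>N\<close> and \<open>N'\<close>
  of the modules, because one module serves both the plain and the stabilised system.\<close>

lemma (in two_limits) isomorphic_systems:
  assumes "T3_system I h J c" "T3_system I' h' J' c'"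
    and size: "\<And>k. \<exists>l a. F (G k {#1#}) = G' l a \<and> (\<forall>t\<in>{1..3}. card (J k) * wt t a \<le> card (J' l))"
    and size': "\<And>l. \<exists>k b. inv_into (dm_carrier M) F (G' l {#1#}) = G k b \<and> (\<forall>t\<in>{1..3}. card (J' l) * wt t b \<le> card (J k))"
  shows "star_ext_isomorphic (cstar_lim I h, alg_lim I h (\<lambda>k. T3 (J k))) (cstar_lim I' h', alg_lim I' h' (\<lambda>k. T3 (J' k)))"
proof -
  interpret S: T3_system I h J c by fact
  interpret S': T3_system I' h' J' c' by fact
  interpret T3_system_pair I h J c I' h' J' c' by unfold_locales
  interpret flip: two_limits M' c' N' G' M c N G "inv_into (dm_carrier M) F" by (rule flip)
  have bij: "bij_betw F (dm_carrier M) (dm_carrier M')" using iso by (simp add: dim_module_iso_def)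
  have mem: "G k m \<in> dm_carrier M" "G' k m \<in> dm_carrier M'" for k m using M.carrier M'.carrier by blast+
  show ?thesis
  proof (rule isomorphic_limits[OF M.G_eq M'.G_eq image_G flip.image_G _ _ size size'])
    show "inv_into (dm_carrier M) F (F (G k {#1#})) = G k {#1#}" for k
      using bij mem by (auto simp: bij_betw_def)
    show "F (inv_into (dm_carrier M) F (G' l {#1#})) = G' l {#1#}" for l
      using bij mem by (auto simp: bij_betw_def f_inv_into_f)
  qed auto
qed

section \<open>The plain and the stabilised limit as systems with finite blocks\<close>

lemma (in T3_system) lim_map_push:
  assumes "k \<le> p" "a \<in> fin_mat (I k)"
  shows "lim_map I h p (push h k p a) = lim_map I h k a"
proof -
  have "asym_eq (\<lambda>j. if j < p then mzero else push h p j (push h k p a)) (\<lambda>j. if j < k then mzero else push h k j a)"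
    unfolding asym_eq_def using assms(1) opdist_le_refl[OF less_imp_le]
    by (intro allI impI exI[of _ p]) (simp add: push_push)
  then show ?thesis unfolding lim_map_cls
    using cls_eq_iff[OF constant_seq[OF push_fin_mat[OF assms]] constant_seq[OF assms(2)]] by blast
qed

lemma has_class_star_hom:
  "finite J \<Longrightarrow> finite K \<Longrightarrow> has_class J K f m \<Longrightarrow> star_hom (fin_mat_alg (T3_idx J)) (fin_mat_alg (T3_idx K)) f"
  using has_class_star_extendible by (auto simp: star_extendible_def T3_alg_def)

context
  fixes n :: "nat \<Rightarrow> nat" and \<phi> and c
  assumes n: "\<And>k. n k \<ge> 1" and c: "\<And>k. has_class {..<n k} {..<n (Suc k)} (\<phi> k) (c k)"
begin

lemma T3_lim_system: "T3_system (\<lambda>k. T3_idx {..<n k}) \<phi> (\<lambda>k. {..<n k}) c"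
proof
  show "star_hom (fin_mat_alg (T3_idx {..<n k})) (fin_mat_alg (T3_idx {..<n (Suc k)})) (\<phi> k)" for k
    by (rule has_class_star_hom[OF _ _ c]) auto
  show "opdist_le (\<phi> k x) (\<phi> k y) C"
    if "x \<in> fin_mat (T3_idx {..<n k})" "y \<in> fin_mat (T3_idx {..<n k})" "0 \<le> C" "opdist_le x y C" for k x y C
    by (rule has_class_contractive[OF _ _ c]) (use that in auto)
  show "{..<n k} \<noteq> {}" for k using n[of k] by (auto simp: lessThan_empty_iff)
  show "\<exists>p\<ge>k. push \<phi> k p x \<in> fin_mat (T3_idx {..<n p})" if "x \<in> fin_mat (T3_idx {..<n k})" for k x
    using that by (intro exI[of _ k]) simp
qed (use c in auto)

lemma amp_class: "has_class ({..<n k} \<times> {..<p::nat}) ({..<n (Suc k)} \<times> {..<p}) (amp (\<phi> k)) (c k)"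
  by (rule has_class_amp[OF _ _ _ c]) auto

lemma stable_level:
  assumes "x \<in> fin_mat (T3_idx ({..<n k} \<times> (UNIV :: nat set)))"
  shows "\<exists>p. \<forall>q\<ge>p. x \<in> fin_mat (T3_idx ({..<n k} \<times> {..<q}))"
proof -
  obtain F where F: "finite F" "F \<subseteq> T3_idx ({..<n k} \<times> (UNIV :: nat set))" "x \<in> fin_mat F"
    using fin_mat_finite_support[OF assms] by blast
  obtain p where p: "snd ` F \<subseteq> {..<n k} \<times> {..<p}"
  proof -
    have "finite (snd ` F)" "snd ` F \<subseteq> {..<n k} \<times> UNIV" using F by (auto simp: T3_idx_def)
    then show thesis using bounded_second that by blast
  qed
  have "F \<subseteq> T3_idx ({..<n k} \<times> {..<q})" if "q \<ge> p" for q
    using p F(2) that by (fastforce simp: mem_T3_idx)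
  then show ?thesis using F(3) fin_mat_mono by blast
qed

text \<open>Every identity or estimate involves at most two matrices, which lie in a common finite
  corner where \<open>amp_class\<close> applies. The second factor \<open>{..<Suc k}\<close> grows,
  so everything is absorbed, and \<open>Suc\<close> keeps level 0 nonempty.\<close>

lemma T3_lim_stab_system:
  "T3_system (\<lambda>k. T3_idx ({..<n k} \<times> (UNIV :: nat set))) (\<lambda>k. amp (\<phi> k)) (\<lambda>k. {..<n k} \<times> {..<Suc k}) c"
proof
  let ?I = "\<lambda>k. T3_idx ({..<n k} \<times> (UNIV :: nat set))"
  have common: "\<exists>p. x \<in> fin_mat (T3_idx ({..<n k} \<times> {..<p})) \<and> y \<in> fin_mat (T3_idx ({..<n k} \<times> {..<p}))"
    if xy: "x \<in> fin_mat (?I k)" "y \<in> fin_mat (?I k)" for k x y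
    using stable_level[OF xy(1)] stable_level[OF xy(2)] by (meson nle_le)
  have sub: "fin_mat (T3_idx ({..<n k} \<times> {..<p})) \<subseteq> fin_mat (?I k)" for k p
    by (rule fin_mat_mono) (auto simp: T3_idx_def)
  have hom: "star_hom (fin_mat_alg (T3_idx ({..<n k} \<times> {..<p}))) (fin_mat_alg (T3_idx ({..<n (Suc k)} \<times> {..<p}))) (amp (\<phi> k))" for k and p :: nat
    by (rule has_class_star_hom[OF _ _ amp_class]) auto
  show "star_hom (fin_mat_alg (?I k)) (fin_mat_alg (?I (Suc k))) (amp (\<phi> k))" for k
  proof -
    have h: "amp (\<phi> k) x \<in> fin_mat (?I (Suc k))"
      "amp (\<phi> k) (\<lambda>i j. x i j + y i j) = (\<lambda>i j. amp (\<phi> k) x i j + amp (\<phi> k) y i j)"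
      "amp (\<phi> k) (mmult x y) = mmult (amp (\<phi> k) x) (amp (\<phi> k) y)"
      "amp (\<phi> k) (\<lambda>i j. a * x i j) = (\<lambda>i j. a * amp (\<phi> k) x i j)"
      "amp (\<phi> k) (madj x) = madj (amp (\<phi> k) x)" if xy: "x \<in> fin_mat (?I k)" "y \<in> fin_mat (?I k)" for x y a
    proof -
      obtain p where p: "x \<in> fin_mat (T3_idx ({..<n k} \<times> {..<p}))" "y \<in> fin_mat (T3_idx ({..<n k} \<times> {..<p}))"
        using common[OF xy] by blast
      show "amp (\<phi> k) x \<in> fin_mat (?I (Suc k))"
        "amp (\<phi> k) (\<lambda>i j. x i j + y i j) = (\<lambda>i j. amp (\<phi> k) x i j + amp (\<phi> k) y i j)"
        "amp (\<phi> k) (mmult x y) = mmult (amp (\<phi> k) x) (amp (\<phi> k) y)"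
        "amp (\<phi> k) (\<lambda>i j. a * x i j) = (\<lambda>i j. a * amp (\<phi> k) x i j)"
        "amp (\<phi> k) (madj x) = madj (amp (\<phi> k) x)"
        using hom[of k p] p sub[of "Suc k" p] unfolding star_hom_def fin_mat_alg_def by auto
    qed
    show ?thesis unfolding star_hom_def fin_mat_alg_def using h by simp
  qed
  show "opdist_le (amp (\<phi> k) x) (amp (\<phi> k) y) C"
    if xy: "x \<in> fin_mat (?I k)" "y \<in> fin_mat (?I k)" and C: "0 \<le> C" "opdist_le x y C" for k x y C
  proof -
    obtain p where "x \<in> fin_mat (T3_idx ({..<n k} \<times> {..<p}))" "y \<in> fin_mat (T3_idx ({..<n k} \<times> {..<p}))"
      using common[OF xy] by blast
    then show ?thesis using C by (intro has_class_contractive[OF _ _ amp_class]) auto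
  qed
  show "{..<n k} \<times> {..<Suc k} \<noteq> {}" for k using n[of k] by (auto simp: lessThan_empty_iff)
  show "has_class ({..<n k} \<times> {..<Suc k}) ({..<n (Suc k)} \<times> {..<Suc (Suc k)}) (amp (\<phi> k)) (c k)" for k
    by (rule has_class_mono[OF amp_class]) auto
  show "\<exists>p\<ge>k. push (\<lambda>k. amp (\<phi> k)) k p x \<in> fin_mat (T3_idx ({..<n p} \<times> {..<Suc p}))" if x: "x \<in> fin_mat (?I k)" for k x
  proof -
    obtain q where q: "\<And>r. r \<ge> q \<Longrightarrow> x \<in> fin_mat (T3_idx ({..<n k} \<times> {..<r}))" using stable_level[OF x] by blast
    have "push (\<lambda>k. amp (\<phi> k)) k p x \<in> fin_mat (T3_idx ({..<n p} \<times> {..<r}))" if "k \<le> p" "r \<ge> q" for p r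
      using that(1)
    proof (induction p rule: dec_induct)
      case (step p)
      then show ?case using has_class_fin_mat[OF _ _ amp_class] by (simp add: push_Suc)
    qed (use q that in auto)
    from this[of "max k q" "Suc (max k q)"] show ?thesis by (intro exI[of _ "max k q"]) auto
  qed
  show "T3_idx ({..<n k} \<times> {..<Suc k}) \<subseteq> ?I k" for k by (auto simp: T3_idx_def)
qed auto

text \<open>An element of level \<open>k\<close> with matrix factor \<open>p\<close> has the same
  class as its image at level \<open>max k p\<close>, where \<open>p\<close> is below the growing
  factor; so the union over \<open>p\<close> is one limit along the diagonal.\<close>

lemma T3_lim_stab_eq: "T3_lim_stab n \<phi> = (cstar_lim (\<lambda>k. T3_idx ({..<n k} \<times> UNIV)) (\<lambda>k. amp (\<phi> k)),
   alg_lim (\<lambda>k. T3_idx ({..<n k} \<times> UNIV)) (\<lambda>k. amp (\<phi> k)) (\<lambda>k. T3 ({..<n k} \<times> {..<Suc k})))"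
proof -
  let ?I = "\<lambda>k. T3_idx ({..<n k} \<times> (UNIV :: nat set))" and ?h = "\<lambda>k. amp (\<phi> k)"
  interpret T3_system ?I ?h "\<lambda>k. {..<n k} \<times> {..<Suc k}" c by (rule T3_lim_stab_system)
  have "X \<in> alg_lim ?I ?h (\<lambda>k. T3 ({..<n k} \<times> {..<Suc k}))" if Xp: "X \<in> alg_lim ?I ?h (\<lambda>k. T3 ({..<n k} \<times> {..<p}))" for X p
  proof -
    obtain k a where a: "a \<in> T3 ({..<n k} \<times> {..<p})" and X: "X = lim_map ?I ?h k a" using Xp by (auto simp: alg_lim_def)
    define q where "q = max k p"
    have kq: "k \<le> q" and pq: "p \<le> q" by (auto simp: q_def)
    have "push ?h k r a \<in> T3 ({..<n r} \<times> {..<p})" if "k \<le> r" for r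
      using that
    proof (induction r rule: dec_induct)
      case (step r)
      then show ?case using has_class_star_extendible[OF _ _ amp_class[of r p]]
        by (auto simp: push_Suc star_extendible_def T3_alg_def)
    qed (use a in auto)
    then have "push ?h k q a \<in> T3 ({..<n q} \<times> {..<p})" using kq by blast
    moreover have "T3_idx ({..<n q} \<times> {..<p}) \<subseteq> T3_idx ({..<n q} \<times> {..<Suc q})" using pq by (auto simp: T3_idx_def)
    ultimately have "push ?h k q a \<in> T3 ({..<n q} \<times> {..<Suc q})" using fin_mat_mono by (auto simp: T3_def)
    moreover have "a \<in> fin_mat (?I k)"
      using a fin_mat_mono[of "T3_idx ({..<n k} \<times> {..<p})" "?I k"] by (auto simp: T3_def T3_idx_def)
    ultimately show ?thesis unfolding X alg_lim_def using lim_map_push[OF kq, of a, symmetric] by blast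
  qed
  moreover have "alg_lim ?I ?h (\<lambda>k. T3 ({..<n k} \<times> {..<Suc k})) \<subseteq> (\<Union>p. alg_lim ?I ?h (\<lambda>k. T3 ({..<n k} \<times> {..<p})))"
    unfolding alg_lim_def by blast
  ultimately show ?thesis unfolding T3_lim_stab_def by blast
qed

end

section \<open>Regularity of composed maps\<close>

declare One_nat_def [simp del]

lemma mmult_assoc:
  assumes "x \<in> fin_mat I" "y \<in> fin_mat I" "z \<in> fin_mat I"
  shows "mmult (mmult x y) z = mmult x (mmult y z)"
proof -
  obtain F1 F2 where F: "finite F1" "x \<in> fin_mat F1" "finite F2" "z \<in> fin_mat F2"
    using assms fin_mat_finite_support by meson
  define F where "F = F1 \<union> F2"
  have fF: "finite F" and xz: "x \<in> fin_mat F" "z \<in> fin_mat F"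
    using F fin_mat_mono[of F1 F] fin_mat_mono[of F2 F] unfolding F_def by auto
  show ?thesis
  proof (intro ext)
    fix i j
    have "mmult (mmult x y) z i j = (\<Sum>l\<in>F. \<Sum>m\<in>F. x i m * y m l * z l j)"
      using fF xz by (simp add: mmult_fin_mat[OF fF] sum_distrib_right)
    also have "\<dots> = (\<Sum>m\<in>F. \<Sum>l\<in>F. x i m * (y m l * z l j))"
      by (subst sum.swap) (simp add: mult.assoc)
    also have "\<dots> = mmult x (mmult y z) i j"
      using fF xz by (simp add: mmult_fin_mat[OF fF] sum_distrib_left)
    finally show "mmult (mmult x y) z i j = mmult x (mmult y z) i j" .
  qed
qed

text \<open>Finitely supported matrices as a ring, so that the noncommutative calculations with
  projections below become ring arithmetic.\<close>

typedef 'i fmat = "fin_mat (UNIV :: 'i set)"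
  morphisms entry Abs_fmat
  using mzero_fin_mat by blast

setup_lifting type_definition_fmat

lemma fin_mat_uminus: "x \<in> fin_mat I \<Longrightarrow> (\<lambda>i j. - x i j) \<in> fin_mat I"
  using fin_mat_scale[of x I "-1"] by simp

lemma fin_mat_minus: "x \<in> fin_mat I \<Longrightarrow> y \<in> fin_mat I \<Longrightarrow> (\<lambda>i j. x i j - y i j) \<in> fin_mat I"
  using fin_mat_add[OF _ fin_mat_uminus, of x I y] by simp

instantiation fmat :: (type) ring
begin

lift_definition zero_fmat :: "'a fmat" is "\<lambda>i j. 0" using mzero_fin_mat by (simp add: mzero_def)
lift_definition plus_fmat :: "'a fmat \<Rightarrow> 'a fmat \<Rightarrow> 'a fmat" is "\<lambda>x y i j. x i j + y i j" by (rule fin_mat_add)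
lift_definition minus_fmat :: "'a fmat \<Rightarrow> 'a fmat \<Rightarrow> 'a fmat" is "\<lambda>x y i j. x i j - y i j" by (rule fin_mat_minus)
lift_definition uminus_fmat :: "'a fmat \<Rightarrow> 'a fmat" is "\<lambda>x i j. - x i j" by (rule fin_mat_uminus)
lift_definition times_fmat :: "'a fmat \<Rightarrow> 'a fmat \<Rightarrow> 'a fmat" is mmult by (rule fin_mat_mmult)

lemma entry_times:
  assumes "finite F" "\<And>l. l \<notin> F \<Longrightarrow> entry x i l * entry y l j = 0"
  shows "entry (x * y) i j = (\<Sum>l\<in>F. entry x i l * entry y l j)"
  unfolding times_fmat.rep_eq using assms by (rule mmult_eq_sum)

lemma entry_times_left:
  assumes "finite F" "entry x \<in> fin_mat F"
  shows "entry (x * y) i j = (\<Sum>l\<in>F. entry x i l * entry y l j)"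
  by (rule entry_times[OF assms(1)]) (simp add: fin_mat_outside(2)[OF assms(2)])

lemma entry_times_right:
  assumes "finite F" "entry y \<in> fin_mat F"
  shows "entry (x * y) i j = (\<Sum>l\<in>F. entry x i l * entry y l j)"
  by (rule entry_times[OF assms(1)]) (simp add: fin_mat_outside(1)[OF assms(2)])

instance
proof
  fix a b c :: "'a fmat"
  show "a * b * c = a * (b * c)" by transfer (rule mmult_assoc)
  obtain F1 where F1: "finite F1" "entry a \<in> fin_mat F1" using fin_mat_finite_support[OF entry[of a]] by blast
  obtain F2 where F2: "finite F2" "entry b \<in> fin_mat F2" using fin_mat_finite_support[OF entry[of b]] by blast
  obtain F3 where F3: "finite F3" "entry c \<in> fin_mat F3" using fin_mat_finite_support[OF entry[of c]] by blast
  have "entry ((a + b) * c) i j = entry (a * c + b * c) i j" for i j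
    unfolding plus_fmat.rep_eq entry_times_right[OF F3] by (simp add: distrib_right sum.distrib)
  then show "(a + b) * c = a * c + b * c" by (simp add: entry_inject[symmetric] fun_eq_iff)
  have "entry (a * (b + c)) i j = entry (a * b + a * c) i j" for i j
    unfolding plus_fmat.rep_eq entry_times_left[OF F1] by (simp add: distrib_left sum.distrib)
  then show "a * (b + c) = a * b + a * c" by (simp add: entry_inject[symmetric] fun_eq_iff)
qed (transfer; simp add: algebra_simps)+

end

lift_definition adj :: "'i fmat \<Rightarrow> 'i fmat" is madj by (rule fin_mat_madj)
lift_definition scl :: "complex \<Rightarrow> 'i fmat \<Rightarrow> 'i fmat" is "\<lambda>c x i j. c * x i j" by (rule fin_mat_scale)

lemma fmat_eqI: "(\<And>i j. entry x i j = entry y i j) \<Longrightarrow> x = y"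
  by (simp add: entry_inject[symmetric] fun_eq_iff)

lemma adj_add: "adj (x + y) = adj x + adj y" by transfer (simp add: madj_def)
lemma adj_diff: "adj (x - y) = adj x - adj y" by transfer (simp add: madj_def)
lemma adj_zero [simp]: "adj 0 = 0" by transfer (simp add: madj_def)
lemma adj_adj [simp]: "adj (adj x) = x" by transfer simp
lemma adj_mult: "adj (x * y) = adj y * adj x" by transfer (rule madj_mmult)
lemma adj_scl: "adj (scl c x) = scl (cnj c) (adj x)" by transfer (simp add: madj_def)
lemma adj_sum: "adj (\<Sum>i\<in>A. f i) = (\<Sum>i\<in>A. adj (f i))"
  by (induction A rule: infinite_finite_induct) (simp_all add: adj_add)

lemma entry_sum: "entry (\<Sum>a\<in>A. f a) i j = (\<Sum>a\<in>A. entry (f a) i j)"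
  by (induction A rule: infinite_finite_induct) (simp_all add: zero_fmat.rep_eq plus_fmat.rep_eq)

lemma scl_add: "scl c (x + y) = scl c x + scl c y" by transfer (simp add: algebra_simps)
lemma scl_add_left: "scl (c + d) x = scl c x + scl d x" by transfer (simp add: algebra_simps)
lemma scl_zero [simp]: "scl c 0 = 0" "scl 0 x = 0" by (transfer, simp)+
lemma scl_one [simp]: "scl 1 x = x" by transfer simp
lemma scl_scl: "scl c (scl d x) = scl (c * d) x" by transfer (simp add: mult.assoc)
lemma scl_minus_left: "scl (c - d) x = scl c x - scl d x" by transfer (simp add: algebra_simps)
lemma scl_diff: "scl c (x - y) = scl c x - scl c y" by transfer (simp add: algebra_simps)
lemma scl_sum_left: "scl (\<Sum>i\<in>A. f i) x = (\<Sum>i\<in>A. scl (f i) x)"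
  by (induction A rule: infinite_finite_induct) (simp_all add: scl_add_left)

lemma scl_times_left: "scl c x * y = scl c (x * y)"
proof (rule fmat_eqI)
  fix i j
  obtain F where F: "finite F" "entry y \<in> fin_mat F" using fin_mat_finite_support[OF entry[of y]] by blast
  show "entry (scl c x * y) i j = entry (scl c (x * y)) i j"
    unfolding scl.rep_eq entry_times_right[OF F] by (simp add: sum_distrib_left mult.assoc)
qed

lemma scl_times_right: "x * scl c y = scl c (x * y)"
proof (rule fmat_eqI)
  fix i j
  obtain F where F: "finite F" "entry y \<in> fin_mat F" using fin_mat_finite_support[OF entry[of y]] by blast
  have F': "finite F" "entry (scl c y) \<in> fin_mat F" using F by (auto simp: scl.rep_eq intro: fin_mat_scale)
  show "entry (x * scl c y) i j = entry (scl c (x * y)) i j"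
    unfolding scl.rep_eq entry_times_right[OF F'] entry_times_right[OF F] by (simp add: scl.rep_eq sum_distrib_left mult_ac)
qed

lemma scl_eq_zero: "scl c x = 0 \<Longrightarrow> c = 0 \<or> x = 0"
  by transfer (auto simp: fun_eq_iff)

text \<open>A triangular system of matrix units: images \<open>U p q\<close> of the matrix units under a star-extendible
  map on \<open>T3 J\<close>, relative to the block projections \<open>Q t\<close> of the target.\<close>

locale tri_units =
  fixes J :: "'j set" and o1 :: 'j and U :: "nat \<times> 'j \<Rightarrow> nat \<times> 'j \<Rightarrow> 'x fmat" and Q :: "nat \<Rightarrow> 'x fmat"
  assumes o1: "o1 \<in> J" and finJ: "finite J"
    and U_mult: "p \<in> T3_idx J \<Longrightarrow> q \<in> T3_idx J \<Longrightarrow> r \<in> T3_idx J \<Longrightarrow> p' \<in> T3_idx J \<Longrightarrow>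
      U p q * U r p' = (if q = r then U p p' else 0)"
    and U_adj: "p \<in> T3_idx J \<Longrightarrow> q \<in> T3_idx J \<Longrightarrow> adj (U p q) = U q p"
    and Q_mult: "Q t * Q s = (if t = s then Q t else 0)"
    and Q_adj: "adj (Q t) = Q t"
    and Q_sum: "p \<in> T3_idx J \<Longrightarrow> q \<in> T3_idx J \<Longrightarrow> (Q 1 + Q 2 + Q 3) * U p q = U p q"
    and Q_range: "t \<notin> {1..3} \<Longrightarrow> Q t = 0"
    and tri: "p \<in> T3_idx J \<Longrightarrow> q \<in> T3_idx J \<Longrightarrow> fst p \<le> fst q \<Longrightarrow> s < t \<Longrightarrow> Q t * U p q * Q s = 0"
begin

lemma Q_sum': "p \<in> T3_idx J \<Longrightarrow> q \<in> T3_idx J \<Longrightarrow> U p q * (Q 1 + Q 2 + Q 3) = U p q"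
  using arg_cong[OF Q_sum[of q p], of adj] by (simp add: adj_mult adj_add Q_adj U_adj)

lemma tri': "p \<in> T3_idx J \<Longrightarrow> q \<in> T3_idx J \<Longrightarrow> fst q \<le> fst p \<Longrightarrow> t < s \<Longrightarrow> Q t * U p q * Q s = 0"
  using arg_cong[OF tri[of q p t s], of adj] by (simp add: adj_mult Q_adj U_adj mult.assoc)

text \<open>For \<open>p\<close> and \<open>q\<close> in the same block both \<open>U p q\<close>
  and its adjoint \<open>U q p\<close> are triangular, so \<open>U p q\<close> is block diagonal
  with respect to the \<open>Q t\<close>.\<close>

lemma Q_commute:
  assumes "p \<in> T3_idx J" "q \<in> T3_idx J" "fst p = fst q"
  shows "Q t * U p q = U p q * Q t"
proof (cases "t \<in> {1..3}")
  case True
  have z: "Q t * U p q * Q s = 0" if "s \<noteq> t" for s t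
    using that tri[OF assms(1,2), of s t] tri'[OF assms(1,2), of t s] assms(3) by (cases "s < t") auto
  have t: "t = 1 \<or> t = 2 \<or> t = 3" using True by auto
  have "Q t * U p q = Q t * (U p q * (Q 1 + Q 2 + Q 3))" using Q_sum'[OF assms(1,2)] by simp
  also have "\<dots> = Q t * U p q * Q 1 + Q t * U p q * Q 2 + Q t * U p q * Q 3" by (simp add: algebra_simps)
  also have "\<dots> = Q t * U p q * Q t" using t z[of 1 t] z[of 2 t] z[of 3 t] by auto
  finally have 1: "Q t * U p q = Q t * U p q * Q t" .
  have "U p q * Q t = (Q 1 + Q 2 + Q 3) * U p q * Q t" using Q_sum[OF assms(1,2)] by simp
  also have "\<dots> = Q 1 * U p q * Q t + Q 2 * U p q * Q t + Q 3 * U p q * Q t" by (simp add: algebra_simps)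
  also have "\<dots> = Q t * U p q * Q t" using t z[of t 1] z[of t 2] z[of t 3] by auto
  finally show ?thesis using 1 by simp
qed (simp add: Q_range)

abbreviation "base \<equiv> (1, o1)"
abbreviation "pt i \<equiv> (i, o1)"
abbreviation "unit \<equiv> U base base"

text \<open>The part of the diagonal unit at \<open>pt i\<close> that lies in target block
  \<open>t\<close>, transported to the corner of \<open>base\<close>. For each \<open>i\<close>
  these elements resolve the one projection \<open>unit\<close>, so that different \<open>i\<close>
  can be compared.\<close>

definition E :: "nat \<Rightarrow> nat \<Rightarrow> 'x fmat" where
  "E i t = U base (pt i) * Q t * U (pt i) base"

lemma pt [simp]: "i \<in> {1..3} \<Longrightarrow> pt i \<in> T3_idx J"
  by (simp add: mem_T3_idx o1)

lemma base_mem [simp]: "base \<in> T3_idx J"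
  using o1 by (simp add: mem_T3_idx)

lemma E_adj: "i \<in> {1..3} \<Longrightarrow> adj (E i t) = E i t"
  by (simp add: E_def adj_mult Q_adj U_adj mult.assoc)

lemma E_mult_expand:
  "i \<in> {1..3} \<Longrightarrow> j \<in> {1..3} \<Longrightarrow> E i t * E j s = U base (pt i) * (Q t * U (pt i) (pt j) * Q s) * U (pt j) base"
proof -
  assume "i \<in> {1..3}" "j \<in> {1..3}"
  then have "U (pt i) base * U base (pt j) = U (pt i) (pt j)" by (simp add: U_mult)
  moreover have "E i t * E j s = U base (pt i) * (Q t * (U (pt i) base * U base (pt j)) * Q s) * U (pt j) base"
    by (simp add: E_def mult.assoc)
  ultimately show ?thesis by simp
qed

lemma E_tri: "i \<in> {1..3} \<Longrightarrow> j \<in> {1..3} \<Longrightarrow> i \<le> j \<Longrightarrow> s < t \<Longrightarrow> E i t * E j s = 0"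
  by (simp add: E_mult_expand tri)

lemma E_orth: "i \<in> {1..3} \<Longrightarrow> E i t * E i s = (if t = s then E i t else 0)"
proof -
  assume i: "i \<in> {1..3}"
  have "E i t * E i s = U base (pt i) * (U (pt i) (pt i) * (Q t * Q s)) * U (pt i) base"
    using E_mult_expand[OF i i] Q_commute[OF pt[OF i] pt[OF i]] by (simp add: mult.assoc)
  also have "\<dots> = U base (pt i) * (Q t * Q s) * U (pt i) base"
    using i by (simp add: mult.assoc[symmetric] U_mult)
  finally show ?thesis by (simp add: Q_mult E_def)
qed

lemma E_sum: "i \<in> {1..3} \<Longrightarrow> E i 1 + E i 2 + E i 3 = unit"
proof -
  assume i: "i \<in> {1..3}"
  have "E i 1 + E i 2 + E i 3 = U base (pt i) * ((Q 1 + Q 2 + Q 3) * U (pt i) base)"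
    unfolding E_def by (simp add: algebra_simps)
  also have "\<dots> = unit" using i by (simp only: Q_sum pt base_mem U_mult simp_thms if_True)
  finally show ?thesis .
qed

lemma E_unit: "i \<in> {1..3} \<Longrightarrow> E i t * unit = E i t" "i \<in> {1..3} \<Longrightarrow> unit * E i t = E i t"
  unfolding E_def by (simp_all add: mult.assoc U_mult) (simp add: mult.assoc[symmetric] U_mult)

lemma unit_unit: "unit * unit = unit" by (simp add: U_mult)

lemma E_range: "t \<notin> {1..3} \<Longrightarrow> E i t = 0" by (simp add: E_def Q_range)

definition \<kappa> :: "nat \<Rightarrow> nat \<Rightarrow> 'x fmat" where
  "\<kappa> i j = E i 1 * E j 3 - E j 3 * E i 1"

context
  fixes i j :: nat assumes ij: "i \<in> {1..3}" "j \<in> {1..3}" "i < j"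
begin

text \<open>Expanding \<open>unit\<close> by \<open>E_sum\<close> next to \<open>E j 1\<close> or
  \<open>E i 3\<close> leaves a single term by triangularity: \<open>E j 1\<close> is below
  \<open>E i 1\<close>, and \<open>E i 3\<close> is below \<open>E j 3\<close>.\<close>

lemma E_le: "E i 1 * E j 1 = E j 1" "E j 1 * E i 1 = E j 1" "E i 3 * E j 3 = E i 3" "E j 3 * E i 3 = E i 3"
proof -
  have "unit * E j 1 = E i 1 * E j 1" using ij by (simp add: E_sum[OF ij(1), symmetric] distrib_right E_tri)
  then show 1: "E i 1 * E j 1 = E j 1" using E_unit ij by simp
  show "E j 1 * E i 1 = E j 1" using arg_cong[OF 1, of adj] ij by (simp add: adj_mult E_adj)
  have "E i 3 * unit = E i 3 * E j 3" using ij by (simp add: E_sum[OF ij(2), symmetric] distrib_left E_tri)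
  then show 2: "E i 3 * E j 3 = E i 3" using E_unit ij by simp
  show "E j 3 * E i 3 = E i 3" using arg_cong[OF 2, of adj] ij by (simp add: adj_mult E_adj)
qed

lemma E_tri_adj: "s < t \<Longrightarrow> E j s * E i t = 0"
  using arg_cong[OF E_tri[of i j s t], of adj] ij by (simp add: adj_mult E_adj)

lemma E_two: "E i 2 = unit - E i 1 - E i 3" "E j 2 = unit - E j 1 - E j 3"
  using E_sum[OF ij(1)] E_sum[OF ij(2)] by (simp_all add: algebra_simps)

text \<open>The first and the last members are comparable by \<open>E_le\<close>, the remaining
  triangular products vanish, and the middle members are \<open>unit\<close> minus the others. Only
  the commutator of \<open>E i 1\<close> with \<open>E j 3\<close> is left free.\<close>

lemma commutators:
  "E i 1 * E j 2 - E j 2 * E i 1 = - \<kappa> i j"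
  "E i 2 * E j 3 - E j 3 * E i 2 = - \<kappa> i j"
  "E i 2 * E j 2 - E j 2 * E i 2 = \<kappa> i j"
  "E i 1 * E j 1 = E j 1 * E i 1" "E i 3 * E j 3 = E j 3 * E i 3"
  "E i 2 * E j 1 = E j 1 * E i 2" "E i 3 * E j 1 = E j 1 * E i 3" "E i 3 * E j 2 = E j 2 * E i 3"
  unfolding E_two \<kappa>_def using ij
  by (simp_all add: algebra_simps E_le E_unit E_tri E_tri_adj unit_unit)

end

definition commuting :: bool where
  "commuting \<longleftrightarrow> (\<forall>i\<in>{1..3}. \<forall>j\<in>{1..3}. \<forall>t s. E i t * E j s = E j s * E i t)"

lemma commuting_iff: "commuting \<longleftrightarrow> (\<forall>i\<in>{1..3}. \<forall>j\<in>{1..3}. i < j \<longrightarrow> \<kappa> i j = 0)"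
proof
  assume "\<forall>i\<in>{1..3}. \<forall>j\<in>{1..3}. i < j \<longrightarrow> \<kappa> i j = 0"
  then have k: "\<kappa> i j = 0" if "i \<in> {1..3}" "j \<in> {1..3}" "i < j" for i j using that by blast
  have lt: "E i t * E j s = E j s * E i t" if ij: "i \<in> {1..3}" "j \<in> {1..3}" "i < j" for i j t s
  proof (cases "t \<in> {1..3} \<and> s \<in> {1..3}")
    case True
    then have "(t = 1 \<or> t = 2 \<or> t = 3) \<and> (s = 1 \<or> s = 2 \<or> s = 3)" by auto
    then show ?thesis using commutators[OF ij] k[OF ij] \<kappa>_def[of i j] by auto
  qed (auto simp: E_range)
  have "E i t * E j s = E j s * E i t" if ij: "i \<in> {1..3}" "j \<in> {1..3}" for i j t s
  proof -
    consider "i < j" | "j < i" | "i = j" by linarith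
    then show ?thesis
    proof cases
      case 3 then show ?thesis using ij by (simp add: E_orth)
    next
      case 1 then show ?thesis by (rule lt[OF ij])
    next
      case 2 then show ?thesis by (rule lt[OF ij(2,1), symmetric])
    qed
  qed
  then show commuting unfolding commuting_def by blast
qed (simp add: commuting_def \<kappa>_def)

text \<open>For commuting resolutions this is the projection onto the copies whose label is the
  identity; in general it is merely an operator whose vanishing replaces the absence of such
  copies.\<close>

definition Z :: "'x fmat" where "Z = E 1 1 * E 2 2 * E 3 3"

text \<open>\<open>tens X G\<close> is the elementary tensor \<open>X \<otimes> G\<close> in the identification of the image of the units
  with a full matrix algebra tensored with the corner at \<open>base\<close>.\<close>

definition tens :: "(nat \<times> 'j) fmat \<Rightarrow> 'x fmat \<Rightarrow> 'x fmat" where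
  "tens X G = (\<Sum>c\<in>T3_idx J. \<Sum>d\<in>T3_idx J. scl (entry X c d) (U c base * G * U base d))"

lemma tens_diff_left: "tens (X - Y) G = tens X G - tens Y G"
  by (simp add: tens_def minus_fmat.rep_eq scl_minus_left sum_subtractf)

lemma tens_add_right: "tens X (G + H) = tens X G + tens X H"
  by (simp add: tens_def algebra_simps scl_add sum.distrib)

lemma tens_diff_right: "tens X (G - H) = tens X G - tens X H"
  by (simp add: tens_def algebra_simps scl_diff sum_subtractf)

lemma tens_zero [simp]: "tens 0 G = 0" "tens X 0 = 0"
  by (simp_all add: tens_def zero_fmat.rep_eq)

text \<open>Between the two factors stands \<open>U base d * U c' base\<close>, which is
  \<open>unit\<close> for \<open>c' = d\<close> and 0 otherwise; the coefficients therefore multiply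
  as matrices.\<close>

lemma tens_mult:
  assumes X: "entry X \<in> fin_mat (T3_idx J)" and H: "unit * H = H"
  shows "tens X G * tens Y H = tens (X * Y) (G * H)"
proof -
  let ?I = "T3_idx J"
  have fI: "finite ?I" using finJ by simp
  have tm: "scl a (U c base * G * U base d) * scl b (U c' base * H * U base d') =
      (if c' = d then scl (a * b) (U c base * (G * H) * U base d') else 0)"
    if "c \<in> ?I" "d \<in> ?I" "c' \<in> ?I" "d' \<in> ?I" for a b c d c' d'
  proof -
    have "(U c base * G * U base d) * (U c' base * H * U base d') = U c base * G * (U base d * U c' base) * H * U base d'"
      by (simp add: mult.assoc)
    also have "\<dots> = (if c' = d then U c base * G * (unit * H) * U base d' else 0)"
      using that by (simp add: U_mult mult.assoc)
    finally show ?thesis by (simp add: scl_times_left scl_times_right scl_scl mult.assoc H mult.commute[of b a])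
  qed
  have "tens X G * tens Y H = (\<Sum>c\<in>?I. \<Sum>d\<in>?I. \<Sum>c'\<in>?I. \<Sum>d'\<in>?I.
    scl (entry X c d) (U c base * G * U base d) * scl (entry Y c' d') (U c' base * H * U base d'))"
    unfolding tens_def sum_product by (rule sum.cong[OF refl], rule sum.swap)
  also have "\<dots> = (\<Sum>c\<in>?I. \<Sum>d\<in>?I. \<Sum>c'\<in>?I. if c' = d then (\<Sum>d'\<in>?I. scl (entry X c d * entry Y c' d') (U c base * (G * H) * U base d')) else 0)"
    by (intro sum.cong[OF refl]) (auto simp: tm intro!: sum.cong)
  also have "\<dots> = (\<Sum>c\<in>?I. \<Sum>d\<in>?I. \<Sum>d'\<in>?I. scl (entry X c d * entry Y d d') (U c base * (G * H) * U base d'))"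
    by (rule sum.cong[OF refl], rule sum.cong[OF refl]) (simp add: fI)
  also have "\<dots> = (\<Sum>c\<in>?I. \<Sum>d'\<in>?I. \<Sum>d\<in>?I. scl (entry X c d * entry Y d d') (U c base * (G * H) * U base d'))"
    by (rule sum.cong[OF refl], rule sum.swap)
  also have "\<dots> = tens (X * Y) (G * H)"
    unfolding tens_def scl_sum_left[symmetric]
    by (intro sum.cong[OF refl], subst entry_times[OF fI]) (use fin_mat_outside[OF X] in auto)
  finally show ?thesis .
qed

text \<open>Multiplying by \<open>U base c\<close> and \<open>U d base\<close> isolates the
  coefficient \<open>(c, d)\<close> of \<open>X\<close> times \<open>G\<close>.\<close>

lemma tens_eq_zero:
  assumes "tens X G = 0" and G: "unit * G * unit = G" and X: "entry X \<in> fin_mat (T3_idx J)"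
  shows "X = 0 \<or> G = 0"
proof (rule ccontr)
  let ?I = "T3_idx J"
  have fI: "finite ?I" using finJ by simp
  assume "\<not> ?thesis"
  then obtain c d where cd: "entry X c d \<noteq> 0" by (metis fmat_eqI zero_fmat.rep_eq)
  then have mem: "c \<in> ?I" "d \<in> ?I" using fin_matD[OF X] by blast+
  have "U base c * tens X G * U d base = (\<Sum>c'\<in>?I. \<Sum>d'\<in>?I. scl (entry X c' d') (U base c * U c' base * G * (U base d' * U d base)))"
    unfolding tens_def by (simp add: sum_distrib_left sum_distrib_right scl_times_left scl_times_right mult.assoc)
  also have "\<dots> = (\<Sum>c'\<in>?I. \<Sum>d'\<in>?I. if d' = d then (if c' = c then scl (entry X c d) G else 0) else 0)"
    using mem G by (intro sum.cong[OF refl]) (auto simp: U_mult)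
  also have "\<dots> = scl (entry X c d) G" using fI mem by simp
  finally have "scl (entry X c d) G = 0" using assms(1) by simp
  then show False using scl_eq_zero cd \<open>\<not> (X = 0 \<or> G = 0)\<close> by blast
qed

end

text \<open>The composition of two star-extendible maps: \<open>A\<close> and \<open>B\<close> are the unit systems of the inner and
  the outer map, and the units of the composition are the \<open>B\<close>-images of those of \<open>A\<close>.\<close>

locale tri_comp = A: tri_units J oJ U QK + B: tri_units K oK W QL
  for J :: "'j set" and oJ U and QK :: "nat \<Rightarrow> (nat \<times> 'k) fmat" and K :: "'k set" and oK
    and W and QL :: "nat \<Rightarrow> 'x fmat" +
  assumes U_supp: "p \<in> T3_idx J \<Longrightarrow> q \<in> T3_idx J \<Longrightarrow> entry (U p q) \<in> fin_mat (T3_idx K)"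
    and QK: "entry (QK t) = (\<lambda>k l. of_bool (k = l \<and> fst k = t \<and> k \<in> T3_idx K))"
begin

definition UW :: "nat \<times> 'j \<Rightarrow> nat \<times> 'j \<Rightarrow> 'x fmat" where
  "UW p q = (\<Sum>c\<in>T3_idx K. \<Sum>d\<in>T3_idx K. scl (entry (U p q) c d) (W c d))"

text \<open>Inside a block of \<open>K\<close> the units \<open>W\<close> commute with
  \<open>QL t\<close>, so a middle index \<open>d\<close> can be moved to the representative
  \<open>(fst d, oK)\<close>. The middle part then depends on the block of \<open>d\<close> only,
  and collecting the indices of each block \<open>b\<close> gives one elementary tensor.\<close>

lemma sandwich_Q:
  assumes p: "p \<in> T3_idx J" "q \<in> T3_idx J" "r \<in> T3_idx J" "s \<in> T3_idx J"
  shows "UW p q * QL t * UW r s = (\<Sum>b\<in>{1..3}. B.tens (U p q * QK b * U r s) (B.E b t))"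
proof -
  let ?I = "T3_idx K"
  have fI: "finite ?I" using B.finJ by simp
  define X Y where "X = U p q" and "Y = U r s"
  define R where "R c d d' = W c (fst d, oK) * QL t * W (fst d, oK) d'" for c d d' :: "nat \<times> 'k"
  have tm: "W c d * QL t * W c' d' = (if c' = d then R c d d' else 0)"
    if "c \<in> ?I" "d \<in> ?I" "c' \<in> ?I" "d' \<in> ?I" for c d c' d'
  proof -
    have b: "(fst d, oK) \<in> ?I" using that(2) B.o1 by (simp add: mem_T3_idx)
    have "W c d * QL t * W c' d' = W c (fst d, oK) * (W (fst d, oK) d * QL t) * W c' d'"
      using that b by (simp add: mult.assoc[symmetric] B.U_mult)
    also have "\<dots> = W c (fst d, oK) * (QL t * W (fst d, oK) d) * W c' d'"
      using B.Q_commute[OF b that(2), of t] by simp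
    also have "\<dots> = W c (fst d, oK) * QL t * (W (fst d, oK) d * W c' d')"
      by (simp add: mult.assoc)
    finally show ?thesis using that b by (simp add: B.U_mult R_def)
  qed
  have "UW p q * QL t * UW r s = (\<Sum>c\<in>?I. \<Sum>d\<in>?I. \<Sum>c'\<in>?I. \<Sum>d'\<in>?I.
      scl (entry X c d * entry Y c' d') (W c d * QL t * W c' d'))"
  proof -
    have "UW p q * QL t = (\<Sum>c\<in>?I. \<Sum>d\<in>?I. scl (entry X c d) (W c d * QL t))"
      unfolding UW_def X_def[symmetric] by (simp only: sum_distrib_right scl_times_left)
    moreover have "UW r s = (\<Sum>c'\<in>?I. \<Sum>d'\<in>?I. scl (entry Y c' d') (W c' d'))"
      unfolding UW_def Y_def[symmetric] ..
    ultimately show ?thesis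
      by (simp only: sum_distrib_right, simp only: sum_distrib_left scl_times_left scl_times_right scl_scl, simp only: mult.commute)
  qed
  also have "\<dots> = (\<Sum>c\<in>?I. \<Sum>d\<in>?I. \<Sum>c'\<in>?I. if c' = d then (\<Sum>d'\<in>?I. scl (entry X c d * entry Y c' d') (R c d d')) else 0)"
    by (intro sum.cong[OF refl]) (auto simp: tm)
  also have "\<dots> = (\<Sum>c\<in>?I. \<Sum>d\<in>?I. \<Sum>d'\<in>?I. scl (entry X c d * entry Y d d') (R c d d'))"
    by (rule sum.cong[OF refl], rule sum.cong[OF refl]) (simp add: fI)
  also have "\<dots> = (\<Sum>c\<in>?I. \<Sum>d'\<in>?I. \<Sum>d\<in>?I. scl (entry X c d * entry Y d d') (R c d d'))"
    by (rule sum.cong[OF refl], rule sum.swap)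
  also have "\<dots> = (\<Sum>c\<in>?I. \<Sum>d'\<in>?I. \<Sum>b\<in>{1..3}. scl (entry (X * QK b * Y) c d') (W c B.base * B.E b t * W B.base d'))"
  proof (intro sum.cong[OF refl])
    fix c d' assume c: "c \<in> ?I" and d': "d' \<in> ?I"
    have xy: "entry (X * QK b * Y) c d' = (\<Sum>d\<in>?I. of_bool (fst d = b) * (entry X c d * entry Y d d'))" for b
    proof -
      have XQ: "entry (X * QK b) c d = entry X c d * of_bool (fst d = b)" if "d \<in> ?I" for d
      proof -
        have "entry (X * QK b) c d = (\<Sum>l\<in>?I. (entry X c l * of_bool (fst l = b)) * of_bool (l = d))"
          by (subst entry_times[OF fI]) (use that in \<open>auto simp: QK intro!: sum.cong\<close>)
        also have "\<dots> = entry X c d * of_bool (fst d = b)" by (rule sum_unit_vector[OF fI that])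
        finally show ?thesis .
      qed
      have "entry (X * QK b * Y) c d' = (\<Sum>d\<in>?I. entry (X * QK b) c d * entry Y d d')"
        by (rule entry_times[OF fI]) (use fin_mat_outside[OF U_supp[OF p(3,4)]] in \<open>auto simp: Y_def\<close>)
      then show ?thesis using XQ by (simp add: mult_ac)
    qed
    have "W c B.base * B.E b t * W B.base d' = W c (b, oK) * QL t * W (b, oK) d'" if "b \<in> {1..3}" for b
    proof -
      have "W c B.base * B.E b t * W B.base d' = (W c B.base * W B.base (b, oK)) * QL t * (W (b, oK) B.base * W B.base d')"
        unfolding B.E_def by (simp add: mult.assoc)
      then show ?thesis using c d' B.pt[OF that] by (simp add: B.U_mult)
    qed
    then have "(\<Sum>b\<in>{1..3}. scl (entry (X * QK b * Y) c d') (W c B.base * B.E b t * W B.base d')) =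
      (\<Sum>b\<in>{1..3}. \<Sum>d\<in>?I. if b = fst d then scl (entry X c d * entry Y d d') (R c d d') else 0)"
      unfolding xy scl_sum_left by (intro sum.cong[OF refl]) (auto simp: R_def)
    also have "\<dots> = (\<Sum>d\<in>?I. \<Sum>b\<in>{1..3}. if b = fst d then scl (entry X c d * entry Y d d') (R c d d') else 0)"
      by (rule sum.swap)
    also have "\<dots> = (\<Sum>d\<in>?I. scl (entry X c d * entry Y d d') (R c d d'))"
      by (intro sum.cong[OF refl]) (auto simp: mem_T3_idx)
    finally show "(\<Sum>d\<in>?I. scl (entry X c d * entry Y d d') (R c d d')) =
      (\<Sum>b\<in>{1..3}. scl (entry (X * QK b * Y) c d') (W c B.base * B.E b t * W B.base d'))" ..
  qed
  also have "\<dots> = (\<Sum>c\<in>?I. \<Sum>b\<in>{1..3}. \<Sum>d'\<in>?I. scl (entry (X * QK b * Y) c d') (W c B.base * B.E b t * W B.base d'))"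
    by (rule sum.cong[OF refl], rule sum.swap)
  also have "\<dots> = (\<Sum>b\<in>{1..3}. B.tens (X * QK b * Y) (B.E b t))"
    unfolding B.tens_def by (rule sum.swap)
  finally show ?thesis unfolding X_def Y_def .
qed

definition EC :: "nat \<Rightarrow> nat \<Rightarrow> 'x fmat" where
  "EC i t = UW A.base (A.pt i) * QL t * UW (A.pt i) A.base"

lemma EC_eq:
  assumes "i \<in> {1..3}"
  shows "EC i t = B.tens (A.E i 1) (B.E 1 t) + B.tens (A.E i 2) (B.E 2 t) + B.tens (A.E i 3) (B.E 3 t)"
proof -
  have "{1..3::nat} = {1, 2, 3}" by auto
  then show ?thesis unfolding EC_def A.E_def using sandwich_Q[of A.base "A.pt i" "A.pt i" A.base t] assms by (simp add: add.assoc)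
qed

lemma E_supp: "i \<in> {1..3} \<Longrightarrow> entry (A.E i t) \<in> fin_mat (T3_idx K)"
proof -
  assume i: "i \<in> {1..3}"
  have "entry (QK t) \<in> fin_mat (T3_idx K)" using B.finJ by (subst fin_mat_iff) (auto simp: QK)
  then show ?thesis unfolding A.E_def times_fmat.rep_eq by (intro fin_mat_mmult U_supp) (use A.pt[OF i] A.base_mem in auto)
qed

lemma supp_mult: "entry X \<in> fin_mat (T3_idx K) \<Longrightarrow> entry Y \<in> fin_mat (T3_idx K) \<Longrightarrow> entry (X * Y) \<in> fin_mat (T3_idx K)"
  unfolding times_fmat.rep_eq by (rule fin_mat_mmult)

lemma tens_E_mult:
  assumes "b \<in> {1..3}" "entry X \<in> fin_mat (T3_idx K)"
  shows "B.tens X G * B.tens Y (B.E b t) = B.tens (X * Y) (G * B.E b t)"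
  using assms by (intro B.tens_mult) (auto simp: B.E_unit)

text \<open>In the expansion by blocks \<open>a\<close>, \<open>b\<close>, \<open>c\<close> of
  \<open>K\<close>, triangularity of the inner map excludes descents and orthogonality in one block
  of the outer map excludes equalities. Only \<open>a < b < c\<close>, that is 1, 2, 3,
  survives.\<close>

lemma Z_comp: "EC 1 1 * EC 2 2 * EC 3 3 = B.tens A.Z B.Z"
proof -
  have A0: "A.E i t * A.E j s = 0" if "i \<in> {1..3}" "j \<in> {1..3}" "i \<le> j" "s < t" for i j s t
    using A.E_tri that by blast
  have B0: "B.E b t * B.E b s = 0" if "b \<in> {1..3}" "t \<noteq> s" for b t s using B.E_orth that by simp
  have A0': "X * A.E i t * A.E j s = 0" if "i \<in> {1..3}" "j \<in> {1..3}" "i \<le> j" "s < t" for X i j s t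
    using A0[OF that] by (simp add: mult.assoc)
  have B0': "X * B.E b t * B.E b s = 0" if "b \<in> {1..3}" "t \<noteq> s" for X b t s using B0[OF that] by (simp add: mult.assoc)
  have "EC 1 1 * EC 2 2 = B.tens (A.E 1 1 * A.E 2 2) (B.E 1 1 * B.E 2 2) + B.tens (A.E 1 1 * A.E 2 3) (B.E 1 1 * B.E 3 2)
    + B.tens (A.E 1 2 * A.E 2 3) (B.E 2 1 * B.E 3 2)"
    by (simp add: EC_eq algebra_simps tens_E_mult E_supp A0 B0)
  then show ?thesis unfolding EC_eq[of 3, simplified]
    by (simp only: distrib_left distrib_right)
      (simp add: tens_E_mult supp_mult E_supp A.Z_def B.Z_def A0' B0')
qed

end

text \<open>The diagonal entries of \<open>adj x * x\<close> are the squared lengths of the columns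
  of \<open>x\<close>.\<close>

lemma adj_mult_self_eq_zero:
  assumes "adj x * x = 0" shows "x = 0"
proof (rule fmat_eqI)
  fix i j
  obtain F where F: "finite F" "entry x \<in> fin_mat F" using fin_mat_finite_support[OF entry[of x]] by blast
  have "complex_of_real (\<Sum>l\<in>F. (cmod (entry x l j))\<^sup>2) = (\<Sum>l\<in>F. entry (adj x) j l * entry x l j)"
    unfolding of_real_sum complex_norm_square by (simp add: adj.rep_eq madj_def mult.commute)
  also have "\<dots> = 0" using assms entry_times_right[OF F, of "adj x" j j] by (simp add: zero_fmat.rep_eq)
  finally have "(\<Sum>l\<in>F. (cmod (entry x l j))\<^sup>2) = 0" by (simp only: of_real_eq_0_iff)
  then have "\<forall>l\<in>F. entry x l j = 0" using F by (subst (asm) sum_nonneg_eq_0_iff) auto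
  then show "entry x i j = entry 0 i j" using fin_mat_outside[OF F(2)] by (cases "i \<in> F") (auto simp: zero_fmat.rep_eq)
qed

text \<open>\<open>E 2 2\<close> is expanded by \<open>E_sum\<close> and the products are absorbed
  by \<open>E_le\<close>. In this form \<open>Z\<close> appears in commutators of composed
  maps.\<close>

lemma (in tri_units) Z_alt: "Z = (E 1 1 - E 2 1) * (E 3 3 - E 2 3)"
proof -
  have "Z = E 1 1 * (unit - E 2 1 - E 2 3) * E 3 3"
  proof -
    have "E 2 2 = unit - E 2 1 - E 2 3" using E_sum[of 2] by (simp add: algebra_simps)
    then show ?thesis unfolding Z_def by simp
  qed
  also have "\<dots> = E 1 1 * E 3 3 - E 2 1 * E 3 3 - E 1 1 * (E 2 3 * E 3 3)"
    using E_le(1)[of 1 2] by (simp add: left_diff_distrib right_diff_distrib E_unit) (simp add: mult.assoc)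
  also have "\<dots> = E 1 1 * E 3 3 - E 2 1 * E 3 3 - E 1 1 * E 2 3" using E_le(3)[of 2 3] by simp
  also have "\<dots> = (E 1 1 - E 2 1) * (E 3 3 - E 2 3)" by (simp add: algebra_simps E_orth)
  finally show ?thesis .
qed

context tri_comp
begin

text \<open>As the outer projections commute, the commutator is the sum over blocks
  \<open>b\<close>, \<open>d\<close> of the inner commutators \<open>T b d\<close> tensored with
  \<open>F b 1 * F d 3\<close>. Of the nine \<open>T b d\<close> five vanish and four are
  \<open>\<kappa> i j\<close> up to sign; the second tensor factors add up to the product form of
  \<open>Z\<close>.\<close>

lemma EC_commutator:
  assumes ij: "i \<in> {1..3}" "j \<in> {1..3}" "i < j" and com: "B.commuting"
  shows "EC i 1 * EC j 3 - EC j 3 * EC i 1 = B.tens (A.\<kappa> i j) B.Z"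
proof -
  define F where "F b t = B.E b t" for b t
  define T where "T b d = A.E i b * A.E j d - A.E j d * A.E i b" for b d
  have F: "F b t * F d s = F d s * F b t" if "b \<in> {1..3}" "d \<in> {1..3}" for b t d s
    using com that unfolding B.commuting_def F_def by blast
  have tm: "B.tens (A.E i b) (F b 1) * B.tens (A.E j d) (F d 3) - B.tens (A.E j d) (F d 3) * B.tens (A.E i b) (F b 1) =
      B.tens (T b d) (F b 1 * F d 3)" if "b \<in> {1..3}" "d \<in> {1..3}" for b d
    using tens_E_mult[OF that(2) E_supp[OF ij(1)]] tens_E_mult[OF that(1) E_supp[OF ij(2)]] F[OF that]
    unfolding F_def[symmetric] by (simp add: T_def B.tens_diff_left)
  have "EC i 1 * EC j 3 - EC j 3 * EC i 1 =
     B.tens (T 1 1) (F 1 1 * F 1 3) + B.tens (T 1 2) (F 1 1 * F 2 3) + B.tens (T 1 3) (F 1 1 * F 3 3)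
   + (B.tens (T 2 1) (F 2 1 * F 1 3) + B.tens (T 2 2) (F 2 1 * F 2 3) + B.tens (T 2 3) (F 2 1 * F 3 3))
   + (B.tens (T 3 1) (F 3 1 * F 1 3) + B.tens (T 3 2) (F 3 1 * F 2 3) + B.tens (T 3 3) (F 3 1 * F 3 3))"
    unfolding EC_eq[OF ij(1)] EC_eq[OF ij(2)] F_def[symmetric]
    by (simp add: tm[symmetric]) (simp add: algebra_simps)
  also have "\<dots> = B.tens (A.\<kappa> i j) (F 1 1 * F 3 3) - B.tens (A.\<kappa> i j) (F 1 1 * F 2 3)
      - B.tens (A.\<kappa> i j) (F 2 1 * F 3 3) + B.tens (A.\<kappa> i j) (F 2 1 * F 2 3)"
  proof -
    have T: "T 1 1 = 0" "T 3 3 = 0" "T 2 1 = 0" "T 3 1 = 0" "T 3 2 = 0"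
      "T 1 2 = 0 - A.\<kappa> i j" "T 2 3 = 0 - A.\<kappa> i j" "T 2 2 = A.\<kappa> i j" "T 1 3 = A.\<kappa> i j"
      using A.commutators[OF ij] by (simp_all add: T_def A.\<kappa>_def)
    show ?thesis unfolding T B.tens_diff_left by (simp add: algebra_simps)
  qed
  also have "\<dots> = B.tens (A.\<kappa> i j) ((F 1 1 - F 2 1) * (F 3 3 - F 2 3))"
    by (simp add: algebra_simps B.tens_add_right B.tens_diff_right)
  finally show ?thesis unfolding B.Z_alt F_def .
qed

text \<open>The outer map is not assumed to be commuting. Multiplying the commutation relation by
  \<open>y2 \<otimes> G\<close> on the left and by \<open>unit \<otimes> R\<close> on the right
  isolates \<open>y2 x y3 \<otimes> G R\<close> on one side and a tensor with first factor
  \<open>y2 x\<close> on the other. A further factor \<open>y2\<close> kills the former, so one of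
  two tensor factors of the latter vanishes, and either alternative makes \<open>x\<close> commute
  with \<open>y3\<close>.\<close>

lemma inner_commutes:
  assumes ij: "i \<in> {1..3}" "j \<in> {1..3}" "i < j"
    and com: "EC i 1 * EC j 3 = EC j 3 * EC i 1" and Z: "B.Z \<noteq> 0"
  shows "A.\<kappa> i j = 0"
proof -
  define x y1 y2 y3 where "x = A.E i 1" and "y1 = A.E j 1" and "y2 = A.E j 2" and "y3 = A.E j 3"
  define F where "F b t = B.E b t" for b t
  define G R where "G = F 1 1 - F 2 1" and "R = F 3 3 - F 2 3"
  have GR: "G * R \<noteq> 0" using Z unfolding B.Z_alt G_def R_def F_def .
  have sy: "entry x \<in> fin_mat (T3_idx K)" "entry y2 \<in> fin_mat (T3_idx K)" "entry y3 \<in> fin_mat (T3_idx K)"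
    unfolding x_def y2_def y3_def using ij by (auto intro: E_supp)
  have ortho: "F b t * F b s = (if t = s then F b t else 0)" if "b \<in> {1..3}" for b t s
    using that by (simp add: F_def B.E_orth)
  have Fle: "F 1 1 * F 2 1 = F 2 1" "F 2 1 * F 1 1 = F 2 1" "F 1 1 * F 3 1 = F 3 1" "F 2 1 * F 3 1 = F 3 1"
    "F 3 3 * F 2 3 = F 2 3" "F 2 3 * F 3 3 = F 2 3" "F 1 3 * F 3 3 = F 1 3" "F 1 3 * F 2 3 = F 1 3"
    unfolding F_def using B.E_le[of 1 2] B.E_le[of 1 3] B.E_le[of 2 3] by simp_all
  have GF: "G * F 1 1 = G" "G * F 2 1 = 0" "G * F 3 1 = 0"
    unfolding G_def by (simp_all add: left_diff_distrib Fle ortho)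
  have FR: "F 3 3 * R = R" "F 2 3 * R = 0" "F 1 3 * R = 0"
    unfolding R_def by (simp_all add: right_diff_distrib Fle ortho)
  have uF: "B.unit * F b t = F b t" "F b t * B.unit = F b t" if "b \<in> {1..3}" for b t
    using that by (simp_all add: F_def B.E_unit)
  have uR: "B.unit * R = R" "R * B.unit = R" unfolding R_def by (simp_all add: right_diff_distrib left_diff_distrib uF)
  have uG: "B.unit * G = G" "G * B.unit = G" unfolding G_def by (simp_all add: right_diff_distrib left_diff_distrib uF)
  have tF: "B.tens X H * B.tens Y (F b t) = B.tens (X * Y) (H * F b t)" if "b \<in> {1..3}" "entry X \<in> fin_mat (T3_idx K)" for X Y H b t
    unfolding F_def by (rule tens_E_mult[OF that])
  have ECi: "EC i 1 = B.tens (A.E i 1) (F 1 1) + B.tens (A.E i 2) (F 2 1) + B.tens (A.E i 3) (F 3 1)"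
    and ECj: "EC j 3 = B.tens (A.E j 1) (F 1 3) + B.tens (A.E j 2) (F 2 3) + B.tens (A.E j 3) (F 3 3)"
    unfolding F_def by (rule EC_eq[OF ij(1)], rule EC_eq[OF ij(2)])
  \<comment> \<open>\<open>G\<close> is chosen so that on its right only the block 1 term of
    \<open>EC i 1\<close> survives; dually \<open>R\<close> keeps only the block 3 term of
    \<open>EC j 3\<close>.\<close>
  have e1: "B.tens y2 G * EC i 1 = B.tens (y2 * x) G"
    unfolding ECi by (simp add: distrib_left tF sy GF x_def[symmetric])
  have e2: "EC j 3 * B.tens A.unit R = B.tens y3 R"
    unfolding ECj y3_def using ij by (simp add: distrib_right B.tens_mult E_supp uR FR A.E_unit)
  have e3: "B.tens y2 G * EC j 3 = B.tens y2 (G * F 2 3)"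
    unfolding ECj using ij A.E_orth[of j 2] by (simp add: distrib_left tF sy) (simp add: y2_def)
  have e4: "EC i 1 * B.tens A.unit R = B.tens x (F 1 1 * R) + B.tens (A.E i 2) (F 2 1 * R) + B.tens (A.E i 3) (F 3 1 * R)"
    unfolding ECi x_def using ij by (simp add: distrib_right B.tens_mult E_supp uR A.E_unit)
  have uFR: "B.unit * (F b t * R) = F b t * R" if "b \<in> {1..3}" for b t using uF(1)[OF that] by (simp add: mult.assoc[symmetric])
  have F231: "G * F 2 3 * (F 2 1 * R) = 0" using ortho[of 2 3 1] by (simp add: mult.assoc) (simp add: mult.assoc[symmetric])
  have y2E3: "y2 * A.E i 3 = 0" unfolding y2_def by (rule A.E_tri_adj[OF ij]) simp
  have "B.tens (y2 * x * y3) (G * R) = B.tens (y2 * x) G * B.tens y3 R"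
    by (rule B.tens_mult[symmetric]) (use sy supp_mult uR in auto)
  also have "\<dots> = B.tens y2 G * (EC i 1 * EC j 3) * B.tens A.unit R" unfolding e1[symmetric] e2[symmetric] by (simp add: mult.assoc)
  also have "\<dots> = (B.tens y2 G * EC j 3) * (EC i 1 * B.tens A.unit R)" unfolding com by (simp add: mult.assoc)
  also have "\<dots> = B.tens (y2 * x) (G * F 2 3 * (F 1 1 * R))"
    unfolding e3 e4 by (simp add: distrib_left B.tens_mult sy uFR F231 y2E3)
  finally have star: "B.tens (y2 * x * y3) (G * R) = B.tens (y2 * x) (G * F 2 3 * (F 1 1 * R))" .
  define H where "H = G * F 2 3 * (F 1 1 * R)"
  have uH: "B.unit * H * B.unit = H" unfolding H_def using uG uR by (simp add: mult.assoc) (simp add: mult.assoc[symmetric])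
  have uGR: "B.unit * (G * R) * B.unit = G * R" using uG uR by (simp add: mult.assoc) (simp add: mult.assoc[symmetric])
  have uHr: "H * B.unit = H" unfolding H_def using uR by (simp add: mult.assoc)
  have y32: "y3 * y2 = 0" unfolding y3_def y2_def using ij A.E_orth[of j 3 2] by simp
  \<comment> \<open>Multiplying by \<open>y2\<close> on the right brings \<open>y3 * y2 = 0\<close>
    into the other side of \<open>star\<close>.\<close>
  have "B.tens (y2 * x * y2) H = B.tens (y2 * x) H * B.tens y2 B.unit"
    using sy supp_mult uHr by (simp add: B.tens_mult B.unit_unit)
  also have "\<dots> = B.tens (y2 * x * y3) (G * R) * B.tens y2 B.unit" using star by (simp add: H_def)
  also have "\<dots> = B.tens (y2 * x * (y3 * y2)) (G * R * B.unit)"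
    using sy supp_mult by (simp add: B.tens_mult B.unit_unit mult.assoc)
  also have "\<dots> = 0" by (simp add: y32)
  finally have "y2 * x * y2 = 0 \<or> H = 0" by (rule B.tens_eq_zero) (use sy supp_mult uH in auto)
  have adjs: "adj x = x" "adj y1 = y1" "adj y2 = y2" "adj y3 = y3"
    using ij by (auto simp: x_def y1_def y2_def y3_def A.E_adj)
  have xx: "x * x = x" unfolding x_def using A.E_orth[OF ij(1), of 1 1] by simp
  have xy1: "x * y1 = y1" "y1 * x = y1" unfolding x_def y1_def using A.E_le[OF ij] by auto
  have ysum: "y1 + y2 + y3 = A.unit" unfolding y1_def y2_def y3_def by (rule A.E_sum[OF ij(2)])
  have xu: "x * A.unit = x" "A.unit * x = x" unfolding x_def using ij by (auto simp: A.E_unit)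
  from \<open>y2 * x * y2 = 0 \<or> H = 0\<close> have "x * y3 = y3 * x"
  proof
    \<comment> \<open>Then \<open>x * y2 = 0\<close>, so \<open>x * y3 = x - y1\<close> is
      self-adjoint, which means that \<open>x\<close> and \<open>y3\<close> commute.\<close>
    assume "y2 * x * y2 = 0"
    then have "adj (x * y2) * (x * y2) = 0" using xx by (simp add: adj_mult adjs mult.assoc) (simp add: mult.assoc[symmetric])
    then have "x * y2 = 0" by (rule adj_mult_self_eq_zero)
    then have "x = y1 + x * y3" using xu(1) unfolding ysum[symmetric] by (simp add: distrib_left xy1)
    then have *: "x * y3 = x - y1" by (simp add: algebra_simps)
    from arg_cong[OF *, of adj] have "y3 * x = x - y1" by (simp add: adj_mult adj_diff adjs)
    then show ?thesis using * by simp
  next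
    \<comment> \<open>Then \<open>y2 * x * y3 = 0\<close>, here \<open>G * R \<noteq> 0\<close> is
      used; since \<open>y1 * x * y3 = 0\<close> as well, \<open>x * y3 = y3 * x * y3\<close> is
      self-adjoint.\<close>
    assume "H = 0"
    then have "B.tens (y2 * x * y3) (G * R) = 0" using star by (simp add: H_def)
    then have "y2 * x * y3 = 0" using B.tens_eq_zero[OF _ uGR] sy supp_mult GR by blast
    moreover have "y1 * x * y3 = 0" using xy1(2) ij A.E_orth[of j 1 3] by (simp add: y1_def[symmetric] y3_def[symmetric])
    ultimately have "A.unit * x * y3 = y3 * x * y3" unfolding ysum[symmetric] by (simp add: distrib_right)
    then have *: "x * y3 = y3 * x * y3" using xu by simp
    have "y3 * x = y3 * (x * y3)" by (rule arg_cong[OF *, of adj, unfolded adj_mult adjs])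
    then show ?thesis using *[unfolded mult.assoc] by (rule trans[OF _ sym, symmetric])
  qed
  then show ?thesis by (simp add: A.\<kappa>_def x_def y3_def)
qed

end

declare One_nat_def [simp]

section \<open>Star-extendible maps as triangular systems of matrix units\<close>

definition units :: "(('i, 'i) cmat \<Rightarrow> ('k, 'k) cmat) \<Rightarrow> 'i \<Rightarrow> 'i \<Rightarrow> 'k fmat" where
  "units f p q = Abs_fmat (f (munit p q))"

definition block_proj :: "'k set \<Rightarrow> nat \<Rightarrow> (nat \<times> 'k) fmat" where
  "block_proj K t = Abs_fmat (\<lambda>k l. of_bool (k = l \<and> fst k = t \<and> k \<in> T3_idx K))"

lemma entry_Abs: "x \<in> fin_mat I \<Longrightarrow> entry (Abs_fmat x) = x"
  using fin_mat_mono[of I UNIV] by (auto intro: Abs_fmat_inverse)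

lemma block_proj_fin_mat: "finite K \<Longrightarrow> (\<lambda>k l. of_bool (k = l \<and> fst k = t \<and> k \<in> T3_idx K)) \<in> fin_mat (T3_idx K)"
  by (subst fin_mat_iff) auto

lemma entry_block_proj:
  "finite K \<Longrightarrow> entry (block_proj K t) = (\<lambda>k l. of_bool (k = l \<and> fst k = t \<and> k \<in> T3_idx K))"
  unfolding block_proj_def by (rule entry_Abs[OF block_proj_fin_mat])

lemma block_proj_times:
  assumes "finite K" "entry x \<in> fin_mat (T3_idx K)"
  shows "entry (block_proj K t * x) k l = (if fst k = t then entry x k l else 0)"
proof -
  have "entry (block_proj K t * x) k l = (\<Sum>m\<in>T3_idx K. entry (block_proj K t) k m * entry x m l)"
    by (rule entry_times_right) (use assms in auto)
  also have "\<dots> = (if k \<in> T3_idx K then (\<Sum>m\<in>T3_idx K. (of_bool (fst k = t) * entry x m l) * of_bool (m = k)) else 0)"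
    unfolding entry_block_proj[OF assms(1)] by (auto intro!: sum.cong)
  also have "\<dots> = (if fst k = t then entry x k l else 0)"
    using fin_mat_outside(1)[OF assms(2), of k l] finite_T3_idx[OF assms(1)] by (simp add: sum_unit_vector)
  finally show ?thesis .
qed

lemma times_block_proj:
  assumes "finite K" "entry x \<in> fin_mat (T3_idx K)"
  shows "entry (x * block_proj K t) k l = (if fst l = t then entry x k l else 0)"
proof -
  have "entry (x * block_proj K t) k l = (\<Sum>m\<in>T3_idx K. entry x k m * entry (block_proj K t) m l)"
    by (rule entry_times_left) (use assms in auto)
  also have "\<dots> = (if l \<in> T3_idx K then (\<Sum>m\<in>T3_idx K. (of_bool (fst l = t) * entry x k m) * of_bool (m = l)) else 0)"
    unfolding entry_block_proj[OF assms(1)] by (auto intro!: sum.cong sum.neutral)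
  also have "\<dots> = (if fst l = t then entry x k l else 0)"
    using fin_mat_outside(2)[OF assms(2), of l k] finite_T3_idx[OF assms(1)] by (simp add: sum_unit_vector)
  finally show ?thesis .
qed

lemma munit_mult:
  "mmult (munit p q) (munit r s) = (if q = r then munit p s else mzero)"
proof (intro ext)
  fix i j
  have "mmult (munit p q) (munit r s) i j = (\<Sum>l\<in>{q}. munit p q i l * munit r s l j)"
    by (rule mmult_eq_sum) (auto simp: munit_def)
  then show "mmult (munit p q) (munit r s) i j = (if q = r then munit p s else mzero) i j"
    by (auto simp: munit_def mzero_def)
qed

lemma madj_munit: "madj (munit p q) = munit q p"
  by (auto simp: madj_def munit_def fun_eq_iff)

lemma star_homD:
  assumes "star_hom (fin_mat_alg I) (fin_mat_alg I') f" "x \<in> fin_mat I"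
  shows "f x \<in> fin_mat I'"
    and "y \<in> fin_mat I \<Longrightarrow> f (\<lambda>i j. x i j + y i j) = (\<lambda>i j. f x i j + f y i j)"
    and "y \<in> fin_mat I \<Longrightarrow> f (mmult x y) = mmult (f x) (f y)"
    and "f (\<lambda>i j. c * x i j) = (\<lambda>i j. c * f x i j)"
    and "f (madj x) = madj (f x)"
  using assms unfolding star_hom_def fin_mat_alg_def by auto

lemma star_hom_mzero: "star_hom (fin_mat_alg I) (fin_mat_alg I') f \<Longrightarrow> f mzero = mzero"
  using star_homD(4)[of I I' f mzero 0, OF _ mzero_fin_mat] by (simp add: mzero_def)

lemma fin_mat_munit_induct [consumes 3, case_names munit scale add]:
  assumes x: "x \<in> fin_mat I" and I: "finite I" "I \<noteq> {}"
    and munit: "\<And>p q. p \<in> I \<Longrightarrow> q \<in> I \<Longrightarrow> P (munit p q)"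
    and scale: "\<And>c y. y \<in> fin_mat I \<Longrightarrow> P y \<Longrightarrow> P (\<lambda>i j. c * y i j)"
    and add: "\<And>y z. y \<in> fin_mat I \<Longrightarrow> z \<in> fin_mat I \<Longrightarrow> P y \<Longrightarrow> P z \<Longrightarrow> P (\<lambda>i j. y i j + z i j)"
  shows "P x"
proof -
  have part: "(\<lambda>i j. if (i, j) \<in> S then x i j else 0) \<in> fin_mat I \<and> P (\<lambda>i j. if (i, j) \<in> S then x i j else 0)"
    if "finite S" "S \<subseteq> I \<times> I" for S
    using that
  proof (induction S)
    case empty
    obtain p where "p \<in> I" using I by blast
    then show ?case using scale[OF munit_in_fin_mat munit, of p p 0] mzero_fin_mat by (simp add: mzero_def)
  next
    case (insert s S)
    obtain p q where s: "s = (p, q)" "p \<in> I" "q \<in> I" using insert.prems by auto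
    have mu: "munit p q \<in> fin_mat I" using s by (intro munit_in_fin_mat)
    have eq: "(\<lambda>i j. if (i, j) \<in> insert s S then x i j else 0) =
      (\<lambda>i j. (\<lambda>i j. x p q * munit p q i j) i j + (\<lambda>i j. if (i, j) \<in> S then x i j else 0) i j)"
      using insert.hyps by (auto simp: munit_def s fun_eq_iff)
    have IH: "(\<lambda>i j. if (i, j) \<in> S then x i j else 0) \<in> fin_mat I" "P (\<lambda>i j. if (i, j) \<in> S then x i j else 0)"
      using insert by auto
    note sc = fin_mat_scale[OF mu, of "x p q"]
    show ?case unfolding eq
      using fin_mat_add[OF sc IH(1)] add[OF sc IH(1) scale[OF mu munit[OF s(2,3)]] IH(2)] by blast
  qed
  have "(\<lambda>i j. if (i, j) \<in> I \<times> I then x i j else 0) = x"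
    using fin_mat_outside[OF x] by (auto simp: fun_eq_iff)
  then show ?thesis using part[of "I \<times> I"] I by simp
qed

lemma star_hom_expand:
  assumes f: "star_hom (fin_mat_alg I) (fin_mat_alg I') f" and I: "finite I" and x: "x \<in> fin_mat I"
  shows "f x = (\<lambda>k l. \<Sum>p\<in>I. \<Sum>q\<in>I. x p q * f (munit p q) k l)"
proof (cases "I = {}")
  case True
  then have "x = mzero" using fin_mat_outside[OF x] by (auto simp: mzero_def fun_eq_iff)
  then show ?thesis using True star_hom_mzero[OF f] by (simp add: mzero_def)
next
  case False
  with x I show ?thesis
  proof (induction rule: fin_mat_munit_induct)
    case (munit p q)
    have "(\<Sum>p'\<in>I. \<Sum>q'\<in>I. munit p q p' q' * f (munit p' q') k l) =
      (\<Sum>p'\<in>I. (\<Sum>q'\<in>I. f (munit p' q') k l * of_bool (q' = q)) * of_bool (p' = p))" for k l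
      unfolding sum_distrib_right by (intro sum.cong refl) (auto simp: munit_def)
    then show ?case using munit I by (simp only: sum_unit_vector)
  next
    case (scale a y)
    then show ?case by (simp add: star_homD(4)[OF f] sum_distrib_left mult.assoc)
  next
    case (add y z)
    then show ?case by (simp add: star_homD(2)[OF f] distrib_right sum.distrib)
  qed
qed

context
  fixes J :: "'j set" and K :: "'k set" and f
  assumes J: "finite J" and K: "finite K" and f: "star_extendible (T3_alg J) (T3_alg K) f"
begin

lemma T3_star_hom: "star_hom (fin_mat_alg (T3_idx J)) (fin_mat_alg (T3_idx K)) f"
  using f by (simp add: star_extendible_def T3_alg_def)

lemma entry_units: "p \<in> T3_idx J \<Longrightarrow> q \<in> T3_idx J \<Longrightarrow> entry (units f p q) = f (munit p q)"
  unfolding units_def by (rule entry_Abs[OF star_homD(1)[OF T3_star_hom munit_in_fin_mat]])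

lemma units_supp: "p \<in> T3_idx J \<Longrightarrow> q \<in> T3_idx J \<Longrightarrow> entry (units f p q) \<in> fin_mat (T3_idx K)"
  unfolding entry_units by (rule star_homD(1)[OF T3_star_hom munit_in_fin_mat])

lemma tri_units_of:
  assumes o1: "o1 \<in> J"
  shows "tri_units J o1 (units f) (block_proj K)"
proof
  have mu: "munit p q \<in> fin_mat (T3_idx J)" if "p \<in> T3_idx J" "q \<in> T3_idx J" for p q
    using that by (intro munit_in_fin_mat)
  show "units f p q * units f r s = (if q = r then units f p s else 0)"
    if "p \<in> T3_idx J" "q \<in> T3_idx J" "r \<in> T3_idx J" "s \<in> T3_idx J" for p q r s
  proof (rule fmat_eqI)
    fix k l
    have "mmult (f (munit p q)) (f (munit r s)) = (if q = r then f (munit p s) else mzero)"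
      using star_homD(3)[OF T3_star_hom mu[OF that(1,2)] mu[OF that(3,4)]] star_hom_mzero[OF T3_star_hom] by (simp add: munit_mult split: if_splits)
    then show "entry (units f p q * units f r s) k l = entry (if q = r then units f p s else 0) k l"
      using that by (simp add: times_fmat.rep_eq entry_units zero_fmat.rep_eq mzero_def)
  qed
  show "adj (units f p q) = units f q p" if "p \<in> T3_idx J" "q \<in> T3_idx J" for p q
    using star_homD(5)[OF T3_star_hom mu[OF that]] that
    by (intro fmat_eqI) (simp add: adj.rep_eq entry_units madj_munit)
  have bsupp: "entry (block_proj K t) \<in> fin_mat (T3_idx K)" for t
    unfolding entry_block_proj[OF K] by (rule block_proj_fin_mat[OF K])
  show "block_proj K t * block_proj K s = (if t = s then block_proj K t else 0)" for t s
    by (intro fmat_eqI) (auto simp: block_proj_times[OF K bsupp] entry_block_proj[OF K] zero_fmat.rep_eq)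
  show "adj (block_proj K t) = block_proj K t" for t
    by (intro fmat_eqI) (auto simp: adj.rep_eq madj_def entry_block_proj[OF K])
  show "block_proj K t = 0" if "t \<notin> {1..3}" for t
    using that by (intro fmat_eqI) (auto simp: entry_block_proj[OF K] zero_fmat.rep_eq mem_T3_idx)
  show "(block_proj K 1 + block_proj K 2 + block_proj K 3) * units f p q = units f p q"
    if "p \<in> T3_idx J" "q \<in> T3_idx J" for p q
  proof (rule fmat_eqI)
    fix k l
    note supp = units_supp[OF that]
    have "entry ((block_proj K 1 + block_proj K 2 + block_proj K 3) * units f p q) k l =
      (if fst k = 1 then entry (units f p q) k l else 0) + (if fst k = 2 then entry (units f p q) k l else 0)
      + (if fst k = 3 then entry (units f p q) k l else 0)"
      unfolding distrib_right plus_fmat.rep_eq block_proj_times[OF K supp] ..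
    also have "\<dots> = entry (units f p q) k l"
    proof (cases "k \<in> T3_idx K")
      case True
      then have "fst k = 1 \<or> fst k = 2 \<or> fst k = 3" by (auto simp: mem_T3_idx)
      then show ?thesis by auto
    next
      case False
      then show ?thesis using fin_mat_outside(1)[OF supp] by simp
    qed
    finally show "entry ((block_proj K 1 + block_proj K 2 + block_proj K 3) * units f p q) k l = entry (units f p q) k l" .
  qed
  show "block_proj K t * units f p q * block_proj K s = 0"
    if pq: "p \<in> T3_idx J" "q \<in> T3_idx J" "fst p \<le> fst q" "s < t" for p q s t
  proof (rule fmat_eqI)
    fix k l
    note supp = units_supp[OF pq(1,2)]
    have "munit p q \<in> T3 J" using pq(3) mu[OF pq(1,2)] unfolding T3_def by (auto simp: munit_def)
    then have "f (munit p q) \<in> T3 K" using f by (auto simp: star_extendible_def T3_alg_def)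
    then have "fst l < fst k \<Longrightarrow> f (munit p q) (fst k, snd k) (fst l, snd l) = 0" unfolding T3_def by blast
    then have z: "fst l < fst k \<Longrightarrow> entry (units f p q) k l = 0" by (simp add: entry_units[OF pq(1,2)])
    have "entry (block_proj K t * units f p q) \<in> fin_mat (T3_idx K)"
      unfolding times_fmat.rep_eq by (rule fin_mat_mmult[OF bsupp supp])
    then show "entry (block_proj K t * units f p q * block_proj K s) k l = entry 0 k l"
      using z pq(4) by (simp add: times_block_proj[OF K] block_proj_times[OF K supp] zero_fmat.rep_eq)
  qed
qed (use J o1 in auto)

end

lemma star_extendible_comp:
  assumes "star_extendible P Q f" "star_extendible Q R g"
  shows "star_extendible P R (g \<circ> f)"
  using assms unfolding star_extendible_def star_hom_def by (auto simp: image_subset_iff)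

lemma units_comp:
  assumes J: "finite J" and K: "finite K" and L: "finite L"
    and f: "star_extendible (T3_alg J) (T3_alg K) f" and g: "star_extendible (T3_alg K) (T3_alg L) g"
    and pq: "p \<in> T3_idx J" "q \<in> T3_idx J"
  shows "units (g \<circ> f) p q = (\<Sum>c\<in>T3_idx K. \<Sum>d\<in>T3_idx K. scl (entry (units f p q) c d) (units g c d))"
proof (rule fmat_eqI)
  fix k l
  have gf: "star_extendible (T3_alg J) (T3_alg L) (g \<circ> f)" by (rule star_extendible_comp[OF f g])
  have fin: "f (munit p q) \<in> fin_mat (T3_idx K)" using units_supp[OF J K f pq] entry_units[OF J K f pq] by simp
  have "entry (units (g \<circ> f) p q) k l = g (f (munit p q)) k l" using entry_units[OF J L gf pq] by simp
  also have "\<dots> = (\<Sum>c\<in>T3_idx K. \<Sum>d\<in>T3_idx K. f (munit p q) c d * g (munit c d) k l)"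
    using star_hom_expand[OF T3_star_hom[OF K L g] finite_T3_idx[OF K] fin] by simp
  also have "\<dots> = entry (\<Sum>c\<in>T3_idx K. \<Sum>d\<in>T3_idx K. scl (entry (units f p q) c d) (units g c d)) k l"
    unfolding entry_sum by (intro sum.cong[OF refl]) (simp add: scl.rep_eq entry_units[OF J K f pq] entry_units[OF K L g])
  finally show "entry (units (g \<circ> f) p q) k l =
    entry (\<Sum>c\<in>T3_idx K. \<Sum>d\<in>T3_idx K. scl (entry (units f p q) c d) (units g c d)) k l" .
qed

declare One_nat_def [simp del]

text \<open>In a decomposition into copies, \<open>E i t\<close> is the sum over the copies of the
  rank one projections on column \<open>base\<close>, with weight 1 if the copy sends
  \<open>i\<close> to \<open>t\<close> and 0 otherwise. Products of such sums multiply the weights,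
  hence commute.\<close>

lemma has_class_commuting:
  assumes J: "finite J" and K: "finite K" and f: "has_class J K f m" and o1: "o1 \<in> J"
  shows "tri_units.commuting o1 (units f) (block_proj K)"
proof -
  obtain v \<sigma> r where v: "block_rep J K f {..<r::nat} v \<sigma>" using f by (rule has_classE)
  note se = has_class_star_extendible[OF J K f]
  interpret tri_units J o1 "units f" "block_proj K" by (rule tri_units_of[OF J K se o1])
  \<comment> \<open>The unit at \<open>(p, q)\<close> with copy \<open>s\<close> weighted by
    \<open>w s\<close>.\<close>
  define D where "D w p q = (\<lambda>k l. \<Sum>s<r. w s * (v s k p * cnj (v s l q)))" for w :: "nat \<Rightarrow> complex" and p q
  have U: "entry (units f p q) = D (\<lambda>_. 1) p q" if "p \<in> T3_idx J" "q \<in> T3_idx J" for p q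
    using that by (intro ext) (simp add: entry_units[OF J K se] D_def block_rep_munit[OF J v])
  have Dmult: "(\<Sum>m\<in>T3_idx K. D w p q k m * D w' q' r' m l) = of_bool (q = q') * D (\<lambda>s. w s * w' s) p r' k l"
    if q: "q \<in> T3_idx J" "q' \<in> T3_idx J" for w w' p q q' r' k l
  proof -
    have "(\<Sum>m\<in>T3_idx K. D w p q k m * D w' q' r' m l) =
      (\<Sum>m\<in>T3_idx K. \<Sum>s<r. \<Sum>t<r. w s * v s k p * (w' t * cnj (v t l r')) * (cnj (v s m q) * v t m q'))"
      unfolding D_def sum_product by (simp add: mult_ac)
    also have "\<dots> = (\<Sum>s<r. \<Sum>m\<in>T3_idx K. \<Sum>t<r. w s * v s k p * (w' t * cnj (v t l r')) * (cnj (v s m q) * v t m q'))"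
      by (rule sum.swap)
    also have "\<dots> = (\<Sum>s<r. \<Sum>t<r. \<Sum>m\<in>T3_idx K. w s * v s k p * (w' t * cnj (v t l r')) * (cnj (v s m q) * v t m q'))"
      by (rule sum.cong[OF refl], rule sum.swap)
    also have "\<dots> = (\<Sum>s<r. \<Sum>t<r. (of_bool (q = q') * (w s * v s k p * (w' t * cnj (v t l r')))) * of_bool (t = s))"
      unfolding sum_distrib_left[symmetric] using block_repD(3)[OF v _ _ q] by (intro sum.cong[OF refl]) auto
    also have "\<dots> = (\<Sum>s<r. of_bool (q = q') * (w s * v s k p * (w' s * cnj (v s l r'))))"
      by (intro sum.cong[OF refl] sum_unit_vector) auto
    finally show ?thesis by (simp add: D_def sum_distrib_left mult_ac)
  qed
  have Esupp: "entry (E i t) \<in> fin_mat (T3_idx K)" if "i \<in> {1..3}" for i t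
    using that J K se units_supp[OF J K se] block_proj_fin_mat[OF K]
    unfolding E_def times_fmat.rep_eq by (intro fin_mat_mmult) (auto simp: entry_block_proj[OF K])
  have E: "entry (E i t) = D (\<lambda>s. of_bool (omap_apply (\<sigma> s) i = t)) base base" if i: "i \<in> {1..3}" for i t
  proof (intro ext)
    fix k l
    have p: "pt i \<in> T3_idx J" "base \<in> T3_idx J" using i by auto
    have "entry (E i t) k l = (\<Sum>m\<in>T3_idx K. entry (units f base (pt i)) k m * entry (block_proj K t * units f (pt i) base) m l)"
      unfolding E_def mult.assoc by (rule entry_times_left) (use K units_supp[OF J K se] p in auto)
    also have "\<dots> = (\<Sum>m\<in>T3_idx K. D (\<lambda>_. 1) base (pt i) k m * D (\<lambda>s. of_bool (omap_apply (\<sigma> s) i = t)) (pt i) base m l)"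
    proof (rule sum.cong[OF refl])
      fix m assume "m \<in> T3_idx K"
      have "(if fst m = t then D (\<lambda>_. 1) (pt i) base m l else 0) = D (\<lambda>s. of_bool (omap_apply (\<sigma> s) i = t)) (pt i) base m l"
      proof -
        have tm: "of_bool (omap_apply (\<sigma> s) i = t) * (v s m (pt i) * cnj (v s l base)) =
          of_bool (fst m = t) * (v s m (pt i) * cnj (v s l base))" if "s < r" for s
          using block_repD(2)[OF v, of s m "pt i"] that by (cases "v s m (pt i) = 0") auto
        have "D (\<lambda>s. of_bool (omap_apply (\<sigma> s) i = t)) (pt i) base m l =
          (\<Sum>s<r. of_bool (fst m = t) * (v s m (pt i) * cnj (v s l base)))"
          unfolding D_def by (rule sum.cong[OF refl]) (use tm in simp)
        then show ?thesis by (simp add: D_def)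
      qed
      then show "entry (units f base (pt i)) k m * entry (block_proj K t * units f (pt i) base) m l =
        D (\<lambda>_. 1) base (pt i) k m * D (\<lambda>s. of_bool (omap_apply (\<sigma> s) i = t)) (pt i) base m l"
        unfolding block_proj_times[OF K units_supp[OF J K se p]] U[OF p] U[OF p(2,1)] by (rule arg_cong)
    qed
    also have "\<dots> = D (\<lambda>s. of_bool (omap_apply (\<sigma> s) i = t)) base base k l"
      using Dmult[OF p(1) p(1)] by simp
    finally show "entry (E i t) k l = D (\<lambda>s. of_bool (omap_apply (\<sigma> s) i = t)) base base k l" .
  qed
  show ?thesis
    unfolding commuting_def
  proof (intro ballI allI)
    fix i j t s assume ij: "i \<in> {1..3::nat}" "j \<in> {1..3::nat}"
    show "E i t * E j s = E j s * E i t"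
    proof (rule fmat_eqI)
      fix k l
      have e: "entry (E i t * E j s) k l = D (\<lambda>a. of_bool (omap_apply (\<sigma> a) i = t) * of_bool (omap_apply (\<sigma> a) j = s)) base base k l"
        if ij: "i \<in> {1..3}" "j \<in> {1..3}" for i j t s
        using entry_times_left[OF finite_T3_idx[OF K] Esupp[OF ij(1)], of t "E j s" k l]
        unfolding E[OF ij(1)] E[OF ij(2)] Dmult[OF base_mem base_mem] by simp
      show "entry (E i t * E j s) k l = entry (E j s * E i t) k l"
        unfolding e[OF ij] e[OF ij(2,1)] by (simp only: mult.commute)
    qed
  qed
qed

text \<open>An irregular \<open>f\<close> can only be hidden by maps \<open>g\<close> without identity component: either \<open>g' \<circ> g\<close> has no
  identity component, so that composing with it destroys the irregularity, or \<open>f\<close> is regular itself.\<close>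

lemma commuting_triple:
  assumes fin: "finite J" "finite K" "finite L" "finite M"
    and f: "star_extendible (T3_alg J) (T3_alg K) f" and g: "star_extendible (T3_alg K) (T3_alg L) g"
    and g': "star_extendible (T3_alg L) (T3_alg M) g'"
    and gf: "has_class J L (g \<circ> f) m" and g'g: "has_class K M (g' \<circ> g) m'"
    and o1: "o1 \<in> J" and o2: "o2 \<in> K" and o3: "o3 \<in> L"
  shows "tri_units.commuting o1 (units (g' \<circ> g \<circ> f)) (block_proj M)"
proof -
  have se: "star_extendible (T3_alg J) (T3_alg L) (g \<circ> f)" "star_extendible (T3_alg K) (T3_alg M) (g' \<circ> g)"
    "star_extendible (T3_alg J) (T3_alg M) (g' \<circ> g \<circ> f)"
    using star_extendible_comp[OF f g] star_extendible_comp[OF g g'] star_extendible_comp[OF star_extendible_comp[OF f g] g'] by (simp_all add: comp_assoc)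
  note tu = tri_units_of[OF fin(1,2) f o1] tri_units_of[OF fin(2,3) g o2] tri_units_of[OF fin(3,4) g' o3]
  interpret F: tri_units J o1 "units f" "block_proj K" by (rule tu)
  interpret G: tri_units K o2 "units g" "block_proj L" by (rule tu)
  interpret G': tri_units L o3 "units g'" "block_proj M" by (rule tu)
  interpret GF: tri_units J o1 "units (g \<circ> f)" "block_proj L" by (rule tri_units_of[OF fin(1,3) se(1) o1])
  interpret G'G: tri_units K o2 "units (g' \<circ> g)" "block_proj M" by (rule tri_units_of[OF fin(2,4) se(2) o2])
  interpret H: tri_units J o1 "units (g' \<circ> g \<circ> f)" "block_proj M" by (rule tri_units_of[OF fin(1,4) se(3) o1])
  interpret C1: tri_comp J o1 "units f" "block_proj K" K o2 "units g" "block_proj L"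
    by unfold_locales (auto simp: units_supp[OF fin(1,2) f] entry_block_proj[OF fin(2)])
  interpret C2: tri_comp K o2 "units g" "block_proj L" L o3 "units g'" "block_proj M"
    by unfold_locales (auto simp: units_supp[OF fin(2,3) g] entry_block_proj[OF fin(3)])
  interpret C3: tri_comp J o1 "units f" "block_proj K" K o2 "units (g' \<circ> g)" "block_proj M"
    by unfold_locales (auto simp: units_supp[OF fin(1,2) f] entry_block_proj[OF fin(2)])
  have EC1: "C1.EC i t = GF.E i t" if "i \<in> {1..3}" for i t
    unfolding C1.EC_def GF.E_def C1.UW_def using units_comp[OF fin(1,2,3) f g] F.pt[OF that] F.base_mem by simp
  have EC2: "C2.EC i t = G'G.E i t" if "i \<in> {1..3}" for i t
    unfolding C2.EC_def G'G.E_def C2.UW_def using units_comp[OF fin(2,3,4) g g'] G.pt[OF that] G.base_mem by simp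
  have EC3: "C3.EC i t = H.E i t" if "i \<in> {1..3}" for i t
    unfolding C3.EC_def H.E_def C3.UW_def using units_comp[OF fin(1,2,4) f se(2)] F.pt[OF that] F.base_mem by (simp add: comp_assoc)
  have com: "G'G.commuting" by (rule has_class_commuting[OF fin(2,4) g'g o2])
  have com': "GF.commuting" by (rule has_class_commuting[OF fin(1,3) gf o1])
  have "H.\<kappa> i j = 0" if ij: "i \<in> {1..3}" "j \<in> {1..3}" "i < j" for i j
  proof -
    \<comment> \<open>Here \<open>f\<close> is the inner map and the regular map
      \<open>g' \<circ> g\<close> the outer one.\<close>
    have k: "H.\<kappa> i j = G'G.tens (F.\<kappa> i j) G'G.Z"
      using C3.EC_commutator[OF ij com] by (simp only: EC3[OF ij(1)] EC3[OF ij(2)] H.\<kappa>_def)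
    have one: "(1::nat) \<in> {1..3}" "(2::nat) \<in> {1..3}" "(3::nat) \<in> {1..3}" by auto
    \<comment> \<open>If \<open>g\<close> has vanishing \<open>Z\<close>, so has
      \<open>g' \<circ> g\<close>, and the commutators disappear; otherwise \<open>g\<close> detects
      them in the regular map \<open>g \<circ> f\<close>.\<close>
    have "G'G.Z = G'.tens G.Z G'.Z"
      using C2.Z_comp by (simp only: EC2[OF one(1)] EC2[OF one(2)] EC2[OF one(3)] G'G.Z_def)
    moreover have "F.\<kappa> i j = 0" if "G.Z \<noteq> 0"
    proof (rule C1.inner_commutes[OF ij _ that])
      show "C1.EC i 1 * C1.EC j 3 = C1.EC j 3 * C1.EC i 1"
        unfolding EC1[OF ij(1)] EC1[OF ij(2)] using com' ij unfolding GF.commuting_def by blast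
    qed
    ultimately show ?thesis unfolding k by (cases "G.Z = 0") simp_all
  qed
  then show ?thesis unfolding H.commuting_iff by blast
qed

section \<open>From commuting resolutions back to multiplicity one summands\<close>

definition mu :: "'i \<Rightarrow> 'i \<Rightarrow> 'i fmat" where
  "mu p q = Abs_fmat (munit p q)"

lemma entry_mu: "entry (mu p q) = munit p q"
  unfolding mu_def by (rule entry_Abs[of _ "{p, q}"]) (simp add: munit_in_fin_mat)

lemma mu_nonzero: "mu x x \<noteq> 0"
proof
  assume "mu x x = 0"
  then have "entry (mu x x) x x = entry 0 x x" by simp
  then show False by (simp add: entry_mu munit_def zero_fmat.rep_eq)
qed

lemma adj_mu: "adj (mu p q) = mu q p"
  by (rule fmat_eqI) (simp add: adj.rep_eq entry_mu madj_munit)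

lemma entry_times_mu: "entry (X * mu p q) k l = (if l = q then entry X k p else 0)"
proof -
  have "entry (X * mu p q) k l = (\<Sum>m\<in>{p, q}. entry X k m * entry (mu p q) m l)"
    by (rule entry_times_right) (auto simp: entry_mu munit_in_fin_mat)
  then show ?thesis by (cases "p = q") (auto simp: entry_mu munit_def)
qed

lemma mu_times: "mu p q * mu r s = (if q = r then mu p s else 0)"
  by (rule fmat_eqI) (auto simp: entry_times_mu entry_mu munit_def zero_fmat.rep_eq)

lemma entry_mu_times: "entry (mu p q * X) k l = (if k = p then entry X q l else 0)"
proof -
  have "entry (mu p q * X) k l = (\<Sum>m\<in>{p, q}. entry (mu p q) k m * entry X m l)"
    by (rule entry_times_left) (auto simp: entry_mu munit_in_fin_mat)
  then show ?thesis by (cases "p = q") (auto simp: entry_mu munit_def)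
qed

lemma mu_sandwich: "mu p q * (X * mu r s) = scl (entry X q r) (mu p s)"
  by (rule fmat_eqI) (auto simp: entry_times_mu entry_mu_times scl.rep_eq entry_mu munit_def)

lemma entry_through_mu: "entry (X * (mu x x * Y)) k l = entry X k x * entry Y x l"
proof -
  have "entry ((X * mu x x) * Y) k l = (\<Sum>m\<in>{x}. entry (X * mu x x) k m * entry Y m l)"
    by (rule entry_times) (auto simp: entry_times_mu)
  then show ?thesis by (simp add: entry_times_mu mult.assoc)
qed

text \<open>Vectors are encoded as matrices with the single column \<open>x\<close>:
  \<open>C * mu x x = C\<close> states this shape, \<open>adj C * C = mu x x\<close> unit length,
  and \<open>C * adj C\<close> is a rank one projection. Induction on the support splits off the
  normalised column \<open>k\<close> of \<open>P\<close> if it is nonzero; what remains is a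
  projection whose row and column \<open>k\<close> vanish.\<close>

lemma projection_decomposition:
  fixes P :: "'k fmat"
  assumes "finite F" "adj P = P" "P * P = P" "entry P \<in> fin_mat F"
  shows "\<exists>S. finite S \<and> (\<forall>C\<in>S. C * mu x x = C) \<and>
    (\<forall>C\<in>S. \<forall>D\<in>S. adj C * D = (if C = D then mu x x else 0)) \<and> P = (\<Sum>C\<in>S. C * adj C)"
  using assms
proof (induction F arbitrary: P)
  case empty
  then have "P = 0" using fin_mat_outside[OF empty(3)] by (intro fmat_eqI) (auto simp: zero_fmat.rep_eq)
  then show ?case by (intro exI[of _ "{}"]) auto
next
  case (insert k F)
  define a where "a = entry P k k"
  have col: "entry R l k = 0 \<and> entry R k l = 0" if R: "adj R = R" "R * R = R" "entry R k k = 0" for R :: "'k fmat" and l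
  proof -
    have "adj (R * mu k k) * (R * mu k k) = mu k k * ((R * R) * mu k k)"
      unfolding adj_mult adj_mu R(1) by (simp add: mult.assoc)
    also have "\<dots> = 0" unfolding R(2) mu_sandwich R(3) by simp
    finally have "R * mu k k = 0" by (rule adj_mult_self_eq_zero)
    then have "entry (R * mu k k) l k = 0" by (simp add: zero_fmat.rep_eq)
    then have "entry R l k = 0" by (simp add: entry_times_mu)
    moreover have "entry R k l = cnj (entry R l k)" by (subst R(1)[symmetric]) (simp add: adj.rep_eq madj_def)
    ultimately show ?thesis by simp
  qed
  have shrink: "entry R \<in> fin_mat F" if R: "adj R = R" "R * R = R" "entry R k k = 0"
    and out: "\<And>i j. i \<notin> insert k F \<or> j \<notin> insert k F \<Longrightarrow> entry R i j = 0" for R :: "'k fmat"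
  proof (subst fin_mat_iff[OF insert.hyps(1)], intro allI impI)
    fix i j assume ne: "entry R i j \<noteq> 0"
    then have "i \<in> insert k F" "j \<in> insert k F" using out by blast+
    then show "i \<in> F \<and> j \<in> F" using ne col[OF R] by blast
  qed
  show ?case
  proof (cases "a = 0")
    case True
    have "entry P \<in> fin_mat F"
      using shrink[OF insert.prems(1,2)] True fin_mat_outside[OF insert.prems(3)] unfolding a_def by blast
    then show ?thesis by (intro insert.IH insert.prems)
  next
    case False
    have "complex_of_real (\<Sum>l\<in>insert k F. (cmod (entry P l k))\<^sup>2) = (\<Sum>l\<in>insert k F. entry (adj P) k l * entry P l k)"
      unfolding of_real_sum complex_norm_square by (simp add: adj.rep_eq madj_def mult.commute)
    also have "\<dots> = entry (P * P) k k"
      using insert.prems(1,3) insert.hyps(1) entry_times_right[of "insert k F" P P k k] by simp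
    finally have "a = complex_of_real (\<Sum>l\<in>insert k F. (cmod (entry P l k))\<^sup>2)"
      unfolding insert.prems(2) a_def ..
    then obtain b where b: "a = complex_of_real b" "b \<ge> 0" by (rule that) (intro sum_nonneg zero_le_power2)
    \<comment> \<open>\<open>b\<close> is the squared length of column \<open>k\<close> of
      \<open>P\<close>, so \<open>c\<close> normalises this column.\<close>
    define c where "c = complex_of_real (1 / sqrt b)"
    have c: "c * c * a = 1" "cnj c = c" using False b unfolding c_def by (simp_all flip: of_real_mult)
    define v where "v = scl c (P * mu k x)"
    have av: "adj v = scl c (mu x k * P)" by (simp add: v_def adj_scl adj_mult adj_mu insert.prems(1) c)
    have vx: "v * mu x x = v" by (simp add: v_def scl_times_left mult.assoc mu_times)
    have vv: "adj v * v = mu x x"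
    proof -
      have "adj v * v = scl (c * c) (mu x k * ((P * P) * mu k x))"
        unfolding av unfolding v_def scl_times_left scl_times_right scl_scl by (simp add: mult.assoc)
      then show ?thesis unfolding insert.prems(2) mu_sandwich scl_scl a_def[symmetric] c(1) by simp
    qed
    have Pv: "P * v = v" unfolding v_def scl_times_right by (simp add: mult.assoc[symmetric] insert.prems(2))
    define R where "R = P - v * adj v"
    have Pv': "adj v * P = adj v" using arg_cong[OF Pv, of adj] by (simp add: adj_mult insert.prems(1))
    have vvv: "adj v * (v * z) = mu x x * z" "v * (mu x x * z) = v * z" "P * (v * z) = v * z" for z
      using vv vx Pv by (simp_all flip: mult.assoc)
    have R1: "adj R = R" by (simp add: R_def adj_diff adj_mult insert.prems(1))
    have R2: "R * R = R"
      by (simp add: R_def left_diff_distrib right_diff_distrib mult.assoc vvv Pv' insert.prems(2))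
    have Rv: "R * v = 0" by (simp add: R_def left_diff_distrib mult.assoc vv vx Pv)
    have vR: "adj v * R = 0" using arg_cong[OF Rv, of adj] by (simp add: adj_mult R1)
    have vv_entry: "entry (v * adj v) i j = entry v i x * cnj (entry v j x)" for i j
      using entry_through_mu[of v x "adj v" i j] vvv(2) by (simp add: adj.rep_eq madj_def)
    have v_entry: "entry v i x = c * entry P i k" for i by (simp add: v_def scl.rep_eq entry_times_mu)
    have "entry R k k = a - c * a * (c * cnj a)"
      by (simp add: R_def minus_fmat.rep_eq vv_entry v_entry a_def[symmetric] c)
    also have "\<dots> = a - c * c * a * a" by (simp add: b mult_ac)
    finally have R3: "entry R k k = 0" using c by simp
    have "entry R \<in> fin_mat F"
    proof (rule shrink[OF R1 R2 R3])
      fix i j assume "i \<notin> insert k F \<or> j \<notin> insert k F"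
      then have "entry P i j = 0" "entry P i k = 0 \<or> entry P j k = 0"
        using fin_mat_outside[OF insert.prems(3)] by blast+
      then show "entry R i j = 0" by (auto simp: R_def minus_fmat.rep_eq vv_entry v_entry)
    qed
    then obtain S where S: "finite S" "\<forall>C\<in>S. C * mu x x = C"
      "\<forall>C\<in>S. \<forall>D\<in>S. adj C * D = (if C = D then mu x x else 0)" "R = (\<Sum>C\<in>S. C * adj C)"
      using insert.IH[OF R1 R2] by blast
    have RC: "R * C = C" if "C \<in> S" for C
    proof -
      have "R * C = (\<Sum>D\<in>S. D * (if D = C then mu x x else 0))"
        unfolding S(4) sum_distrib_right mult.assoc using S(3) that by (intro sum.cong[OF refl]) auto
      also have "\<dots> = (\<Sum>D\<in>S. if D = C then C * mu x x else 0)" by (intro sum.cong) auto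
      finally show ?thesis using S(1,2) that by simp
    qed
    have vC: "adj v * C = 0" "adj C * v = 0" if "C \<in> S" for C
    proof -
      have "adj v * C = adj v * R * C" using RC[OF that] by (simp add: mult.assoc)
      then show 1: "adj v * C = 0" by (simp add: vR)
      show "adj C * v = 0" using arg_cong[OF 1, of adj] by (simp add: adj_mult)
    qed
    have vS: "v \<notin> S" using vC(1)[of v] vv mu_nonzero[of x] by auto
    show ?thesis
    proof (intro exI[of _ "insert v S"] conjI ballI)
      show "P = (\<Sum>C\<in>insert v S. C * adj C)" using vS S(1,4) by (simp add: R_def algebra_simps)
      fix C D assume "C \<in> insert v S" "D \<in> insert v S"
      then show "adj C * D = (if C = D then mu x x else 0)" using vv vC S(3) vS by auto
    qed (use S vx in auto)
  qed
qed

lemma (in tri_units) U_E: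
  assumes p: "p \<in> T3_idx J" and i: "fst p = i" "i \<in> {1..3}"
  shows "Q t * (U p base * E i t) = U p base * E i t"
proof -
  have *: "U p base * E i t = U p (pt i) * Q t * U (pt i) base"
    using p i by (simp add: E_def mult.assoc[symmetric] U_mult)
  have "Q t * (U p (pt i) * Q t * U (pt i) base) = U p (pt i) * (Q t * Q t) * U (pt i) base"
    using Q_commute[OF p pt[OF i(2)], of t] i(1) by (simp add: mult.assoc[symmetric])
  then show ?thesis unfolding * by (simp add: Q_mult)
qed

text \<open>The products \<open>\<Psi> \<tau>\<close> are the joint spectral projections of the
  three resolutions, one for each triple of blocks, and they sum to \<open>unit\<close>. Each is
  split into unit vectors; such a vector \<open>C\<close>, carried around by the units
  \<open>U p base\<close>, spans one copy of the identity representation, and its block pattern is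
  \<open>\<tau>\<close>.\<close>

lemma commuting_has_class:
  fixes f :: "(nat \<times> 'j, nat \<times> 'j) cmat \<Rightarrow> (nat \<times> 'k, nat \<times> 'k) cmat"
  assumes J: "finite J" and K: "finite K" and se: "star_extendible (T3_alg J) (T3_alg K) f" and o1: "o1 \<in> J"
    and com: "tri_units.commuting o1 (units f) (block_proj K)"
  shows "\<exists>m. has_class J K f m"
proof -
  interpret tri_units J o1 "units f" "block_proj K" by (rule tri_units_of[OF J K se o1])
  define T where "T = {1..3::nat} \<times> {1..3::nat} \<times> {1..3::nat}"
  define \<Psi> where "\<Psi> \<tau> = E 1 (fst \<tau>) * (E 2 (fst (snd \<tau>)) * E 3 (snd (snd \<tau>)))" for \<tau>
  define tat where "tat \<tau> i = (if i = 1 then fst \<tau> else if i = 2 then fst (snd \<tau>) else snd (snd \<tau>))" for \<tau> :: "nat \<times> nat \<times> nat" and i :: nat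
  \<comment> \<open>An arbitrary fixed column in which the vectors are stored.\<close>
  define x0 :: "nat \<times> 'k" where "x0 = undefined"
  have C: "E i t * E j s = E j s * E i t" if "i \<in> {1..3}" "j \<in> {1..3}" for i j t s
    using com that unfolding commuting_def by blast
  have one: "(1::nat) \<in> {1..3}" "(2::nat) \<in> {1..3}" "(3::nat) \<in> {1..3}" by auto
  have Eidem: "E i t * (E i s * z) = (if t = s then E i t * z else 0)" if "i \<in> {1..3}" for i t s z
    using E_orth[OF that, of t s] by (simp flip: mult.assoc)
  have Cz: "E 2 t * (E 1 s * z) = E 1 s * (E 2 t * z)" "E 3 t * (E 1 s * z) = E 1 s * (E 3 t * z)"
    "E 3 t * (E 2 s * z) = E 2 s * (E 3 t * z)" for t s z
    using C[OF one(2) one(1), of t s] C[OF one(3) one(1), of t s] C[OF one(3) one(2), of t s] by (simp_all flip: mult.assoc)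
  note Cs = C[OF one(2) one(1)] C[OF one(3) one(1)] C[OF one(3) one(2)]
  have \<Psi>_mult: "\<Psi> \<tau> * \<Psi> \<tau>' = (if \<tau> = \<tau>' then \<Psi> \<tau> else 0)" for \<tau> \<tau>'
    unfolding \<Psi>_def by (simp add: mult.assoc Cz Cs Eidem one E_orth prod_eq_iff)
  have \<Psi>_adj: "adj (\<Psi> \<tau>) = \<Psi> \<tau>" for \<tau>
    unfolding \<Psi>_def by (simp add: adj_mult E_adj Cz Cs mult.assoc)
  have \<Psi>_unit: "unit * \<Psi> \<tau> = \<Psi> \<tau>" for \<tau>
    unfolding \<Psi>_def by (simp add: E_unit flip: mult.assoc)
  have \<Psi>_tat: "E i (tat \<tau> i) * \<Psi> \<tau> = \<Psi> \<tau>" if "i \<in> {1..3}" for i \<tau>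
  proof -
    have "i = 1 \<or> i = 2 \<or> i = 3" using that by auto
    then show ?thesis unfolding \<Psi>_def tat_def by (auto simp: Cz Cs Eidem one E_orth)
  qed
  have \<Psi>_sum: "(\<Sum>\<tau>\<in>T. \<Psi> \<tau>) = unit"
  proof -
    have s: "(\<Sum>t\<in>{1..3}. E i t) = unit" if "i \<in> {1..3}" for i
    proof -
      have "{1..3::nat} = {1, 2, 3}" by auto
      then show ?thesis using E_sum[OF that] by (simp add: add.assoc)
    qed
    have "(\<Sum>\<tau>\<in>T. \<Psi> \<tau>) = (\<Sum>a\<in>{1..3}. E 1 a * (\<Sum>b\<in>{1..3}. E 2 b * (\<Sum>c\<in>{1..3}. E 3 c)))"
      unfolding T_def \<Psi>_def by (simp only: sum_distrib_left sum.cartesian_product split_def fst_conv snd_conv)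
    then show ?thesis by (simp only: s one E_unit)
  qed
  have Esupp: "entry (E i t) \<in> fin_mat (T3_idx K)" if "i \<in> {1..3}" for i t
    using units_supp[OF J K se] block_proj_fin_mat[OF K] pt[OF that] base_mem
    unfolding E_def times_fmat.rep_eq by (intro fin_mat_mmult) (auto simp: entry_block_proj[OF K])
  have \<Psi>_supp: "entry (\<Psi> \<tau>) \<in> fin_mat (T3_idx K)" for \<tau>
    unfolding \<Psi>_def times_fmat.rep_eq by (intro fin_mat_mmult Esupp one)
  have "\<exists>S. finite S \<and> (\<forall>C\<in>S. C * mu x0 x0 = C) \<and>
    (\<forall>C\<in>S. \<forall>D\<in>S. adj C * D = (if C = D then mu x0 x0 else 0)) \<and> \<Psi> \<tau> = (\<Sum>C\<in>S. C * adj C)" for \<tau>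
    by (rule projection_decomposition[OF finite_T3_idx[OF K] \<Psi>_adj _ \<Psi>_supp]) (simp add: \<Psi>_mult)
  then obtain S where S: "\<And>\<tau>. finite (S \<tau>)" "\<And>\<tau> C. C \<in> S \<tau> \<Longrightarrow> C * mu x0 x0 = C"
    "\<And>\<tau> C D. C \<in> S \<tau> \<Longrightarrow> D \<in> S \<tau> \<Longrightarrow> adj C * D = (if C = D then mu x0 x0 else 0)"
    "\<And>\<tau>. \<Psi> \<tau> = (\<Sum>C\<in>S \<tau>. C * adj C)" by metis
  have \<Psi>C: "\<Psi> \<tau> * C = C" if "C \<in> S \<tau>" for \<tau> C
  proof -
    have "\<Psi> \<tau> * C = (\<Sum>D\<in>S \<tau>. D * (if D = C then mu x0 x0 else 0))"
      unfolding S(4) sum_distrib_right mult.assoc using S(3) that by (intro sum.cong[OF refl]) auto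
    also have "\<dots> = (\<Sum>D\<in>S \<tau>. if D = C then C * mu x0 x0 else 0)" by (intro sum.cong) auto
    finally show ?thesis using S(1,2) that by simp
  qed
  define A where "A = Sigma T S"
  have CC: "adj C * D = (if \<tau> = \<tau>' \<and> C = D then mu x0 x0 else 0)" if "C \<in> S \<tau>" "D \<in> S \<tau>'" for \<tau> \<tau>' C D
  proof (cases "\<tau> = \<tau>'")
    case False
    have "adj C * D = adj (\<Psi> \<tau> * C) * (\<Psi> \<tau>' * D)" using \<Psi>C that by simp
    also have "\<dots> = adj C * ((\<Psi> \<tau> * \<Psi> \<tau>') * D)" by (simp add: adj_mult \<Psi>_adj mult.assoc)
    finally show ?thesis using False by (simp add: \<Psi>_mult)
  qed (use S(3) that in auto)
  \<comment> \<open>The column of copy \<open>(\<tau>, C)\<close> at \<open>p\<close> is the image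
    of the vector \<open>C\<close> under \<open>units f p base\<close>.\<close>
  define v where "v s k p = (if p \<in> T3_idx J then entry (units f p base * snd s) k x0 else 0)"
    for s :: "(nat \<times> nat \<times> nat) \<times> (nat \<times> 'k) fmat" and k p
  \<comment> \<open>A triple that carries a vector has a nonzero \<open>\<Psi> \<tau>\<close>; a
    descent in the triple would make it 0 by \<open>E_tri\<close>. Hence the pattern is order
    preserving.\<close>
  have mono: "tat \<tau> i \<in> {1..3} \<and> (j \<in> {1..3} \<longrightarrow> i \<le> j \<longrightarrow> tat \<tau> i \<le> tat \<tau> j)"
    if tC: "\<tau> \<in> T" "C \<in> S \<tau>" "i \<in> {1..3}" for \<tau> C i j
  proof -
    have "tat \<tau> i \<le> tat \<tau> j" if ij: "j \<in> {1..3}" "i \<le> j"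
    proof (rule ccontr)
      assume "\<not> ?thesis"
      then have "E i (tat \<tau> i) * E j (tat \<tau> j) = 0" using E_tri[OF \<open>i \<in> {1..3}\<close> ij] by simp
      then have "E i (tat \<tau> i) * (E j (tat \<tau> j) * \<Psi> \<tau>) = 0" by (simp flip: mult.assoc)
      then have "\<Psi> \<tau> = 0" using \<Psi>_tat \<open>i \<in> {1..3}\<close> ij by simp
      then have "mu x0 x0 = 0" using \<Psi>C[OF tC(2)] S(3)[OF tC(2,2)] by simp
      then show False by (simp add: mu_nonzero)
    qed
    moreover have "tat \<tau> i \<in> {1..3}" using tC(1) by (auto simp: tat_def T_def)
    ultimately show ?thesis by blast
  qed
  have "\<exists>\<sigma>. \<forall>i\<in>{1..3::nat}. omap_apply \<sigma> i = tat (fst s) i" if "s \<in> A" for s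
    by (rule omap_exists) (use that mono[of "fst s" "snd s"] in \<open>auto simp: A_def\<close>)
  then obtain \<sigma> where \<sigma>: "\<And>s i. s \<in> A \<Longrightarrow> i \<in> {1..3::nat} \<Longrightarrow> omap_apply (\<sigma> s) i = tat (fst s) i" by metis
  have x0col: "(units f p base * C) * mu x0 x0 = units f p base * C" if "C \<in> S \<tau>" for p C \<tau>
    using S(2)[OF that] by (simp add: mult.assoc)
  have "block_rep J K f A v \<sigma>"
  proof (rule block_repI)
    show "finite A" unfolding A_def by (intro finite_SigmaI S(1)) (simp add: T_def)
    fix s assume s: "s \<in> A"
    obtain \<tau> C where sC: "s = (\<tau>, C)" "\<tau> \<in> T" "C \<in> S \<tau>" using s by (auto simp: A_def)
    show "k \<in> T3_idx K \<and> i \<in> T3_idx J \<and> fst k = omap_apply (\<sigma> s) (fst i)" if "v s k i \<noteq> 0" for k i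
    proof -
      have i: "i \<in> T3_idx J" and ne: "entry (units f i base * C) k x0 \<noteq> 0" using that by (auto simp: v_def sC split: if_splits)
      have fi: "fst i \<in> {1..3}" using i by (auto simp: mem_T3_idx)
      have EC: "E (fst i) (tat \<tau> (fst i)) * C = C"
        using \<Psi>C[OF sC(3)] \<Psi>_tat[OF fi, of \<tau>] by (metis mult.assoc)
      have e: "block_proj K (tat \<tau> (fst i)) * (units f i base * C) = units f i base * C"
        using arg_cong[OF U_E[OF i refl fi, of "tat \<tau> (fst i)"], of "\<lambda>z. z * C"] by (simp add: mult.assoc EC)
      have bs: "entry (block_proj K (tat \<tau> (fst i))) \<in> fin_mat (T3_idx K)"
        unfolding entry_block_proj[OF K] by (rule block_proj_fin_mat[OF K])
      have "entry (units f i base * C) k x0 = (\<Sum>l\<in>T3_idx K. entry (block_proj K (tat \<tau> (fst i))) k l * entry (units f i base * C) l x0)"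
        using entry_times_left[OF finite_T3_idx[OF K] bs, of "units f i base * C" k x0] unfolding e .
      then obtain l where "entry (block_proj K (tat \<tau> (fst i))) k l \<noteq> 0" using ne by (metis (no_types, lifting) mult_zero_left sum.neutral)
      then have "k \<in> T3_idx K" "fst k = tat \<tau> (fst i)" by (auto simp: entry_block_proj[OF K] split: if_splits)
      then show ?thesis using \<sigma>[OF s fi] i by (simp add: sC)
    qed
    fix t i j assume t: "t \<in> A" and ij: "i \<in> T3_idx J" "j \<in> T3_idx J"
    obtain \<tau>' D where tD: "t = (\<tau>', D)" "D \<in> S \<tau>'" using t by (auto simp: A_def)
    have "(\<Sum>k\<in>T3_idx K. cnj (v s k i) * v t k j) =
        (\<Sum>k\<in>T3_idx K. entry (adj (units f i base * C)) x0 k * entry (units f j base * D) k x0)"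
      using ij by (simp add: v_def sC tD adj.rep_eq madj_def)
    also have "\<dots> = entry (adj (units f i base * C) * (units f j base * D)) x0 x0"
    proof (rule entry_times[symmetric, OF finite_T3_idx[OF K]])
      fix l assume l: "l \<notin> T3_idx K"
      have "entry (units f i base * C) l x0 = (\<Sum>m\<in>T3_idx K. entry (units f i base) l m * entry C m x0)"
        by (rule entry_times_left[OF finite_T3_idx[OF K] units_supp[OF J K se ij(1) base_mem]])
      also have "\<dots> = 0" using fin_mat_outside(1)[OF units_supp[OF J K se ij(1) base_mem] l] by simp
      finally show "entry (adj (units f i base * C)) x0 l * entry (units f j base * D) l x0 = 0"
        by (simp add: adj.rep_eq madj_def)
    qed
    also have "adj (units f i base * C) * (units f j base * D) = adj C * ((units f base i * units f j base) * D)"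
      using ij by (simp add: adj_mult U_adj mult.assoc)
    also have "\<dots> = (if i = j then adj C * (unit * (\<Psi> \<tau>' * D)) else 0)"
      using ij \<Psi>C[OF tD(2)] by (simp add: U_mult)
    also have "\<dots> = (if i = j \<and> s = t then mu x0 x0 else 0)"
    proof -
      have "unit * (\<Psi> \<tau>' * D) = D" using \<Psi>C[OF tD(2)] \<Psi>_unit[of \<tau>'] by (metis mult.assoc)
      then show ?thesis unfolding sC tD by (simp only: CC[OF sC(3) tD(2)] prod.inject) auto
    qed
    finally show "(\<Sum>k\<in>T3_idx K. cnj (v s k i) * v t k j) = of_bool (s = t) * of_bool (i = j)"
      by (auto simp: entry_mu munit_def zero_fmat.rep_eq)
  next
    fix x assume x: "x \<in> fin_mat (T3_idx J)"
    have rep: "f (munit p q) k l = (\<Sum>s\<in>A. v s k p * cnj (v s l q))" if pq: "p \<in> T3_idx J" "q \<in> T3_idx J" for p q k l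
    proof -
      have "units f p q = units f p base * (\<Sum>\<tau>\<in>T. \<Psi> \<tau>) * units f base q"
        using pq unfolding \<Psi>_sum by (simp add: U_mult)
      also have "\<dots> = (\<Sum>\<tau>\<in>T. \<Sum>C\<in>S \<tau>. (units f p base * C) * adj (units f q base * C))"
        using pq unfolding S(4) by (simp add: sum_distrib_left sum_distrib_right adj_mult U_adj mult.assoc)
      also have "\<dots> = (\<Sum>s\<in>A. (units f p base * snd s) * adj (units f q base * snd s))"
        unfolding A_def using S(1) by (simp add: sum.Sigma T_def split_def)
      finally have "entry (units f p q) k l = (\<Sum>s\<in>A. entry ((units f p base * snd s) * adj (units f q base * snd s)) k l)"
        by (simp only: entry_sum)
      also have "\<dots> = (\<Sum>s\<in>A. v s k p * cnj (v s l q))"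
      proof (rule sum.cong[OF refl])
        fix s assume "s \<in> A"
        then have "snd s \<in> S (fst s)" by (auto simp: A_def)
        note e = x0col[OF this, of p]
        have "entry ((units f p base * snd s) * adj (units f q base * snd s)) k l =
          entry ((units f p base * snd s) * (mu x0 x0 * adj (units f q base * snd s))) k l"
          by (subst e[symmetric]) (simp add: mult.assoc)
        then show "entry ((units f p base * snd s) * adj (units f q base * snd s)) k l = v s k p * cnj (v s l q)"
          unfolding entry_through_mu using pq by (simp add: v_def adj.rep_eq madj_def)
      qed
      finally show ?thesis by (simp add: entry_units[OF J K se pq])
    qed
    show "f x = (\<lambda>k l. \<Sum>s\<in>A. sandwich (T3_idx J) (v s) x k l)"
    proof (intro ext)
      fix k l
      have "f x k l = (\<Sum>p\<in>T3_idx J. \<Sum>q\<in>T3_idx J. \<Sum>s\<in>A. x p q * (v s k p * cnj (v s l q)))"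
        using star_hom_expand[OF T3_star_hom[OF J K se] finite_T3_idx[OF J] x] by (simp add: rep sum_distrib_left)
      also have "\<dots> = (\<Sum>p\<in>T3_idx J. \<Sum>s\<in>A. \<Sum>q\<in>T3_idx J. x p q * (v s k p * cnj (v s l q)))"
        by (rule sum.cong[OF refl], rule sum.swap)
      also have "\<dots> = (\<Sum>s\<in>A. \<Sum>p\<in>T3_idx J. \<Sum>q\<in>T3_idx J. x p q * (v s k p * cnj (v s l q)))"
        by (rule sum.swap)
      finally show "f x k l = (\<Sum>s\<in>A. sandwich (T3_idx J) (v s) x k l)"
        by (simp add: sandwich_def mult_ac)
    qed
  qed
  then show ?thesis using has_classI by blast
qed

lemma has_class_triple:
  assumes fin: "finite J" "finite K" "finite L" "finite M"
    and f: "star_extendible (T3_alg J) (T3_alg K) f" and g: "star_extendible (T3_alg K) (T3_alg L) g"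
    and g': "star_extendible (T3_alg L) (T3_alg M) g'"
    and gf: "has_class J L (g \<circ> f) m" and g'g: "has_class K M (g' \<circ> g) m'"
    and ne: "J \<noteq> {}" "K \<noteq> {}" "L \<noteq> {}"
  shows "\<exists>m. has_class J M (g' \<circ> g \<circ> f) m"
proof -
  obtain o1 o2 o3 where "o1 \<in> J" "o2 \<in> K" "o3 \<in> L" using ne by blast
  then show ?thesis
    using commuting_has_class[OF fin(1,4) star_extendible_comp[OF star_extendible_comp[OF f g] g']]
      commuting_triple[OF fin f g g' gf g'g] by (simp add: comp_assoc)
qed

section \<open>Isomorphic limits have isomorphic dimension modules\<close>

declare One_nat_def [simp]

section \<open>Homomorphisms prescribed on matrix units\<close>

definition units_map :: "'i set \<Rightarrow> ('i \<Rightarrow> 'i \<Rightarrow> 'k fmat) \<Rightarrow> ('i, 'i) cmat \<Rightarrow> ('k, 'k) cmat" where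
  "units_map I W x = entry (\<Sum>p\<in>I. \<Sum>q\<in>I. scl (x p q) (W p q))"

lemma units_map_entry: "units_map I W x i j = (\<Sum>p\<in>I. \<Sum>q\<in>I. x p q * entry (W p q) i j)"
  by (simp add: units_map_def entry_sum scl.rep_eq)

lemma units_map_munit:
  assumes "finite I" "p \<in> I" "q \<in> I" shows "units_map I W (munit p q) = entry (W p q)"
proof (intro ext)
  fix i j
  have "units_map I W (munit p q) i j = (\<Sum>p'\<in>I. (\<Sum>q'\<in>I. entry (W p' q') i j * of_bool (q' = q)) * of_bool (p' = p))"
    unfolding units_map_entry sum_distrib_right by (intro sum.cong refl) (auto simp: munit_def)
  then show "units_map I W (munit p q) i j = entry (W p q) i j" using assms by (simp only: sum_unit_vector)
qed

lemma units_map_star_hom: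
  assumes I: "finite I" and I': "finite I'"
    and supp: "\<And>p q. p \<in> I \<Longrightarrow> q \<in> I \<Longrightarrow> entry (W p q) \<in> fin_mat I'"
    and mult: "\<And>p q r s. p \<in> I \<Longrightarrow> q \<in> I \<Longrightarrow> r \<in> I \<Longrightarrow> s \<in> I \<Longrightarrow> W p q * W r s = (if q = r then W p s else 0)"
    and adj: "\<And>p q. p \<in> I \<Longrightarrow> q \<in> I \<Longrightarrow> adj (W p q) = W q p"
  shows "star_hom (fin_mat_alg I) (fin_mat_alg I') (units_map I W)"
proof -
  have range: "units_map I W x \<in> fin_mat I'" for x
    unfolding fin_mat_iff[OF I']
  proof (intro allI impI)
    fix i j assume "units_map I W x i j \<noteq> 0"
    then obtain p where p: "p \<in> I" "(\<Sum>q\<in>I. x p q * entry (W p q) i j) \<noteq> 0"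
      unfolding units_map_entry by (meson sum.not_neutral_contains_not_neutral)
    then obtain q where "q \<in> I" "x p q * entry (W p q) i j \<noteq> 0"
      by (meson sum.not_neutral_contains_not_neutral)
    then show "i \<in> I' \<and> j \<in> I'" using fin_matD[OF supp[OF p(1)]] by (metis mult_zero_right)
  qed
  have m: "units_map I W (mmult x y) = mmult (units_map I W x) (units_map I W y)"
    if x: "x \<in> fin_mat I" for x y
  proof -
    have "(\<Sum>p\<in>I. \<Sum>q\<in>I. scl (x p q) (W p q)) * (\<Sum>r\<in>I. \<Sum>s\<in>I. scl (y r s) (W r s)) =
      (\<Sum>p\<in>I. \<Sum>q\<in>I. \<Sum>r\<in>I. \<Sum>s\<in>I. scl (x p q * y r s) (W p q * W r s))"
      unfolding sum_distrib_right
      by (simp only: sum_distrib_left scl_times_left scl_times_right scl_scl mult.commute)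
    also have "\<dots> = (\<Sum>p\<in>I. \<Sum>q\<in>I. \<Sum>r\<in>I. if r = q then (\<Sum>s\<in>I. scl (x p q * y r s) (W p s)) else 0)"
      by (intro sum.cong refl) (auto simp: mult)
    also have "\<dots> = (\<Sum>p\<in>I. \<Sum>q\<in>I. \<Sum>s\<in>I. scl (x p q * y q s) (W p s))"
      by (rule sum.cong[OF refl], rule sum.cong[OF refl]) (simp add: I)
    also have "\<dots> = (\<Sum>p\<in>I. \<Sum>s\<in>I. \<Sum>q\<in>I. scl (x p q * y q s) (W p s))"
      by (rule sum.cong[OF refl], rule sum.swap)
    also have "\<dots> = (\<Sum>p\<in>I. \<Sum>s\<in>I. scl (mmult x y p s) (W p s))"
      unfolding scl_sum_left[symmetric]
      by (intro sum.cong refl, subst mmult_eq_sum[OF I]) (use fin_mat_outside[OF x] in auto)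
    finally show ?thesis unfolding units_map_def times_fmat.rep_eq[symmetric] by simp
  qed
  have a: "units_map I W (madj x) = madj (units_map I W x)" for x
  proof -
    have "adj (\<Sum>p\<in>I. \<Sum>q\<in>I. scl (x p q) (W p q)) = (\<Sum>p\<in>I. \<Sum>q\<in>I. scl (madj x q p) (W q p))"
      unfolding adj_sum by (intro sum.cong refl) (simp add: adj_scl adj madj_def)
    also have "\<dots> = (\<Sum>p\<in>I. \<Sum>q\<in>I. scl (madj x p q) (W p q))" by (rule sum.swap)
    finally show ?thesis unfolding units_map_def adj.rep_eq[symmetric] by simp
  qed
  show ?thesis
    unfolding star_hom_def fin_mat_alg_def
    using range m a by (auto simp: units_map_entry fun_eq_iff algebra_simps sum.distrib sum_distrib_left)
qed

context T3_system
begin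

abbreviation "\<iota> k x \<equiv> lim_map I h k x"

lemma finite_idx: "finite (T3_idx (J k))" and idx_nonempty: "T3_idx (J k) \<noteq> {}"
  using finite_J[of k] J_nonempty[of k] by (auto simp: T3_idx_def)

lemma \<iota>_carrier: "x \<in> D k \<Longrightarrow> \<iota> k x \<in> sa_carrier A"
  unfolding lim_map_cls carrier_eq using constant_seq[OF D_sub] by blast

lemma \<iota>_ops:
  assumes x: "x \<in> D k"
  shows "y \<in> D k \<Longrightarrow> sa_add A (\<iota> k x) (\<iota> k y) = \<iota> k (\<lambda>i j. x i j + y i j)"
    and "y \<in> D k \<Longrightarrow> sa_mult A (\<iota> k x) (\<iota> k y) = \<iota> k (mmult x y)"
    and "sa_scale A a (\<iota> k x) = \<iota> k (\<lambda>i j. a * x i j)"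
    and "sa_star A (\<iota> k x) = \<iota> k (madj x)"
proof -
  note c = constant_seq[OF D_sub]
  show "sa_add A (\<iota> k x) (\<iota> k y) = \<iota> k (\<lambda>i j. x i j + y i j)" if y: "y \<in> D k"
    unfolding lim_map_cls add_cls[OF c[OF x] c[OF y]]
    by (rule arg_cong[where f = cls]) (auto simp: fun_eq_iff mzero_def push_add[OF _ D_sub[OF x] D_sub[OF y]])
  have "mmult mzero mzero = mzero" by (simp add: mmult_def mzero_def)
  then show "sa_mult A (\<iota> k x) (\<iota> k y) = \<iota> k (mmult x y)" if y: "y \<in> D k"
    unfolding lim_map_cls mult_cls[OF c[OF x] c[OF y]]
    by (intro arg_cong[where f = cls]) (auto simp: push_mult[OF _ D_sub[OF x] D_sub[OF y]])
  show "sa_scale A a (\<iota> k x) = \<iota> k (\<lambda>i j. a * x i j)"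
    unfolding lim_map_cls scale_cls[OF c[OF x]]
    by (rule arg_cong[where f = cls]) (auto simp: fun_eq_iff mzero_def push_scale[OF _ D_sub[OF x]])
  show "sa_star A (\<iota> k x) = \<iota> k (madj x)"
    unfolding lim_map_cls star_cls[OF c[OF x]]
    by (rule arg_cong[where f = cls]) (auto simp: fun_eq_iff mzero_def madj_def push_star[OF _ D_sub[OF x], unfolded madj_def])
qed

lemma \<iota>_push: "k \<le> p \<Longrightarrow> x \<in> D k \<Longrightarrow> \<iota> p (push h k p x) = \<iota> k x"
  by (rule lim_map_push[OF _ D_sub])

text \<open>If a connecting map from level \<open>k\<close> has an empty multiset, it is zero and
  the two images agree from there on. Otherwise all of them are isometric, so asymptotic equality
  forces \<open>x = y\<close>.\<close>

lemma \<iota>_eq: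
  assumes x: "x \<in> D k" and y: "y \<in> D k" and eq: "\<iota> k x = \<iota> k y"
  shows "\<forall>\<^sub>F q in sequentially. push h k q x = push h k q y"
proof -
  have "\<exists>p\<ge>k. push h k p x = push h k p y"
  proof (cases "\<exists>p\<ge>k. compose_from c k p = {#}")
    case True
    then obtain p where p: "k \<le> p" "compose_from c k p = {#}" by blast
    then have "has_class (J k) (J p) (push h k p) {#}" using push_class[OF p(1)] by simp
    then obtain v \<sigma> where "block_rep (J k) (J p) (push h k p) {..<0::nat} v \<sigma>" unfolding has_class_def by auto
    then show ?thesis using p(1) block_repD(4)[of "J k" "J p" "push h k p" "{..<0::nat}" v \<sigma>] x y by auto
  next
    case False
    have "asym_eq (\<lambda>j. if j < k then mzero else push h k j x) (\<lambda>j. if j < k then mzero else push h k j y)"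
      using eq cls_eq_iff[OF constant_seq[OF D_sub[OF x]] constant_seq[OF D_sub[OF y]]] unfolding lim_map_cls by simp
    note as = asym_eqE[OF this]
    have close: "opdist_le x y e" if e: "e > 0" for e
    proof -
      obtain N where N: "opdist_le (if j < k then mzero else push h k j x) (if j < k then mzero else push h k j y) e" if "j \<ge> N" for j
        using as[OF e] by blast
      have "opdist_le (push h k (max N k) x) (push h k (max N k) y) e" using N[of "max N k"] by simp
      then show ?thesis
        using has_class_isometric[OF finite_J finite_J push_class[of k "max N k"] _ x y, of e] False e by simp
    qed
    have "x i j = y i j" for i j
    proof (rule ccontr)
      assume ne: "x i j \<noteq> y i j"
      then have "cmod (x i j - y i j) \<le> cmod (x i j - y i j) / 2" by (intro opdist_le_entry close) simp
      then show False using ne by simp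
    qed
    then show ?thesis by (metis order_refl ext)
  qed
  then obtain p where p: "k \<le> p" "push h k p x = push h k p y" by blast
  have "push h k q x = push h k q y" if "p \<le> q" for q
    using push_push[OF p(1) that, of h x] push_push[OF p(1) that, of h y] p(2) by simp
  then show ?thesis unfolding eventually_sequentially by blast
qed

lemma alg_lim_eventually:
  assumes "X \<in> alg_lim I h (\<lambda>k. T3 (J k))"
  shows "\<forall>\<^sub>F q in sequentially. \<exists>t\<in>T3 (J q). \<iota> q t = X"
proof -
  obtain k t where t: "t \<in> T3 (J k)" "X = \<iota> k t" using assms by (auto simp: alg_lim_def)
  then have "\<exists>t\<in>T3 (J q). \<iota> q t = X" if "k \<le> q" for q
    using push_T3[OF that] \<iota>_push[OF that T3_D] by blast
  then show ?thesis unfolding eventually_sequentially by blast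
qed

text \<open>Only finitely many matrix units have to agree, and each pair does so from some level on;
  linearity extends this to all elements at once.\<close>

lemma \<iota>_hom_eq:
  assumes L: "finite L" "L \<noteq> {}"
    and f: "star_hom (fin_mat_alg (T3_idx L)) (fin_mat_alg (T3_idx (J k))) f"
    and g: "star_hom (fin_mat_alg (T3_idx L)) (fin_mat_alg (T3_idx (J k))) g"
    and eq: "\<And>x. x \<in> fin_mat (T3_idx L) \<Longrightarrow> \<iota> k (f x) = \<iota> k (g x)"
  shows "\<forall>\<^sub>F q in sequentially. \<forall>x\<in>fin_mat (T3_idx L). push h k q (f x) = push h k q (g x)"
proof -
  have fI: "finite (T3_idx L)" "T3_idx L \<noteq> {}" using L by (auto simp: T3_idx_def)
  have "\<forall>\<^sub>F q in sequentially. \<forall>p\<in>T3_idx L. \<forall>r\<in>T3_idx L. push h k q (f (munit p r)) = push h k q (g (munit p r))"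
    by (intro eventually_ball_finite fI ballI \<iota>_eq star_homD(1)[OF f] star_homD(1)[OF g] eq munit_in_fin_mat)
  then show ?thesis using eventually_ge_at_top[of k]
  proof eventually_elim
    case (elim q)
    have hom: "star_hom (fin_mat_alg (I k)) (fin_mat_alg (I q)) (push h k q)" by (rule push_hom[OF elim(2)])
    note fD = D_sub[OF star_homD(1)[OF f]] and gD = D_sub[OF star_homD(1)[OF g]]
    show ?case
    proof
      fix x assume "x \<in> fin_mat (T3_idx L)"
      then show "push h k q (f x) = push h k q (g x)" using fI
      proof (induction rule: fin_mat_munit_induct)
        case (munit p r)
        then show ?case using elim(1) by blast
      next
        case (scale a y)
        then show ?case by (simp add: star_homD(4)[OF f] star_homD(4)[OF g] star_homD(4)[OF hom] fD gD)
      next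
        case (add y z)
        then show ?case by (simp add: star_homD(2)[OF f] star_homD(2)[OF g] star_homD(2)[OF hom] fD gD)
      qed
    qed
  qed
qed

end

locale limit_hom = S: T3_system I h J c + S': T3_system I' h' J' c'
  for I :: "nat \<Rightarrow> (nat \<times> 'j) set" and h J c
    and I' :: "nat \<Rightarrow> (nat \<times> 'k) set" and h' J' c' +
  fixes \<Phi> assumes hom: "star_hom S.A S'.A \<Phi>"
    and alg: "\<Phi> ` alg_lim I h (\<lambda>k. T3 (J k)) \<subseteq> alg_lim I' h' (\<lambda>k. T3 (J' k))"
begin

lemma \<Phi>_ops:
  assumes "X \<in> sa_carrier S.A"
  shows "Y \<in> sa_carrier S.A \<Longrightarrow> \<Phi> (sa_add S.A X Y) = sa_add S'.A (\<Phi> X) (\<Phi> Y)"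
    and "Y \<in> sa_carrier S.A \<Longrightarrow> \<Phi> (sa_mult S.A X Y) = sa_mult S'.A (\<Phi> X) (\<Phi> Y)"
    and "\<Phi> (sa_scale S.A a X) = sa_scale S'.A a (\<Phi> X)"
    and "\<Phi> (sa_star S.A X) = sa_star S'.A (\<Phi> X)"
  using hom assms unfolding star_hom_def by blast+

text \<open>The images of the matrix units satisfy the matrix unit relations in the limit, hence already at some
  finite level.\<close>

lemma lifting:
  "\<exists>l \<alpha>. N \<le> l \<and> star_extendible (T3_alg (J k)) (T3_alg (J' l)) \<alpha> \<and> (\<forall>x\<in>S.D k. \<Phi> (S.\<iota> k x) = S'.\<iota> l (\<alpha> x))"
proof -
  let ?X = "T3_idx (J k)"
  note fX = S.finite_idx[of k]
  \<comment> \<open>An upper unit needs a representative inside \<open>T3 (J' l)\<close>, available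
    because its image lies in the algebraic limit; a lower unit gets the adjoint of such a
    representative.\<close>
  define good where "good l p q t \<longleftrightarrow> t \<in> S'.D l \<and> S'.\<iota> l t = \<Phi> (S.\<iota> k (munit p q)) \<and> (fst p \<le> fst q \<longrightarrow> t \<in> T3 (J' l))" for l p q t
  have mu: "munit p q \<in> S.D k" if "p \<in> ?X" "q \<in> ?X" for p q using that by (rule munit_in_fin_mat)
  have upper: "\<forall>\<^sub>F l in sequentially. \<exists>t\<in>T3 (J' l). S'.\<iota> l t = \<Phi> (S.\<iota> k (munit p q))"
    if "p \<in> ?X" "q \<in> ?X" "fst p \<le> fst q" for p q
  proof -
    have "munit p q \<in> T3 (J k)" using that(3) mu[OF that(1,2)] unfolding T3_def by (auto simp: munit_def)
    then have "S.\<iota> k (munit p q) \<in> alg_lim I h (\<lambda>k. T3 (J k))" by (auto simp: alg_lim_def)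
    then show ?thesis using alg by (intro S'.alg_lim_eventually) blast
  qed
  have "\<forall>\<^sub>F l in sequentially. \<exists>t. good l p q t" if pq: "p \<in> ?X" "q \<in> ?X" for p q
  proof (cases "fst p \<le> fst q")
    case True
    show ?thesis using upper[OF pq True] by eventually_elim (use S'.T3_D in \<open>auto simp: good_def\<close>)
  next
    case False
    then have "fst q \<le> fst p" by simp
    from upper[OF pq(2,1) this] show ?thesis
    proof eventually_elim
      case (elim l)
      then obtain t where t: "t \<in> T3 (J' l)" "S'.\<iota> l t = \<Phi> (S.\<iota> k (munit q p))" by blast
      have "S'.\<iota> l (madj t) = \<Phi> (sa_star S.A (S.\<iota> k (munit q p)))"
        using S'.\<iota>_ops(4)[OF S'.T3_D[OF t(1)]] \<Phi>_ops(4)[OF S.\<iota>_carrier[OF mu[OF pq(2,1)]]] t(2) by simp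
      also have "\<dots> = \<Phi> (S.\<iota> k (munit p q))" using S.\<iota>_ops(4)[OF mu[OF pq(2,1)]] by (simp add: madj_munit)
      finally have "good l p q (madj t)" using fin_mat_madj[OF S'.T3_D[OF t(1)]] False by (simp add: good_def)
      then show ?case by blast
    qed
  qed
  then have "\<forall>\<^sub>F l in sequentially. \<forall>p\<in>?X. \<forall>q\<in>?X. \<exists>t. good l p q t"
    by (intro eventually_ball_finite fX ballI)
  then obtain l where "\<forall>p\<in>?X. \<forall>q\<in>?X. \<exists>t. good l p q t" using eventually_happens' sequentially_bot by blast
  then obtain u where u: "\<And>p q. p \<in> ?X \<Longrightarrow> q \<in> ?X \<Longrightarrow> good l p q (u p q)" by metis
  have uD: "u p q \<in> S'.D l" and u\<iota>: "S'.\<iota> l (u p q) = \<Phi> (S.\<iota> k (munit p q))" if "p \<in> ?X" "q \<in> ?X" for p q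
    using u[OF that] by (auto simp: good_def)
  have mult: "S'.\<iota> l (mmult (u p q) (u r s)) = S'.\<iota> l (if q = r then u p s else mzero)"
    if pqrs: "p \<in> ?X" "q \<in> ?X" "r \<in> ?X" "s \<in> ?X" for p q r s
  proof -
    have "S'.\<iota> l (mmult (u p q) (u r s)) = sa_mult S'.A (\<Phi> (S.\<iota> k (munit p q))) (\<Phi> (S.\<iota> k (munit r s)))"
      using S'.\<iota>_ops(2)[OF uD uD] u\<iota> pqrs by metis
    also have "\<dots> = \<Phi> (S.\<iota> k (mmult (munit p q) (munit r s)))"
      using \<Phi>_ops(2)[OF S.\<iota>_carrier S.\<iota>_carrier] S.\<iota>_ops(2)[OF mu mu] mu pqrs by metis
    also have "\<dots> = S'.\<iota> l (if q = r then u p s else mzero)"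
    proof (cases "q = r")
      case False
      have "\<Phi> (S.\<iota> k mzero) = \<Phi> (sa_scale S.A 0 (S.\<iota> k (munit p p)))"
        using S.\<iota>_ops(3)[OF mu[OF pqrs(1,1)], of 0] by (simp add: mzero_def)
      also have "\<dots> = S'.\<iota> l mzero"
        using \<Phi>_ops(3)[OF S.\<iota>_carrier[OF mu[OF pqrs(1,1)]], of 0] S'.\<iota>_ops(3)[OF uD[OF pqrs(1,1)], of 0] u\<iota>[OF pqrs(1,1)]
        by (simp add: mzero_def)
      finally show ?thesis using False by (simp add: munit_mult)
    qed (use u\<iota> pqrs in \<open>simp add: munit_mult\<close>)
    finally show ?thesis .
  qed
  have adj: "S'.\<iota> l (madj (u p q)) = S'.\<iota> l (u q p)" if pq: "p \<in> ?X" "q \<in> ?X" for p q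
    using S'.\<iota>_ops(4)[OF uD[OF pq]] \<Phi>_ops(4)[OF S.\<iota>_carrier[OF mu[OF pq]]] S.\<iota>_ops(4)[OF mu[OF pq]] u\<iota>[OF pq] u\<iota>[OF pq(2,1)]
    by (simp add: madj_munit)
  have "\<forall>\<^sub>F m in sequentially. \<forall>p\<in>?X. \<forall>q\<in>?X. \<forall>r\<in>?X. \<forall>s\<in>?X.
      push h' l m (mmult (u p q) (u r s)) = push h' l m (if q = r then u p s else mzero)"
    by (intro eventually_ball_finite fX ballI S'.\<iota>_eq mult fin_mat_mmult uD) (auto intro: uD mzero_fin_mat)
  moreover have "\<forall>\<^sub>F m in sequentially. \<forall>p\<in>?X. \<forall>q\<in>?X. push h' l m (madj (u p q)) = push h' l m (u q p)"
    by (intro eventually_ball_finite fX ballI S'.\<iota>_eq adj fin_mat_madj uD)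
  moreover have "\<forall>\<^sub>F m in sequentially. max N l \<le> m" by (rule eventually_ge_at_top)
  ultimately have "\<forall>\<^sub>F m in sequentially. (\<forall>p\<in>?X. \<forall>q\<in>?X. \<forall>r\<in>?X. \<forall>s\<in>?X.
      push h' l m (mmult (u p q) (u r s)) = push h' l m (if q = r then u p s else mzero)) \<and>
      (\<forall>p\<in>?X. \<forall>q\<in>?X. push h' l m (madj (u p q)) = push h' l m (u q p)) \<and> max N l \<le> m"
    by eventually_elim blast
  from eventually_happens'[OF sequentially_bot this]
  obtain m where m0: "\<forall>p\<in>?X. \<forall>q\<in>?X. \<forall>r\<in>?X. \<forall>s\<in>?X.
      push h' l m (mmult (u p q) (u r s)) = push h' l m (if q = r then u p s else mzero)"
    "\<forall>p\<in>?X. \<forall>q\<in>?X. push h' l m (madj (u p q)) = push h' l m (u q p)" and "max N l \<le> m"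
    by (elim exE conjE)
  then have lm: "N \<le> m" "l \<le> m" by simp_all
  define w where "w p q = push h' l m (u p q)" for p q
  define W where "W p q = Abs_fmat (w p q)" for p q
  have wD: "w p q \<in> S'.D m" if "p \<in> ?X" "q \<in> ?X" for p q unfolding w_def by (rule S'.push_D[OF lm(2) uD[OF that]])
  have W: "entry (W p q) = w p q" if "p \<in> ?X" "q \<in> ?X" for p q unfolding W_def by (rule entry_Abs[OF wD[OF that]])
  define \<alpha> where "\<alpha> = units_map ?X W"
  have \<alpha>_hom: "star_hom (fin_mat_alg ?X) (fin_mat_alg (T3_idx (J' m))) \<alpha>"
    unfolding \<alpha>_def
  proof (rule units_map_star_hom[OF fX S'.finite_idx])
    show "entry (W p q) \<in> S'.D m" if "p \<in> ?X" "q \<in> ?X" for p q unfolding W[OF that] by (rule wD[OF that])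
    show "W p q * W r s = (if q = r then W p s else 0)" if "p \<in> ?X" "q \<in> ?X" "r \<in> ?X" "s \<in> ?X" for p q r s
    proof -
      have "mmult (w p q) (w r s) = (if q = r then w p s else mzero)"
        using m0(1) S'.push_mult[OF lm(2) S'.D_sub[OF uD] S'.D_sub[OF uD], of p q r s] S'.push_zero[OF lm(2)] that
        unfolding w_def by (auto split: if_splits)
      then show ?thesis using that by (intro fmat_eqI) (simp add: times_fmat.rep_eq W zero_fmat.rep_eq mzero_def)
    qed
    show "adj (W p q) = W q p" if "p \<in> ?X" "q \<in> ?X" for p q
      using m0(2) S'.push_star[OF lm(2) S'.D_sub[OF uD[OF that]]] that
      by (intro fmat_eqI) (simp add: adj.rep_eq W w_def)
  qed
  have "\<alpha> x \<in> T3 (J' m)" if x: "x \<in> T3 (J k)" for x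
    unfolding T3_def
  proof (intro CollectI conjI allI impI)
    show "\<alpha> x \<in> S'.D m" by (rule star_homD(1)[OF \<alpha>_hom S.T3_D[OF x]])
    fix s a t b assume ts: "(t::nat) < s"
    \<comment> \<open>For an upper unit \<open>w p q\<close> is triangular, and for a lower one the
      coefficient of the triangular \<open>x\<close> is 0.\<close>
    have "x p q * w p q (s, a) (t, b) = 0" if "p \<in> ?X" "q \<in> ?X" for p q
    proof (cases "fst p \<le> fst q")
      case True
      then have "w p q \<in> T3 (J' m)" using u[OF that] S'.push_T3[OF lm(2)] by (simp add: good_def w_def)
      then show ?thesis using ts by (simp add: T3_def)
    next
      case False
      then have "x p q = 0" using x by (cases p; cases q) (simp add: T3_def)
      then show ?thesis by simp
    qed
    then show "\<alpha> x (s, a) (t, b) = 0" unfolding \<alpha>_def units_map_entry by (intro sum.neutral ballI) (simp add: W)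
  qed
  then have "star_extendible (T3_alg (J k)) (T3_alg (J' m)) \<alpha>"
    using \<alpha>_hom by (auto simp: star_extendible_def T3_alg_def)
  moreover have "\<Phi> (S.\<iota> k x) = S'.\<iota> m (\<alpha> x)" if "x \<in> S.D k" for x
    using that fX S.idx_nonempty
  proof (induction rule: fin_mat_munit_induct)
    case (munit p q)
    then show ?case using S'.\<iota>_push[OF lm(2) uD[OF munit]] u\<iota>[OF munit]
      by (simp add: \<alpha>_def units_map_munit[OF fX] W w_def)
  next
    case (scale a y)
    then show ?case using S.\<iota>_ops(3)[OF scale(1), of a] \<Phi>_ops(3)[OF S.\<iota>_carrier[OF scale(1)], of a]
      S'.\<iota>_ops(3)[OF star_homD(1)[OF \<alpha>_hom scale(1)], of a] star_homD(4)[OF \<alpha>_hom scale(1), of a] by simp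
  next
    case (add y z)
    then show ?case using S.\<iota>_ops(1)[OF add(1,2)] \<Phi>_ops(1)[OF S.\<iota>_carrier[OF add(1)] S.\<iota>_carrier[OF add(2)]]
      S'.\<iota>_ops(1)[OF star_homD(1)[OF \<alpha>_hom add(1)] star_homD(1)[OF \<alpha>_hom add(2)]] star_homD(2)[OF \<alpha>_hom add(1,2)] by simp
  qed
  ultimately show ?thesis using lm(1) by blast
qed

end

section \<open>Regular liftings of an isomorphism and the correspondence of multisets\<close>

locale limit_iso = to: limit_hom I h J c I' h' J' c' \<Phi> + bwd: limit_hom I' h' J' c' I h J c \<Psi>
  for I :: "nat \<Rightarrow> (nat \<times> 'j) set" and h J c and I' :: "nat \<Rightarrow> (nat \<times> 'k) set" and h' J' c' \<Phi> \<Psi> +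
  assumes \<Psi>\<Phi>: "X \<in> sa_carrier to.S.A \<Longrightarrow> \<Psi> (\<Phi> X) = X"
    and \<Phi>\<Psi>: "Y \<in> sa_carrier to.S'.A \<Longrightarrow> \<Phi> (\<Psi> Y) = Y"
begin

lemma flip: "limit_iso I' h' J' c' I h J c \<Psi> \<Phi>"
  by unfold_locales (use \<Psi>\<Phi> \<Phi>\<Psi> in auto)

text \<open>A lifting of \<open>\<Psi>\<close> after \<open>\<alpha>\<close> agrees in the limit
  with a connecting map, hence exactly on level \<open>k\<close> once both are moved to a later
  level \<open>q\<close>. There the composite has the class of the connecting map and is in
  particular regular.\<close>

lemma left_inverse:
  assumes \<alpha>: "star_extendible (T3_alg (J k)) (T3_alg (J' l)) \<alpha>"
    and \<alpha>\<Phi>: "\<And>x. x \<in> to.S.D k \<Longrightarrow> \<Phi> (to.S.\<iota> k x) = to.S'.\<iota> l (\<alpha> x)"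
  shows "\<exists>q \<beta>. k \<le> q \<and> star_extendible (T3_alg (J' l)) (T3_alg (J q)) \<beta> \<and>
    (\<forall>y\<in>to.S'.D l. \<Psi> (to.S'.\<iota> l y) = to.S.\<iota> q (\<beta> y)) \<and> has_class (J k) (J q) (\<beta> \<circ> \<alpha>) (compose_from c k q)"
proof -
  obtain p \<beta> where p: "k \<le> p" and \<beta>: "star_extendible (T3_alg (J' l)) (T3_alg (J p)) \<beta>"
    and \<beta>\<Psi>: "\<forall>y\<in>to.S'.D l. \<Psi> (to.S'.\<iota> l y) = to.S.\<iota> p (\<beta> y)" using bwd.lifting by blast
  note fin = to.S.finite_J to.S'.finite_J
  note \<alpha>h = T3_star_hom[OF fin \<alpha>] and \<beta>h = T3_star_hom[OF fin(2,1) \<beta>]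
  note push_ext = has_class_star_extendible[OF fin(1,1) to.S.push_class]
  have "to.S.\<iota> p ((\<beta> \<circ> \<alpha>) x) = to.S.\<iota> p (push h k p x)" if x: "x \<in> to.S.D k" for x
    using \<beta>\<Psi> star_homD(1)[OF \<alpha>h x] \<alpha>\<Phi>[OF x] \<Psi>\<Phi>[OF to.S.\<iota>_carrier[OF x]] to.S.\<iota>_push[OF p x] by simp
  then have "\<forall>\<^sub>F q in sequentially. \<forall>x\<in>to.S.D k. push h p q ((\<beta> \<circ> \<alpha>) x) = push h p q (push h k p x)"
    by (rule to.S.\<iota>_hom_eq[OF to.S.finite_J to.S.J_nonempty T3_star_hom[OF fin(1,1) star_extendible_comp[OF \<alpha> \<beta>]] T3_star_hom[OF fin(1,1) push_ext[OF p]]])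
  then have "\<forall>\<^sub>F q in sequentially. p \<le> q \<and> (\<forall>x\<in>to.S.D k. push h p q ((\<beta> \<circ> \<alpha>) x) = push h p q (push h k p x))"
    using eventually_ge_at_top[of p] by eventually_elim blast
  then obtain q where q: "p \<le> q" "\<forall>x\<in>to.S.D k. push h p q ((\<beta> \<circ> \<alpha>) x) = push h p q (push h k p x)"
    using eventually_happens' sequentially_bot by blast
  have "has_class (J k) (J q) ((push h p q \<circ> \<beta>) \<circ> \<alpha>) (compose_from c k q)"
    by (rule has_class_cong[OF to.S.push_class]) (use p q push_push[OF p q(1)] in auto)
  moreover have "\<Psi> (to.S'.\<iota> l y) = to.S.\<iota> q ((push h p q \<circ> \<beta>) y)" if y: "y \<in> to.S'.D l" for y
    using \<beta>\<Psi> y to.S.\<iota>_push[OF q(1) star_homD(1)[OF \<beta>h y]] by simp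
  moreover have "star_extendible (T3_alg (J' l)) (T3_alg (J q)) (push h p q \<circ> \<beta>)"
    by (rule star_extendible_comp[OF \<beta> push_ext[OF q(1)]])
  ultimately show ?thesis using p q(1) order_trans by blast
qed

definition S :: "nat \<Rightarrow> nat \<Rightarrow> omap multiset \<Rightarrow> bool" where
  "S k l a \<longleftrightarrow> (\<exists>\<alpha>. has_class (J k) (J' l) \<alpha> a \<and> (\<forall>x\<in>to.S.D k. \<Phi> (to.S.\<iota> k x) = to.S'.\<iota> l (\<alpha> x)))"

text \<open>\<open>left_inverse\<close> gives \<beta> for \<alpha> and, with the two systems
  exchanged, \<alpha>' for \<beta>, so both adjacent composites have a class. The map recorded in
  \<open>S\<close> is the triple composite: it still induces \<open>\<Phi>\<close> because
  \<open>\<Phi>\<close> undoes \<open>\<Psi>\<close>.\<close>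

lemma S_ex: "\<exists>l a. S k l a"
proof -
  note fin = to.S.finite_J to.S'.finite_J
  obtain l \<alpha> where \<alpha>: "star_extendible (T3_alg (J k)) (T3_alg (J' l)) \<alpha>"
    and \<alpha>\<Phi>: "\<forall>x\<in>to.S.D k. \<Phi> (to.S.\<iota> k x) = to.S'.\<iota> l (\<alpha> x)" using to.lifting by blast
  obtain q \<beta> where q: "k \<le> q" and \<beta>: "star_extendible (T3_alg (J' l)) (T3_alg (J q)) \<beta>"
    and \<beta>\<Psi>: "\<forall>y\<in>to.S'.D l. \<Psi> (to.S'.\<iota> l y) = to.S.\<iota> q (\<beta> y)"
    and \<beta>\<alpha>: "has_class (J k) (J q) (\<beta> \<circ> \<alpha>) (compose_from c k q)" using left_inverse[OF \<alpha>] \<alpha>\<Phi> by blast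
  obtain l' \<alpha>' where l': "l \<le> l'" and \<alpha>': "star_extendible (T3_alg (J q)) (T3_alg (J' l')) \<alpha>'"
    and \<alpha>'\<Phi>: "\<forall>x\<in>to.S.D q. \<Phi> (to.S.\<iota> q x) = to.S'.\<iota> l' (\<alpha>' x)"
    and \<alpha>'\<beta>: "has_class (J' l) (J' l') (\<alpha>' \<circ> \<beta>) (compose_from c' l l')"
    using limit_iso.left_inverse[OF flip \<beta>] \<beta>\<Psi> by blast
  obtain m where m: "has_class (J k) (J' l') (\<alpha>' \<circ> \<beta> \<circ> \<alpha>) m"
    using has_class_triple[OF fin fin \<alpha> \<beta> \<alpha>' \<beta>\<alpha> \<alpha>'\<beta>] to.S.J_nonempty to.S'.J_nonempty by blast
  have "\<Phi> (to.S.\<iota> k x) = to.S'.\<iota> l' ((\<alpha>' \<circ> \<beta> \<circ> \<alpha>) x)" if x: "x \<in> to.S.D k" for x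
  proof -
    have \<alpha>x: "\<alpha> x \<in> to.S'.D l" by (rule star_homD(1)[OF T3_star_hom[OF fin \<alpha>] x])
    have "to.S'.\<iota> l' ((\<alpha>' \<circ> \<beta> \<circ> \<alpha>) x) = \<Phi> (\<Psi> (to.S'.\<iota> l (\<alpha> x)))"
      using \<alpha>'\<Phi> \<beta>\<Psi> \<alpha>x star_homD(1)[OF T3_star_hom[OF fin(2,1) \<beta>] \<alpha>x] by simp
    then show ?thesis using \<Phi>\<Psi>[OF to.S'.\<iota>_carrier[OF \<alpha>x]] \<alpha>\<Phi> x by simp
  qed
  then show ?thesis unfolding S_def using m by blast
qed

lemma S_down:
  assumes "S p l a" "k \<le> p"
  shows "S k l (mprod a (compose_from c k p))"
proof -
  obtain \<alpha> where \<alpha>: "has_class (J p) (J' l) \<alpha> a" "\<forall>x\<in>to.S.D p. \<Phi> (to.S.\<iota> p x) = to.S'.\<iota> l (\<alpha> x)"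
    using assms(1) unfolding S_def by blast
  have "has_class (J k) (J' l) (\<alpha> \<circ> push h k p) (mprod a (compose_from c k p))"
    by (rule has_class_comp[OF to.S.finite_J to.S.finite_J to.S'.finite_J to.S.push_class[OF assms(2)] \<alpha>(1)])
  moreover have "\<Phi> (to.S.\<iota> k x) = to.S'.\<iota> l ((\<alpha> \<circ> push h k p) x)" if "x \<in> to.S.D k" for x
    using bspec[OF \<alpha>(2) to.S.push_D[OF assms(2) that]] to.S.\<iota>_push[OF assms(2) that] by simp
  ultimately show ?thesis unfolding S_def by blast
qed

text \<open>The round trip and the identity of level \<open>k\<close> induce the same map into the
  limit, so they coincide as maps at some level \<open>r\<close>; uniqueness of the multiset
  converts this into an equality of products.\<close>

lemma S_S':
  assumes "S k l a" "limit_iso.S I' h' J' I h J \<Psi> l p b"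
  shows "lim_rel c p (mprod b a) k {#1#}"
proof -
  note fin = to.S.finite_J to.S'.finite_J
  obtain \<alpha> where \<alpha>: "has_class (J k) (J' l) \<alpha> a" "\<forall>x\<in>to.S.D k. \<Phi> (to.S.\<iota> k x) = to.S'.\<iota> l (\<alpha> x)"
    using assms(1) unfolding S_def by blast
  obtain \<beta> where \<beta>: "has_class (J' l) (J p) \<beta> b" "\<forall>y\<in>to.S'.D l. \<Psi> (to.S'.\<iota> l y) = to.S.\<iota> p (\<beta> y)"
    using assms(2) unfolding limit_iso.S_def[OF flip] by blast
  define q where "q = max p k"
  have q: "p \<le> q" "k \<le> q" by (auto simp: q_def)
  have \<beta>\<alpha>: "has_class (J k) (J p) (\<beta> \<circ> \<alpha>) (mprod b a)" by (rule has_class_comp[OF fin fin(1) \<alpha>(1) \<beta>(1)])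
  have D: "\<alpha> x \<in> to.S'.D l" "(\<beta> \<circ> \<alpha>) x \<in> to.S.D p" if "x \<in> to.S.D k" for x
    using has_class_fin_mat[OF fin \<alpha>(1) that] has_class_fin_mat[OF fin(1,1) \<beta>\<alpha> that] by auto
  note cl = has_class_comp[OF fin(1,1,1) \<beta>\<alpha> to.S.push_class[OF q(1)]] and cl' = to.S.push_class[OF q(2)]
  note hm = has_class_star_hom[OF fin(1,1)]
  have "to.S.\<iota> q ((push h p q \<circ> (\<beta> \<circ> \<alpha>)) x) = to.S.\<iota> q (push h k q x)" if x: "x \<in> to.S.D k" for x
    using \<beta>(2) \<alpha>(2) x D[OF x] \<Psi>\<Phi>[OF to.S.\<iota>_carrier[OF x]] to.S.\<iota>_push[OF q(2) x] to.S.\<iota>_push[OF q(1) D(2)[OF x]] by simp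
  then have "\<forall>\<^sub>F r in sequentially. \<forall>x\<in>to.S.D k. push h q r ((push h p q \<circ> (\<beta> \<circ> \<alpha>)) x) = push h q r (push h k q x)"
    by (intro to.S.\<iota>_hom_eq to.S.finite_J to.S.J_nonempty hm[OF cl] hm[OF cl']) auto
  then have "\<forall>\<^sub>F r in sequentially. q \<le> r \<and> (\<forall>x\<in>to.S.D k. push h q r ((push h p q \<circ> (\<beta> \<circ> \<alpha>)) x) = push h q r (push h k q x))"
    using eventually_ge_at_top[of q] by eventually_elim blast
  then obtain r where r: "q \<le> r" "\<forall>x\<in>to.S.D k. push h q r ((push h p q \<circ> (\<beta> \<circ> \<alpha>)) x) = push h q r (push h k q x)"
    using eventually_happens' sequentially_bot by blast
  have pr: "p \<le> r" "k \<le> r" using q r(1) by auto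
  have eq: "(push h p r \<circ> (\<beta> \<circ> \<alpha>)) x = push h k r x" if "x \<in> to.S.D k" for x
    using bspec[OF r(2) that] by (simp add: push_push[OF q(1) r(1)] push_push[OF q(2) r(1)])
  have "mprod (compose_from c p r) (mprod b a) = compose_from c k r"
    by (rule has_class_unique[OF fin(1) to.S.J_nonempty fin(1)
      has_class_comp[OF fin(1,1,1) \<beta>\<alpha> to.S.push_class[OF pr(1)]] to.S.push_class[OF pr(2)] eq])
  then show ?thesis unfolding lim_rel_def using pr by (intro exI[of _ r]) simp
qed

lemma S_size: "S k l a \<Longrightarrow> card (J k) * wt t a \<le> card (J' l)"
  unfolding S_def using has_class_size[OF to.S.finite_J to.S'.finite_J] by blast

lemma correspondence:
  assumes "multiset_limit M c N G" "multiset_limit M' c' N' G'"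
  shows "limit_correspondence M c N G M' c' N' G' S (limit_iso.S I' h' J' I h J \<Psi>)"
proof -
  interpret flip: limit_iso I' h' J' c' I h J c \<Psi> \<Phi> by (rule flip)
  interpret M: multiset_limit M c N G by fact
  interpret M': multiset_limit M' c' N' G' by fact
  show ?thesis
    by unfold_locales (use S_ex flip.S_ex S_down flip.S_down S_S' flip.S_S' in auto)
qed

end

lemma isomorphic_limit_iso:
  assumes S: "T3_system I h J c" and S': "T3_system I' h' J' c'"
    and iso: "star_ext_isomorphic (cstar_lim I h, alg_lim I h (\<lambda>k. T3 (J k))) (cstar_lim I' h', alg_lim I' h' (\<lambda>k. T3 (J' k)))"
  shows "\<exists>\<Phi> \<Psi>. limit_iso I h J c I' h' J' c' \<Phi> \<Psi>"
proof -
  interpret S: T3_system I h J c by fact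
  interpret S': T3_system I' h' J' c' by fact
  obtain \<Phi> where hom: "star_hom S.A S'.A \<Phi>" and bij: "bij_betw \<Phi> (sa_carrier S.A) (sa_carrier S'.A)"
    and alg: "\<Phi> ` alg_lim I h (\<lambda>k. T3 (J k)) = alg_lim I' h' (\<lambda>k. T3 (J' k))"
    using iso unfolding star_ext_isomorphic_def star_iso_def by auto
  define \<Psi> where "\<Psi> = inv_into (sa_carrier S.A) \<Phi>"
  have inv: "\<Psi> (\<Phi> X) = X" if "X \<in> sa_carrier S.A" for X
    unfolding \<Psi>_def using bij that by (simp add: bij_betw_inv_into_left)
  have inv': "\<Phi> (\<Psi> Y) = Y" "\<Psi> Y \<in> sa_carrier S.A" if "Y \<in> sa_carrier S'.A" for Y
    unfolding \<Psi>_def using bij that by (simp_all add: bij_betw_inv_into_right bij_betw_def inv_into_into)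
  have closed: "sa_add S.A X Y \<in> sa_carrier S.A" "sa_mult S.A X Y \<in> sa_carrier S.A"
    "sa_scale S.A a X \<in> sa_carrier S.A" "sa_star S.A X \<in> sa_carrier S.A"
    if "X \<in> sa_carrier S.A" "Y \<in> sa_carrier S.A" for X Y a
  proof -
    obtain x y where x: "x \<in> S.seqs" "y \<in> S.seqs" "X = S.cls x" "Y = S.cls y" using \<open>X \<in> _\<close> \<open>Y \<in> _\<close> unfolding S.carrier_eq by blast
    show "sa_add S.A X Y \<in> sa_carrier S.A" "sa_mult S.A X Y \<in> sa_carrier S.A"
      "sa_scale S.A a X \<in> sa_carrier S.A" "sa_star S.A X \<in> sa_carrier S.A"
      unfolding x(3,4) S.add_cls[OF x(1,2)] S.mult_cls[OF x(1,2)] S.scale_cls[OF x(1)] S.star_cls[OF x(1)] S.carrier_eq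
      using S.seqs_add[OF x(1,2)] S.seqs_mult[OF x(1,2)] S.seqs_scale[OF x(1)] S.seqs_star[OF x(1)] by blast+
  qed
  have "star_hom S'.A S.A \<Psi>"
    unfolding star_hom_def
  proof (intro conjI ballI allI)
    fix X assume X: "X \<in> sa_carrier S'.A"
    note X' = inv'[OF X]
    show "\<Psi> X \<in> sa_carrier S.A" by (rule X')
    show "\<Psi> (sa_scale S'.A a X) = sa_scale S.A a (\<Psi> X)" for a
      using inv[OF closed(3)[OF X'(2,2)]] hom X' unfolding star_hom_def by metis
    show "\<Psi> (sa_star S'.A X) = sa_star S.A (\<Psi> X)"
      using inv[OF closed(4)[OF X'(2,2)]] hom X' unfolding star_hom_def by metis
    fix Y assume Y: "Y \<in> sa_carrier S'.A"
    note Y' = inv'[OF Y]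
    show "\<Psi> (sa_add S'.A X Y) = sa_add S.A (\<Psi> X) (\<Psi> Y)"
      using inv[OF closed(1)[OF X'(2) Y'(2)]] hom X' Y' unfolding star_hom_def by metis
    show "\<Psi> (sa_mult S'.A X Y) = sa_mult S.A (\<Psi> X) (\<Psi> Y)"
      using inv[OF closed(2)[OF X'(2) Y'(2)]] hom X' Y' unfolding star_hom_def by metis
  qed
  moreover have "\<Psi> ` alg_lim I' h' (\<lambda>k. T3 (J' k)) \<subseteq> alg_lim I h (\<lambda>k. T3 (J k))"
  proof -
    have "alg_lim I h (\<lambda>k. T3 (J k)) \<subseteq> sa_carrier S.A" using S.\<iota>_carrier[OF S.T3_D] by (auto simp: alg_lim_def)
    then show ?thesis unfolding alg[symmetric] using inv by auto
  qed
  ultimately have "limit_iso I h J c I' h' J' c' \<Phi> \<Psi>"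
    using hom alg inv inv' by unfold_locales auto
  then show ?thesis by blast
qed

theorem corollary10p3:
  fixes n n' :: "nat \<Rightarrow> nat"
    and \<phi> \<phi>' :: "nat \<Rightarrow> (nat \<times> nat, nat \<times> nat) cmat \<Rightarrow> (nat \<times> nat, nat \<times> nat) cmat"
  assumes "\<And>k. n k \<ge> 1" and "\<And>k. regular {..<n k} {..<n (Suc k)} (\<phi> k)"
    and "\<And>k. n' k \<ge> 1" and "\<And>k. regular {..<n' k} {..<n' (Suc k)} (\<phi>' k)"
  shows "(star_ext_isomorphic (T3_lim_stab n \<phi>) (T3_lim_stab n' \<phi>') \<longleftrightarrow>
            (\<exists>F. dim_module_iso (V_lim n \<phi>) (V_lim n' \<phi>') F)) \<and>
         (star_ext_isomorphic (T3_lim n \<phi>) (T3_lim n' \<phi>') \<longleftrightarrow>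
            (\<exists>F. dim_module_iso (V_lim n \<phi>) (V_lim n' \<phi>') F \<and>
                 scale_preserving (V_lim n \<phi>) (V_lim n' \<phi>') F))"
proof -
  have ne: "{..<m} \<noteq> {}" if "m \<ge> 1" for m :: nat using that by (simp add: lessThan_empty_iff)
  have "\<exists>m. has_class {..<n k} {..<n (Suc k)} (\<phi> k) m" "\<exists>m. has_class {..<n' k} {..<n' (Suc k)} (\<phi>' k) m" for k
    by (rule regular_has_class[OF finite_lessThan ne[OF assms(1)] finite_lessThan assms(2)],
      rule regular_has_class[OF finite_lessThan ne[OF assms(3)] finite_lessThan assms(4)])
  then obtain c c' where c: "\<And>k. has_class {..<n k} {..<n (Suc k)} (\<phi> k) (c k)"
    and c': "\<And>k. has_class {..<n' k} {..<n' (Suc k)} (\<phi>' k) (c' k)" by metis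
  obtain G where G: "multiset_limit (V_lim n \<phi>) c n G" using V_lim_multiset_limit[where n = n and \<phi> = \<phi> and c = c, OF assms(1) c] by blast
  obtain G' where G': "multiset_limit (V_lim n' \<phi>') c' n' G'" using V_lim_multiset_limit[where n = n' and \<phi> = \<phi>' and c = c', OF assms(3) c'] by blast
  note S = T3_lim_system[where n = n and \<phi> = \<phi> and c = c, OF assms(1) c] and S' = T3_lim_system[where n = n' and \<phi> = \<phi>' and c = c', OF assms(3) c']
  note SS = T3_lim_stab_system[where n = n and \<phi> = \<phi> and c = c, OF assms(1) c] and SS' = T3_lim_stab_system[where n = n' and \<phi> = \<phi>' and c = c', OF assms(3) c']
  note eqs = T3_lim_stab_eq[where n = n and \<phi> = \<phi> and c = c, OF assms(1) c] T3_lim_stab_eq[where n = n' and \<phi> = \<phi>' and c = c', OF assms(3) c'] T3_lim_def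
  have two: "two_limits (V_lim n \<phi>) c n G (V_lim n' \<phi>') c' n' G' F"
    if "dim_module_iso (V_lim n \<phi>) (V_lim n' \<phi>') F" for F
    using G G' that by (simp add: two_limits_def two_limits_axioms_def)
  show ?thesis
  proof (intro conjI iffI)
    assume "star_ext_isomorphic (T3_lim_stab n \<phi>) (T3_lim_stab n' \<phi>')"
    then obtain \<Phi> \<Psi> where "limit_iso (\<lambda>k. T3_idx ({..<n k} \<times> UNIV)) (\<lambda>k. amp (\<phi> k)) (\<lambda>k. {..<n k} \<times> {..<Suc k}) c
      (\<lambda>k. T3_idx ({..<n' k} \<times> UNIV)) (\<lambda>k. amp (\<phi>' k)) (\<lambda>k. {..<n' k} \<times> {..<Suc k}) c' \<Phi> \<Psi>"
      using isomorphic_limit_iso[OF SS SS'] unfolding eqs by blast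
    \<comment> \<open>Amplification leaves the multisets \<open>c\<close> unchanged, so the
      correspondence found for the stabilised systems is one between the original modules.\<close>
    from limit_correspondence.induced_iso[OF limit_iso.correspondence[OF this G G']]
    show "\<exists>F. dim_module_iso (V_lim n \<phi>) (V_lim n' \<phi>') F" by blast
  next
    assume "\<exists>F. dim_module_iso (V_lim n \<phi>) (V_lim n' \<phi>') F"
    then obtain F where F: "dim_module_iso (V_lim n \<phi>) (V_lim n' \<phi>') F" by blast
    interpret two_limits "V_lim n \<phi>" c n G "V_lim n' \<phi>'" c' n' G' F by (rule two[OF F])
    \<comment> \<open>The blocks have sizes \<open>n k * Suc k\<close> and
      \<open>n' k * Suc k\<close>, the ones provided for by \<open>image_stable\<close>.\<close>
    show "star_ext_isomorphic (T3_lim_stab n \<phi>) (T3_lim_stab n' \<phi>')"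
      unfolding eqs
      by (rule isomorphic_systems[OF SS SS'])
        (use image_stable two_limits.image_stable[OF flip] in \<open>simp_all add: card_cartesian_product\<close>)
  next
    assume "star_ext_isomorphic (T3_lim n \<phi>) (T3_lim n' \<phi>')"
    then obtain \<Phi> \<Psi> where iso: "limit_iso (\<lambda>k. T3_idx {..<n k}) \<phi> (\<lambda>k. {..<n k}) c
      (\<lambda>k. T3_idx {..<n' k}) \<phi>' (\<lambda>k. {..<n' k}) c' \<Phi> \<Psi>"
      using isomorphic_limit_iso[OF S S'] unfolding eqs by blast
    note cor = limit_iso.correspondence[OF iso G G']
    \<comment> \<open>Here the level sizes are \<open>n k\<close> and \<open>n' k\<close>, the
      bounds that occur in the scales.\<close>
    note size = limit_iso.S_size[OF iso] limit_iso.S_size[OF limit_iso.flip[OF iso]]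
    show "\<exists>F. dim_module_iso (V_lim n \<phi>) (V_lim n' \<phi>') F \<and> scale_preserving (V_lim n \<phi>) (V_lim n' \<phi>') F"
      using limit_correspondence.induced_iso[OF cor] limit_correspondence.induced_scale_preserving[OF cor] size
      unfolding card_lessThan by blast
  next
    assume "\<exists>F. dim_module_iso (V_lim n \<phi>) (V_lim n' \<phi>') F \<and> scale_preserving (V_lim n \<phi>) (V_lim n' \<phi>') F"
    then obtain F where F: "dim_module_iso (V_lim n \<phi>) (V_lim n' \<phi>') F" and sc: "scale_preserving (V_lim n \<phi>) (V_lim n' \<phi>') F" by blast
    interpret two_limits "V_lim n \<phi>" c n G "V_lim n' \<phi>'" c' n' G' F by (rule two[OF F])
    show "star_ext_isomorphic (T3_lim n \<phi>) (T3_lim n' \<phi>')"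
      unfolding eqs
      by (rule isomorphic_systems[OF S S'])
        (use image_scaled[OF sc] two_limits.image_scaled[OF flip scale_preserving_flip[OF sc]] in simp_all)
  qed
qed

end
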